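(* Let $n\ge 2$, let $S\subset\mathbb{R}^n$ be a smooth compact convex hypersurface of finite type, and let $r>0$. If the restriction operator $\mathcal{R}$ is bounded from $L^{\frac{2(r+1)}{r+2}}(\mathbb{R}^n)$ to $L^2(S)$, then there is a constant $C$ such that $|F_S(\xi)|\le C(1+|\xi|)^{-r}$ for all $\xi\in\mathbb{R}^n$.
   Context: Let $d\sigma$ be the Lebesgue (surface) measure on $S$, and let $F_S(\xi)=\int_S e^{-i\langle x,\xi\rangle}\,d\sigma(x)$. The space $L^2(S)$ is taken with respect to $d\sigma$. The restriction operator is $\mathcal{R}f=\hat f|_S$, where $\hat f$ is the standard Fourier transform of $f$; boundedness from $L^p(\mathbb{R}^n)$ to $L^2(S)$ means $\|\mathcal{R}f\|_{L^2(S)}\le C\|f\|_{L^p(\mathbb{R}^n)}$ with $C$ independent of $f$ (e.g. for all Schwartz functions $f$, so that $\mathcal{R}$ extends by density). A smooth convex hypersurface is of finite type if its order of contact with every tangent line is finite. *)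

theory Defs
  imports "HOL-Analysis.Analysis"
begin

subsection \<open>Smooth functions, Schwartz functions, Fourier transform\<close>

fun iterated_deriv ::
  "'a list \<Rightarrow> ('a::real_normed_vector \<Rightarrow> 'b::real_normed_vector) \<Rightarrow> 'a \<Rightarrow> 'b" where
  "iterated_deriv [] f = f"
| "iterated_deriv (v # vs) f = (\<lambda>x. frechet_derivative (iterated_deriv vs f) (at x) v)"

text \<open>For open \<open>U\<close> this is \<open>C\<^sup>\<infinity>\<close>: all iterated directional derivatives are
  differentiable, hence continuous, on \<open>U\<close>.\<close>

definition smooth_on ::
  "'a::real_normed_vector set \<Rightarrow> ('a \<Rightarrow> 'b::real_normed_vector) \<Rightarrow> bool" where
  "smooth_on U f \<longleftrightarrow> (\<forall>vs. \<forall>x\<in>U. iterated_deriv vs f differentiable (at x))"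

definition schwartz :: "('a::euclidean_space \<Rightarrow> complex) \<Rightarrow> bool" where
  "schwartz f \<longleftrightarrow> smooth_on UNIV f \<and>
     (\<forall>k::nat. \<forall>vs. bounded (range (\<lambda>x. norm x ^ k * norm (iterated_deriv vs f x))))"

definition fourier_transform :: "('a::euclidean_space \<Rightarrow> complex) \<Rightarrow> 'a \<Rightarrow> complex" where
  "fourier_transform f \<xi> = (LINT x|lborel. exp (- \<i> * of_real (x \<bullet> \<xi>)) * f x)"

definition Lp_norm :: "'a measure \<Rightarrow> real \<Rightarrow> ('a \<Rightarrow> complex) \<Rightarrow> real" where
  "Lp_norm M p f = (LINT x|M. norm (f x) powr p) powr (1 / p)"


subsection \<open>Smooth convex hypersurfaces of finite type\<close>

definition local_defining_function ::
  "'a::euclidean_space set \<Rightarrow> 'a \<Rightarrow> 'a set \<Rightarrow> ('a \<Rightarrow> real) \<Rightarrow> bool" where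
  "local_defining_function S p U \<phi> \<longleftrightarrow>
     open U \<and> p \<in> U \<and> smooth_on U \<phi> \<and> S \<inter> U = {x \<in> U. \<phi> x = 0} \<and>
     (\<forall>x\<in>U. \<exists>v. frechet_derivative \<phi> (at x) v \<noteq> 0)"

definition smooth_hypersurface :: "'a::euclidean_space set \<Rightarrow> bool" where
  "smooth_hypersurface S \<longleftrightarrow> (\<forall>p\<in>S. \<exists>U \<phi>. local_defining_function S p U \<phi>)"

text \<open>A compact hypersurface is convex if it bounds a convex body.\<close>

definition convex_hypersurface :: "'a::euclidean_space set \<Rightarrow> bool" where
  "convex_hypersurface S \<longleftrightarrow>
     (\<exists>K. compact K \<and> convex K \<and> interior K \<noteq> {} \<and> S = frontier K)"

text \<open>The order of contact at \<open>p\<close> of the line \<open>p + \<real> v\<close> with the hypersurface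
  \<open>\<phi> = 0\<close> is the vanishing order of \<open>\<phi>\<close> along the line.  It does not depend on the
  choice of the local defining function \<open>\<phi>\<close>.\<close>

definition contact_order ::
  "('a::euclidean_space \<Rightarrow> real) \<Rightarrow> 'a \<Rightarrow> 'a \<Rightarrow> enat" where
  "contact_order \<phi> p v =
     (INF k\<in>{k. (deriv ^^ k) (\<lambda>t. \<phi> (p + t *\<^sub>R v)) (0::real) \<noteq> 0}. enat k)"

definition finite_type :: "'a::euclidean_space set \<Rightarrow> bool" where
  "finite_type S \<longleftrightarrow>
     (\<forall>p\<in>S. \<forall>U \<phi> v. local_defining_function S p U \<phi> \<and> v \<noteq> 0 \<and>
        frechet_derivative \<phi> (at p) v = 0 \<longrightarrow> contact_order \<phi> p v < \<infinity>)"


subsection \<open>Surface measure\<close>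

definition hproj :: "'a::euclidean_space \<Rightarrow> 'a \<Rightarrow> 'a" where
  "hproj b x = x - (x \<bullet> b) *\<^sub>R b"

text \<open>For a unit vector \<open>b\<close>, the Lebesgue measure on the hyperplane orthogonal to \<open>b\<close>:
  the measure of \<open>D\<close> is the volume of the cylinder \<open>{y + t b | y \<in> D, 0 \<le> t \<le> 1}\<close>.\<close>

definition hyperplane_lborel :: "'a::euclidean_space \<Rightarrow> 'a measure" where
  "hyperplane_lborel b =
     distr (density lborel (indicator {x. 0 \<le> x \<bullet> b \<and> x \<bullet> b \<le> 1})) borel (hproj b)"

definition graph_over :: "'a::euclidean_space \<Rightarrow> ('a \<Rightarrow> real) \<Rightarrow> 'a set \<Rightarrow> 'a set" where
  "graph_over b h D = (\<lambda>y. y + h y *\<^sub>R b) ` D"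

text \<open>The area of a graph, i.e. the integral of \<open>sqrt (1 + |grad h|\<^sup>2)\<close>, where the gradient is
  taken within the hyperplane orthogonal to \<open>b\<close>; the component of the \<open>'a\<close>-gradient of \<open>h\<close>
  in direction \<open>b\<close> is projected away.\<close>

definition graph_area :: "'a::euclidean_space \<Rightarrow> ('a \<Rightarrow> real) \<Rightarrow> 'a set \<Rightarrow> ennreal" where
  "graph_area b h D =
     (\<integral>\<^sup>+y\<in>D. ennreal (sqrt (1 + (\<Sum>i\<in>Basis. (frechet_derivative h (at y) (hproj b i))\<^sup>2)))
        \<partial>hyperplane_lborel b)"

definition graph_patch ::
  "'a::euclidean_space set \<Rightarrow> 'a \<times> ('a \<Rightarrow> real) \<times> 'a set \<Rightarrow> bool" where
  "graph_patch S = (\<lambda>(b, h, D). norm b = 1 \<and> D \<in> sets borel \<and> D \<subseteq> {y. y \<bullet> b = 0} \<and>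
     (\<exists>U. open U \<and> D \<subseteq> U \<and> smooth_on U h \<and> graph_over b h (U \<inter> {y. y \<bullet> b = 0}) \<subseteq> S))"

text \<open>The surface measure of a smooth hypersurface is obtained from the area of local graphs
  in the same way as Lebesgue measure is obtained from the volume of boxes.
  Since the area is independent of the chosen graph representation, graph patches of \<open>S\<close>
  have their area as measure.\<close>

definition surface_outer :: "'a::euclidean_space set \<Rightarrow> 'a set \<Rightarrow> ennreal" where
  "surface_outer S A =
     (INF P\<in>{P :: nat \<Rightarrow> _. (\<forall>i. graph_patch S (P i)) \<and>
               A \<subseteq> (\<Union>i. case P i of (b, h, D) \<Rightarrow> graph_over b h D)}.
        (\<Sum>i. case P i of (b, h, D) \<Rightarrow> graph_area b h D))"

definition surface_measure :: "'a::euclidean_space set \<Rightarrow> 'a measure" where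
  "surface_measure S = measure_of S (sets (restrict_space borel S)) (surface_outer S)"


text \<open>\<open>measure_of\<close> yields the null measure unless its argument is a measure; the following
  lemmas show that this default case does not occur.\<close>

lemma smooth_on_continuous:
  assumes "smooth_on U f"
  shows "continuous_on U (iterated_deriv vs f)"
  using assms
  by (meson continuous_at_imp_continuous_on differentiable_imp_continuous_within smooth_on_def)

lemma graph_patch_Int:
  assumes "graph_patch S (b, h, D)" "A \<in> sets (restrict_space borel S)"
  shows "graph_patch S (b, h, D \<inter> (\<lambda>y. y + h y *\<^sub>R b) -` A)"
proof -
  obtain U where U: "open U" "D \<subseteq> U" "smooth_on U h"
      "graph_over b h (U \<inter> {y. y \<bullet> b = 0}) \<subseteq> S"
      and D: "D \<in> sets borel" "D \<subseteq> {y. y \<bullet> b = 0}" "norm b = 1"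
    using assms(1) by (auto simp: graph_patch_def)
  obtain B where B: "B \<in> sets borel" "A = B \<inter> S"
    using assms(2) by (auto simp: sets_restrict_space)
  have "continuous_on U h" using smooth_on_continuous[OF U(3), of "[]"] by simp
  then have "continuous_on D (\<lambda>y. y + h y *\<^sub>R b)"
    by (intro continuous_intros) (use U continuous_on_subset in blast)
  then have m: "(\<lambda>y. y + h y *\<^sub>R b) \<in> borel_measurable (restrict_space borel D)"
    by (rule borel_measurable_continuous_on_restrict)
  have "(\<lambda>y. y + h y *\<^sub>R b) -` B \<inter> space (restrict_space borel D) \<in> sets (restrict_space borel D)"
    using m B(1) by (rule measurable_sets)
  then have "D \<inter> (\<lambda>y. y + h y *\<^sub>R b) -` B \<in> sets borel"
    using D(1) by (auto simp: sets_restrict_space_iff space_restrict_space Int_commute)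
  moreover have "D \<inter> (\<lambda>y. y + h y *\<^sub>R b) -` A = D \<inter> (\<lambda>y. y + h y *\<^sub>R b) -` B"
    using U(2,4) D(2) B(2) unfolding graph_over_def by blast
  ultimately show ?thesis
    using U D unfolding graph_patch_def by auto
qed

lemma graph_area_disjoint:
  assumes "\<And>n. graph_patch S (b, h, D n)" "disjoint_family D" "(\<Union>n. D n) \<subseteq> E"
    "graph_patch S (b, h, E)"
  shows "(\<Sum>n::nat. graph_area b h (D n)) \<le> graph_area b h E"
proof -
  let ?g = "\<lambda>y. ennreal (sqrt (1 + (\<Sum>i\<in>Basis. (frechet_derivative h (at y) (hproj b i))\<^sup>2)))"
  let ?M = "hyperplane_lborel b"
  obtain U where U: "open U" "E \<subseteq> U" "smooth_on U h" "E \<in> sets borel"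
    using assms(4) by (auto simp: graph_patch_def)
  have D: "D n \<in> sets borel" for n using assms(1) by (auto simp: graph_patch_def)
  have [simp]: "sets ?M = sets borel" by (simp add: hyperplane_lborel_def)
  have "continuous_on U (\<lambda>y. frechet_derivative h (at y) v)" for v
    using smooth_on_continuous[OF U(3), of "[v]"] by simp
  then have "continuous_on E (\<lambda>y. sqrt (1 + (\<Sum>i\<in>Basis. (frechet_derivative h (at y) (hproj b i))\<^sup>2)))"
    by (intro continuous_intros) (use U continuous_on_subset in blast)
  then have "(\<lambda>y. sqrt (1 + (\<Sum>i\<in>Basis. (frechet_derivative h (at y) (hproj b i))\<^sup>2)))
      \<in> borel_measurable (restrict_space borel E)"
    by (rule borel_measurable_continuous_on_restrict)
  then have "?g \<in> borel_measurable (restrict_space borel E)" by measurable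
  then have gE: "(\<lambda>y. ?g y * indicator E y) \<in> borel_measurable borel"
    using U(4) by (subst (asm) borel_measurable_restrict_space_iff_ennreal) auto
  have eq: "?g y * indicator (D n) y = (?g y * indicator E y) * indicator (D n) y" for n y
    using assms(3) by (auto simp: indicator_def)
  have [measurable]: "(\<lambda>y. (?g y * indicator E y) * indicator (D n) y) \<in> borel_measurable ?M" for n
    unfolding measurable_cong_sets[OF \<open>sets ?M = sets borel\<close> refl]
    by (intro borel_measurable_times_ennreal gE borel_measurable_indicator D)
  have "(\<Sum>n. graph_area b h (D n)) = (\<Sum>n. \<integral>\<^sup>+y. (?g y * indicator E y) * indicator (D n) y \<partial>?M)"
    unfolding graph_area_def eq ..
  also have "\<dots> = (\<integral>\<^sup>+y. (\<Sum>n. (?g y * indicator E y) * indicator (D n) y) \<partial>?M)"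
    by (rule nn_integral_suminf[symmetric]) measurable
  also have "\<dots> \<le> graph_area b h E"
    unfolding graph_area_def
  proof (rule nn_integral_mono)
    fix y
    have "(\<Sum>n. (?g y * indicator E y) * indicator (D n) y :: ennreal)
        = (?g y * indicator E y) * indicator (\<Union>n. D n) y"
      using suminf_indicator[OF assms(2), of y] by simp
    also have "\<dots> \<le> ?g y * indicator E y" by (auto simp: indicator_def)
    finally show "(\<Sum>n. (?g y * indicator E y) * indicator (D n) y) \<le> ?g y * indicator E y" .
  qed
  finally show ?thesis .
qed

lemma surface_outer_le:
  assumes "\<And>i. graph_patch S (P i)" "A \<subseteq> (\<Union>i. case P i of (b, h, D) \<Rightarrow> graph_over b h D)"
  shows "surface_outer S A \<le> (\<Sum>i. case P i of (b, h, D) \<Rightarrow> graph_area b h D)"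
  unfolding surface_outer_def using assms by (intro INF_lower) auto

lemma surface_outer_empty: "surface_outer (S :: 'a::euclidean_space set) {} = 0"
proof -
  obtain b :: 'a where b: "b \<in> Basis" using nonempty_Basis by blast
  have "smooth_on {} (\<lambda>_::'a. 0::real)" by (simp add: smooth_on_def)
  then have "graph_patch S (b, \<lambda>_. 0, {})"
    using b by (auto simp: graph_patch_def graph_over_def norm_Basis intro!: exI[of _ "{}"])
  from surface_outer_le[of S "\<lambda>_. (b, \<lambda>_. 0, {})" "{}"] this show ?thesis
    by (simp add: graph_area_def)
qed

lemma surface_outer_countably_additive:
  "countably_additive (sets (restrict_space borel S)) (surface_outer S)"
  unfolding countably_additive_def
proof (intro allI impI antisym)
  fix A :: "nat \<Rightarrow> 'a set"
  assume A: "range A \<subseteq> sets (restrict_space borel S)" "disjoint_family A"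
  show "(\<Sum>n. surface_outer S (A n)) \<le> surface_outer S (\<Union>n. A n)"
    unfolding surface_outer_def[of _ "\<Union>n. A n"]
  proof (rule INF_greatest, clarify)
    fix P :: "nat \<Rightarrow> 'a \<times> ('a \<Rightarrow> real) \<times> 'a set"
    assume P: "\<forall>i. graph_patch S (P i)"
      and cov: "(\<Union>n. A n) \<subseteq> (\<Union>i. case P i of (b, h, D) \<Rightarrow> graph_over b h D)"
    define b h D where "b i = fst (P i)" and "h i = fst (snd (P i))" and "D i = snd (snd (P i))" for i
    have Pi: "P i = (b i, h i, D i)" for i by (simp add: b_def h_def D_def)
    define E where "E n i = D i \<inter> (\<lambda>y. y + h i y *\<^sub>R b i) -` A n" for n i
    have gp: "graph_patch S (b i, h i, E n i)" for n i
      unfolding E_def using A(1) P by (intro graph_patch_Int) (auto simp: Pi[symmetric])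
    have "surface_outer S (A n) \<le> (\<Sum>i. graph_area (b i) (h i) (E n i))" for n
    proof -
      have "A n \<subseteq> (\<Union>i. graph_over (b i) (h i) (E n i))"
      proof
        fix x assume x: "x \<in> A n"
        then have "x \<in> (\<Union>i. case P i of (b, h, D) \<Rightarrow> graph_over b h D)"
          using cov by blast
        then obtain i where "x \<in> graph_over (b i) (h i) (D i)"
          unfolding Pi by auto
        then have "x \<in> graph_over (b i) (h i) (E n i)"
          using x by (auto simp: graph_over_def E_def)
        then show "x \<in> (\<Union>i. graph_over (b i) (h i) (E n i))" by blast
      qed
      then show ?thesis
        using surface_outer_le[of S "\<lambda>i. (b i, h i, E n i)" "A n"] gp by simp
    qed
    then have "(\<Sum>n. surface_outer S (A n)) \<le> (\<Sum>n. \<Sum>i. graph_area (b i) (h i) (E n i))"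
      by (intro suminf_le) auto
    also have "\<dots> = (\<Sum>i. \<Sum>n. graph_area (b i) (h i) (E n i))"
      unfolding nn_integral_count_space_nat[symmetric]
      by (rule pair_sigma_finite.Fubini')
         (auto simp: pair_sigma_finite_def sigma_finite_measure_count_space_countable
            pair_measure_countable)
    also have "\<dots> \<le> (\<Sum>i. graph_area (b i) (h i) (D i))"
    proof (intro suminf_le graph_area_disjoint)
      show "disjoint_family (\<lambda>n. E n i)" for i
        using A(2) by (auto simp: disjoint_family_on_def E_def)
    qed (use gp P in \<open>auto simp: E_def Pi[symmetric]\<close>)
    finally show "(\<Sum>n. surface_outer S (A n)) \<le> (\<Sum>i. case P i of (b, h, D) \<Rightarrow> graph_area b h D)"
      by (simp add: Pi)
  qed
  show "surface_outer S (\<Union>n. A n) \<le> (\<Sum>n. surface_outer S (A n))"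
  proof (rule ennreal_le_epsilon)
    fix e :: real assume fin: "(\<Sum>n. surface_outer S (A n)) < top" and e: "0 < e"
    have fn: "surface_outer S (A n) < top" for n
      using ennreal_suminf_lessD[OF fin] by simp
    have "\<exists>P. (\<forall>i. graph_patch S (P i)) \<and>
          A n \<subseteq> (\<Union>i::nat. case P i of (b, h, D) \<Rightarrow> graph_over b h D) \<and>
          (\<Sum>i. case P i of (b, h, D) \<Rightarrow> graph_area b h D) \<le> surface_outer S (A n) + ennreal (e * (1/2) ^ Suc n)" for n
    proof -
      have "surface_outer S (A n) < surface_outer S (A n) + ennreal (e * (1/2) ^ Suc n)"
        using fn[of n] e by (cases "surface_outer S (A n)")
          (auto simp: ennreal_plus[symmetric] ennreal_less_iff simp del: ennreal_plus)
      then show ?thesis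
        unfolding surface_outer_def[of S "A n"] INF_less_iff by (auto simp: less_imp_le)
    qed
    then obtain P where P: "\<And>n i. graph_patch S (P n i)"
          "\<And>n. A n \<subseteq> (\<Union>i::nat. case P n i of (b, h, D) \<Rightarrow> graph_over b h D)"
          "\<And>n. (\<Sum>i. case P n i of (b, h, D) \<Rightarrow> graph_area b h D) \<le> surface_outer S (A n) + ennreal (e * (1/2) ^ Suc n)"
      by metis
    let ?a = "\<lambda>x. case x of (b, h, D) \<Rightarrow> graph_area b h D"
    define Q where "Q k = (case prod_decode k of (n, i) \<Rightarrow> P n i)" for k
    have Q: "Q (prod_encode (n, i)) = P n i" for n i by (simp add: Q_def)
    have "surface_outer S (\<Union>n. A n) \<le> (\<Sum>k. ?a (Q k))"
    proof (rule surface_outer_le)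
      show "graph_patch S (Q k)" for k by (simp add: Q_def P split: prod.split)
      show "(\<Union>n. A n) \<subseteq> (\<Union>k. case Q k of (b, h, D) \<Rightarrow> graph_over b h D)"
      proof
        fix x assume "x \<in> (\<Union>n. A n)"
        then obtain n where "x \<in> A n" by blast
        then have "x \<in> (\<Union>i. case P n i of (b, h, D) \<Rightarrow> graph_over b h D)"
          by (rule subsetD[OF P(2)])
        then obtain i where "x \<in> (case P n i of (b, h, D) \<Rightarrow> graph_over b h D)"
          by (rule UN_E)
        then show "x \<in> (\<Union>k. case Q k of (b, h, D) \<Rightarrow> graph_over b h D)"
          unfolding Q[symmetric] by (rule UN_I[OF UNIV_I])
      qed
    qed
    also have "\<dots> = (\<Sum>n. \<Sum>i. ?a (P n i))"
      using suminf_ennreal_2dimen[of "\<lambda>n. \<Sum>i. ?a (P n i)" "\<lambda>(n, i). ?a (P n i)"]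
      by (simp add: Q_def case_prod_beta comp_def)
    also have "\<dots> \<le> (\<Sum>n. surface_outer S (A n) + ennreal (e * (1/2) ^ Suc n))"
      by (intro suminf_le P) auto
    also have "\<dots> = (\<Sum>n. surface_outer S (A n)) + (\<Sum>n. ennreal (e * (1/2) ^ Suc n))"
      by (intro suminf_add[symmetric]) auto
    also have "(\<Sum>n. ennreal (e * (1/2) ^ Suc n)) = ennreal e"
      using e sums_mult[OF power_half_series, of e] by (intro suminf_ennreal_eq) auto
    finally show "surface_outer S (\<Union>n. A n) \<le> (\<Sum>n. surface_outer S (A n)) + ennreal e" .
  qed
qed

lemma emeasure_surface_measure:
  assumes "A \<in> sets (restrict_space borel S)"
  shows "emeasure (surface_measure S) A = surface_outer S A"
proof (rule emeasure_measure_of[OF surface_measure_def])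
  show "sets (restrict_space borel S) \<subseteq> Pow S"
    using sets.sets_into_space[of _ "restrict_space borel S"] by (auto simp: space_restrict_space)
  have "sets (surface_measure S) = sigma_sets S (sets (restrict_space borel S))"
    using \<open>_ \<subseteq> Pow S\<close> by (simp add: surface_measure_def)
  also have "\<dots> = sets (restrict_space borel S)"
    using sets.sigma_sets_eq[of "restrict_space borel S"] by (simp add: space_restrict_space)
  finally have eq: "sets (surface_measure S) = sets (restrict_space borel S)" .
  show "A \<in> sets (surface_measure S)" using assms eq by simp
  show "countably_additive (sets (surface_measure S)) (surface_outer S)"
    unfolding eq by (rule surface_outer_countably_additive)
qed (auto simp: positive_def surface_outer_empty)


subsection \<open>The Fourier transform of surface measure and the restriction operator\<close>

definition surface_fourier :: "'a::euclidean_space set \<Rightarrow> 'a \<Rightarrow> complex" where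
  "surface_fourier S \<xi> = (LINT x|surface_measure S. exp (- \<i> * of_real (x \<bullet> \<xi>)))"

definition restriction_bounded :: "'a::euclidean_space set \<Rightarrow> real \<Rightarrow> bool" where
  "restriction_bounded S p \<longleftrightarrow>
     (\<exists>C. \<forall>f. schwartz f \<longrightarrow>
        Lp_norm (surface_measure S) 2 (fourier_transform f) \<le> C * Lp_norm lborel p f)"

end

(*
  Near each point S is the graph of a function which is convex up to sign. Testing
  the restriction inequality on modulated Gaussians adapted to a cap
  (Knapp's example) bounds the measure of a cap in terms of the volume of any parallelepiped containing it.
  By Auerbach's lemma the cylinder over the convex base of the cap fits into a parallelepiped of comparable
  volume. The resulting inequality contains the measure of the cap on both sides; solving for it shows
  that the caps of height delta have measure O(delta^r), uniformly in the base point.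

  Conversely, uniform cap bounds yield Fourier decay for convex finite type surfaces. Let y0 minimize
  the phase f of a localized integral on a closed ball of the chart, which need not be a critical point.
  Averaging over dilations about y0 turns the integral into a superposition of oscillatory integrals over
  s |-> y0 + e^s v. Along such a ray the remainder f - f(y0) is nonnegative and, by convexity and
  finite type, its logarithmic derivatives are bounded by a multiple of the remainder itself. Hence repeated integration
  by parts gives O((1 + f(y) - f(y0))^(-N)). If the frequency is close to normal, the dyadic sum of this
  bound over caps is O(|xi|^(-r)); otherwise f - f(y0) is at least of order |xi| on the relevant rays.
*)
theory Submission
  imports Defs
begin

text \<open>That the cap inequality can be solved is a matter of exponents: p = 2(r+1)/(r+2) has 1 -
  1/p = r/(2(r+1)), which lies below the 1/2 that the L^2 norm puts on the measure of the cap, and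
  the difference 1/(2(r+1)) turns the exponent of delta into exactly r. The obstacle to the converse
  is that the Hessian of the phase may degenerate in a manner that depends on direction and base
  point, so there is no normal form. What survives is one-dimensional: on each line the Taylor
  remainder g satisfies t^j |g^(j)(t)| <= C g(t) for small t, with one C for all base points and
  unit directions. These bounds are invariant under scaling of t, which is why rays are parametrized
  by log t. A minimizer on the ball replaces the critical point because its first-order condition
  gives a linear term that is nonnegative towards every point of the ball and hence grows along the
  rays together with the remainder. The dyadic sum asks only for N > r integrations by parts, so
  powers of truncated polynomials can serve as cutoffs.\<close>

section \<open>Differentiability of finite order\<close>

text \<open>Order k here means k + 1 derivatives: the iterated derivatives of length k must still be
  differentiable. The finite order makes closure properties provable by induction on k and admits
  cutoffs that are not smooth.\<close>

definition diff_on ::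
  "nat \<Rightarrow> 'a::real_normed_vector set \<Rightarrow> ('a \<Rightarrow> 'b::real_normed_vector) \<Rightarrow> bool" where
  "diff_on k U f \<longleftrightarrow>
     (\<forall>vs. length vs \<le> k \<longrightarrow> (\<forall>x\<in>U. iterated_deriv vs f differentiable (at x)))"

lemma smooth_on_iff_diff_on: "smooth_on U f \<longleftrightarrow> (\<forall>k. diff_on k U f)"
  unfolding smooth_on_def diff_on_def by blast

lemma smooth_on_imp_diff_on: "smooth_on U f \<Longrightarrow> diff_on k U f"
  by (simp add: smooth_on_iff_diff_on)

lemma iterated_deriv_append:
  "iterated_deriv (vs @ ws) f = iterated_deriv vs (iterated_deriv ws f)"
  by (induction vs) auto

lemma diff_on_0: "diff_on 0 U f \<longleftrightarrow> (\<forall>x\<in>U. f differentiable (at x))"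
  by (simp add: diff_on_def)

lemma diff_on_Suc:
  "diff_on (Suc k) U f \<longleftrightarrow>
     (\<forall>x\<in>U. f differentiable (at x)) \<and> (\<forall>v. diff_on k U (\<lambda>x. frechet_derivative f (at x) v))"
proof (intro iffI conjI allI)
  assume L: "diff_on (Suc k) U f"
  show "\<forall>x\<in>U. f differentiable (at x)"
    using L unfolding diff_on_def by (metis iterated_deriv.simps(1) le0 list.size(3))
  show "diff_on k U (\<lambda>x. frechet_derivative f (at x) v)" for v
    unfolding diff_on_def
  proof (intro allI impI)
    fix vs :: "'a list" assume "length vs \<le> k"
    then show "\<forall>x\<in>U. iterated_deriv vs (\<lambda>x. frechet_derivative f (at x) v) differentiable at x"
      using L unfolding diff_on_def
      by (auto dest!: spec[of _ "vs @ [v]"] simp: iterated_deriv_append)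
  qed
next
  assume R: "(\<forall>x\<in>U. f differentiable (at x)) \<and> (\<forall>v. diff_on k U (\<lambda>x. frechet_derivative f (at x) v))"
  show "diff_on (Suc k) U f"
    unfolding diff_on_def
  proof (intro allI impI)
    fix vs :: "'a list" assume l: "length vs \<le> Suc k"
    show "\<forall>x\<in>U. iterated_deriv vs f differentiable at x"
    proof (cases vs rule: rev_cases)
      case Nil
      then show ?thesis using R by simp
    next
      case (snoc ws v)
      then show ?thesis using R l by (auto simp: diff_on_def iterated_deriv_append)
    qed
  qed
qed

lemma diff_on_mono: "diff_on k U f \<Longrightarrow> j \<le> k \<Longrightarrow> diff_on j U f"
  by (auto simp: diff_on_def)

lemma diff_on_subset: "diff_on k U f \<Longrightarrow> V \<subseteq> U \<Longrightarrow> diff_on k V f"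
  by (auto simp: diff_on_def)

lemma diff_on_imp_differentiable: "diff_on k U f \<Longrightarrow> x \<in> U \<Longrightarrow> f differentiable (at x)"
  using diff_on_0 diff_on_mono by blast

lemma diff_on_imp_has_derivative:
  "diff_on k U f \<Longrightarrow> x \<in> U \<Longrightarrow> (f has_derivative frechet_derivative f (at x)) (at x)"
  using diff_on_imp_differentiable frechet_derivative_works by blast

lemma diff_on_imp_continuous_on: "diff_on k U f \<Longrightarrow> continuous_on U f"
  by (meson continuous_at_imp_continuous_on diff_on_imp_differentiable differentiable_imp_continuous_within)

text \<open>Differentiability is not assumed: \<open>f\<close> and \<open>g\<close> have the same
  derivatives at \<open>x\<close>, so where there is none both sides are the same arbitrary
  choice.\<close>

lemma frechet_derivative_cong_open:
  assumes "open U" "x \<in> U" "\<And>y. y \<in> U \<Longrightarrow> f y = g y"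
  shows "frechet_derivative f (at x) = frechet_derivative g (at x)"
proof -
  have "(f has_derivative D) (at x) \<longleftrightarrow> (g has_derivative D) (at x)" for D
    using has_derivative_transform_within_open[OF _ assms(1,2), of f D UNIV g]
      has_derivative_transform_within_open[OF _ assms(1,2), of g D UNIV f] assms(3) by auto
  then show ?thesis unfolding frechet_derivative_def by simp
qed

lemma iterated_deriv_cong_open:
  assumes "open U" "x \<in> U" "\<And>y. y \<in> U \<Longrightarrow> f y = g y"
  shows "iterated_deriv vs f x = iterated_deriv vs g x"
  using assms(2)
proof (induction vs arbitrary: x)
  case (Cons v vs)
  then show ?case
    using frechet_derivative_cong_open[OF assms(1), of x "iterated_deriv vs f" "iterated_deriv vs g"] by simp
qed (use assms in auto)

lemma diff_on_cong_imp:
  assumes "open U" "diff_on k U f" "\<And>y. y \<in> U \<Longrightarrow> f y = g y"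
  shows "diff_on k U g"
  unfolding diff_on_def
proof (intro allI impI ballI)
  fix vs :: "'a list" and x assume *: "length vs \<le> k" "x \<in> U"
  have "iterated_deriv vs f differentiable at x" using assms(2) * by (auto simp: diff_on_def)
  then show "iterated_deriv vs g differentiable at x"
    unfolding differentiable_def
    using has_derivative_transform_within_open[OF _ assms(1) *(2), of "iterated_deriv vs f" _ UNIV "iterated_deriv vs g"]
      iterated_deriv_cong_open[of U _ f g vs, OF assms(1) _ assms(3)] by blast
qed

lemma diff_on_SucI:
  assumes "open U" "\<And>x. x \<in> U \<Longrightarrow> (f has_derivative f' x) (at x)"
    "\<And>v. diff_on k U (\<lambda>x. f' x v)"
  shows "diff_on (Suc k) U f"
  unfolding diff_on_Suc
proof (intro conjI allI ballI)
  show "f differentiable at x" if "x \<in> U" for x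
    using assms(2)[OF that] by (auto simp: differentiable_def)
  show "diff_on k U (\<lambda>x. frechet_derivative f (at x) v)" for v
    by (rule diff_on_cong_imp[OF assms(1) assms(3)[of v]]) (metis assms(2) frechet_derivative_at)
qed

lemma diff_on_0I:
  "(\<And>x. x \<in> U \<Longrightarrow> (f has_derivative f' x) (at x)) \<Longrightarrow> diff_on 0 U f"
  by (auto simp: diff_on_0 differentiable_def)

lemma diff_on_deriv:
  "diff_on (Suc k) U f \<Longrightarrow> diff_on k U (\<lambda>x. frechet_derivative f (at x) v)"
  by (simp add: diff_on_Suc)

lemma diff_on_const: "diff_on k U (\<lambda>x. c)"
proof (induction k arbitrary: c)
  case (Suc k)
  have "frechet_derivative (\<lambda>x::'a. c) (at x) = (\<lambda>v. 0)" for x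
    using frechet_derivative_at[OF has_derivative_const] by metis
  then show ?case using Suc[of 0] by (simp add: diff_on_Suc)
qed (simp add: diff_on_0)

lemma diff_on_bounded_linear:
  assumes "bounded_linear f" shows "diff_on k U f"
proof (cases k)
  case 0
  then show ?thesis using assms
    by (auto simp: diff_on_0 bounded_linear_imp_differentiable)
next
  case (Suc k')
  have "frechet_derivative f (at x) = f" for x
    using frechet_derivative_at[OF bounded_linear_imp_has_derivative[OF assms]] by metis
  moreover have "diff_on k' U (\<lambda>x::'a. f v)" for v by (rule diff_on_const)
  ultimately show ?thesis unfolding Suc diff_on_Suc
    by (simp add: bounded_linear_imp_differentiable[OF assms])
qed

lemma diff_on_add:
  assumes "open U" "diff_on k U f" "diff_on k U g"
  shows "diff_on k U (\<lambda>x. f x + g x)"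
  using assms(2,3)
proof (induction k arbitrary: f g)
  case 0
  then show ?case by (auto simp: diff_on_0)
next
  case (Suc k)
  show ?case
    by (rule diff_on_SucI[OF assms(1) has_derivative_add[OF
          diff_on_imp_has_derivative[OF Suc.prems(1)] diff_on_imp_has_derivative[OF Suc.prems(2)]]])
       (simp_all only: Suc.IH Suc.prems diff_on_deriv)
qed

lemma diff_on_linear_compose:
  assumes L: "bounded_linear L" and "open U" "diff_on k U f"
  shows "diff_on k U (\<lambda>x. L (f x))"
  using assms(3)
proof (induction k arbitrary: f)
  case 0
  then show ?case using bounded_linear.has_derivative[OF L] unfolding diff_on_0 differentiable_def by blast
next
  case (Suc k)
  show ?case
    by (rule diff_on_SucI[OF assms(2) bounded_linear.has_derivative[OF L diff_on_imp_has_derivative[OF Suc.prems]]])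
       (simp_all only: Suc.IH Suc.prems diff_on_deriv)
qed

lemma diff_on_bilinear:
  assumes B: "bounded_bilinear B" and "open U" "diff_on k U f" "diff_on k U g"
  shows "diff_on k U (\<lambda>x. B (f x) (g x))"
  using assms(3,4)
proof (induction k arbitrary: f g)
  case 0
  then show ?case using bounded_bilinear.FDERIV[OF B] unfolding diff_on_0 differentiable_def by blast
next
  case (Suc k)
  have *: "diff_on k U f" "diff_on k U g" using Suc.prems diff_on_mono le_Suc_eq by blast+
  show ?case
    by (rule diff_on_SucI[OF assms(2) bounded_bilinear.FDERIV[OF B
          diff_on_imp_has_derivative[OF Suc.prems(1)] diff_on_imp_has_derivative[OF Suc.prems(2)]]])
       (simp_all only: diff_on_add[OF assms(2)] Suc.IH * diff_on_deriv[OF Suc.prems(1)] diff_on_deriv[OF Suc.prems(2)])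
qed

lemmas diff_on_mult = diff_on_bilinear[OF bounded_bilinear_mult]
lemmas diff_on_scaleR = diff_on_bilinear[OF bounded_bilinear_scaleR]
lemmas diff_on_uminus = diff_on_linear_compose[OF bounded_linear_minus[OF bounded_linear_ident]]

lemma diff_on_diff:
  "open U \<Longrightarrow> diff_on k U f \<Longrightarrow> diff_on k U g \<Longrightarrow> diff_on k U (\<lambda>x. f x - g x)"
  using diff_on_add[of U k f "\<lambda>x. - g x"] diff_on_uminus[of U k g] by simp

lemma diff_on_sum:
  assumes "open U" "\<And>i. i \<in> I \<Longrightarrow> diff_on k U (f i)"
  shows "diff_on k U (\<lambda>x. \<Sum>i\<in>I. f i x)"
  using assms(2) by (induction I rule: infinite_finite_induct) (auto intro!: diff_on_add assms(1) diff_on_const)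

lemma diff_on_power:
  fixes f :: "_ \<Rightarrow> real"
  assumes "open U" "diff_on k U f" shows "diff_on k U (\<lambda>x. f x ^ m)"
  by (induction m) (auto intro!: diff_on_mult diff_on_const assms)

lemma diff_on_inverse:
  fixes f :: "'a::real_normed_vector \<Rightarrow> real"
  assumes "open U" "diff_on k U f" "\<And>x. x \<in> U \<Longrightarrow> f x \<noteq> 0"
  shows "diff_on k U (\<lambda>x. inverse (f x))"
  using assms(2)
proof (induction k)
  case 0
  show ?case
    by (rule diff_on_0I[OF Deriv.has_derivative_inverse[OF assms(3) diff_on_imp_has_derivative[OF 0]]])
next
  case (Suc k)
  have *: "diff_on k U f" using Suc.prems diff_on_mono le_Suc_eq by blast
  show ?case
  proof (rule diff_on_SucI[OF assms(1)])
    show "((\<lambda>x. inverse (f x)) has_derivative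
        (\<lambda>v. - (inverse (f x) * frechet_derivative f (at x) v * inverse (f x)))) (at x)" if "x \<in> U" for x
      by (rule Deriv.has_derivative_inverse[OF assms(3)[OF that] diff_on_imp_has_derivative[OF Suc.prems that]])
    show "diff_on k U (\<lambda>x. - (inverse (f x) * frechet_derivative f (at x) v * inverse (f x)))" for v
      by (intro diff_on_uminus diff_on_mult assms(1) Suc.IH * diff_on_deriv[OF Suc.prems])
  qed
qed

lemma diff_on_divide:
  fixes f g :: "'a::real_normed_vector \<Rightarrow> real"
  assumes "open U" "diff_on k U f" "diff_on k U g" "\<And>x. x \<in> U \<Longrightarrow> g x \<noteq> 0"
  shows "diff_on k U (\<lambda>x. f x / g x)"
  unfolding divide_inverse by (intro diff_on_mult diff_on_inverse assms)

lemma diff_on_sqrt: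
  fixes f :: "'a::real_normed_vector \<Rightarrow> real"
  assumes "open U" "diff_on k U f" "\<And>x. x \<in> U \<Longrightarrow> f x > 0"
  shows "diff_on k U (\<lambda>x. sqrt (f x))"
  using assms(2)
proof (induction k)
  case 0
  show ?case
  proof (rule diff_on_0I)
    show "((\<lambda>x. sqrt (f x)) has_derivative
        (\<lambda>v. frechet_derivative f (at x) v * (inverse (sqrt (f x)) / 2))) (at x)" if "x \<in> U" for x
      using assms(3)[OF that] that 
      by (intro has_derivative_real_sqrt diff_on_imp_has_derivative[OF 0]) auto
  qed
next
  case (Suc k)
  have *: "diff_on k U f" using Suc.prems diff_on_mono le_Suc_eq by blast
  show ?case
  proof (rule diff_on_SucI[OF assms(1)])
    show "((\<lambda>x. sqrt (f x)) has_derivative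
        (\<lambda>v. frechet_derivative f (at x) v * (inverse (sqrt (f x)) / 2))) (at x)" if "x \<in> U" for x
      using assms(3)[OF that] that
      by (intro has_derivative_real_sqrt diff_on_imp_has_derivative[OF Suc.prems]) auto
    have "sqrt (f x) \<noteq> 0" if "x \<in> U" for x using assms(3)[OF that] by simp
    then show "diff_on k U (\<lambda>x. frechet_derivative f (at x) v * (inverse (sqrt (f x)) / 2))" for v
      by (intro diff_on_divide diff_on_inverse diff_on_mult assms(1) diff_on_const Suc.IH * diff_on_deriv[OF Suc.prems]) auto
  qed
qed

text \<open>The chain rule is expanded over the basis because iterated derivatives have fixed
  directions, whereas the inner derivative is a direction that moves with the point. Each summand is
  then a product to which the induction hypothesis applies.\<close>

lemma diff_on_compose:
  fixes f :: "'b::euclidean_space \<Rightarrow> 'c::real_normed_vector" and g :: "'a::real_normed_vector \<Rightarrow> 'b"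
  assumes "open U" "diff_on k V f" "diff_on k U g" "\<And>x. x \<in> U \<Longrightarrow> g x \<in> V"
  shows "diff_on k U (\<lambda>x. f (g x))"
  using assms(2,3)
proof (induction k arbitrary: f)
  case 0
  show ?case
    by (rule diff_on_0I[OF has_derivative_compose[OF diff_on_imp_has_derivative[OF 0(2)] diff_on_imp_has_derivative[OF 0(1)]]])
       (use assms(4) in auto)
next
  case (Suc k)
  have *: "diff_on k U g" using Suc.prems diff_on_mono le_Suc_eq by blast
  show ?case
  proof (rule diff_on_SucI[OF assms(1)])
    show "((\<lambda>x. f (g x)) has_derivative
       (\<lambda>v. \<Sum>i\<in>Basis. (frechet_derivative g (at x) v \<bullet> i) *\<^sub>R frechet_derivative f (at (g x)) i)) (at x)" if "x \<in> U" for x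
    proof -
      have D: "(f has_derivative frechet_derivative f (at (g x))) (at (g x))"
        by (rule diff_on_imp_has_derivative[OF Suc.prems(1) assms(4)[OF that]])
      interpret L: bounded_linear "frechet_derivative f (at (g x))"
        using D by (rule has_derivative_bounded_linear)
      have "(\<lambda>v. \<Sum>i\<in>Basis. (frechet_derivative g (at x) v \<bullet> i) *\<^sub>R frechet_derivative f (at (g x)) i)
          = (\<lambda>v. frechet_derivative f (at (g x)) (frechet_derivative g (at x) v))"
        by (subst (3) euclidean_representation[symmetric]) (simp add: L.sum L.scaleR)
      then show ?thesis
        using has_derivative_compose[OF diff_on_imp_has_derivative[OF Suc.prems(2) that] D] by simp
    qed
    show "diff_on k U (\<lambda>x. \<Sum>i\<in>Basis. (frechet_derivative g (at x) v \<bullet> i) *\<^sub>R frechet_derivative f (at (g x)) i)" for v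
      by (intro diff_on_sum diff_on_scaleR assms(1) diff_on_linear_compose[OF bounded_linear_inner_left]
            Suc.IH[OF diff_on_deriv[OF Suc.prems(1)] *] diff_on_deriv[OF Suc.prems(2)])
  qed
qed

lemma has_field_derivative_max_0_power:
  "((\<lambda>t::real. (max 0 t) ^ Suc (Suc m)) has_field_derivative real (Suc (Suc m)) * (max 0 t) ^ Suc m) (at t)"
proof -
  consider "t < 0" | "t > 0" | "t = 0" by linarith
  then show ?thesis
  proof cases
    case 1
    have "((\<lambda>t::real. 0) has_field_derivative real (Suc (Suc m)) * (max 0 t) ^ Suc m) (at t)"
      using 1 by (auto intro!: derivative_eq_intros)
    then show ?thesis
      by (rule DERIV_cong_ev[THEN iffD1, rotated -1])
         (use 1 in \<open>auto intro!: eventually_mono[OF eventually_nhds_in_open[of "{..<0}"]]\<close>)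
  next
    case 2
    have "((\<lambda>t::real. t ^ Suc (Suc m)) has_field_derivative real (Suc (Suc m)) * (max 0 t) ^ Suc m) (at t)"
      using 2 by (auto intro!: derivative_eq_intros simp del: power_Suc)
    then show ?thesis
      by (rule DERIV_cong_ev[THEN iffD1, rotated -1])
         (use 2 in \<open>auto intro!: eventually_mono[OF eventually_nhds_in_open[of "{0<..}"]]\<close>)
  next
    case 3
    have "((\<lambda>h::real. (max 0 h) ^ Suc (Suc m) / h) \<longlongrightarrow> 0) (at 0)"
    proof (rule Lim_null_comparison)
      show "\<forall>\<^sub>F h in at 0. norm ((max 0 h) ^ Suc (Suc m) / h) \<le> \<bar>h\<bar> ^ Suc m"
      proof (rule eventually_at_topological[THEN iffD2], intro exI[of _ UNIV] conjI ballI impI)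
        fix h :: real assume "h \<noteq> 0"
        have "norm ((max 0 h) ^ Suc (Suc m) / h) \<le> \<bar>h\<bar> ^ Suc (Suc m) / \<bar>h\<bar>"
          unfolding real_norm_def abs_divide power_abs by (intro divide_right_mono power_mono) auto
        then show "norm ((max 0 h) ^ Suc (Suc m) / h) \<le> \<bar>h\<bar> ^ Suc m" using \<open>h \<noteq> 0\<close> by simp
      qed auto
      show "((\<lambda>h::real. \<bar>h\<bar> ^ Suc m) \<longlongrightarrow> 0) (at 0)" by (auto intro!: tendsto_eq_intros)
    qed
    then show ?thesis using 3 by (simp add: DERIV_def)
  qed
qed

text \<open>Each derivative costs one power, and differentiating across the kink needs an exponent
  of at least 2. Tying the exponent to the order as k + 2 makes the induction hypothesis
  fit.\<close>

lemma diff_on_max_0_power: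
  fixes q :: "'a::real_normed_vector \<Rightarrow> real"
  assumes "open U" "diff_on k U q"
  shows "diff_on k U (\<lambda>x. (max 0 (q x)) ^ (k + 2))"
proof -
  have d: "((\<lambda>x. (max 0 (q x)) ^ Suc (Suc m)) has_derivative
      (\<lambda>v. frechet_derivative q (at x) v * (real (Suc (Suc m)) * (max 0 (q x)) ^ Suc m))) (at x)"
    if "x \<in> U" for x m
    by (rule has_derivative_compose[OF diff_on_imp_has_derivative[OF assms(2) that]
          has_field_derivative_max_0_power[unfolded has_field_derivative_def], THEN has_derivative_eq_rhs])
       (auto simp: mult_ac)
  have "j \<le> k \<Longrightarrow> diff_on j U (\<lambda>x. (max 0 (q x)) ^ (j + 2))" for j
  proof (induction j)
    case 0
    then show ?case using diff_on_0I[OF d[where m=0]] by (simp add: numeral_2_eq_2)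
  next
    case (Suc j)
    have q: "diff_on (Suc j) U q" using assms(2) Suc.prems diff_on_mono by blast
    have "diff_on j U (\<lambda>x. frechet_derivative q (at x) v * (real (Suc (Suc (Suc j))) * (max 0 (q x)) ^ Suc (Suc j)))" for v
      using Suc.IH Suc.prems by (intro diff_on_mult assms(1) diff_on_const diff_on_deriv[OF q]) simp
    from diff_on_SucI[OF assms(1) d[where m="Suc j"] this] show ?case by simp
  qed
  then show ?thesis by simp
qed

section \<open>Symbol estimates on the unit interval and integration by parts\<close>

text \<open>A symbol class: \<open>u\<close> and its first K derivatives are bounded by C times one
  common weight \<open>w\<close>, and the last derivative is continuous. Recursion through an
  existential derivative avoids naming higher derivatives and turns the Leibniz rule into an
  induction. The weight itself is never differentiated.\<close>

primrec jet ::
  "nat \<Rightarrow> real \<Rightarrow> (real \<Rightarrow> real) \<Rightarrow> (real \<Rightarrow> complex) \<Rightarrow> bool" where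
  "jet 0 C w u \<longleftrightarrow> continuous_on {0..1} u \<and> (\<forall>s\<in>{0..1}. norm (u s) \<le> C * w s)"
| "jet (Suc K) C w u \<longleftrightarrow> (\<forall>s\<in>{0..1}. norm (u s) \<le> C * w s) \<and>
     (\<exists>u'. (\<forall>s\<in>{0..1}. (u has_vector_derivative u' s) (at s within {0..1})) \<and> jet K C w u')"

lemma jet_bound: "jet K C w u \<Longrightarrow> s \<in> {0..1} \<Longrightarrow> norm (u s) \<le> C * w s"
  by (cases K) auto

lemma jet_continuous: "jet K C w u \<Longrightarrow> continuous_on {0..1} u"
  by (cases K) (auto intro: continuous_on_vector_derivative)

lemma jet_mono:
  "jet K C w u \<Longrightarrow> (\<And>s. s \<in> {0..1} \<Longrightarrow> C * w s \<le> C' * w' s) \<Longrightarrow> jet K C' w' u"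
proof (induction K arbitrary: u)
  case (Suc K)
  then obtain u' where u': "\<forall>s\<in>{0..1}. (u has_vector_derivative u' s) (at s within {0..1})" "jet K C w u'"
    by auto
  show ?case
    using Suc.prems(1) Suc.IH[OF u'(2) Suc.prems(2)] u'(1) by (auto intro: order_trans Suc.prems(2))
qed (auto intro: order_trans)

lemma jet_Suc_imp: "jet (Suc K) C w u \<Longrightarrow> jet K C w u"
proof (induction K arbitrary: u)
  case 0
  then show ?case using jet_continuous[OF 0] by auto
next
  case (Suc K)
  then show ?case unfolding jet.simps(2)[of "Suc K"] jet.simps(2)[of K] by blast
qed

lemma jet_cong: "jet K C w u \<Longrightarrow> (\<And>s. s \<in> {0..1} \<Longrightarrow> u s = v s) \<Longrightarrow> jet K C w v"
proof (cases K)
  case (Suc k)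
  assume a: "jet K C w u" "\<And>s. s \<in> {0..1} \<Longrightarrow> u s = v s"
  then obtain u' where u': "\<forall>s\<in>{0..1}. (u has_vector_derivative u' s) (at s within {0..1})" "jet k C w u'"
    using Suc by auto
  have "(v has_vector_derivative u' s) (at s within {0..1})" if "s \<in> {0..1}" for s
    using u'(1) that a(2) by (metis has_vector_derivative_transform)
  then have "\<exists>u'. (\<forall>s\<in>{0..1}. (v has_vector_derivative u' s) (at s within {0..1})) \<and> jet k C w u'"
    using u'(2) by blast
  then show ?thesis using a Suc by simp
next
  case 0
  assume a: "jet K C w u" "\<And>s. s \<in> {0..1} \<Longrightarrow> u s = v s"
  then have "continuous_on {0..1} v" using continuous_on_eq[of "{0..1}" u v] 0 by simp
  then show ?thesis using a 0 by simp
qed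

lemma jet_add:
  "jet K C w u \<Longrightarrow> jet K D w v \<Longrightarrow> jet K (C + D) w (\<lambda>s. u s + v s)"
proof (induction K arbitrary: u v)
  case 0
  then show ?case by (auto intro!: continuous_intros norm_triangle_le simp: distrib_right add_mono)
next
  case (Suc K)
  obtain u' where u': "\<forall>s\<in>{0..1}. (u has_vector_derivative u' s) (at s within {0..1})" "jet K C w u'"
    using Suc.prems by auto
  obtain v' where v': "\<forall>s\<in>{0..1}. (v has_vector_derivative v' s) (at s within {0..1})" "jet K D w v'"
    using Suc.prems by auto
  have "norm (u s + v s) \<le> (C + D) * w s" if "s \<in> {0..1}" for s
    using jet_bound[OF Suc.prems(1) that] jet_bound[OF Suc.prems(2) that]
    by (intro norm_triangle_le) (simp add: distrib_right)
  then show ?case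
    using Suc.IH[OF u'(2) v'(2)] u'(1) v'(1) by (auto intro!: exI[of _ "\<lambda>s. u' s + v' s"] derivative_intros)
qed

text \<open>The Leibniz rule doubles the number of terms with each derivative, whence 2^K; the
  weights multiply.\<close>

lemma jet_mult:
  "jet K C w u \<Longrightarrow> jet K D w' v \<Longrightarrow> jet K (2 ^ K * (C * D)) (\<lambda>s. w s * w' s) (\<lambda>s. u s * v s)"
proof (induction K arbitrary: u v)
  case 0
  have "norm (u s) * norm (v s) \<le> (C * w s) * (D * w' s)" if "s \<in> {0..1}" for s
    by (rule mult_mono') (use 0 that in auto)
  then show ?case using 0 by (auto intro!: continuous_intros simp: norm_mult mult_ac)
next
  case (Suc K)
  obtain u' where u': "\<forall>s\<in>{0..1}. (u has_vector_derivative u' s) (at s within {0..1})" "jet K C w u'"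
    using Suc.prems by auto
  obtain v' where v': "\<forall>s\<in>{0..1}. (v has_vector_derivative v' s) (at s within {0..1})" "jet K D w' v'"
    using Suc.prems by auto
  have b: "norm (u s * v s) \<le> 2 ^ Suc K * (C * D) * (w s * w' s)" if "s \<in> {0..1}" for s
  proof -
    have *: "norm (u s) * norm (v s) \<le> (C * w s) * (D * w' s)"
      by (rule mult_mono') (use jet_bound[OF Suc.prems(1) that] jet_bound[OF Suc.prems(2) that] in auto)
    then have "0 \<le> (C * w s) * (D * w' s)" by (meson mult_nonneg_nonneg norm_ge_zero order_trans)
    then have "1 * ((C * w s) * (D * w' s)) \<le> 2 ^ Suc K * ((C * w s) * (D * w' s))"
      by (intro mult_right_mono) (auto intro: one_le_power simp del: power_Suc)
    then show ?thesis using * by (simp add: norm_mult mult_ac)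
  qed
  have "jet K (2 ^ K * (C * D) + 2 ^ K * (C * D)) (\<lambda>s. w s * w' s) (\<lambda>s. u s * v' s + u' s * v s)"
    using Suc.IH[OF jet_Suc_imp[OF Suc.prems(1)] v'(2)] Suc.IH[OF u'(2) jet_Suc_imp[OF Suc.prems(2)]]
    by (rule jet_add)
  also have "2 ^ K * (C * D) + 2 ^ K * (C * D) = 2 ^ Suc K * (C * D)" by simp
  finally have "jet K (2 ^ Suc K * (C * D)) (\<lambda>s. w s * w' s) (\<lambda>s. u s * v' s + u' s * v s)" .
  moreover have "((\<lambda>s. u s * v s) has_vector_derivative (u s * v' s + u' s * v s)) (at s within {0..1})"
    if "s \<in> {0..1}" for s
    by (intro has_vector_derivative_mult u'(1)[rule_format] v'(1)[rule_format] that)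
  ultimately show ?case unfolding jet.simps(2) using b
    by (intro conjI ballI exI[of _ "\<lambda>s. u s * v' s + u' s * v s"])
qed

lemma jet_const_zero: "0 \<le> C \<Longrightarrow> jet K C (\<lambda>_. 1) (\<lambda>_. 0)"
  by (induction K) (auto intro!: exI[of _ "\<lambda>_. 0"])

lemma jet_const: "jet K (norm c) (\<lambda>_. 1) (\<lambda>_. c)"
  by (cases K) (auto intro!: exI[of _ "\<lambda>_. 0"] jet_const_zero)

lemma jet_cmult:
  assumes "jet K C w u" shows "jet K (2 ^ K * (norm c * C)) w (\<lambda>s. c * u s)"
  using jet_mult[OF jet_const assms, of c] by simp

lemma jet_exp: "\<exists>C\<ge>0. jet K C (\<lambda>_. 1) (\<lambda>s. of_real (exp (d * s)))"
proof (induction K)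
  case 0
  have "exp (d * s) \<le> exp \<bar>d\<bar>" if "s \<in> {0..1}" for s
    using that by (simp add: mult_left_le abs_mult order_trans[OF abs_ge_self])
  then show ?case by (auto intro!: exI[of _ "exp \<bar>d\<bar>"] continuous_intros)
next
  case (Suc K)
  then obtain C where C: "C \<ge> 0" "jet K C (\<lambda>_. 1) (\<lambda>s. of_real (exp (d * s)) :: complex)" by blast
  let ?C = "max C (2 ^ K * (norm (of_real d :: complex) * C))"
  have "jet K ?C (\<lambda>_. 1) (\<lambda>s. of_real d * of_real (exp (d * s)))"
    by (rule jet_mono[OF jet_cmult[OF C(2)]]) auto
  moreover have "((\<lambda>s. of_real (exp (d * s)) :: complex) has_vector_derivative of_real d * of_real (exp (d * s))) (at s within {0..1})" for s
    by (rule has_vector_derivative_eq_rhs[OF has_vector_derivative_of_real[where D="d * exp (d * s)"]])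
       (auto intro!: derivative_eq_intros simp: has_real_derivative_iff_has_vector_derivative[symmetric])
  moreover have "norm (of_real (exp (d * s)) :: complex) \<le> ?C * 1" if "s \<in> {0..1}" for s
    using jet_bound[OF C(2) that] by (auto simp: max_def)
  ultimately show ?case using C(1) unfolding jet.simps
    by (intro exI[of _ ?C] conjI ballI exI[of _ "\<lambda>s. of_real d * of_real (exp (d * s))"])
      (auto simp: le_max_iff_disj simp del: norm_of_real)
qed

text \<open>An indicator of the open interval as weight says that the function and its first K
  derivatives vanish at both end points, which removes all boundary terms of repeated integration by
  parts. One power is lost per derivative and at least one must remain, hence K < M.\<close>

lemma jet_flat_bump:
  "K < M \<Longrightarrow> \<exists>C\<ge>0. jet K C (indicator {0<..<1}) (\<lambda>s. of_real ((s * (1 - s)) ^ M))"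
proof (induction K arbitrary: M)
  case 0
  have "(s * (1 - s)) ^ M \<le> indicator {0<..<1} s" if "s \<in> {0..1}" for s :: real
  proof (cases "s \<in> {0<..<1}")
    case True
    then show ?thesis by (auto intro!: power_le_one mult_le_one)
  qed (use that 0 in \<open>auto simp: zero_power\<close>)
  then show ?case by (auto intro!: exI[of _ 1] continuous_intros simp: norm_power norm_mult abs_mult power_mult_distrib[symmetric] simp del: of_real_power of_real_mult)
next
  case (Suc K)
  then obtain m where M: "M = Suc m" "K < m" by (cases M) auto
  then obtain C where C: "C \<ge> 0" "jet K C (indicator {0<..<1}) (\<lambda>s. of_real ((s * (1 - s)) ^ m))"
    using Suc.IH by blast
  obtain C0 where C0: "C0 \<ge> 0" "jet 0 C0 (indicator {0<..<1}) (\<lambda>s. of_real ((s * (1 - s)) ^ M))"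
    proof -
      have "(s * (1 - s)) ^ M \<le> indicator {0<..<1} s" if "s \<in> {0..1}" for s :: real
      proof (cases "s \<in> {0<..<1}")
        case True
        then show ?thesis by (auto intro!: power_le_one mult_le_one)
      qed (use that M in \<open>auto simp: zero_power\<close>)
      then show ?thesis by (intro that[of 1]) (auto intro!: continuous_intros simp: norm_power norm_mult abs_mult power_mult_distrib[symmetric] simp del: of_real_power of_real_mult)
    qed
  have "jet K 2 (\<lambda>_. 1) (\<lambda>s. of_real (1 - 2 * s))"
  proof (cases K)
    case (Suc k)
    have "jet k 2 (\<lambda>_. 1) (\<lambda>s. -2)" using jet_const[of k "-2"] by simp
    moreover have "((\<lambda>s. of_real (1 - 2 * s) :: complex) has_vector_derivative -2) (at s within {0..1})" for s
      by (rule has_vector_derivative_eq_rhs[OF has_vector_derivative_of_real[where D="-2"]])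
         (auto intro!: derivative_eq_intros simp: has_real_derivative_iff_has_vector_derivative[symmetric])
    moreover have "norm (of_real (1 - 2 * s) :: complex) \<le> 2 * 1" if "s \<in> {0..1}" for s
      using that unfolding norm_of_real by auto
    ultimately show ?thesis unfolding Suc jet.simps by (intro conjI ballI exI[of _ "\<lambda>_. -2"])
  next
    case 0
    have "norm (of_real (1 - 2 * s) :: complex) \<le> 2 * 1" if "s \<in> {0..1}" for s
      using that unfolding norm_of_real by auto
    then show ?thesis unfolding 0 jet.simps by (auto intro!: continuous_intros)
  qed
  from jet_mult[OF this C(2), THEN jet_cmult, of "of_real (real M)"]
  obtain C1 where C1: "jet K C1 (indicator {0<..<1}) (\<lambda>s. of_real (real M) * (of_real (1 - 2 * s) * of_real ((s * (1 - s)) ^ m)))"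
    by auto
  let ?C = "max C0 C1"
  have "jet K ?C (indicator {0<..<1}) (\<lambda>s. of_real (real M) * (of_real (1 - 2 * s) * of_real ((s * (1 - s)) ^ m)))"
    by (rule jet_mono[OF C1]) (auto intro: mult_right_mono)
  moreover have "((\<lambda>s. of_real ((s * (1 - s)) ^ M) :: complex) has_vector_derivative
      of_real (real M) * (of_real (1 - 2 * s) * of_real ((s * (1 - s)) ^ m))) (at s within {0..1})" for s
  proof -
    have "((\<lambda>s. (s * (1 - s)) ^ M) has_real_derivative real M * ((1 - 2 * s) * (s * (1 - s)) ^ m)) (at s within {0..1})"
    proof -
      have "((\<lambda>s. s * (1 - s)) has_real_derivative 1 - 2 * s) (at s within {0..1})"
        by (auto intro!: derivative_eq_intros)
      from DERIV_power[OF this, of M] show ?thesis by (simp add: M mult_ac)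
    qed
    then show ?thesis
      by (intro has_vector_derivative_eq_rhs[OF has_vector_derivative_of_real[where D="real M * ((1 - 2 * s) * (s * (1 - s)) ^ m)"]])
        (auto simp: has_real_derivative_iff_has_vector_derivative)
  qed
  moreover have "norm (of_real ((s * (1 - s)) ^ M) :: complex) \<le> ?C * indicator {0<..<1} s" if "s \<in> {0..1}" for s
    by (rule order_trans[OF jet_bound[OF C0(2) that]]) (auto intro: mult_right_mono)
  ultimately show ?case using C0(1) unfolding jet.simps by (intro exI[of _ ?C] conjI ballI exI) (auto simp: le_max_iff_disj)
qed

lemma has_real_derivative_nonneg_imp_mono:
  fixes f :: "real \<Rightarrow> real"
  assumes "a \<le> b" "{a..b} \<subseteq> S"
    "\<And>x. x \<in> {a..b} \<Longrightarrow> (f has_real_derivative f' x) (at x within S)"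
    "\<And>x. x \<in> {a..b} \<Longrightarrow> 0 \<le> f' x"
  shows "f a \<le> f b"
proof -
  have "(f' has_integral f b - f a) {a..b}"
    using assms by (intro fundamental_theorem_of_calculus)
      (auto simp: has_real_derivative_iff_has_vector_derivative[symmetric] intro: DERIV_subset)
  then have "0 \<le> f b - f a" by (rule has_integral_nonneg) (use assms in auto)
  then show ?thesis by simp
qed

text \<open>With q = 1 / (1 - i p1) one has q' = i p2 q^2. If p2 and its derivatives are O(1 + p1),
  differentiation costs (1 + p1) / (1 + p1)^2, so the class with weight 1 / (1 + p1) reproduces
  itself. The constant D is chosen before p1 and p2, since it has to serve all rays and all
  frequencies.\<close>

lemma jet_resolvent:
  "\<exists>D\<ge>0. \<forall>p1 p2. (\<forall>s\<in>{0..1}. p1 s \<ge> 0 \<and> (p1 has_real_derivative p2 s) (at s within {0..1})) \<and>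
      jet K C (\<lambda>s. 1 + p1 s) (\<lambda>s. of_real (p2 s)) \<longrightarrow>
      jet K D (\<lambda>s. 1 / (1 + p1 s)) (\<lambda>s. 1 / (1 - \<i> * of_real (p1 s)))"
proof (induction K)
  case base: 0
  have b: "norm (1 / (1 - \<i> * of_real x)) \<le> 2 * (1 / (1 + x))" if "x \<ge> 0" for x :: real
  proof -
    have "(1 + x) / 2 \<le> sqrt (1 + x\<^sup>2)"
    proof (rule real_le_rsqrt)
      have "(1 + x)\<^sup>2 \<le> 2 * (1 + x\<^sup>2)" using zero_le_power2[of "1 - x"] by (simp add: power2_eq_square algebra_simps)
      also have "2 * (1 + x\<^sup>2) \<le> 4 * (1 + x\<^sup>2)" by (rule mult_right_mono) auto
      finally have "(1 + x)\<^sup>2 \<le> 4 * (1 + x\<^sup>2)" .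
      then show "((1 + x) / 2)\<^sup>2 \<le> 1 + x\<^sup>2" unfolding power_divide by simp
    qed
    also have "sqrt (1 + x\<^sup>2) = norm (1 - \<i> * of_real x)" by (simp add: cmod_def)
    finally have "(1 + x) / 2 \<le> norm (1 - \<i> * of_real x)" .
    then have "1 / norm (1 - \<i> * of_real x) \<le> 1 / ((1 + x) / 2)" using that by (intro divide_left_mono mult_pos_pos) auto
    then show ?thesis by (simp add: norm_divide)
  qed
  have nz: "1 - \<i> * of_real x \<noteq> 0" for x :: real by (simp add: complex_eq_iff)
  show ?case
  proof (intro exI[of _ 2] conjI allI impI; (elim conjE)?)
    fix p1 p2 assume a: "\<forall>s\<in>{0..1}. p1 s \<ge> 0 \<and> (p1 has_real_derivative p2 s) (at s within {0..1::real})"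
    then have "continuous_on {0..1} p1" using DERIV_continuous_on by blast
    then show "jet 0 2 (\<lambda>s. 1 / (1 + p1 s)) (\<lambda>s. 1 / (1 - \<i> * of_real (p1 s)))"
      using a b nz by (auto intro!: continuous_intros)
  qed auto
next
  case (Suc K)
  then obtain D where D: "D \<ge> 0" "\<And>p1 p2. (\<forall>s\<in>{0..1}. p1 s \<ge> 0 \<and> (p1 has_real_derivative p2 s) (at s within {0..1})) \<and>
      jet K C (\<lambda>s. 1 + p1 s) (\<lambda>s. of_real (p2 s)) \<Longrightarrow>
      jet K D (\<lambda>s. 1 / (1 + p1 s)) (\<lambda>s. 1 / (1 - \<i> * of_real (p1 s)))"
    by blast
  define E where "E = max D (2 ^ K * (norm \<i> * (2 ^ K * (C * (2 ^ K * (D * D))))))"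
  show ?case
  proof (intro exI[of _ E] conjI allI impI)
    show "0 \<le> E" using D(1) by (simp add: E_def le_max_iff_disj)
    fix p1 p2
    assume a: "(\<forall>s\<in>{0..1}. p1 s \<ge> 0 \<and> (p1 has_real_derivative p2 s) (at s within {0..1::real})) \<and>
      jet (Suc K) C (\<lambda>s. 1 + p1 s) (\<lambda>s. of_real (p2 s))"
    let ?q = "\<lambda>s. 1 / (1 - \<i> * of_real (p1 s))"
    have nz: "1 - \<i> * of_real x \<noteq> 0" for x :: real by (simp add: complex_eq_iff)
    have j: "jet K D (\<lambda>s. 1 / (1 + p1 s)) ?q" and jp: "jet K C (\<lambda>s. 1 + p1 s) (\<lambda>s. of_real (p2 s))"
      using D(2) a jet_Suc_imp by blast+
    have "jet K E (\<lambda>s. 1 / (1 + p1 s)) (\<lambda>s. \<i> * (of_real (p2 s) * (?q s * ?q s)))"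
    proof (rule jet_mono[OF jet_cmult[OF jet_mult[OF jp jet_mult[OF j j]]]])
      fix s :: real assume s: "s \<in> {0..1}"
      then have p: "p1 s \<ge> 0" using a by auto
      then have "(1 + p1 s) * (1 / (1 + p1 s) * (1 / (1 + p1 s))) = 1 / (1 + p1 s)" by simp
      then show "2 ^ K * (cmod \<i> * (2 ^ K * (C * (2 ^ K * (D * D))))) * ((1 + p1 s) * (1 / (1 + p1 s) * (1 / (1 + p1 s))))
         \<le> E * (1 / (1 + p1 s))"
        using p by (simp only:) (auto simp: E_def intro!: divide_right_mono)
    qed
    moreover have "(?q has_vector_derivative \<i> * (of_real (p2 s) * (?q s * ?q s))) (at s within {0..1})"
      if "s \<in> {0..1}" for s
    proof -
      have "(p1 has_real_derivative p2 s) (at s within {0..1})"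
        using a that by auto
      then have "((\<lambda>s. 1 - \<i> * of_real (p1 s)) has_vector_derivative - \<i> * of_real (p2 s)) (at s within {0..1})"
        by (auto intro!: derivative_eq_intros has_vector_derivative_of_real)
      moreover have "((\<lambda>z. 1 / z) has_field_derivative - 1 / (z * z)) (at z within T)" if "z \<noteq> 0" for z :: complex and T
        using that by (auto intro!: derivative_eq_intros)
      ultimately have "(((\<lambda>z. 1 / z) \<circ> (\<lambda>s. 1 - \<i> * of_real (p1 s))) has_vector_derivative
          (- \<i> * of_real (p2 s)) * (- 1 / ((1 - \<i> * of_real (p1 s)) * (1 - \<i> * of_real (p1 s))))) (at s within {0..1})"
        by (rule field_vector_diff_chain_within) (use nz in auto)
      then show ?thesis by (simp add: o_def)
    qed
    moreover have "norm (?q s) \<le> E * (1 / (1 + p1 s))" if "s \<in> {0..1}" for s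
    proof (rule order_trans[OF jet_bound[OF j that]])
      show "D * (1 / (1 + p1 s)) \<le> E * (1 / (1 + p1 s))"
        using a that by (intro mult_right_mono) (auto simp: E_def)
    qed
    ultimately show "jet (Suc K) E (\<lambda>s. 1 / (1 + p1 s)) ?q"
      unfolding jet.simps by (intro conjI ballI exI)
  qed
qed

(* Integration by parts with e^(-ip) = q (1 + d/ds) e^(-ip), q = 1 / (1 - i p'), which in contrast to
  1 / p' is regular at zeros of p'. *)

lemma oscillatory_step:
  assumes p: "\<And>s. s \<in> {0..1} \<Longrightarrow> (p has_real_derivative p1 s) (at s within {0..1})"
    and v: "\<And>s. s \<in> {0..1} \<Longrightarrow> (v has_vector_derivative v' s) (at s within {0..1})"
    and c: "continuous_on {0..1} v'" "continuous_on {0..1} p1" and z: "v 0 = 0" "v 1 = 0"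
  shows "integral {0..1} (\<lambda>s. v s * (1 - \<i> * of_real (p1 s)) * exp (- \<i> * of_real (p s)))
       = integral {0..1} (\<lambda>s. (v s - v' s) * exp (- \<i> * of_real (p s)))"
proof -
  have cp: "continuous_on {0..1} p" using p DERIV_continuous_on by blast
  have cv: "continuous_on {0..1} v" using v continuous_on_vector_derivative by blast
  let ?e = "\<lambda>s. exp (- \<i> * of_real (p s))"
  have e: "(?e has_vector_derivative (- \<i> * of_real (p1 s)) * ?e s) (at s within {0..1})" if "s \<in> {0..1}" for s
  proof -
    have "((\<lambda>s. - \<i> * of_real (p s)) has_vector_derivative - \<i> * of_real (p1 s)) (at s within {0..1})"
      by (intro has_vector_derivative_mult_right has_vector_derivative_of_real p that)
    then have "((exp \<circ> (\<lambda>s. - \<i> * of_real (p s))) has_vector_derivative (- \<i> * of_real (p1 s)) * exp (- \<i> * of_real (p s))) (at s within {0..1})"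
      by (rule field_vector_diff_chain_within) (rule has_field_derivative_at_within[OF DERIV_exp])
    then show ?thesis by (simp add: o_def)
  qed
  have "((\<lambda>s. v s * ((- \<i> * of_real (p1 s)) * ?e s) + v' s * ?e s) has_integral v 1 * ?e 1 - v 0 * ?e 0) {0..1}"
    by (rule fundamental_theorem_of_calculus[OF zero_le_one has_vector_derivative_mult[OF v e]])
  then have 1: "integral {0..1} (\<lambda>s. v s * ((- \<i> * of_real (p1 s)) * ?e s) + v' s * ?e s) = 0"
    using z by (simp add: integral_unique)
  have i: "(\<lambda>s. (v s - v' s) * ?e s) integrable_on {0..1}"
    "(\<lambda>s. v s * ((- \<i> * of_real (p1 s)) * ?e s) + v' s * ?e s) integrable_on {0..1}"
    by (rule integrable_continuous_interval; intro continuous_intros cp cv c)+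
  show ?thesis
    using integral_add[OF i] unfolding 1 by (simp add: algebra_simps)
qed

text \<open>Each step replaces u by v - v' with v = u / (1 - i p1): one power of 1 + p1 is gained
  and one derivative is spent. When none is left, p1 >= p >= p(0) converts the accumulated power; p
  is nondecreasing because p1 >= p >= 0. B depends on N, C, A and k alone.\<close>

lemma oscillatory_bound_aux:
  "\<exists>B\<ge>0. \<forall>p p1 p2 u. (\<forall>s\<in>{0..1}. 0 \<le> p s \<and> p s \<le> p1 s \<and> (p has_real_derivative p1 s) (at s within {0..1}) \<and>
        (p1 has_real_derivative p2 s) (at s within {0..1})) \<and>
      jet N C (\<lambda>s. 1 + p1 s) (\<lambda>s. of_real (p2 s)) \<and>
      jet N A (\<lambda>s. indicator {0<..<1} s / (1 + p1 s) ^ k) u \<longrightarrow>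
      norm (integral {0..1} (\<lambda>s. u s * exp (- \<i> * of_real (p s)))) \<le> B / (1 + p 0) ^ (k + N)"
proof (induction N arbitrary: k A)
  case 0
  show ?case
  proof (intro exI[of _ "max 0 A"] conjI allI impI; (elim conjE)?)
    fix p p1 p2 :: "real \<Rightarrow> real" and u
    assume a: "\<forall>s\<in>{0..1}. 0 \<le> p s \<and> p s \<le> p1 s \<and> (p has_real_derivative p1 s) (at s within {0..1}) \<and>
        (p1 has_real_derivative p2 s) (at s within {0..1})"
      and u: "jet 0 A (\<lambda>s. indicator {0<..<1} s / (1 + p1 s) ^ k) u"
    have cp: "continuous_on {0..1} p" using a DERIV_continuous_on by blast
    have mono: "p 0 \<le> p s" if "s \<in> {0..1}" for s
    proof (rule has_real_derivative_nonneg_imp_mono[of 0 s "{0..1}" p p1])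
    qed (use a that in \<open>auto intro: order_trans\<close>)
    have "norm (u s * exp (- \<i> * of_real (p s))) \<le> max 0 A / (1 + p 0) ^ k" if s: "s \<in> {0..1}" for s
    proof -
      have "norm (u s * exp (- \<i> * of_real (p s))) = norm (u s)" by (simp add: norm_mult)
      also have "\<dots> \<le> A * (indicator {0<..<1} s / (1 + p1 s) ^ k)" by (rule jet_bound[OF u s])
      also have "\<dots> \<le> max 0 A * (indicator {0<..<1} s / (1 + p1 s) ^ k)"
      proof -
        have "0 \<le> p s" "p s \<le> p1 s" using a s by auto
        then have "0 \<le> 1 + p1 s" by simp
        then show ?thesis by (intro mult_right_mono divide_nonneg_nonneg zero_le_power) auto
      qed
      also have "\<dots> \<le> max 0 A * (1 / (1 + p 0) ^ k)"
      proof (rule mult_left_mono)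
        have "1 + p 0 \<le> 1 + p1 s" "0 \<le> p 0" using mono[OF s] a s by (auto intro: order_trans)
        then have "(1 + p 0) ^ k \<le> (1 + p1 s) ^ k" "(1 + p 0) ^ k > 0" by (auto intro: power_mono)
        then show "indicator {0<..<1} s / (1 + p1 s) ^ k \<le> 1 / (1 + p 0) ^ k"
          by (intro frac_le) (auto simp: indicator_def)
      qed simp
      finally show ?thesis by simp
    qed
    then have "norm (integral {0..1} (\<lambda>s. u s * exp (- \<i> * of_real (p s)))) \<le> (max 0 A / (1 + p 0) ^ k) * (1 - 0)"
      by (intro integral_bound) (use jet_continuous[OF u] cp in \<open>auto intro!: continuous_intros\<close>)
    then show "norm (integral {0..1} (\<lambda>s. u s * exp (- \<i> * of_real (p s)))) \<le> max 0 A / (1 + p 0) ^ (k + 0)" by simp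
  qed auto
next
  case (Suc N)
  obtain D where D: "D \<ge> 0" "\<And>p1 p2. (\<forall>s\<in>{0..1}. p1 s \<ge> 0 \<and> (p1 has_real_derivative p2 s) (at s within {0..1})) \<and>
      jet (Suc N) C (\<lambda>s. 1 + p1 s) (\<lambda>s. of_real (p2 s)) \<Longrightarrow>
      jet (Suc N) D (\<lambda>s. 1 / (1 + p1 s)) (\<lambda>s. 1 / (1 - \<i> * of_real (p1 s)))"
    using jet_resolvent[of "Suc N" C] by blast
  define E where "E = 2 ^ Suc N * (A * D)"
  obtain B where B: "B \<ge> 0" "\<And>p p1 p2 u. (\<forall>s\<in>{0..1}. 0 \<le> p s \<and> p s \<le> p1 s \<and> (p has_real_derivative p1 s) (at s within {0..1}) \<and>
        (p1 has_real_derivative p2 s) (at s within {0..1})) \<and>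
      jet N C (\<lambda>s. 1 + p1 s) (\<lambda>s. of_real (p2 s)) \<and>
      jet N (E + 2 ^ N * (norm (-1 :: complex) * E)) (\<lambda>s. indicator {0<..<1} s / (1 + p1 s) ^ Suc k) u \<Longrightarrow>
      norm (integral {0..1} (\<lambda>s. u s * exp (- \<i> * of_real (p s)))) \<le> B / (1 + p 0) ^ (Suc k + N)"
    using Suc.IH[of "E + 2 ^ N * (norm (-1 :: complex) * E)" "Suc k"] by blast
  show ?case
  proof (intro exI[of _ B] conjI allI impI; (elim conjE)?)
    fix p p1 p2 :: "real \<Rightarrow> real" and u
    assume a: "\<forall>s\<in>{0..1}. 0 \<le> p s \<and> p s \<le> p1 s \<and> (p has_real_derivative p1 s) (at s within {0..1}) \<and>
        (p1 has_real_derivative p2 s) (at s within {0..1})"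
      and jp: "jet (Suc N) C (\<lambda>s. 1 + p1 s) (\<lambda>s. of_real (p2 s))"
      and u: "jet (Suc N) A (\<lambda>s. indicator {0<..<1} s / (1 + p1 s) ^ k) u"
    let ?q = "\<lambda>s. 1 / (1 - \<i> * of_real (p1 s))"
    define v where "v = (\<lambda>s. u s * ?q s)"
    have "jet (Suc N) D (\<lambda>s. 1 / (1 + p1 s)) ?q"
      by (rule D(2)[of p1 p2]) (use a jp in \<open>auto intro: order_trans simp del: jet.simps\<close>)
    from jet_mult[OF u this] have jv: "jet (Suc N) E (\<lambda>s. indicator {0<..<1} s / (1 + p1 s) ^ Suc k) v"
      unfolding E_def v_def by (rule jet_mono) (auto simp: mult_ac)
    then obtain v' where v': "\<forall>s\<in>{0..1}. (v has_vector_derivative v' s) (at s within {0..1})"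
        "jet N E (\<lambda>s. indicator {0<..<1} s / (1 + p1 s) ^ Suc k) v'" unfolding jet.simps by blast
    \<comment> \<open>The weight contains the indicator of the open interval, so it is 0 at both
      ends.\<close>
    have z: "v 0 = 0" "v 1 = 0" using jet_bound[OF jv, of 0] jet_bound[OF jv, of 1] by auto
    have cp1: "continuous_on {0..1} p1" using a DERIV_continuous_on by blast
    have "integral {0..1} (\<lambda>s. u s * exp (- \<i> * of_real (p s)))
        = integral {0..1} (\<lambda>s. v s * (1 - \<i> * of_real (p1 s)) * exp (- \<i> * of_real (p s)))"
    proof -
      have "1 - \<i> * of_real x \<noteq> 0" for x :: real by (simp add: complex_eq_iff)
      then show ?thesis by (simp add: v_def)
    qed
    also have "\<dots> = integral {0..1} (\<lambda>s. (v s - v' s) * exp (- \<i> * of_real (p s)))"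
      by (rule oscillatory_step) (use a v' z cp1 jet_continuous[OF v'(2)] in auto)
    also have "norm \<dots> \<le> B / (1 + p 0) ^ (Suc k + N)"
    proof (rule B(2)[of p p1 p2])
      have "jet N (E + 2 ^ N * (norm (-1 :: complex) * E)) (\<lambda>s. indicator {0<..<1} s / (1 + p1 s) ^ Suc k) (\<lambda>s. v s + (-1) * v' s)"
        by (rule jet_add[OF jet_Suc_imp[OF jv] jet_cmult[OF v'(2)]])
      then show "(\<forall>s\<in>{0..1}. 0 \<le> p s \<and> p s \<le> p1 s \<and> (p has_real_derivative p1 s) (at s within {0..1}) \<and>
        (p1 has_real_derivative p2 s) (at s within {0..1})) \<and>
      jet N C (\<lambda>s. 1 + p1 s) (\<lambda>s. of_real (p2 s)) \<and>
      jet N (E + 2 ^ N * (norm (-1 :: complex) * E)) (\<lambda>s. indicator {0<..<1} s / (1 + p1 s) ^ Suc k) (\<lambda>s. v s - v' s)"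
        using a jet_Suc_imp[OF jp] by simp
    qed
    finally show "norm (integral {0..1} (\<lambda>s. u s * exp (- \<i> * of_real (p s)))) \<le> B / (1 + p 0) ^ (k + Suc N)" by simp
  qed (rule B)
qed

lemma oscillatory_bound:
  obtains B where "B \<ge> 0" "\<And>p p1 p2 u. \<lbrakk>\<And>s. s \<in> {0..1} \<Longrightarrow> 0 \<le> p s \<and> p s \<le> p1 s;
      \<And>s. s \<in> {0..1} \<Longrightarrow> (p has_real_derivative p1 s) (at s within {0..1});
      \<And>s. s \<in> {0..1} \<Longrightarrow> (p1 has_real_derivative p2 s) (at s within {0..1});
      jet N C (\<lambda>s. 1 + p1 s) (\<lambda>s. of_real (p2 s)); jet N A (indicator {0<..<1}) u\<rbrakk> \<Longrightarrow>
      norm (integral {0..1} (\<lambda>s. u s * exp (- \<i> * of_real (p s)))) \<le> B / (1 + p 0) ^ N"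
proof -
  obtain B where B: "B \<ge> 0 \<and> (\<forall>p p1 p2 u. (\<forall>s\<in>{0..1}. 0 \<le> p s \<and> p s \<le> p1 s \<and> (p has_real_derivative p1 s) (at s within {0..1}) \<and>
        (p1 has_real_derivative p2 s) (at s within {0..1})) \<and>
      jet N C (\<lambda>s. 1 + p1 s) (\<lambda>s. of_real (p2 s)) \<and>
      jet N A (\<lambda>s. indicator {0<..<1} s / (1 + p1 s) ^ 0) u \<longrightarrow>
      norm (integral {0..1} (\<lambda>s. u s * exp (- \<i> * of_real (p s)))) \<le> B / (1 + p 0) ^ (0 + N))"
    using oscillatory_bound_aux[of N C A 0] by (rule exE)
  show ?thesis
  proof (rule that[OF conjunct1[OF B]])
    fix p p1 p2 :: "real \<Rightarrow> real" and u
    assume *: "\<And>s. s \<in> {0..1} \<Longrightarrow> 0 \<le> p s \<and> p s \<le> p1 s"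
      "\<And>s. s \<in> {0..1} \<Longrightarrow> (p has_real_derivative p1 s) (at s within {0..1})"
      "\<And>s. s \<in> {0..1} \<Longrightarrow> (p1 has_real_derivative p2 s) (at s within {0..1})"
      "jet N C (\<lambda>s. 1 + p1 s) (\<lambda>s. of_real (p2 s))" "jet N A (indicator {0<..<1}) u"
    have "jet N A (\<lambda>s. indicator {0<..<1} s / (1 + p1 s) ^ 0) u"
      using *(5) by (simp add: power_0 del: jet.simps)
    with * have "norm (integral {0..1} (\<lambda>s. u s * exp (- \<i> * of_real (p s)))) \<le> B / (1 + p 0) ^ (0 + N)"
      by (intro conjunct2[OF B, rule_format, of p p1 p2 u] conjI ballI) (simp_all only:)
    then show "norm (integral {0..1} (\<lambda>s. u s * exp (- \<i> * of_real (p s)))) \<le> B / (1 + p 0) ^ N" by simp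
  qed
qed

section \<open>Determinants and transport to a well-ordered index type\<close>

text \<open>Conjugation by f is a sign-preserving bijection between the permutations of the two
  index types, so the Leibniz sums agree term by term.\<close>

lemma det_reindex:
  fixes A :: "real^'n^'n" and f :: "'m::finite \<Rightarrow> 'n::finite"
  assumes f: "bij f"
  shows "det (\<chi> i j. A $ f i $ f j) = det A"
proof -
  have inv: "inv_into UNIV f (f x) = x" "f (inv_into UNIV f y) = y" for x y
    using f by (auto simp: bij_def surj_f_inv_f)
  have "det A = (\<Sum>p\<in>{p. p permutes (UNIV::'n set)}. of_int (sign p) * prod (\<lambda>i. A $ i $ p i) UNIV)"
    by (simp add: det_def)
  also have "\<dots> = (\<Sum>p\<in>{p. p permutes (UNIV::'m set)}. of_int (sign p) * prod (\<lambda>i. A $ f i $ f (p i)) UNIV)"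
  proof (rule sum.reindex_bij_witness[where i = "\<lambda>p. map_permutation UNIV f p" and j = "\<lambda>p. map_permutation UNIV (inv f) p"])
    fix p :: "'n \<Rightarrow> 'n" assume p: "p \<in> {p. p permutes UNIV}"
    have fi: "bij_betw (inv f) UNIV UNIV" using f by (simp add: bij_imp_bij_inv)
    have q: "map_permutation UNIV (inv f) p = inv f \<circ> p \<circ> f"
      using f by (auto simp: map_permutation_def fun_eq_iff restrict_id_def inv bij_is_surj bij_imp_bij_inv surj_imp_inj_inv inv_inv_eq)
    show "map_permutation UNIV f (map_permutation UNIV (inv f) p) = p"
      unfolding q using f by (auto simp: map_permutation_def fun_eq_iff restrict_id_def inv bij_is_surj)
    show "map_permutation UNIV (inv f) p \<in> {p. p permutes UNIV}"
      using map_permutation_permutes[OF fi, of p] p by auto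
    have "sign (map_permutation UNIV (inv f) p) = sign p"
      by (rule sign_map_permutation) (use p fi in \<open>auto simp: bij_betw_def\<close>)
    moreover have "(\<Prod>i\<in>UNIV. A $ f i $ f (map_permutation UNIV (inv f) p i)) = (\<Prod>i\<in>UNIV. A $ i $ p i)"
      unfolding q by (simp add: inv) (rule prod.reindex_bij_betw[OF f, of "\<lambda>i. A $ i $ p i"])
    ultimately show "of_int (sign (map_permutation UNIV (inv f) p)) * (\<Prod>i\<in>UNIV. A $ f i $ f (map_permutation UNIV (inv f) p i)) =
         of_int (sign p) * (\<Prod>i\<in>UNIV. A $ i $ p i)" by simp
  next
    fix p :: "'m \<Rightarrow> 'm" assume p: "p \<in> {p. p permutes UNIV}"
    have q: "map_permutation UNIV f p = f \<circ> p \<circ> inv f"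
      using f by (auto simp: map_permutation_def fun_eq_iff restrict_id_def inv bij_is_surj)
    show "map_permutation UNIV (inv f) (map_permutation UNIV f p) = p"
      unfolding q using f by (auto simp: map_permutation_def fun_eq_iff restrict_id_def inv bij_is_surj inv_inv_eq bij_imp_bij_inv)
    show "map_permutation UNIV f p \<in> {p. p permutes UNIV}"
      using map_permutation_permutes[OF f, of p] p by auto
  qed
  also have "\<dots> = det (\<chi> i j. A $ f i $ f j)" by (simp add: det_def)
  finally show ?thesis ..
qed

text \<open>The matrix is the identity with column k replaced by e_k + c u, which is the situation
  of Cramer's rule.\<close>

lemma det_rank_one_axis:
  fixes u :: "real^'n"
  shows "det (matrix (\<lambda>x. x + (c * x $ k) *\<^sub>R u)) = 1 + c * u $ k"
proof -
  have "matrix (\<lambda>x. x + (c * x $ k) *\<^sub>R u) =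
    (\<chi> i j. if j = k then (mat 1 *v (axis k 1 + c *\<^sub>R u)) $ i else (mat 1 :: real^'n^'n) $ i $ j)"
    by (simp add: matrix_def vec_eq_iff axis_def) (simp add: mat_def)
  then show ?thesis using cramer_lemma[of k "mat 1" "axis k 1 + c *\<^sub>R u"] by (simp add: axis_def)
qed

text \<open>An orthogonal map taking m to a multiple of a coordinate vector reduces this to
  \<open>det_rank_one_axis\<close>; the determinants of the map and its inverse cancel.\<close>

lemma det_rank_one:
  fixes m u :: "real^'n"
  shows "det (matrix (\<lambda>x. x + (m \<bullet> x) *\<^sub>R u)) = 1 + m \<bullet> u"
proof -
  fix k :: 'n
  have n: "norm m = norm (norm m *\<^sub>R (axis k 1 :: real^'n))" by simp
  obtain f :: "real^'n \<Rightarrow> real^'n" where f: "orthogonal_transformation f" "f m = norm m *\<^sub>R axis k 1"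
    by (rule orthogonal_transformation_exists[OF n])
  obtain g :: "real^'n \<Rightarrow> real^'n" where g: "linear g" "\<And>x. g (f x) = x" "\<And>x. f (g x) = x"
    using orthogonal_transformation_linear[OF orthogonal_transformation_inv[OF f(1)]]
      orthogonal_transformation_bij[OF f(1)] that[of "inv f"] by (simp add: bij_is_inj bij_is_surj surj_f_inv_f)
  have lf: "linear f" using f orthogonal_transformation_linear by blast
  let ?L = "\<lambda>x. x + (norm m * x $ k) *\<^sub>R f u"
  have lL: "linear ?L" by (auto intro!: linearI simp: algebra_simps)
  have "m \<bullet> x = f m \<bullet> f x" for x using f(1) by (simp add: orthogonal_transformation_def)
  then have m: "m \<bullet> x = norm m * f x $ k" for x by (simp add: f(2) inner_axis' )
  have "(\<lambda>x. x + (m \<bullet> x) *\<^sub>R u) = g \<circ> (?L \<circ> f)"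
    by (auto simp: fun_eq_iff m linear_add[OF g(1)] linear_scale[OF g(1)] g(2))
  then have "det (matrix (\<lambda>x. x + (m \<bullet> x) *\<^sub>R u)) = det (matrix g) * (det (matrix ?L) * det (matrix f))"
    by (simp add: matrix_compose[OF linear_compose[OF lf lL] g(1)] matrix_compose[OF lf lL] det_mul)
  also have "det (matrix ?L) = 1 + m \<bullet> u" by (simp add: det_rank_one_axis m)
  finally have e: "det (matrix (\<lambda>x. x + (m \<bullet> x) *\<^sub>R u)) = det (matrix g) * ((1 + m \<bullet> u) * det (matrix f))" .
  have gf: "det (matrix g) * det (matrix f) = 1"
  proof -
    have "matrix g ** matrix f = matrix (g \<circ> f)" by (simp add: matrix_compose[OF lf g(1)])
    also have "g \<circ> f = id" using g by auto
    finally have "det (matrix g ** matrix f) = det (mat 1 :: real^'n^'n)" by (simp only: matrix_id_mat_1)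
    then show ?thesis by (simp add: det_mul)
  qed
  show ?thesis by (simp add: e mult.left_commute gf)
qed

text \<open>A copy of a finite type with a well-order: the change-of-variables theorem of the library
  is only available for Euclidean spaces with a well-ordered index type.\<close>

typedef 'a wo = "UNIV :: 'a set" by simp

instance wo :: (finite) finite
proof
  have "(UNIV :: 'a wo set) = Abs_wo ` UNIV" by (metis Abs_wo_cases surj_def)
  then show "finite (UNIV :: 'a wo set)" by (metis finite finite_imageI)
qed

definition wo_index :: "'a::finite wo \<Rightarrow> nat" where
  "wo_index = (SOME f. inj f)"

lemma inj_wo_index: "inj (wo_index :: 'a::finite wo \<Rightarrow> nat)"
proof -
  have "\<exists>f :: 'a wo \<Rightarrow> nat. inj f" using finite_imp_inj_to_nat_seg[of "UNIV :: 'a wo set"] by auto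
  then show ?thesis unfolding wo_index_def by (rule someI_ex)
qed

instantiation wo :: (finite) wellorder
begin
definition less_eq_wo :: "'a wo \<Rightarrow> 'a wo \<Rightarrow> bool" where "less_eq_wo x y \<longleftrightarrow> wo_index x \<le> wo_index y"
definition less_wo :: "'a wo \<Rightarrow> 'a wo \<Rightarrow> bool" where "less_wo x y \<longleftrightarrow> wo_index x < wo_index y"
instance
proof
  fix P :: "'a wo \<Rightarrow> bool" and a
  assume *: "\<And>x. (\<And>y. y < x \<Longrightarrow> P y) \<Longrightarrow> P x"
  show "P a" by (induction a rule: measure_induct_rule[of wo_index]) (auto intro: * simp: less_wo_def)
qed (use inj_wo_index in \<open>auto simp: less_eq_wo_def less_wo_def dest: injD\<close>)
end

definition to_wo :: "real^'n \<Rightarrow> real^('n::finite wo)" where "to_wo x = (\<chi> i. x $ Rep_wo i)"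
definition of_wo :: "real^('n::finite wo) \<Rightarrow> real^'n" where "of_wo x = (\<chi> i. x $ Abs_wo i)"

lemma of_to_wo [simp]: "of_wo (to_wo x) = x" "to_wo (of_wo y) = y"
  by (auto simp: to_wo_def of_wo_def Abs_wo_inverse Rep_wo_inverse)

lemma linear_to_wo: "linear to_wo" and linear_of_wo: "linear of_wo"
  by (auto intro!: linearI simp: to_wo_def of_wo_def vec_eq_iff)

lemma bij_Rep_wo: "bij Rep_wo"
  by (metis Abs_wo_inverse Rep_wo_inverse UNIV_I bij_iff)

lemma det_wo:
  fixes f :: "real^'n \<Rightarrow> real^'n"
  assumes "linear f"
  shows "det (matrix (to_wo \<circ> f \<circ> of_wo)) = det (matrix f)"
proof -
  have "of_wo (axis j 1) = axis (Rep_wo j) 1" for j :: "'n wo"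
    by (auto simp: of_wo_def axis_def vec_eq_iff Rep_wo_inverse Abs_wo_inverse)
  note this[simp]
  have "matrix (to_wo \<circ> f \<circ> of_wo) = (\<chi> i j. matrix f $ Rep_wo i $ Rep_wo j)"
    by (simp add: matrix_def vec_eq_iff to_wo_def)
  then show ?thesis using det_reindex[OF bij_Rep_wo, of "matrix f"] by simp
qed

lemma Basis_wo: "(Basis :: (real^'n::finite wo) set) = to_wo ` Basis"
proof -
  have "to_wo (axis j 1) = axis (Abs_wo j) 1" for j :: 'n
    by (auto simp: to_wo_def axis_def vec_eq_iff Rep_wo_inverse Abs_wo_inverse)
  moreover have "range Abs_wo = (UNIV :: 'n wo set)" by (metis Abs_wo_cases surj_def)
  ultimately show ?thesis unfolding Basis_vec_def by (auto simp: image_iff) (metis Rep_wo_inverse)+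
qed

lemma inner_to_wo: "to_wo x \<bullet> to_wo y = x \<bullet> y"
  unfolding inner_vec_def to_wo_def
  using sum.reindex_bij_betw[OF bij_Rep_wo, of "\<lambda>i. x $ i \<bullet> y $ i"] by simp

lemma borel_to_wo [measurable]: "to_wo \<in> borel_measurable borel" "of_wo \<in> borel_measurable borel"
  by (auto intro!: borel_measurable_continuous_onI linear_continuous_on linear_to_wo linear_of_wo simp: linear_conv_bounded_linear[symmetric])

lemma lborel_distr_to_wo: "distr lborel borel to_wo = (lborel :: (real^'n::finite wo) measure)"
proof (rule lborel_eqI[symmetric])
  fix l u :: "real^'n wo" assume le: "\<And>b. b \<in> Basis \<Longrightarrow> l \<bullet> b \<le> u \<bullet> b"
  have i: "l \<bullet> to_wo b = of_wo l \<bullet> b" for b :: "real^'n" and l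
    using inner_to_wo[of "of_wo l" b] by simp
  have "to_wo -` box l u = box (of_wo l) (of_wo u)"
    using inner_to_wo unfolding box_def Basis_wo by (auto simp: i)
  then have "emeasure (distr lborel borel to_wo) (box l u) = emeasure lborel (box (of_wo l) (of_wo u))"
    by (simp add: emeasure_distr)
  also have "\<dots> = (\<Prod>b\<in>Basis. (of_wo u - of_wo l) \<bullet> b)"
    by (rule emeasure_lborel_box) (metis Basis_wo i imageI le)
  also have "(\<Prod>b\<in>Basis. (of_wo u - of_wo l) \<bullet> b) = (\<Prod>b\<in>Basis. (u - l) \<bullet> b)"
    unfolding Basis_wo
    by (subst prod.reindex) (auto simp: inj_on_def i inner_diff_left linear_diff[OF linear_of_wo], metis of_to_wo(1))
  finally show "emeasure (distr lborel borel to_wo) (box l u) = (\<Prod>b\<in>Basis. (u - l) \<bullet> b)" .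
qed simp

section \<open>Contact estimates on lines for convex functions of finite type\<close>

text \<open>Subtracting 2^(m+1) P(t/2) from P(t) removes the coefficient of order m + 1 and
  multiplies coefficient k by 1 - 2^(m+1-k), whose modulus is at least 1. So the lower coefficients
  are controlled by induction, and the leading one follows from the value at t = 1.\<close>

lemma polynomial_coeff_bound:
  "\<exists>C\<ge>0. \<forall>(a :: nat \<Rightarrow> real) S. (\<forall>t\<in>{0..1}. \<bar>\<Sum>k\<le>m. a k * t ^ k\<bar> \<le> S) \<longrightarrow> (\<forall>k\<le>m. \<bar>a k\<bar> \<le> C * S)"
proof (induction m)
  case 0
  show ?case by (intro exI[of _ 1]) auto
next
  case (Suc m)
  then obtain C where C: "C \<ge> 0"
    "\<And>(a :: nat \<Rightarrow> real) S k. (\<forall>t\<in>{0..1}. \<bar>\<Sum>k\<le>m. a k * t ^ k\<bar> \<le> S) \<Longrightarrow> k \<le> m \<Longrightarrow> \<bar>a k\<bar> \<le> C * S"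
    by metis
  define E where "E = C * (1 + 2 ^ Suc m)"
  have E: "E \<ge> 0" using C(1) by (simp add: E_def)
  show ?case
  proof (intro exI[of _ "1 + real (Suc m) * E"] conjI allI impI)
    fix a :: "nat \<Rightarrow> real" and S k
    assume a: "\<forall>t\<in>{0..1}. \<bar>\<Sum>k\<le>Suc m. a k * t ^ k\<bar> \<le> S" and k: "k \<le> Suc m"
    have S: "S \<ge> 0" using a[rule_format, of 0] by (auto intro: order_trans[OF abs_ge_zero])
    have le: "\<bar>a k\<bar> \<le> E * S" if "k \<le> m" for k
    proof -
      have b: "\<bar>\<Sum>k\<le>m. (a k * (1 - 2 ^ (Suc m - k))) * t ^ k\<bar> \<le> (1 + 2 ^ Suc m) * S" if t: "t \<in> {0..1}" for t
      proof -
        have "a k * (1 - 2 ^ (Suc m - k)) * t ^ k = a k * t ^ k - 2 ^ Suc m * (a k * (t / 2) ^ k)" if "k \<le> Suc m" for k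
        proof -
          have "(2::real) ^ Suc m = 2 ^ (Suc m - k) * 2 ^ k" using that by (simp flip: power_add)
          then show ?thesis by (simp add: power_divide algebra_simps)
        qed
        then have "(\<Sum>k\<le>Suc m. a k * (1 - 2 ^ (Suc m - k)) * t ^ k)
            = (\<Sum>k\<le>Suc m. a k * t ^ k) - 2 ^ Suc m * (\<Sum>k\<le>Suc m. a k * (t / 2) ^ k)"
          unfolding sum_distrib_left sum_subtractf[symmetric] by (intro sum.cong) auto
        moreover have "(\<Sum>k\<le>Suc m. a k * (1 - 2 ^ (Suc m - k)) * t ^ k) = (\<Sum>k\<le>m. a k * (1 - 2 ^ (Suc m - k)) * t ^ k)"
          by simp
        ultimately have "\<bar>\<Sum>k\<le>m. a k * (1 - 2 ^ (Suc m - k)) * t ^ k\<bar>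
            \<le> \<bar>\<Sum>k\<le>Suc m. a k * t ^ k\<bar> + \<bar>2 ^ Suc m * (\<Sum>k\<le>Suc m. a k * (t / 2) ^ k)\<bar>" by linarith
        also have "\<dots> \<le> S + 2 ^ Suc m * S"
          unfolding abs_mult using a[rule_format, of t] a[rule_format, of "t / 2"] t
          by (intro add_mono mult_mono) auto
        finally show ?thesis by (simp add: algebra_simps)
      qed
      have "\<bar>a k * (1 - 2 ^ (Suc m - k))\<bar> \<le> C * ((1 + 2 ^ Suc m) * S)"
        by (rule C(2)[OF _ that]) (use b in blast)
      moreover have "\<bar>a k\<bar> * 1 \<le> \<bar>a k\<bar> * \<bar>1 - 2 ^ (Suc m - k)\<bar>"
      proof (rule mult_left_mono)
        have "(2::real) ^ 1 \<le> 2 ^ (Suc m - k)" using that by (intro power_increasing) auto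
        then show "1 \<le> \<bar>1 - (2::real) ^ (Suc m - k)\<bar>" by simp
      qed simp
      ultimately show ?thesis by (simp add: E_def abs_mult mult.assoc)
    qed
    show "\<bar>a k\<bar> \<le> (1 + real (Suc m) * E) * S"
    proof (cases "k \<le> m")
      case True
      have "E * S \<le> (1 + real (Suc m) * E) * S" using E S by (intro mult_right_mono) (auto simp: algebra_simps)
      then show ?thesis using le[OF True] by simp
    next
      case False
      then have "k = Suc m" using k by simp
      moreover have "\<bar>\<Sum>k\<le>m. a k\<bar> \<le> real (Suc m) * (E * S)"
        by (rule order_trans[OF sum_abs]) (use sum_bounded_above[of "{..m}" "\<lambda>k. \<bar>a k\<bar>" "E * S"] le in simp)
      moreover have "\<bar>(\<Sum>k\<le>m. a k) + a (Suc m)\<bar> \<le> S" using a[rule_format, of 1] by simp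
      ultimately show ?thesis by (simp add: algebra_simps)
    qed
  qed (use E in auto)
qed

text \<open>Since g is nondecreasing from 0, the values g(s t) with s in [0, 1] lie between 0 and
  g(t). Hence the Taylor polynomial of degree m, rescaled to [0, 1], is at most g(t) + B t^(m+1),
  and so are its coefficients up to a constant: no cancellation can hide them. Finite type makes one
  of them at least of size t^m, which gives t^m = O(g(t)) for small t. This absorbs the error, and
  Taylor expansion of the derivatives yields all the bounds.\<close>

lemma finite_type_taylor_bound:
  fixes c B \<rho> :: real
  assumes m: "m \<ge> 2" and c: "c > 0" and B: "B \<ge> 0" and \<rho>: "\<rho> > 0" and J: "J \<ge> Suc m"
  obtains \<rho>0 C where "\<rho>0 > 0" "\<rho>0 \<le> \<rho>" "C \<ge> 0"
    "\<And>(g :: nat \<Rightarrow> real \<Rightarrow> real) t j. \<lbrakk>\<And>j t. j < J \<Longrightarrow> t \<in> {0..\<rho>} \<Longrightarrow> (g j has_real_derivative g (Suc j) t) (at t);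
       \<And>j t. j \<le> J \<Longrightarrow> t \<in> {0..\<rho>} \<Longrightarrow> \<bar>g j t\<bar> \<le> B; g 0 0 = 0; g 1 0 = 0;
       \<And>t. t \<in> {0..\<rho>} \<Longrightarrow> 0 \<le> g 1 t; c \<le> (\<Sum>k=2..m. \<bar>g k 0\<bar>); 0 < t; t \<le> \<rho>0; j \<le> J\<rbrakk> \<Longrightarrow>
       t ^ j * \<bar>g j t\<bar> \<le> C * g 0 t"
proof -
  obtain Cm where Cm: "Cm \<ge> 0"
    "\<And>(a :: nat \<Rightarrow> real) S k. (\<forall>t\<in>{0..1}. \<bar>\<Sum>k\<le>m. a k * t ^ k\<bar> \<le> S) \<Longrightarrow> k \<le> m \<Longrightarrow> \<bar>a k\<bar> \<le> Cm * S"
    using polynomial_coeff_bound[of m] by metis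
  \<comment> \<open>K is the constant of t^m <= K g(t). The bound on rho0 makes the Taylor error at
    most half of c t^m, so that it can be absorbed. C adds the Taylor terms of order up to m to the
    remainder term.\<close>
  define K where "K = 2 * fact m * (real m * Cm) / c"
  define C where "C = real (Suc m) * (fact m * (Cm * (1 + B * K))) + B * K"
  define \<rho>0 where "\<rho>0 = min (min \<rho> 1) (c / (2 * fact m * (real m * Cm * B + 1)))"
  have K: "K \<ge> 0" using Cm c by (simp add: K_def)
  have C0: "C \<ge> 0" using K B Cm by (simp add: C_def)
  have pos: "0 < 2 * fact m * (real m * Cm * B + 1)" using Cm B by (intro mult_pos_pos add_nonneg_pos) auto
  then have r0: "\<rho>0 > 0" using \<rho> c by (simp add: \<rho>0_def)
  show ?thesis
  proof (rule that[OF r0 _ C0])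
    show "\<rho>0 \<le> \<rho>" by (simp add: \<rho>0_def)
    fix g :: "nat \<Rightarrow> real \<Rightarrow> real" and t j
    assume d: "\<And>j t. j < J \<Longrightarrow> t \<in> {0..\<rho>} \<Longrightarrow> (g j has_real_derivative g (Suc j) t) (at t)"
      and b: "\<And>j t. j \<le> J \<Longrightarrow> t \<in> {0..\<rho>} \<Longrightarrow> \<bar>g j t\<bar> \<le> B"
      and g0: "g 0 0 = 0" and g1: "g 1 0 = 0"
      and mono: "\<And>t. t \<in> {0..\<rho>} \<Longrightarrow> 0 \<le> g 1 t"
      and cs: "c \<le> (\<Sum>k=2..m. \<bar>g k 0\<bar>)" and t: "0 < t" "t \<le> \<rho>0" and jJ: "j \<le> J"
    have t1: "t \<le> 1" "t \<le> \<rho>" using t by (auto simp: \<rho>0_def)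
    have taylor: "\<exists>x\<in>{0..h}. g i h = (\<Sum>k<n. g (i + k) 0 / fact k * h ^ k) + g (i + n) x / fact n * h ^ n"
      if "i + n \<le> J" "0 < n" "0 < h" "h \<le> \<rho>" for i n h
    proof -
      have "\<exists>x>0. x < h \<and> g i h = (\<Sum>k<n. g (i + k) 0 / fact k * h ^ k) + g (i + n) x / fact n * h ^ n"
        by (rule Maclaurin[of h n "\<lambda>k. g (i + k)" "g i"]) (use that d in auto)
      then show ?thesis by force
    qed
    have g_mono: "g 0 x \<le> g 0 y" if "0 \<le> x" "x \<le> y" "y \<le> \<rho>" for x y
    proof (rule DERIV_nonneg_imp_nondecreasing[OF that(2)])
      fix v assume "x \<le> v" "v \<le> y"
      then have "v \<in> {0..\<rho>}" using that by auto
      then show "\<exists>y. (g 0 has_real_derivative y) (at v) \<and> 0 \<le> y"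
        using d[of 0 v] mono[of v] J by auto
    qed
    have gt0: "0 \<le> g 0 t" using g_mono[of 0 t] g0 t t1 by simp
    define a where "a k = g k 0 / fact k * t ^ k" for k
    define S where "S = g 0 t + B * t ^ Suc m"
    have S0: "S \<ge> 0" using gt0 B t by (simp add: S_def)
    have ak: "\<bar>a k\<bar> \<le> Cm * S" if "k \<le> m" for k
    proof (rule Cm(2)[OF _ that], intro ballI)
      fix s :: real assume s: "s \<in> {0..1}"
      show "\<bar>\<Sum>k\<le>m. a k * s ^ k\<bar> \<le> S"
      proof (cases "s = 0")
        case True
        have "(\<Sum>k\<le>m. a k * s ^ k) = a 0" using True by (simp add: sum.atMost_shift)
        then show ?thesis using S0 g0 by (simp add: a_def)
      next
        case False
        have st: "0 < s * t" "s * t \<le> t" using s False t by (auto simp: mult_le_cancel_right2)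
        then obtain x where x: "x \<in> {0..s * t}"
          "g 0 (s * t) = (\<Sum>k<Suc m. g (0 + k) 0 / fact k * (s * t) ^ k) + g (0 + Suc m) x / fact (Suc m) * (s * t) ^ Suc m"
          using taylor[of 0 "Suc m" "s * t"] t1 J by auto
        have "(\<Sum>k<Suc m. g (0 + k) 0 / fact k * (s * t) ^ k) = (\<Sum>k\<le>m. a k * s ^ k)"
          unfolding lessThan_Suc_atMost a_def by (intro sum.cong) (auto simp: power_mult_distrib)
        then have e: "(\<Sum>k\<le>m. a k * s ^ k) = g 0 (s * t) - g (Suc m) x / fact (Suc m) * (s * t) ^ Suc m"
          using x(2) by simp
        have "\<bar>g (Suc m) x / fact (Suc m) * (s * t) ^ Suc m\<bar> \<le> B * t ^ Suc m"
        proof -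
          have "\<bar>g (Suc m) x / fact (Suc m)\<bar> \<le> B / 1"
            unfolding abs_divide using b[of "Suc m" x] J x(1) st t1 by (intro frac_le) (auto simp: fact_ge_1 simp del: fact_Suc)
          moreover have "\<bar>(s * t) ^ Suc m\<bar> \<le> t ^ Suc m" unfolding power_abs using st by (intro power_mono) auto
          ultimately show ?thesis unfolding abs_mult[of "g (Suc m) x / fact (Suc m)"] using B by (intro mult_mono) auto
        qed
        moreover have "0 \<le> g 0 (s * t)" "g 0 (s * t) \<le> g 0 t"
          using g_mono[of 0 "s * t"] g_mono[of "s * t" t] st t1 g0 by auto
        ultimately show ?thesis unfolding e S_def by linarith
      qed
    qed
    have tm: "t ^ m \<le> K * g 0 t"
    proof -
      have "c * t ^ m \<le> (\<Sum>k=2..m. \<bar>g k 0\<bar>) * t ^ m" using cs t by (intro mult_right_mono) auto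
      also have "\<dots> \<le> (\<Sum>k=2..m. fact m * \<bar>a k\<bar>)"
        unfolding sum_distrib_right
      proof (rule sum_mono)
        fix k assume k: "k \<in> {2..m}"
        have "fact m * \<bar>a k\<bar> = \<bar>g k 0\<bar> * (t ^ k * (fact m / fact k))" using t by (simp add: a_def abs_mult)
        moreover have "t ^ m * 1 \<le> t ^ k * (fact m / fact k)"
          using t t1 k by (intro mult_mono power_decreasing) (auto simp: fact_mono)
        then have "\<bar>g k 0\<bar> * t ^ m \<le> \<bar>g k 0\<bar> * (t ^ k * (fact m / fact k))"
          by (intro mult_left_mono) simp_all
        ultimately show "\<bar>g k 0\<bar> * t ^ m \<le> fact m * \<bar>a k\<bar>" by (simp only:)
      qed
      also have "\<dots> \<le> (\<Sum>k=2..m. fact m * (Cm * S))" by (intro sum_mono mult_left_mono ak) auto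
      also have "\<dots> \<le> real m * (fact m * (Cm * S))"
        using m Cm(1) S0 by (auto intro!: mult_right_mono)
      also have "\<dots> = fact m * (real m * Cm) * g 0 t + (fact m * (real m * Cm * B) * t) * t ^ m"
        by (simp add: S_def algebra_simps)
      also have "\<dots> \<le> fact m * (real m * Cm) * g 0 t + c / 2 * t ^ m"
      proof (intro add_left_mono mult_right_mono)
        have "t * (2 * fact m * (real m * Cm * B + 1)) \<le> c" using t(2) pos by (simp add: \<rho>0_def pos_le_divide_eq)
        moreover have "0 \<le> t * (2 * fact m)" using t by simp
        ultimately show "fact m * (real m * Cm * B) * t \<le> c / 2" by (simp add: algebra_simps)
      qed (use t in auto)
      finally have "c / 2 * t ^ m \<le> fact m * (real m * Cm) * g 0 t" by simp
      then show ?thesis using c by (simp add: K_def field_simps)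
    qed
    have Sg: "S \<le> (1 + B * K) * g 0 t"
    proof -
      have "B * t ^ Suc m \<le> B * (K * g 0 t)"
        using tm t t1 by (intro mult_left_mono B) (auto intro: order_trans[OF power_decreasing[of m "Suc m"]] simp del: power_Suc)
      then show ?thesis by (simp add: S_def algebra_simps)
    qed
    show "t ^ j * \<bar>g j t\<bar> \<le> C * g 0 t"
    proof (cases "j \<le> m")
      case True
      obtain x where x: "x \<in> {0..t}"
        "g j t = (\<Sum>k<Suc m - j. g (j + k) 0 / fact k * t ^ k) + g (j + (Suc m - j)) x / fact (Suc m - j) * t ^ (Suc m - j)"
        using taylor[of j "Suc m - j" t] t t1 J True by auto
      have "t ^ j * \<bar>g j t\<bar> \<le> t ^ j * ((\<Sum>k<Suc m - j. \<bar>g (j + k) 0 / fact k * t ^ k\<bar>) + \<bar>g (Suc m) x / fact (Suc m - j) * t ^ (Suc m - j)\<bar>)"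
        unfolding x(2) using True t
        by (intro mult_left_mono order_trans[OF abs_triangle_ineq] add_mono sum_abs) auto
      also have "\<dots> = (\<Sum>k<Suc m - j. t ^ j * \<bar>g (j + k) 0 / fact k * t ^ k\<bar>) + t ^ j * \<bar>g (Suc m) x / fact (Suc m - j) * t ^ (Suc m - j)\<bar>"
        by (simp add: distrib_left sum_distrib_left)
      also have "\<dots> \<le> (\<Sum>k<Suc m - j. fact m * (Cm * S)) + B * t ^ m"
      proof (intro add_mono sum_mono)
        fix k assume "k \<in> {..<Suc m - j}"
        then have k: "j + k \<le> m" by auto
        have "t ^ j * \<bar>g (j + k) 0 / fact k * t ^ k\<bar> = \<bar>a (j + k)\<bar> * (fact (j + k) / fact k)"
          using t by (simp add: a_def abs_mult power_add)
        also have "\<dots> \<le> (Cm * S) * (fact m / 1)"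
          using ak[OF k] k Cm(1) S0 by (intro mult_mono frac_le) (auto simp: fact_mono fact_ge_1)
        finally show "t ^ j * \<bar>g (j + k) 0 / fact k * t ^ k\<bar> \<le> fact m * (Cm * S)" by (simp add: mult_ac)
      next
        have "t ^ j * \<bar>g (Suc m) x / fact (Suc m - j) * t ^ (Suc m - j)\<bar> = \<bar>g (Suc m) x\<bar> / fact (Suc m - j) * (t ^ j * t ^ (Suc m - j))"
          using t by (simp add: abs_mult)
        also have "t ^ j * t ^ (Suc m - j) = t ^ Suc m" using True by (simp flip: power_add)
        also have "\<bar>g (Suc m) x\<bar> / fact (Suc m - j) * t ^ Suc m \<le> B / 1 * t ^ m"
          using b[of "Suc m" x] J x(1) t t1 B
          by (intro mult_mono frac_le power_decreasing) (auto simp: fact_ge_1 simp del: power_Suc)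
        finally show "t ^ j * \<bar>g (Suc m) x / fact (Suc m - j) * t ^ (Suc m - j)\<bar> \<le> B * t ^ m" by simp
      qed
      also have "\<dots> \<le> real (Suc m) * (fact m * (Cm * ((1 + B * K) * g 0 t))) + B * (K * g 0 t)"
      proof (intro add_mono mult_left_mono tm B)
        have "(\<Sum>k<Suc m - j. fact m * (Cm * S)) = real (Suc m - j) * (fact m * (Cm * S))" by simp
        also have "\<dots> \<le> real (Suc m) * (fact m * (Cm * ((1 + B * K) * g 0 t)))"
          using Cm(1) S0 by (intro mult_mono mult_left_mono Sg) auto
        finally show "(\<Sum>k<Suc m - j. fact m * (Cm * S)) \<le> real (Suc m) * (fact m * (Cm * ((1 + B * K) * g 0 t)))" .
      qed
      also have "\<dots> = C * g 0 t" by (simp add: C_def algebra_simps)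
      finally show ?thesis .
    next
      case False
      have "t ^ j * \<bar>g j t\<bar> \<le> t ^ m * B"
        using False t t1 b[of j t] jJ by (intro mult_mono power_decreasing) auto
      also have "\<dots> \<le> K * g 0 t * B" by (intro mult_right_mono tm B)
      also have "\<dots> \<le> C * g 0 t"
      proof -
        have "B * K * g 0 t \<le> C * g 0 t"
          using gt0 K B Cm(1) by (intro mult_right_mono) (auto simp: C_def)
        then show ?thesis by (simp add: mult_ac)
      qed
      finally show ?thesis .
    qed
  qed
qed

lemma iterated_deriv_sum:
  fixes f :: "'i \<Rightarrow> 'a::real_normed_vector \<Rightarrow> real"
  assumes "open U" "\<And>i. i \<in> I \<Longrightarrow> diff_on (length vs) U (f i)" "x \<in> U"
  shows "iterated_deriv vs (\<lambda>x. \<Sum>i\<in>I. c i * f i x) x = (\<Sum>i\<in>I. c i * iterated_deriv vs (f i) x)"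
  using assms(2,3)
proof (induction vs arbitrary: x)
  case (Cons v vs)
  have d: "diff_on (length vs) U (f i)" if "i \<in> I" for i using Cons.prems(1)[OF that] diff_on_mono by fastforce
  have "frechet_derivative (iterated_deriv vs (\<lambda>x. \<Sum>i\<in>I. c i * f i x)) (at x)
      = frechet_derivative (\<lambda>x. \<Sum>i\<in>I. c i * iterated_deriv vs (f i) x) (at x)"
    by (rule frechet_derivative_cong_open[OF assms(1) Cons.prems(2)]) (rule Cons.IH[OF d])
  also have "\<dots> = (\<lambda>h. \<Sum>i\<in>I. c i * frechet_derivative (iterated_deriv vs (f i)) (at x) h)"
  proof (rule frechet_derivative_at[symmetric], rule has_derivative_sum, rule has_derivative_mult_right)
    fix i assume "i \<in> I"
    then show "(iterated_deriv vs (f i) has_derivative frechet_derivative (iterated_deriv vs (f i)) (at x)) (at x)"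
      using Cons.prems by (auto simp: diff_on_def frechet_derivative_works[symmetric])
  qed
  finally show ?case by simp
qed simp

text \<open>Joint continuity in point and direction prepares compactness over base points and unit
  directions. The innermost derivative is peeled off and expanded over the basis: its coefficients
  are constant in x, so the induction closes over f with all remaining directions still
  equal.\<close>

lemma continuous_on_iterated_deriv_replicate:
  fixes f :: "'a::euclidean_space \<Rightarrow> real"
  assumes "open U" "diff_on k U f"
  shows "continuous_on (U \<times> UNIV) (\<lambda>(x, \<theta>). iterated_deriv (replicate k \<theta>) f x)"
  using assms(2)
proof (induction k arbitrary: f)
  case 0
  then have "continuous_on U f" by (rule diff_on_imp_continuous_on)
  then show ?case
    by (auto simp: case_prod_beta intro!: continuous_on_compose2[of U f] continuous_intros)
next
  case (Suc k)
  have eq: "iterated_deriv (replicate (Suc k) \<theta>) f x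
      = (\<Sum>i\<in>Basis. (\<theta> \<bullet> i) * iterated_deriv (replicate k \<theta>) (\<lambda>x. frechet_derivative f (at x) i) x)"
    if "x \<in> U" for x \<theta>
  proof -
    have "iterated_deriv (replicate (Suc k) \<theta>) f x = iterated_deriv (replicate k \<theta>) (\<lambda>x. frechet_derivative f (at x) \<theta>) x"
      unfolding replicate_Suc replicate_append_same[symmetric] iterated_deriv_append by simp
    also have "\<dots> = iterated_deriv (replicate k \<theta>) (\<lambda>x. \<Sum>i\<in>Basis. (\<theta> \<bullet> i) * frechet_derivative f (at x) i) x"
    proof (rule iterated_deriv_cong_open[OF assms(1) that])
      fix y assume "y \<in> U"
      then have "linear (frechet_derivative f (at y))"
        using diff_on_imp_differentiable[OF Suc.prems] linear_frechet_derivative by blast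
      then show "frechet_derivative f (at y) \<theta> = (\<Sum>i\<in>Basis. (\<theta> \<bullet> i) * frechet_derivative f (at y) i)"
        by (subst (1) euclidean_representation[of \<theta>, symmetric]) (simp add: linear_sum linear_scale)
    qed
    also have "\<dots> = (\<Sum>i\<in>Basis. (\<theta> \<bullet> i) * iterated_deriv (replicate k \<theta>) (\<lambda>x. frechet_derivative f (at x) i) x)"
      by (rule iterated_deriv_sum[OF assms(1) _ that]) (simp add: diff_on_deriv[OF Suc.prems])
    finally show ?thesis .
  qed
  have "continuous_on (U \<times> UNIV) (\<lambda>z. \<Sum>i\<in>Basis. (snd z \<bullet> i) *
      iterated_deriv (replicate k (snd z)) (\<lambda>x. frechet_derivative f (at x) i) (fst z))"
  proof (intro continuous_on_sum continuous_on_mult)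
    fix i :: 'a
    show "continuous_on (U \<times> UNIV) (\<lambda>z. iterated_deriv (replicate k (snd z)) (\<lambda>x. frechet_derivative f (at x) i) (fst z))"
      using Suc.IH[OF diff_on_deriv[OF Suc.prems, of i]] by (simp add: case_prod_beta)
  qed (intro continuous_intros)
  then show ?case
    by (rule continuous_on_eq) (auto simp: eq simp del: replicate_Suc)
qed

text \<open>Turns pointwise finite type into one order m and one constant c on a compact set.
  Otherwise counterexamples for growing m would accumulate at a point where, by monotonicity in m,
  no F M is positive.\<close>

lemma compact_increasing_positive:
  fixes F :: "nat \<Rightarrow> 'a::metric_space \<Rightarrow> real"
  assumes K: "compact K" and cont: "\<And>m. continuous_on K (F m)"
    and mono: "\<And>m n x. x \<in> K \<Longrightarrow> m \<le> n \<Longrightarrow> F m x \<le> F n x"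
    and pos: "\<And>x. x \<in> K \<Longrightarrow> \<exists>m. F m x > 0"
  obtains m c where "m0 \<le> m" "c > 0" "\<And>x. x \<in> K \<Longrightarrow> c \<le> F m x"
proof -
  have "\<exists>m\<ge>m0. \<forall>x\<in>K. inverse (real (Suc m)) \<le> F m x"
  proof (rule ccontr)
    assume "\<not> ?thesis"
    then have "\<forall>n. \<exists>x\<in>K. F (m0 + n) x < inverse (real (Suc (m0 + n)))"
      by (metis le_add1 not_le)
    then obtain z where z: "\<And>n. z n \<in> K" "\<And>n. F (m0 + n) (z n) < inverse (real (Suc (m0 + n)))" by metis
    obtain l s where l: "l \<in> K" "strict_mono s" "(z \<circ> s) \<longlonglongrightarrow> l"
      using K z(1) unfolding compact_def by blast
    obtain M where M: "F M l > 0" using pos l(1) by blast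
    have lim: "(\<lambda>n. F M (z (s n))) \<longlonglongrightarrow> F M l"
      using continuous_on_tendsto_compose[OF cont l(3)[unfolded o_def] l(1)] z(1) by auto
    have "(\<lambda>n. inverse (real (Suc n))) \<longlonglongrightarrow> 0" by (rule LIMSEQ_inverse_real_of_nat)
    moreover have "\<forall>\<^sub>F n in sequentially. F M (z (s n)) \<le> inverse (real (Suc n))"
    proof (rule eventually_sequentiallyI[of M])
      fix n assume n: "M \<le> n"
      have sn: "n \<le> s n" using l(2) by (rule seq_suble)
      have "F M (z (s n)) \<le> F (m0 + s n) (z (s n))" by (rule mono[OF z(1)]) (use n sn in linarith)
      also have "\<dots> \<le> inverse (real (Suc (m0 + s n)))" using z(2) less_imp_le by blast
      also have "\<dots> \<le> inverse (real (Suc n))" using sn by (intro le_imp_inverse_le) auto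
      finally show "F M (z (s n)) \<le> inverse (real (Suc n))" .
    qed
    ultimately have "F M l \<le> 0" using lim by (intro tendsto_le[OF _ _ lim]) auto
    then show False using M by simp
  qed
  then obtain m where "m \<ge> m0" "\<forall>x\<in>K. inverse (real (Suc m)) \<le> F m x" by blast
  then show ?thesis using that[of m "inverse (real (Suc m))"] by simp
qed

text \<open>The Taylor remainder of first order of \<open>h\<close> on the line through \<open>y\<close> with direction \<open>\<theta>\<close>,
  and its derivatives.\<close>

definition line_rem :: "('a::euclidean_space \<Rightarrow> real) \<Rightarrow> 'a \<Rightarrow> 'a \<Rightarrow> nat \<Rightarrow> real \<Rightarrow> real" where
  "line_rem h y \<theta> j t = iterated_deriv (replicate j \<theta>) h (y + t *\<^sub>R \<theta>) -
     (if j = 0 then h y + t * frechet_derivative h (at y) \<theta>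
      else if j = 1 then frechet_derivative h (at y) \<theta> else 0)"

lemma line_rem_deriv:
  assumes "diff_on j U h" "y + t *\<^sub>R \<theta> \<in> U"
  shows "(line_rem h y \<theta> j has_real_derivative line_rem h y \<theta> (Suc j) t) (at t)"
proof -
  have "(iterated_deriv (replicate j \<theta>) h has_derivative frechet_derivative (iterated_deriv (replicate j \<theta>) h) (at (y + t *\<^sub>R \<theta>))) (at (y + t *\<^sub>R \<theta>))"
    using assms by (auto simp: diff_on_def frechet_derivative_works[symmetric])
  moreover have "((\<lambda>t. y + t *\<^sub>R \<theta>) has_vector_derivative \<theta>) (at t)"
    by (auto intro!: derivative_eq_intros)
  ultimately have 1: "((\<lambda>t. iterated_deriv (replicate j \<theta>) h (y + t *\<^sub>R \<theta>)) has_real_derivative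
      iterated_deriv (replicate (Suc j) \<theta>) h (y + t *\<^sub>R \<theta>)) (at t)"
    using vector_derivative_diff_chain_within[of "\<lambda>t. y + t *\<^sub>R \<theta>" \<theta> t UNIV "iterated_deriv (replicate j \<theta>) h"
      "frechet_derivative (iterated_deriv (replicate j \<theta>) h) (at (y + t *\<^sub>R \<theta>))"]
    by (auto simp: o_def has_real_derivative_iff_has_vector_derivative intro: has_derivative_at_withinI)
  have "((\<lambda>t. if j = 0 then h y + t * frechet_derivative h (at y) \<theta>
      else if j = 1 then frechet_derivative h (at y) \<theta> else 0) has_real_derivative
      (if Suc j = 0 then h y + t * frechet_derivative h (at y) \<theta>
      else if Suc j = 1 then frechet_derivative h (at y) \<theta> else 0)) (at t)"
    by (cases "j = 0"; cases "j = 1") (auto intro!: derivative_eq_intros)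
  from DERIV_diff[OF 1 this] show ?thesis unfolding line_rem_def[abs_def] .
qed

text \<open>The line estimate made uniform in base point and unit direction. Convexity and finite
  type are demanded on a subspace H only, because chart functions live on a ball of the whole space
  and are constant along one axis.\<close>

lemma finite_type_convex_bound:
  fixes h :: "'a::euclidean_space \<Rightarrow> real"
  assumes h: "smooth_on (ball z \<rho>) h" and \<rho>: "\<rho> > 0" and H: "subspace H"
    and convex: "\<And>y y'. y \<in> ball z \<rho> \<inter> H \<Longrightarrow> y' \<in> ball z \<rho> \<inter> H \<Longrightarrow>
        h y + frechet_derivative h (at y) (y' - y) \<le> h y'"
    and ft: "\<And>y \<theta>. y \<in> ball z \<rho> \<inter> H \<Longrightarrow> \<theta> \<in> H \<Longrightarrow> \<theta> \<noteq> 0 \<Longrightarrow> \<exists>k\<ge>2. iterated_deriv (replicate k \<theta>) h y \<noteq> 0"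
  obtains \<rho>0 C where "\<rho>0 > 0" "\<rho>0 \<le> \<rho> / 4" "C \<ge> 0"
    "\<And>y \<theta> t j. y \<in> cball z (\<rho> / 2) \<inter> H \<Longrightarrow> \<theta> \<in> H \<Longrightarrow> norm \<theta> = 1 \<Longrightarrow> 0 < t \<Longrightarrow> t \<le> \<rho>0 \<Longrightarrow> j \<le> J \<Longrightarrow>
       t ^ j * \<bar>line_rem h y \<theta> j t\<bar> \<le> C * line_rem h y \<theta> 0 t"
proof -
  let ?U = "ball z \<rho>"
  have hk: "diff_on k ?U h" for k using h by (rule smooth_on_imp_diff_on)
  define K where "K = (cball z (\<rho> / 2) \<inter> H) \<times> (sphere 0 1 \<inter> H)"
  have clH: "closed H" using H by (rule closed_subspace)
  have K: "compact K" unfolding K_def using clH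
    by (intro compact_Times compact_Int_closed) auto
  have KU: "K \<subseteq> ?U \<times> UNIV" using \<rho> by (auto simp: K_def)
  have contK: "continuous_on K (\<lambda>z. iterated_deriv (replicate k (snd z)) h (fst z))" for k
    using continuous_on_subset[OF continuous_on_iterated_deriv_replicate[OF open_ball hk] KU]
    by (simp add: case_prod_beta)
  obtain m c where m: "2 \<le> m" "c > 0"
    "\<And>x. x \<in> K \<Longrightarrow> c \<le> (\<Sum>k=2..m. \<bar>iterated_deriv (replicate k (snd x)) h (fst x)\<bar>)"
  proof (rule compact_increasing_positive[OF K, of "\<lambda>m x. \<Sum>k=2..m. \<bar>iterated_deriv (replicate k (snd x)) h (fst x)\<bar>" 2])
    show "continuous_on K (\<lambda>x. \<Sum>k = 2..m. \<bar>iterated_deriv (replicate k (snd x)) h (fst x)\<bar>)" for m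
      by (intro continuous_intros contK)
    show "(\<Sum>k = 2..m. \<bar>iterated_deriv (replicate k (snd x)) h (fst x)\<bar>)
        \<le> (\<Sum>k = 2..n. \<bar>iterated_deriv (replicate k (snd x)) h (fst x)\<bar>)" if "m \<le> n" for m n x
      using that by (intro sum_mono2) auto
    show "\<exists>m. 0 < (\<Sum>k = 2..m. \<bar>iterated_deriv (replicate k (snd x)) h (fst x)\<bar>)" if "x \<in> K" for x
    proof -
      have "fst x \<in> ?U \<inter> H" "snd x \<in> H" "snd x \<noteq> 0" using that \<rho> by (auto simp: K_def)
      then obtain k where k: "k \<ge> 2" "iterated_deriv (replicate k (snd x)) h (fst x) \<noteq> 0" using ft by blast
      then have "0 < \<bar>iterated_deriv (replicate k (snd x)) h (fst x)\<bar>" by simp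
      also have "\<dots> \<le> (\<Sum>k = 2..k. \<bar>iterated_deriv (replicate k (snd x)) h (fst x)\<bar>)"
        using k by (intro member_le_sum) auto
      finally show ?thesis by blast
    qed
  qed (blast intro: that)
  define N where "N = max J (Suc m)"
  \<comment> \<open>The lower bound concerns base points in the half ball, but the upper bounds are
    needed at all y + t theta with t <= rho / 4, hence on the larger ball.\<close>
  define L where "L = cball z (3 * \<rho> / 4) \<times> sphere (0::'a) 1"
  have L: "compact L" unfolding L_def by (intro compact_Times) auto
  have LU: "L \<subseteq> ?U \<times> UNIV" using \<rho> by (auto simp: L_def)
  have contL: "continuous_on L (\<lambda>z. iterated_deriv (replicate k (snd z)) h (fst z))" for k
    using continuous_on_subset[OF continuous_on_iterated_deriv_replicate[OF open_ball hk] LU]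
    by (simp add: case_prod_beta)
  have "\<exists>B\<ge>0. \<forall>x\<in>L. \<bar>iterated_deriv (replicate k (snd x)) h (fst x)\<bar> \<le> B" for k
  proof -
    have "bounded ((\<lambda>z. iterated_deriv (replicate k (snd z)) h (fst z)) ` L)"
      by (rule compact_imp_bounded[OF compact_continuous_image[OF contL L]])
    then obtain B where "\<forall>x\<in>L. \<bar>iterated_deriv (replicate k (snd x)) h (fst x)\<bar> \<le> B" by (auto simp: bounded_iff)
    then show ?thesis by (intro exI[of _ "max 0 B"]) (auto simp: le_max_iff_disj)
  qed
  then obtain B where B: "\<And>k. B k \<ge> 0" "\<And>k x. x \<in> L \<Longrightarrow> \<bar>iterated_deriv (replicate k (snd x)) h (fst x)\<bar> \<le> B k"
    by metis
  define B' where "B' = (\<Sum>k\<le>N. B k) * (2 + \<rho>)"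
  have sumB: "B k \<le> (\<Sum>k\<le>N. B k)" if "k \<le> N" for k
    using that B(1) by (intro member_le_sum) auto
  have B'0: "B' \<ge> 0" unfolding B'_def using B(1) \<rho> by (intro mult_nonneg_nonneg sum_nonneg) auto
  obtain \<rho>0 C where rC: "\<rho>0 > 0" "\<rho>0 \<le> \<rho> / 4" "C \<ge> 0"
    "\<And>(g :: nat \<Rightarrow> real \<Rightarrow> real) t j. \<lbrakk>\<And>j t. j < N \<Longrightarrow> t \<in> {0..\<rho> / 4} \<Longrightarrow> (g j has_real_derivative g (Suc j) t) (at t);
       \<And>j t. j \<le> N \<Longrightarrow> t \<in> {0..\<rho> / 4} \<Longrightarrow> \<bar>g j t\<bar> \<le> B'; g 0 0 = 0; g 1 0 = 0;
       \<And>t. t \<in> {0..\<rho> / 4} \<Longrightarrow> 0 \<le> g 1 t; c \<le> (\<Sum>k=2..m. \<bar>g k 0\<bar>); 0 < t; t \<le> \<rho>0; j \<le> N\<rbrakk> \<Longrightarrow>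
       t ^ j * \<bar>g j t\<bar> \<le> C * g 0 t"
  proof -
    have "\<rho> / 4 > 0" "Suc m \<le> N" using \<rho> by (auto simp: N_def)
    from finite_type_taylor_bound[OF m(1,2) B'0 this] show ?thesis using that by blast
  qed
  show ?thesis
  proof (rule that[OF rC(1-3)])
    fix y \<theta> t j
    assume y: "y \<in> cball z (\<rho> / 2) \<inter> H" and \<theta>: "\<theta> \<in> H" "norm \<theta> = 1" and t: "0 < t" "t \<le> \<rho>0" and j: "j \<le> J"
    have yt: "y + t *\<^sub>R \<theta> \<in> cball z (3 * \<rho> / 4)" if "t \<in> {0..\<rho> / 4}" for t
    proof -
      have "dist z (y + t *\<^sub>R \<theta>) \<le> dist z y + norm (t *\<^sub>R \<theta>)"
        using dist_triangle[of z "y + t *\<^sub>R \<theta>" y] by (simp add: dist_norm)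
      then show ?thesis using y \<theta> that by auto
    qed
    have ytU: "y + t *\<^sub>R \<theta> \<in> ?U" if "t \<in> {0..\<rho> / 4}" for t using yt[OF that] \<rho> by auto
    have ytH: "y + t *\<^sub>R \<theta> \<in> H" for t using y \<theta> H by (auto intro: subspace_add subspace_mul)
    have yL: "(y, \<theta>) \<in> L" "\<And>t. t \<in> {0..\<rho> / 4} \<Longrightarrow> (y + t *\<^sub>R \<theta>, \<theta>) \<in> L"
      using y yt \<theta> \<rho> by (auto simp: L_def)
    have lin: "linear (frechet_derivative h (at x))" if "x \<in> ?U" for x
      using diff_on_imp_differentiable[OF hk that] linear_frechet_derivative by blast
    \<comment> \<open>Adding the tangent inequalities at y and at y + t theta shows that the
      derivative along the line is nondecreasing.\<close>
    have pos: "0 \<le> line_rem h y \<theta> 1 t" if t: "t \<in> {0..\<rho> / 4}" for t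
    proof (cases "t = 0")
      case False
      have "y \<in> ?U \<inter> H" "y + t *\<^sub>R \<theta> \<in> ?U \<inter> H" using ytU[OF t] ytH y \<rho> by auto
      from convex[OF this] convex[OF this(2,1)]
      have "h y + t * frechet_derivative h (at y) \<theta> \<le> h (y + t *\<^sub>R \<theta>)"
        "h (y + t *\<^sub>R \<theta>) - t * frechet_derivative h (at (y + t *\<^sub>R \<theta>)) \<theta> \<le> h y"
        using linear_scale[OF lin, of y t \<theta>] linear_scale[OF lin, of "y + t *\<^sub>R \<theta>" "-t" \<theta>] ytU[OF t] y \<rho> by auto
      then have "0 \<le> t * line_rem h y \<theta> 1 t" by (simp add: line_rem_def algebra_simps)
      then show ?thesis using t False by (simp add: zero_le_mult_iff)
    qed (simp add: line_rem_def)
    show "t ^ j * \<bar>line_rem h y \<theta> j t\<bar> \<le> C * line_rem h y \<theta> 0 t"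
    proof (rule rC(4)[of "line_rem h y \<theta>"])
      show "(line_rem h y \<theta> j has_real_derivative line_rem h y \<theta> (Suc j) t) (at t)" if "t \<in> {0..\<rho> / 4}" for j t
        by (rule line_rem_deriv[OF hk ytU[OF that]])
      show "\<bar>line_rem h y \<theta> j t\<bar> \<le> B'" if j: "j \<le> N" and t: "t \<in> {0..\<rho> / 4}" for j t
      proof -
        let ?B = "\<Sum>k\<le>N. B k"
        have b: "\<bar>iterated_deriv (replicate k \<theta>) h (y + t *\<^sub>R \<theta>)\<bar> \<le> ?B" "\<bar>iterated_deriv (replicate k \<theta>) h y\<bar> \<le> ?B" if "k \<le> N" for k
          using B(2)[OF yL(2)[OF t], of k] B(2)[OF yL(1), of k] sumB[OF that] by auto
        have N1: "1 \<le> N" by (simp add: N_def)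
        have D: "\<bar>h y\<bar> \<le> ?B" "\<bar>frechet_derivative h (at y) \<theta>\<bar> \<le> ?B" using b(2)[of 0] b(2)[OF N1] by auto
        have "\<bar>t * frechet_derivative h (at y) \<theta>\<bar> \<le> \<rho> * ?B" unfolding abs_mult
          using t D \<rho> by (intro mult_mono) auto
        then have "\<bar>line_rem h y \<theta> j t\<bar> \<le> ?B + (?B + \<rho> * ?B)"
          using b(1)[OF j] D \<rho> unfolding line_rem_def by (auto simp: abs_if split: if_splits)
        then show ?thesis by (simp add: B'_def algebra_simps)
      qed
      have "(y, \<theta>) \<in> K" using y \<theta> by (auto simp: K_def)
      moreover have "(\<Sum>k = 2..m. \<bar>line_rem h y \<theta> k 0\<bar>) = (\<Sum>k = 2..m. \<bar>iterated_deriv (replicate k \<theta>) h y\<bar>)"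
        by (intro sum.cong) (auto simp: line_rem_def)
      ultimately show "c \<le> (\<Sum>k = 2..m. \<bar>line_rem h y \<theta> k 0\<bar>)" using m(3)[of "(y, \<theta>)"] by simp
    qed (use pos t j in \<open>auto simp: line_rem_def N_def\<close>)
  qed
qed

section \<open>Change of variables in Euclidean space\<close>

text \<open>The map is conjugated by \<open>to_wo\<close>, which preserves determinants and Lebesgue
  measure, and the theorem is applied to the conjugate \<open>k\<close>. Boundedness of the image
  makes it a set of finite measure, as the real-valued form of the theorem demands.\<close>

lemma det_measurable_image:
  fixes g :: "real^'n \<Rightarrow> real^'n"
  assumes X: "X \<in> sets borel" and gX: "g ` X \<in> sets borel" "bounded (g ` X)"
    and der: "\<And>x. x \<in> X \<Longrightarrow> (g has_derivative g' x) (at x within X)" and inj: "inj_on g X"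
    and m: "(\<lambda>x. det (matrix (g' x)) * indicator X x) \<in> borel_measurable borel"
  shows "emeasure lborel (g ` X) = (\<integral>\<^sup>+x. ennreal \<bar>det (matrix (g' x))\<bar> * indicator X x \<partial>lborel)"
proof -
  define Y where "Y = to_wo ` X"
  define k where "k = to_wo \<circ> g \<circ> of_wo"
  define k' where "k' y = to_wo \<circ> g' (of_wo y) \<circ> of_wo" for y
  have Yv: "Y = of_wo -` X" unfolding Y_def by (auto simp: image_iff) (metis of_to_wo(2))
  have Yb: "Y \<in> sets borel"
    using measurable_sets[OF borel_to_wo(2) X] by (simp add: Yv)
  have kY: "k ` Y = of_wo -` (g ` X)" unfolding Y_def k_def by (auto simp: image_iff) (metis of_to_wo(2))
  then have kYb: "k ` Y \<in> sets borel" using measurable_sets[OF borel_to_wo(2) gX(1)] by simp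
  have kYim: "k ` Y = to_wo ` (g ` X)" unfolding Y_def k_def by (auto simp: image_iff)
  have em: "emeasure lborel (of_wo -` A) = emeasure lborel A" if "A \<in> sets borel" for A :: "(real^'n) set"
  proof -
    have "of_wo -` A \<in> sets borel" using measurable_sets[OF borel_to_wo(2) that] by simp
    then have "emeasure lborel (of_wo -` A) = emeasure lborel (to_wo -` (of_wo -` A))"
      by (subst lborel_distr_to_wo[symmetric]) (simp add: emeasure_distr)
    also have "to_wo -` (of_wo -` A) = A" by auto
    finally show ?thesis .
  qed
  have "bounded (k ` Y)"
    unfolding kYim using linear_to_wo by (intro bounded_linear_image gX(2)) (simp add: linear_conv_bounded_linear)
  then have lm: "k ` Y \<in> lmeasurable" using kYb by (intro bounded_set_imp_lmeasurable) auto
  have derk: "(k has_derivative k' y) (at y within Y)" if "y \<in> Y" for y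
  proof -
    have "(g has_derivative g' (of_wo y)) (at (of_wo y) within X)" using der that by (auto simp: Yv)
    moreover have "of_wo ` Y = X" unfolding Y_def by (auto simp: image_iff)
    moreover have "(of_wo has_derivative of_wo) (at y within Y)"
      by (simp add: linear_imp_has_derivative linear_of_wo)
    ultimately have "((g \<circ> of_wo) has_derivative (g' (of_wo y) \<circ> of_wo)) (at y within Y)"
      by (intro diff_chain_within) simp_all
    then have "((to_wo \<circ> (g \<circ> of_wo)) has_derivative (to_wo \<circ> (g' (of_wo y) \<circ> of_wo))) (at y within Y)"
      by (rule diff_chain_within[OF _ linear_imp_has_derivative[OF linear_to_wo]])
    then show ?thesis by (simp add: k_def k'_def o_assoc)
  qed
  have injk: "inj_on k Y"
    using inj unfolding Y_def k_def inj_on_def by (auto) (metis of_to_wo(1))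
  have detk: "det (matrix (k' y)) = det (matrix (g' (of_wo y)))" if "y \<in> Y" for y
    unfolding k'_def
    by (rule det_wo) (use der[of "of_wo y"] that in \<open>auto simp: Yv dest: has_derivative_linear\<close>)
  have "((\<lambda>y. \<bar>det (matrix (k' y))\<bar>) has_integral measure lebesgue (k ` Y)) Y"
    using has_measure_differentiable_image[of Y k k' "measure lebesgue (k ` Y)"] Yb derk injk lm by simp
  then have "((\<lambda>y. \<bar>det (matrix (g' (of_wo y)))\<bar>) has_integral measure lebesgue (k ` Y)) Y"
    by (rule has_integral_eq[rotated]) (simp add: detk)
  then have "((\<lambda>y. if y \<in> Y then \<bar>det (matrix (g' (of_wo y)))\<bar> else 0) has_integral measure lebesgue (k ` Y)) UNIV"
    by (simp add: has_integral_restrict_UNIV)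
  then have hi: "((\<lambda>y. \<bar>det (matrix (g' (of_wo y))) * indicator Y y\<bar>) has_integral measure lebesgue (k ` Y)) UNIV"
    by (rule has_integral_eq[rotated]) (auto simp: indicator_def)
  have hm: "(\<lambda>y. \<bar>det (matrix (g' (of_wo y))) * indicator Y y\<bar>) \<in> borel_measurable borel"
    using measurable_compose[OF borel_to_wo(2) m] by (simp add: Yv indicator_vimage[symmetric])
  have "emeasure lborel (g ` X) = emeasure lborel (k ` Y)" unfolding kY by (rule em[OF gX(1), symmetric])
  also have "\<dots> = emeasure lebesgue (k ` Y)" using kYb by simp
  also have "\<dots> = ennreal (measure lebesgue (k ` Y))" by (rule emeasure_eq_ennreal_measure) (use fmeasurableD2[OF lm] in simp)
  also have "\<dots> = (\<integral>\<^sup>+y. ennreal \<bar>det (matrix (g' (of_wo y))) * indicator Y y\<bar> \<partial>lborel)"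
    using nn_integral_has_integral_lborel[OF hm _ hi] by simp
  also have "\<dots> = (\<integral>\<^sup>+y. ennreal \<bar>det (matrix (g' (of_wo y))) * indicator Y y\<bar> \<partial>distr lborel borel to_wo)"
    by (simp add: lborel_distr_to_wo)
  also have "\<dots> = (\<integral>\<^sup>+x. ennreal \<bar>det (matrix (g' x)) * indicator Y (to_wo x)\<bar> \<partial>lborel)"
    using hm by (subst nn_integral_distr) auto
  also have "\<dots> = (\<integral>\<^sup>+x. ennreal \<bar>det (matrix (g' x))\<bar> * indicator X x \<partial>lborel)"
    by (intro nn_integral_cong) (auto simp: Yv indicator_def)
  finally show ?thesis .
qed

text \<open>The formula for sets, applied to Borel subsets of X, identifies two measures: Lebesgue
  measure on the image, and the push-forward of the Jacobian density. Off X the map is replaced by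
  0, so that the push-forward is along a globally measurable function \<open>h\<close>.\<close>

lemma nn_integral_change_of_variables:
  fixes g :: "real^'n \<Rightarrow> real^'n"
  assumes X: "X \<in> sets borel" and gX: "bounded (g ` X)" "g ` X \<in> sets borel"
    and der: "\<And>x. x \<in> X \<Longrightarrow> (g has_derivative g' x) (at x within X)" and inj: "inj_on g X"
    and m: "(\<lambda>x. det (matrix (g' x)) * indicator X x) \<in> borel_measurable borel"
    and F: "F \<in> borel_measurable borel"
  shows "(\<integral>\<^sup>+x. F x * indicator (g ` X) x \<partial>lborel)
       = (\<integral>\<^sup>+x. ennreal \<bar>det (matrix (g' x))\<bar> * F (g x) * indicator X x \<partial>lborel)"
proof -
  let ?d = "\<lambda>x. ennreal \<bar>det (matrix (g' x)) * indicator X x\<bar>"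
  define h where "h x = (if x \<in> X then g x else 0)" for x
  have contg: "continuous_on X g"
    using der by (meson continuous_on_eq_continuous_within has_derivative_continuous)
  have hm [measurable]: "h \<in> borel_measurable borel"
    using borel_measurable_continuous_on_indicator[OF X contg]
    by (rule measurable_cong[THEN iffD1, rotated]) (auto simp: h_def indicator_def)
  have dm [measurable]: "?d \<in> borel_measurable borel" using m by measurable
  have F' [measurable]: "F \<in> borel_measurable borel" by (rule F)
  have X' [measurable]: "X \<in> sets borel" and gX' [measurable]: "g ` X \<in> sets borel" by fact+
  have eq: "density lborel (indicator (g ` X)) = distr (density lborel ?d) borel h"
  proof (rule measure_eqI)
    fix B assume "B \<in> sets (density lborel (indicator (g ` X) :: _ \<Rightarrow> ennreal))"
    then have B [measurable]: "B \<in> sets borel" by simp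
    define Z where "Z = X \<inter> h -` B"
    have Z: "Z \<in> sets borel" "Z \<subseteq> X" unfolding Z_def using measurable_sets[OF hm B] X by auto
    have gZ: "g ` Z = g ` X \<inter> B" unfolding Z_def h_def by auto
    have "(\<lambda>x. det (matrix (g' x)) * indicator X x * indicator Z x) \<in> borel_measurable borel"
      using m Z(1) by measurable
    moreover have "(\<lambda>x. det (matrix (g' x)) * indicator X x * indicator Z x) = (\<lambda>x. det (matrix (g' x)) * indicator Z x)"
      using Z(2) by (auto simp: fun_eq_iff split: split_indicator)
    ultimately have mZ: "(\<lambda>x. det (matrix (g' x)) * indicator Z x) \<in> borel_measurable borel" by simp
    have "emeasure (density lborel (indicator (g ` X))) B = (\<integral>\<^sup>+x. indicator (g ` X) x * indicator B x \<partial>lborel)"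
      by (rule emeasure_density) simp_all
    also have "\<dots> = (\<integral>\<^sup>+x. indicator (g ` X \<inter> B) x \<partial>lborel)"
      by (intro nn_integral_cong) (simp split: split_indicator)
    also have "\<dots> = emeasure lborel (g ` X \<inter> B)" by (rule nn_integral_indicator) simp
    finally have "emeasure (density lborel (indicator (g ` X))) B = emeasure lborel (g ` X \<inter> B)" .
    also have "\<dots> = (\<integral>\<^sup>+x. ennreal \<bar>det (matrix (g' x))\<bar> * indicator Z x \<partial>lborel)"
      unfolding gZ[symmetric]
      by (rule det_measurable_image[OF Z(1) _ _ _ _ mZ])
         (use gZ gX B inj Z(2) in \<open>auto intro: inj_on_subset has_derivative_subset[OF der] bounded_subset\<close>)
    also have "\<dots> = (\<integral>\<^sup>+x. ?d x * indicator (h -` B) x \<partial>lborel)"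
      by (intro nn_integral_cong) (auto simp: Z_def indicator_def)
    also have "\<dots> = emeasure (distr (density lborel ?d) borel h) B"
    proof -
      have v: "h -` B \<in> sets borel" using measurable_sets[OF hm B] by simp
      have "emeasure (distr (density lborel ?d) borel h) B = emeasure (density lborel ?d) (h -` B)"
        by (subst emeasure_distr) (use hm in auto)
      also have "\<dots> = (\<integral>\<^sup>+x. ?d x * indicator (h -` B) x \<partial>lborel)"
        by (rule emeasure_density) (use dm v in auto)
      finally show ?thesis ..
    qed
    finally show "emeasure (density lborel (indicator (g ` X))) B = emeasure (distr (density lborel ?d) borel h) B" .
  qed simp
  have "(\<integral>\<^sup>+x. F x * indicator (g ` X) x \<partial>lborel) = (\<integral>\<^sup>+x. F x \<partial>density lborel (indicator (g ` X)))"
    by (simp add: nn_integral_density mult.commute)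
  also have "\<dots> = (\<integral>\<^sup>+x. F (h x) \<partial>density lborel ?d)"
    unfolding eq by (rule nn_integral_distr) simp_all
  also have "\<dots> = (\<integral>\<^sup>+x. ?d x * F (h x) \<partial>lborel)"
    by (rule nn_integral_density) (use dm in simp_all)
  also have "\<dots> = (\<integral>\<^sup>+x. ennreal \<bar>det (matrix (g' x))\<bar> * F (g x) * indicator X x \<partial>lborel)"
    by (intro nn_integral_cong) (auto simp: h_def indicator_def)
  finally show ?thesis .
qed

lemma emeasure_linear_image:
  fixes f :: "real^'n \<Rightarrow> real^'n"
  assumes f: "linear f" "det (matrix f) \<noteq> 0" and X: "X \<in> sets borel" "bounded (f ` X)"
  shows "f ` X \<in> sets borel" "emeasure lborel (f ` X) = ennreal \<bar>det (matrix f)\<bar> * emeasure lborel X"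
proof -
  have inj: "inj f" using f det_nz_iff_inj by blast
  obtain h :: "real^'n \<Rightarrow> real^'n" where h: "linear h" "\<And>x. h (f x) = x" "\<And>x. f (h x) = x"
  proof -
    obtain h where h: "linear h" "h \<circ> f = id" using linear_injective_left_inverse[OF f(1) inj] by blast
    moreover have "f (h y) = y" for y
    proof -
      obtain x where "y = f x" using linear_injective_imp_surjective[OF f(1) inj refl] by (metis surjD)
      then show ?thesis using h(2) by (simp add: fun_eq_iff)
    qed
    ultimately show ?thesis using that[of h] by (simp add: fun_eq_iff)
  qed
  have "h \<in> borel_measurable borel"
    using h(1) by (intro borel_measurable_continuous_onI linear_continuous_on) (simp add: linear_conv_bounded_linear)
  moreover have "f ` X = h -` X" using h by (auto simp: image_iff) metis
  ultimately show fX: "f ` X \<in> sets borel" using measurable_sets[of h borel borel X] X(1) by simp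
  have "emeasure lborel (f ` X) = (\<integral>\<^sup>+x. ennreal \<bar>det (matrix f)\<bar> * indicator X x \<partial>lborel)"
    by (rule det_measurable_image[OF X(1) fX X(2)])
       (use X(1) inj f(1) in \<open>auto intro: linear_imp_has_derivative inj_on_subset\<close>)
  then show "emeasure lborel (f ` X) = ennreal \<bar>det (matrix f)\<bar> * emeasure lborel X"
    using X(1) by (simp add: nn_integral_cmult)
qed

lemma lborel_linear:
  fixes f :: "real^'n \<Rightarrow> real^'n"
  assumes f: "linear f" "det (matrix f) \<noteq> 0"
  shows "lborel = density (distr lborel borel f) (\<lambda>_. ennreal \<bar>det (matrix f)\<bar>)"
proof (rule lborel_eqI)
  have fm [measurable]: "f \<in> borel_measurable borel"
    using f(1) by (intro borel_measurable_continuous_onI linear_continuous_on) (simp add: linear_conv_bounded_linear)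
  fix l u :: "real^'n" assume le: "\<And>b. b \<in> Basis \<Longrightarrow> l \<bullet> b \<le> u \<bullet> b"
  have inj: "inj f" using f det_nz_iff_inj by blast
  have "surj f" by (rule linear_injective_imp_surjective[OF f(1) inj refl])
  then have im: "f ` (f -` box l u) = box l u" by (rule surj_image_vimage_eq)
  have v: "f -` box l u \<in> sets borel" using measurable_sets[OF fm, of "box l u"] by simp
  have "emeasure (density (distr lborel borel f) (\<lambda>_. ennreal \<bar>det (matrix f)\<bar>)) (box l u)
      = ennreal \<bar>det (matrix f)\<bar> * emeasure lborel (f -` box l u)"
    by (simp add: emeasure_density nn_integral_cmult emeasure_distr)
  also have "\<dots> = emeasure lborel (box l u)"
    using emeasure_linear_image(2)[OF f v] im by simp
  also have "\<dots> = (\<Prod>b\<in>Basis. (u - l) \<bullet> b)" using le by (rule emeasure_lborel_box)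
  finally show "emeasure (density (distr lborel borel f) (\<lambda>_. ennreal \<bar>det (matrix f)\<bar>)) (box l u) = (\<Prod>b\<in>Basis. (u - l) \<bullet> b)" .
qed simp

lemma integral_lborel_linear:
  fixes f :: "real^'n \<Rightarrow> real^'n" and F :: "real^'n \<Rightarrow> 'b::{banach,second_countable_topology}"
  assumes f: "linear f" "det (matrix f) \<noteq> 0" and F: "F \<in> borel_measurable borel"
  shows "(LINT x|lborel. F (f x)) = (LINT x|lborel. F x) /\<^sub>R \<bar>det (matrix f)\<bar>"
proof -
  have fm [measurable]: "f \<in> borel_measurable borel"
    using f(1) by (intro borel_measurable_continuous_onI linear_continuous_on) (simp add: linear_conv_bounded_linear)
  have "(LINT x|lborel. F x) = (LINT x|density (distr lborel borel f) (\<lambda>_. ennreal \<bar>det (matrix f)\<bar>). F x)"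
    using lborel_linear[OF f] by simp
  also have "\<dots> = (LINT x|distr lborel borel f. \<bar>det (matrix f)\<bar> *\<^sub>R F x)"
    using F by (subst integral_density) auto
  also have "\<dots> = \<bar>det (matrix f)\<bar> *\<^sub>R (LINT x|lborel. F (f x))"
    using F by (subst integral_distr) auto
  finally show ?thesis using f(2) by simp
qed

section \<open>Projection to a hyperplane and invariance of graph area\<close>

lemma linear_hproj: "linear (hproj b)"
  by (auto intro!: linearI simp: hproj_def algebra_simps)

lemma bounded_linear_hproj: "bounded_linear (hproj b)"
  using linear_hproj linear_conv_bounded_linear by blast

lemma borel_hproj [measurable]: "hproj b \<in> borel_measurable borel"
  by (intro borel_measurable_continuous_onI linear_continuous_on bounded_linear_hproj)

lemma hproj_inner: "norm b = 1 \<Longrightarrow> hproj b x \<bullet> b = 0"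
  by (simp add: hproj_def inner_diff_left dot_square_norm)

lemma hproj_self: "norm b = 1 \<Longrightarrow> hproj b b = 0"
  by (simp add: hproj_def dot_square_norm)

lemma hproj_id: "x \<bullet> b = 0 \<Longrightarrow> hproj b x = x"
  by (simp add: hproj_def)

lemma hproj_scale_self: "norm b = 1 \<Longrightarrow> hproj b (y + t *\<^sub>R b) = hproj b y"
  using linear_add[OF linear_hproj] linear_scale[OF linear_hproj] hproj_self by (metis add.right_neutral scale_zero_right)

lemma hproj_decomp: "x = hproj b x + (x \<bullet> b) *\<^sub>R b"
  by (simp add: hproj_def)

lemma sets_hyperplane_lborel [simp, measurable_cong]: "sets (hyperplane_lborel b) = sets borel"
  by (simp add: hyperplane_lborel_def)

lemma space_hyperplane_lborel [simp]: "space (hyperplane_lborel b) = UNIV"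
  by (simp add: hyperplane_lborel_def)

abbreviation slab :: "'a::euclidean_space \<Rightarrow> 'a set" where
  "slab b \<equiv> {x. 0 \<le> x \<bullet> b \<and> x \<bullet> b \<le> 1}"

lemma borel_slab [measurable]: "slab b \<in> sets borel"
  by measurable

lemma nn_integral_hyperplane_lborel:
  assumes "F \<in> borel_measurable borel"
  shows "(\<integral>\<^sup>+y. F y \<partial>hyperplane_lborel b) = (\<integral>\<^sup>+x. F (hproj b x) * indicator (slab b) x \<partial>lborel)"
proof -
  have "(\<integral>\<^sup>+y. F y \<partial>hyperplane_lborel b) = (\<integral>\<^sup>+x. F (hproj b x) \<partial>density lborel (indicator (slab b)))"
    unfolding hyperplane_lborel_def by (rule nn_integral_distr) (use assms in simp_all)
  also have "\<dots> = (\<integral>\<^sup>+x. indicator (slab b) x * F (hproj b x) \<partial>lborel)"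
    by (rule nn_integral_density) (use assms in simp_all)
  finally show ?thesis by (simp add: mult.commute)
qed

text \<open>The gradient of h within the hyperplane orthogonal to b. Then b minus this vector is
  normal to the graph, and its length is the area density
  (\<open>area_density_norm\<close>).\<close>

definition hgrad :: "'a::euclidean_space \<Rightarrow> ('a \<Rightarrow> real) \<Rightarrow> 'a \<Rightarrow> 'a" where
  "hgrad b h y = (\<Sum>i\<in>Basis. frechet_derivative h (at y) (hproj b i) *\<^sub>R i)"

definition area_density :: "'a::euclidean_space \<Rightarrow> ('a \<Rightarrow> real) \<Rightarrow> 'a \<Rightarrow> real" where
  "area_density b h y = sqrt (1 + (\<Sum>i\<in>Basis. (frechet_derivative h (at y) (hproj b i))\<^sup>2))"

lemma graph_area_eq:
  "graph_area b h D = (\<integral>\<^sup>+y. ennreal (area_density b h y) * indicator D y \<partial>hyperplane_lborel b)"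
  by (simp add: graph_area_def area_density_def)

lemma area_density_ge_1: "area_density b h y \<ge> 1"
  by (simp add: area_density_def sum_nonneg)

lemma inner_hgrad:
  assumes "h differentiable (at y)"
  shows "hgrad b h y \<bullet> x = frechet_derivative h (at y) (hproj b x)"
proof -
  have l: "linear (\<lambda>x. frechet_derivative h (at y) (hproj b x))"
    using linear_compose[OF linear_hproj linear_frechet_derivative[OF assms]] by (simp add: o_def)
  have "hgrad b h y \<bullet> x = (\<Sum>i\<in>Basis. (x \<bullet> i) * frechet_derivative h (at y) (hproj b i))"
    by (simp add: hgrad_def inner_sum_left mult.commute inner_commute[of x])
  also have "\<dots> = frechet_derivative h (at y) (hproj b (\<Sum>i\<in>Basis. (x \<bullet> i) *\<^sub>R i))"
    by (simp add: linear_sum[OF l] linear_scale[OF l])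
  finally show ?thesis by (simp add: euclidean_representation)
qed

lemma hgrad_orth: "norm b = 1 \<Longrightarrow> h differentiable (at y) \<Longrightarrow> hgrad b h y \<bullet> b = 0"
  by (simp add: inner_hgrad hproj_self linear_0[OF linear_frechet_derivative])

lemma area_density_norm:
  assumes "norm b = 1" "h differentiable (at y)"
  shows "area_density b h y = norm (b - hgrad b h y)"
proof -
  have "(norm (hgrad b h y))\<^sup>2 = (\<Sum>i\<in>Basis. (frechet_derivative h (at y) (hproj b i))\<^sup>2)"
    unfolding power2_norm_eq_inner euclidean_inner[of "hgrad b h y" "hgrad b h y"]
    by (intro sum.cong refl) (simp only: inner_hgrad[OF assms(2)] power2_eq_square)
  moreover have "(norm (b - hgrad b h y))\<^sup>2 = 1 + (norm (hgrad b h y))\<^sup>2"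
  proof -
    have "hgrad b h y \<bullet> b = 0" "b \<bullet> hgrad b h y = 0" "b \<bullet> b = 1"
      using hgrad_orth[OF assms] assms(1) by (simp_all add: inner_commute[of b] dot_square_norm)
    then show ?thesis unfolding power2_norm_eq_inner inner_diff_left inner_diff_right by simp
  qed
  ultimately show ?thesis unfolding area_density_def by (metis norm_ge_zero real_sqrt_unique)
qed

lemma continuous_on_area_density:
  assumes "smooth_on U h" shows "continuous_on U (area_density b h)"
proof -
  have "continuous_on U (\<lambda>y. frechet_derivative h (at y) v)" for v
    using smooth_on_continuous[OF assms, of "[v]"] by simp
  then show ?thesis unfolding area_density_def[abs_def] by (intro continuous_intros)
qed

lemma borel_area_density:
  assumes "smooth_on U h" "D \<in> sets borel" "D \<subseteq> U"
  shows "(\<lambda>y. ennreal (area_density b h y) * indicator D y) \<in> borel_measurable borel"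
proof -
  have "continuous_on D (area_density b h)"
    using continuous_on_area_density[OF assms(1)] assms(3) continuous_on_subset by blast
  from borel_measurable_continuous_on_indicator[OF assms(2) this]
  have "(\<lambda>y. ennreal (indicator D y *\<^sub>R area_density b h y)) \<in> borel_measurable borel" by measurable
  moreover have "(\<lambda>y. ennreal (indicator D y *\<^sub>R area_density b h y)) = (\<lambda>y. ennreal (area_density b h y) * indicator D y)"
    by (auto simp: indicator_def)
  ultimately show ?thesis by simp
qed

text \<open>Two hyperplanes parametrize the same tangent space. L lifts a vector from the second
  hyperplane to the tangent space, projects it to the first, and sends b' to b. It factors into
  three rank-one perturbations of the identity: the lift and the projection have determinant 1, and
  the middle factor, which exchanges b' for b and fixes the tangent space, gives the value. Both b -
  a and b' - a' are normal to the tangent space and thus parallel, which turns the determinant into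
  the quotient of their lengths.\<close>

lemma det_tangent_transition:
  fixes a a' b b' :: "real^'n"
  assumes b: "norm b = 1" "norm b' = 1" and a: "a \<bullet> b = 0" "a' \<bullet> b' = 0"
    and tangent: "\<And>v. v \<bullet> b' = 0 \<Longrightarrow> (v + (a' \<bullet> v) *\<^sub>R b') \<bullet> (b - a) = 0"
  defines "L \<equiv> \<lambda>x. hproj b (hproj b' x + (a' \<bullet> x) *\<^sub>R b') + (x \<bullet> b') *\<^sub>R b"
  shows "det (matrix L) = (b' - a') \<bullet> b" "\<bar>det (matrix L)\<bar> * norm (b - a) = norm (b' - a')"
proof -
  let ?L1 = "\<lambda>x. x + (a' \<bullet> x) *\<^sub>R b'" and ?L2 = "\<lambda>u. u + ((b' - a') \<bullet> u) *\<^sub>R (b - b')"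
    and ?L3 = "\<lambda>w. w + (a \<bullet> w) *\<^sub>R (- b)"
  have lin: "linear ?L1" "linear ?L2" "linear ?L3"
    by (auto intro!: linearI simp: algebra_simps)
  have bb: "b \<bullet> b = 1" "b' \<bullet> b' = 1" using b by (auto simp: dot_square_norm)
  have b'a': "b' \<bullet> a' = 0" "b \<bullet> a = 0" using a by (auto simp: inner_commute)
  have "L x = ?L3 (?L2 (?L1 x))" for x
  proof -
    let ?v = "hproj b' x" and ?s = "x \<bullet> b'"
    have v: "?v \<bullet> b' = 0" by (rule hproj_inner[OF b(2)])
    have av: "a' \<bullet> x = a' \<bullet> ?v" using a by (simp add: hproj_def inner_diff_right)
    have 1: "(b' - a') \<bullet> ?L1 x = ?s"
      using a bb by (simp add: inner_add_right inner_diff_left inner_commute[of b' x] inner_commute[of b' a'])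
    have 2: "?L2 (?L1 x) = ?v + (a' \<bullet> x) *\<^sub>R b' + ?s *\<^sub>R b"
      unfolding 1 by (simp add: hproj_def algebra_simps)
    let ?t = "?v + (a' \<bullet> x) *\<^sub>R b'"
    have "?t \<bullet> b = a \<bullet> ?t" using tangent[OF v] by (simp add: av inner_diff_right inner_commute[of a])
    moreover have "a \<bullet> (?t + ?s *\<^sub>R b) = a \<bullet> ?t" using a by (simp add: inner_add_right)
    ultimately show ?thesis unfolding 2 L_def by (simp add: hproj_def)
  qed
  then have "L = ?L3 \<circ> (?L2 \<circ> ?L1)" by auto
  then have "det (matrix L) = det (matrix ?L3) * (det (matrix ?L2) * det (matrix ?L1))"
    by (simp only: matrix_compose[OF linear_compose[OF lin(1,2)] lin(3)] matrix_compose[OF lin(1,2)] det_mul)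
  also have "\<dots> = 1 + (b' - a') \<bullet> (b - b')"
    unfolding det_rank_one using a by simp
  also have "\<dots> = (b' - a') \<bullet> b" using a bb by (simp add: inner_diff_left inner_diff_right)
  finally show d: "det (matrix L) = (b' - a') \<bullet> b" .
  let ?c = "(b - a) \<bullet> b'"
  have par: "b - a = ?c *\<^sub>R (b' - a')"
  proof (rule vector_eq_rdot[THEN iffD1], rule allI)
    fix x
    let ?v = "hproj b' x"
    have v: "?v \<bullet> b' = 0" by (rule hproj_inner[OF b(2)])
    have av: "a' \<bullet> x = a' \<bullet> ?v" using a by (simp add: hproj_def inner_diff_right)
    have "(b - a) \<bullet> ?v = - (a' \<bullet> x) * ?c"
      using tangent[OF v] unfolding av by (simp add: inner_add_right inner_commute[of _ "b - a"])
    moreover have "(b - a) \<bullet> x = (b - a) \<bullet> ?v + (x \<bullet> b') * ?c"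
      by (subst hproj_decomp[of x b']) (simp add: inner_add_right)
    ultimately show "(b - a) \<bullet> x = (?c *\<^sub>R (b' - a')) \<bullet> x"
      by (simp add: inner_diff_left algebra_simps inner_commute[of b' x])
  qed
  have "1 = (b - a) \<bullet> b" using bb a by (simp add: inner_diff_left)
  also have "\<dots> = ?c * ((b' - a') \<bullet> b)" by (subst par) simp
  finally have "\<bar>?c\<bar> * \<bar>(b' - a') \<bullet> b\<bar> = 1" by (metis abs_mult abs_one)
  moreover have "norm (b - a) = \<bar>?c\<bar> * norm (b' - a')" by (subst par) simp
  ultimately have "\<bar>(b' - a') \<bullet> b\<bar> * norm (b - a) = (\<bar>?c\<bar> * \<bar>(b' - a') \<bullet> b\<bar>) * norm (b' - a')"
    by (simp only: mult_ac)
  then show "\<bar>det (matrix L)\<bar> * norm (b - a) = norm (b' - a')"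
    unfolding d \<open>\<bar>?c\<bar> * \<bar>(b' - a') \<bullet> b\<bar> = 1\<close> by simp
qed

text \<open>The area does not depend on the projection direction. Hyperplane measure is the volume
  of cylinders of height 1, so the change of base is extended by b' -> b to a map \<open>g\<close>
  between such cylinders, and the change of variables in the whole space applies. Its Jacobian is
  the quotient of the two area densities by \<open>det_tangent_transition\<close>.\<close>

lemma graph_area_transition:
  fixes b b' :: "real^'n"
  assumes b: "norm b = 1" "norm b' = 1"
    and h: "open V" "smooth_on V h" and h': "open U" "smooth_on U h'"
    and E: "E \<in> sets borel" "E \<subseteq> U" "E \<subseteq> {y. y \<bullet> b' = 0}"
    and W: "open W" "\<And>y. y \<in> E \<Longrightarrow> y + h' y *\<^sub>R b' \<in> W"
    and graph: "\<And>y. y \<in> U \<Longrightarrow> y \<bullet> b' = 0 \<Longrightarrow> y + h' y *\<^sub>R b' \<in> W \<Longrightarrow>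
        hproj b (y + h' y *\<^sub>R b') \<in> V \<and> (y + h' y *\<^sub>R b') \<bullet> b = h (hproj b (y + h' y *\<^sub>R b'))"
    and D: "(\<lambda>y. hproj b (y + h' y *\<^sub>R b')) ` E \<in> sets borel" "bounded ((\<lambda>y. hproj b (y + h' y *\<^sub>R b')) ` E)"
  shows "graph_area b h ((\<lambda>y. hproj b (y + h' y *\<^sub>R b')) ` E) = graph_area b' h' E"
proof -
  define G where "G y = y + h' y *\<^sub>R b'" for y
  define D1 where "D1 = (\<lambda>y. hproj b (G y)) ` E"
  have D1: "D1 \<in> sets borel" "bounded D1" using D by (simp_all add: D1_def G_def)
  define X where "X = {x. hproj b' x \<in> E} \<inter> slab b'"
  define g where "g x = hproj b (G (hproj b' x)) + (x \<bullet> b') *\<^sub>R b" for x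
  define g' where "g' x = (\<lambda>w. hproj b (hproj b' w + (hgrad b' h' (hproj b' x) \<bullet> w) *\<^sub>R b') + (w \<bullet> b') *\<^sub>R b)" for x
  have dh': "h' differentiable (at y)" if "y \<in> U" for y
    using diff_on_imp_differentiable[OF smooth_on_imp_diff_on[OF h'(2)] that] .
  have dh: "h differentiable (at y)" if "y \<in> V" for y
    using diff_on_imp_differentiable[OF smooth_on_imp_diff_on[OF h(2)] that] .
  have derG: "((\<lambda>x. G (hproj b' x)) has_derivative (\<lambda>w. hproj b' w + (hgrad b' h' (hproj b' x) \<bullet> w) *\<^sub>R b')) (at x)"
    if "hproj b' x \<in> U" for x
  proof -
    have "(h' has_derivative frechet_derivative h' (at (hproj b' x))) (at (hproj b' x))"
      using dh'[OF that] frechet_derivative_works by blast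
    from has_derivative_compose[OF bounded_linear_imp_has_derivative[OF bounded_linear_hproj] this]
    have "((\<lambda>x. h' (hproj b' x)) has_derivative (\<lambda>w. hgrad b' h' (hproj b' x) \<bullet> w)) (at x)"
      by (simp add: inner_hgrad[OF dh'[OF that]])
    from has_derivative_add[OF bounded_linear_imp_has_derivative[OF bounded_linear_hproj] has_derivative_scaleR_left[OF this]]
    show ?thesis by (simp add: G_def)
  qed
  have derg: "(g has_derivative g' x) (at x)" if "hproj b' x \<in> U" for x
    unfolding g_def g'_def
    by (intro has_derivative_add has_derivative_scaleR_left
         bounded_linear.has_derivative[OF bounded_linear_hproj] derG[OF that]
         bounded_linear_imp_has_derivative bounded_linear_inner_left)
  have XE: "hproj b' x \<in> E" if "x \<in> X" for x using that by (simp add: X_def)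
  have gr: "hproj b (G y) \<in> V" "G y \<bullet> b = h (hproj b (G y))" if "y \<in> E" for y
    using graph[of y] W(2)[OF that] E that by (auto simp: G_def)
  \<comment> \<open>Near y the second graph stays in W and hence lies on the first, so
    \<open>?k\<close> vanishes in a neighbourhood. The vanishing of its derivative says that lifted
    vectors are orthogonal to the normal of the first graph.\<close>
  have tangent: "(v + (hgrad b' h' y \<bullet> v) *\<^sub>R b') \<bullet> (b - hgrad b h (hproj b (G y))) = 0"
    if y: "y \<in> E" and v: "v \<bullet> b' = 0" for y v
  proof -
    have yU: "y \<in> U" and yb: "y \<bullet> b' = 0" using E y by auto
    have yp: "hproj b' y = y" by (rule hproj_id[OF yb])
    let ?k = "\<lambda>x. G (hproj b' x) \<bullet> b - h (hproj b (G (hproj b' x)))"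
    let ?d = "\<lambda>w. hproj b' w + (hgrad b' h' y \<bullet> w) *\<^sub>R b'"
    have dG: "((\<lambda>x. G (hproj b' x)) has_derivative ?d) (at y)" using derG[of y] yU yp by simp
    have "(h has_derivative frechet_derivative h (at (hproj b (G (hproj b' y))))) (at (hproj b (G (hproj b' y))))"
      using dh[OF gr(1)[OF y]] frechet_derivative_works yp by auto
    from has_derivative_compose[OF bounded_linear.has_derivative[OF bounded_linear_hproj dG] this]
    have "((\<lambda>x. h (hproj b (G (hproj b' x)))) has_derivative
        (\<lambda>w. hgrad b h (hproj b (G y)) \<bullet> ?d w)) (at y)"
      using inner_hgrad[OF dh[OF gr(1)[OF y]]] by (simp add: yp)
    with dG have k1: "(?k has_derivative (\<lambda>w. ?d w \<bullet> b - hgrad b h (hproj b (G y)) \<bullet> ?d w)) (at y)"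
      by (intro has_derivative_diff has_derivative_inner_left)
    have "isCont (\<lambda>x. G (hproj b' x)) y" using has_derivative_continuous[OF dG] .
    then have "((\<lambda>x. G (hproj b' x)) \<longlongrightarrow> G y) (nhds y)"
      using tendsto_at_iff_tendsto_nhds[of "\<lambda>x. G (hproj b' x)" y] unfolding isCont_def yp by blast
    then have "\<forall>\<^sub>F x in nhds y. G (hproj b' x) \<in> W"
      by (rule topological_tendstoD[OF _ W(1)]) (use W(2)[OF y] in \<open>simp add: G_def\<close>)
    moreover have "\<forall>\<^sub>F x in nhds y. hproj b' x \<in> U"
    proof (rule topological_tendstoD[OF _ h'(1)])
      show "(hproj b' \<longlongrightarrow> y) (nhds y)"
        using linear_continuous_at[OF bounded_linear_hproj[of b'], of y]
          tendsto_at_iff_tendsto_nhds[of "hproj b'" y] unfolding isCont_def yp by blast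
    qed (rule yU)
    ultimately have "\<forall>\<^sub>F x in nhds y. ?k x = 0"
    proof eventually_elim
      case (elim x)
      then show ?case using graph[of "hproj b' x"] hproj_inner[OF b(2), of x] by (simp add: G_def)
    qed
    then have "(?k has_derivative (\<lambda>w. 0)) (at y)"
      unfolding eventually_nhds
      by (elim exE conjE) (rule has_derivative_transform_within_open[of "\<lambda>_. 0"], auto)
    then have "(\<lambda>w. ?d w \<bullet> b - hgrad b h (hproj b (G y)) \<bullet> ?d w) = (\<lambda>w. 0)"
      using k1 has_derivative_unique by blast
    then have "?d v \<bullet> b - hgrad b h (hproj b (G y)) \<bullet> ?d v = 0" by metis
    then show ?thesis
      unfolding hproj_id[OF v] inner_diff_right by (simp only: inner_commute[of "hgrad b h (hproj b (G y))"])
  qed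
  have det: "det (matrix (g' x)) = (b' - hgrad b' h' (hproj b' x)) \<bullet> b"
    "\<bar>det (matrix (g' x))\<bar> * area_density b h (hproj b (G (hproj b' x))) = area_density b' h' (hproj b' x)"
    if x: "x \<in> X" for x
  proof -
    let ?y = "hproj b' x"
    have y: "?y \<in> E" by (rule XE[OF x])
    have yU: "?y \<in> U" using y E by auto
    note d = det_tangent_transition[OF b hgrad_orth[OF b(1) dh[OF gr(1)[OF y]]] hgrad_orth[OF b(2) dh'[OF yU]] tangent[OF y]]
    show "det (matrix (g' x)) = (b' - hgrad b' h' ?y) \<bullet> b" unfolding g'_def by (rule d(1))
    show "\<bar>det (matrix (g' x))\<bar> * area_density b h (hproj b (G ?y)) = area_density b' h' ?y"
      unfolding g'_def area_density_norm[OF b(1) dh[OF gr(1)[OF y]]] area_density_norm[OF b(2) dh'[OF yU]]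
      by (rule d(2))
  qed
  have Xb: "X \<in> sets borel" unfolding X_def using E(1) by measurable
  have gp: "hproj b (g x) = hproj b (G (hproj b' x))" "g x \<bullet> b = x \<bullet> b'" for x
    using hproj_scale_self[OF b(1), of "hproj b (G (hproj b' x))"] hproj_inner[OF b(1)] b(1)
    by (auto simp: g_def hproj_id inner_add_left dot_square_norm)
  have gX: "g ` X = {x. hproj b x \<in> D1} \<inter> slab b"
  proof (intro equalityI subsetI)
    fix w assume w: "w \<in> {x. hproj b x \<in> D1} \<inter> slab b"
    then obtain y where y: "y \<in> E" "hproj b w = hproj b (G y)" by (auto simp: D1_def)
    have yb: "y \<bullet> b' = 0" using E y by auto
    let ?x = "y + (w \<bullet> b) *\<^sub>R b'"
    have px: "hproj b' ?x = y" using hproj_scale_self[OF b(2)] hproj_id[OF yb] by simp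
    have "?x \<bullet> b' = w \<bullet> b" using yb b(2) by (simp add: inner_add_left dot_square_norm)
    moreover from this have "g ?x = w" unfolding g_def px using y(2) hproj_decomp[of w b] by simp
    ultimately show "w \<in> g ` X" using w y px by (intro image_eqI[of _ _ ?x]) (auto simp: X_def)
  next
    fix w assume "w \<in> g ` X"
    then obtain x where x: "x \<in> X" "w = g x" by blast
    have "hproj b w \<in> D1" unfolding x(2) gp(1) D1_def using XE[OF x(1)] by (rule imageI)
    moreover have "w \<in> slab b" using x(1) unfolding x(2) by (simp add: gp(2) X_def)
    ultimately show "w \<in> {x. hproj b x \<in> D1} \<inter> slab b" by simp
  qed
  have gXb: "g ` X \<in> sets borel" unfolding gX using D1(1) by measurable
  have bgX: "bounded (g ` X)"
  proof -
    obtain B where B: "\<And>y. y \<in> D1 \<Longrightarrow> norm y \<le> B" using D1(2) by (auto simp: bounded_iff)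
    have "norm w \<le> B + 1" if "w \<in> g ` X" for w
    proof -
      have w: "hproj b w \<in> D1" "0 \<le> w \<bullet> b" "w \<bullet> b \<le> 1" using that gX by auto
      have "norm w \<le> norm (hproj b w) + norm ((w \<bullet> b) *\<^sub>R b)" by (subst hproj_decomp[of w b]) (rule norm_triangle_ineq)
      then show ?thesis using B[OF w(1)] w b(1) by simp
    qed
    then show ?thesis by (auto simp: bounded_iff)
  qed
  have inj: "inj_on g X"
  proof (rule inj_onI)
    fix x1 x2 assume x: "x1 \<in> X" "x2 \<in> X" "g x1 = g x2"
    have e: "hproj b (G (hproj b' x1)) = hproj b (G (hproj b' x2))" "x1 \<bullet> b' = x2 \<bullet> b'"
      using gp x(3) by metis+
    then have "G (hproj b' x1) = G (hproj b' x2)"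
      using gr(2)[OF XE[OF x(1)]] gr(2)[OF XE[OF x(2)]] hproj_decomp[of _ b] by metis
    moreover have "hproj b' (G (hproj b' x)) = hproj b' x" for x
      unfolding G_def hproj_scale_self[OF b(2)] by (rule hproj_id[OF hproj_inner[OF b(2)]])
    ultimately have "hproj b' x1 = hproj b' x2" by metis
    then show "x1 = x2" using e(2) hproj_decomp[of _ b'] by metis
  qed
  have m: "(\<lambda>x. det (matrix (g' x)) * indicator X x) \<in> borel_measurable borel"
  proof -
    have "continuous_on U (\<lambda>y. frechet_derivative h' (at y) v)" for v
      using smooth_on_continuous[OF h'(2), of "[v]"] by simp
    then have "continuous_on U (hgrad b' h')" unfolding hgrad_def[abs_def] by (intro continuous_intros)
    then have "continuous_on X (\<lambda>x. hgrad b' h' (hproj b' x))"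
      by (rule continuous_on_compose2[OF _ linear_continuous_on[OF bounded_linear_hproj]]) (use XE E(2) in blast)
    then have "continuous_on X (\<lambda>x. (b' - hgrad b' h' (hproj b' x)) \<bullet> b)" by (intro continuous_intros)
    from borel_measurable_continuous_on_indicator[OF Xb this] show ?thesis
      by (rule measurable_cong[THEN iffD1, rotated]) (auto simp: det(1) indicator_def)
  qed
  have F: "(\<lambda>x. ennreal (area_density b h (hproj b x)) * indicator D1 (hproj b x)) \<in> borel_measurable borel"
    using measurable_compose[OF borel_hproj borel_area_density[OF h(2) D1(1)]] gr(1) by (auto simp: D1_def)
  have "graph_area b h D1 = (\<integral>\<^sup>+x. ennreal (area_density b h (hproj b x)) * indicator D1 (hproj b x) * indicator (slab b) x \<partial>lborel)"
    unfolding graph_area_eq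
    by (rule nn_integral_hyperplane_lborel) (rule borel_area_density[OF h(2) D1(1)], use gr(1) in \<open>auto simp: D1_def\<close>)
  also have "\<dots> = (\<integral>\<^sup>+x. (ennreal (area_density b h (hproj b x)) * indicator D1 (hproj b x)) * indicator (g ` X) x \<partial>lborel)"
    unfolding gX by (intro nn_integral_cong) (auto simp: indicator_def)
  also have "\<dots> = (\<integral>\<^sup>+x. ennreal \<bar>det (matrix (g' x))\<bar> * (ennreal (area_density b h (hproj b (g x))) * indicator D1 (hproj b (g x))) * indicator X x \<partial>lborel)"
    by (rule nn_integral_change_of_variables[OF Xb bgX gXb _ inj m F])
       (use derg XE E(2) in \<open>auto intro: has_derivative_at_withinI\<close>)
  also have "\<dots> = (\<integral>\<^sup>+x. ennreal (area_density b' h' (hproj b' x)) * indicator E (hproj b' x) * indicator (slab b') x \<partial>lborel)"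
  proof (intro nn_integral_cong)
    fix x
    show "ennreal \<bar>det (matrix (g' x))\<bar> * (ennreal (area_density b h (hproj b (g x))) * indicator D1 (hproj b (g x))) * indicator X x
      = ennreal (area_density b' h' (hproj b' x)) * indicator E (hproj b' x) * indicator (slab b') x"
    proof (cases "x \<in> X")
      case True
      have "hproj b (g x) \<in> D1" using XE[OF True] by (auto simp: gp D1_def)
      then show ?thesis using True det(2)[OF True] XE[OF True] area_density_ge_1[of b h "hproj b (g x)"]
        by (auto simp: gp X_def ennreal_mult[symmetric])
    qed (auto simp: X_def indicator_def)
  qed
  also have "\<dots> = graph_area b' h' E"
    unfolding graph_area_eq
    by (rule nn_integral_hyperplane_lborel[symmetric]) (rule borel_area_density[OF h'(2) E(1,2)])
  finally show ?thesis by (simp add: D1_def G_def)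
qed

section \<open>Gaussian wave packets, Knapp's inequality and Auerbach's lemma\<close>

text \<open>The polynomial multiples of E, built one affine factor at a time. This is the form in
  which the Leibniz rule and the decay estimate are inductive: if the derivatives of E belong to the
  class, it is closed under differentiation, and an affine factor costs one power of |x|.\<close>

inductive poly_times :: "('a::real_inner \<Rightarrow> complex) \<Rightarrow> ('a \<Rightarrow> complex) \<Rightarrow> bool" for E where
  base: "poly_times E E"
| add: "poly_times E f \<Longrightarrow> poly_times E g \<Longrightarrow> poly_times E (\<lambda>x. f x + g x)"
| affine: "poly_times E f \<Longrightarrow> poly_times E (\<lambda>x. (\<alpha> + \<beta> * of_real (u \<bullet> x)) * f x)"

lemma poly_times_cmult: "poly_times E f \<Longrightarrow> poly_times E (\<lambda>x. c * f x)"
  using poly_times.affine[of E f c 0 0] by simp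

lemma poly_times_deriv:
  assumes E: "\<And>x. (E has_derivative E' x) (at x)" "\<And>v. poly_times E (\<lambda>x. E' x v)"
    and "poly_times E f"
  shows "\<exists>f'. (\<forall>x. (f has_derivative f' x) (at x)) \<and> (\<forall>v. poly_times E (\<lambda>x. f' x v))"
  using assms(3)
proof induction
  case base
  then show ?case using E by blast
next
  case (add f g)
  then obtain f' g' where fg: "\<forall>x. (f has_derivative f' x) (at x)" "\<forall>v. poly_times E (\<lambda>x. f' x v)"
    "\<forall>x. (g has_derivative g' x) (at x)" "\<forall>v. poly_times E (\<lambda>x. g' x v)" by blast
  show ?case
    by (rule exI[of _ "\<lambda>x v. f' x v + g' x v"]) (use fg in \<open>auto intro: has_derivative_add poly_times.add\<close>)
next
  case (affine f \<alpha> \<beta> u)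
  then obtain f' where f: "\<forall>x. (f has_derivative f' x) (at x)" "\<forall>v. poly_times E (\<lambda>x. f' x v)" by blast
  show ?case
  proof (rule exI[of _ "\<lambda>x v. (\<alpha> + \<beta> * of_real (u \<bullet> x)) * f' x v + (\<beta> * of_real (u \<bullet> v)) * f x"], intro conjI allI)
    fix x
    have "((\<lambda>x. \<alpha> + \<beta> * of_real (u \<bullet> x)) has_derivative (\<lambda>v. \<beta> * of_real (u \<bullet> v))) (at x)"
      by (auto intro!: derivative_eq_intros)
    from has_derivative_mult[OF this f(1)[rule_format]]
    show "((\<lambda>x. (\<alpha> + \<beta> * of_real (u \<bullet> x)) * f x) has_derivative
       (\<lambda>v. (\<alpha> + \<beta> * of_real (u \<bullet> x)) * f' x v + (\<beta> * of_real (u \<bullet> v)) * f x)) (at x)" .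
    show "poly_times E (\<lambda>x. (\<alpha> + \<beta> * of_real (u \<bullet> x)) * f' x v + (\<beta> * of_real (u \<bullet> v)) * f x)" for v
      by (intro poly_times.add poly_times.affine poly_times_cmult f(2)[rule_format] affine(1))
  qed
qed

lemma poly_times_bounded:
  assumes E: "\<And>k. \<exists>C. \<forall>x. norm x ^ k * norm (E x) \<le> C" and "poly_times E f"
  shows "\<exists>C. \<forall>x. norm x ^ k * norm (f x) \<le> C"
  using assms(2)
proof (induction arbitrary: k)
  case base
  then show ?case by (rule E)
next
  case (add f g)
  obtain C D where "\<forall>x. norm x ^ k * norm (f x) \<le> C" "\<forall>x. norm x ^ k * norm (g x) \<le> D" using add.IH by blast
  then have "norm x ^ k * norm (f x + g x) \<le> C + D" for x
    using mult_left_mono[OF norm_triangle_ineq[of "f x" "g x"], of "norm x ^ k"]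
    by (simp add: distrib_left) (meson add_mono order_trans)
  then show ?case by blast
next
  case (affine f \<alpha> \<beta> u)
  obtain C where C: "\<forall>x. norm x ^ k * norm (f x) \<le> C" using affine.IH by blast
  obtain D where D: "\<forall>x. norm x ^ Suc k * norm (f x) \<le> D" using affine.IH by blast
  have "norm x ^ k * norm ((\<alpha> + \<beta> * of_real (u \<bullet> x)) * f x) \<le> norm \<alpha> * C + (norm \<beta> * norm u) * D" for x
  proof -
    have "norm (\<alpha> + \<beta> * of_real (u \<bullet> x)) \<le> norm \<alpha> + norm \<beta> * (norm u * norm x)"
      by (rule order_trans[OF norm_triangle_ineq])
         (auto simp: norm_mult intro!: mult_left_mono Cauchy_Schwarz_ineq2)
    then have "norm x ^ k * norm ((\<alpha> + \<beta> * of_real (u \<bullet> x)) * f x)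
        \<le> norm x ^ k * ((norm \<alpha> + norm \<beta> * (norm u * norm x)) * norm (f x))"
      unfolding norm_mult[of "\<alpha> + \<beta> * of_real (u \<bullet> x)"] by (intro mult_left_mono mult_right_mono) auto
    also have "\<dots> = norm \<alpha> * (norm x ^ k * norm (f x)) + (norm \<beta> * norm u) * (norm x ^ Suc k * norm (f x))"
      by (simp add: algebra_simps)
    also have "\<dots> \<le> norm \<alpha> * C + (norm \<beta> * norm u) * D"
      using C D by (intro add_mono mult_left_mono) auto
    finally show ?thesis .
  qed
  then show ?case by blast
qed

lemma schwartz_poly_times:
  fixes E :: "'a::euclidean_space \<Rightarrow> complex"
  assumes E: "\<And>x. (E has_derivative E' x) (at x)" "\<And>v. poly_times E (\<lambda>x. E' x v)"
    "\<And>k. \<exists>C. \<forall>x. norm x ^ k * norm (E x) \<le> C"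
  shows "schwartz E"
proof -
  have P: "poly_times E (iterated_deriv vs E)" for vs
  proof (induction vs)
    case (Cons v vs)
    obtain f' where f': "\<forall>x. (iterated_deriv vs E has_derivative f' x) (at x)" "\<forall>v. poly_times E (\<lambda>x. f' x v)"
      using poly_times_deriv[OF E(1,2) Cons] by blast
    have "frechet_derivative (iterated_deriv vs E) (at x) = f' x" for x
      using frechet_derivative_at f'(1) by metis
    then show ?case using f'(2) by simp
  qed (simp add: poly_times.base)
  have "iterated_deriv vs E differentiable at x" for vs x
    using poly_times_deriv[OF E(1,2) P[of vs]] by (auto simp: differentiable_def)
  moreover have "bounded (range (\<lambda>x. norm x ^ k * norm (iterated_deriv vs E x)))" for k vs
  proof -
    obtain C where "\<forall>x. norm x ^ k * norm (iterated_deriv vs E x) \<le> C"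
      using poly_times_bounded[OF E(3) P] by blast
    then show ?thesis by (auto simp: bounded_iff intro!: exI[of _ C])
  qed
  ultimately show ?thesis by (simp add: schwartz_def smooth_on_def)
qed

text \<open>For t > 1 this compares with (1 + x / j)^j <= e^x at x = (m t)^2 and j = k + 1, which
  yields even t^(2j) = O(e^x).\<close>

lemma power_exp_minus_square_bounded:
  assumes "m > 0" shows "\<exists>C. \<forall>t\<ge>0. t ^ k * exp (- (m * t)\<^sup>2) \<le> (C::real)"
proof -
  let ?j = "Suc k"
  define D where "D = (real ?j / m\<^sup>2) ^ ?j"
  have D: "D \<ge> 0" by (simp add: D_def)
  have "t ^ k * exp (- (m * t)\<^sup>2) \<le> 1 + D" if t: "t \<ge> 0" for t
  proof (cases "t \<le> 1")
    case True
    have "t ^ k * exp (- (m * t)\<^sup>2) \<le> 1 * 1" using t True by (intro mult_mono power_le_one) auto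
    then show ?thesis using D by simp
  next
    case False
    have "((m * t)\<^sup>2 / real ?j) ^ ?j \<le> (1 + (m * t)\<^sup>2 / real ?j) ^ ?j" by (intro power_mono) auto
    also have "\<dots> \<le> exp ((m * t)\<^sup>2)"
      by (rule exp_ge_one_plus_x_over_n_power_n) (auto intro: order_trans[of _ 0])
    finally have "D * ((m * t)\<^sup>2 / real ?j) ^ ?j \<le> D * exp ((m * t)\<^sup>2)" by (rule mult_left_mono[OF _ D])
    moreover have "D * ((m * t)\<^sup>2 / real ?j) ^ ?j = (t\<^sup>2) ^ ?j"
    proof -
      have "real ?j / m\<^sup>2 * ((m * t)\<^sup>2 / real ?j) = t\<^sup>2"
        using assms by (simp add: power_mult_distrib del: of_nat_Suc)
      then show ?thesis unfolding D_def power_mult_distrib[symmetric] by (simp only:)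
    qed
    moreover have "t ^ k \<le> (t\<^sup>2) ^ ?j"
      unfolding power_mult[symmetric] using False by (intro power_increasing) auto
    ultimately have "t ^ k \<le> D * exp ((m * t)\<^sup>2)" by linarith
    then have "t ^ k * exp (- (m * t)\<^sup>2) \<le> D * exp ((m * t)\<^sup>2) * exp (- (m * t)\<^sup>2)" by (rule mult_right_mono) simp
    also have "D * exp ((m * t)\<^sup>2) * exp (- (m * t)\<^sup>2) = D" by (simp add: mult.assoc flip: exp_add)
    finally show ?thesis by simp
  qed
  then show ?thesis by blast
qed

text \<open>For invertible B the Fourier transform is a bump of height comparable to 1 / |det B|
  around p, on the image of the unit ball under the adjoint of B. So p is a point of the surface and
  the adjoint of B spans the parallelepiped around the cap.\<close>

definition gauss_wave :: "('a::euclidean_space \<Rightarrow> 'a) \<Rightarrow> 'a \<Rightarrow> 'a \<Rightarrow> complex" where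
  "gauss_wave B p x = exp (\<i> * of_real (p \<bullet> x) - of_real (B x \<bullet> B x))"

lemma norm_gauss_wave: "norm (gauss_wave B p x) = exp (- (norm (B x))\<^sup>2)"
  by (simp add: gauss_wave_def norm_exp_eq_Re power2_norm_eq_inner)

lemma schwartz_gauss_wave:
  fixes B :: "'a::euclidean_space \<Rightarrow> 'a"
  assumes B: "linear B" "inj B"
  shows "schwartz (gauss_wave B p)"
proof (rule schwartz_poly_times)
  show "(gauss_wave B p has_derivative (\<lambda>v. (\<i> * of_real (p \<bullet> v) + (-2) * of_real (adjoint B (B v) \<bullet> x)) * gauss_wave B p x)) (at x)" for x
  proof -
    have dB: "(B has_derivative B) (at x)" using B(1) by (simp add: linear_imp_has_derivative)
    have 1: "((\<lambda>x. B x \<bullet> B x) has_derivative (\<lambda>v. B x \<bullet> B v + B v \<bullet> B x)) (at x)"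
      by (rule has_derivative_inner[OF dB dB])
    have "((\<lambda>x. \<i> * of_real (p \<bullet> x) - of_real (B x \<bullet> B x)) has_derivative
       (\<lambda>v. \<i> * of_real (p \<bullet> v) - of_real (B x \<bullet> B v + B v \<bullet> B x))) (at x)"
      by (intro has_derivative_diff has_derivative_mult_right has_derivative_of_real 1 has_derivative_inner_right has_derivative_ident)
    then have "(gauss_wave B p has_derivative (\<lambda>v. (\<i> * of_real (p \<bullet> v) - of_real (B x \<bullet> B v + B v \<bullet> B x)) * gauss_wave B p x)) (at x)"
      unfolding gauss_wave_def[abs_def]
      using has_derivative_compose[OF _ DERIV_exp[unfolded has_field_derivative_def]] by (fastforce simp: mult.commute)
    moreover have "B x \<bullet> B v = adjoint B (B v) \<bullet> x" "B v \<bullet> B x = adjoint B (B v) \<bullet> x" for v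
      using adjoint_works[OF B(1), of x "B v"] by (simp_all add: inner_commute)
    ultimately show ?thesis by (simp add: algebra_simps)
  qed
  show "poly_times (gauss_wave B p) (\<lambda>x. (\<i> * of_real (p \<bullet> v) + (-2) * of_real (adjoint B (B v) \<bullet> x)) * gauss_wave B p x)" for v
    by (rule poly_times.affine[OF poly_times.base])
  show "\<exists>C. \<forall>x. norm x ^ k * norm (gauss_wave B p x) \<le> C" for k
  proof -
    obtain m where m: "m > 0" "\<And>x. m * norm x \<le> norm (B x)" using linear_inj_bounded_below_pos[OF B] by blast
    obtain C where C: "\<And>t. t \<ge> 0 \<Longrightarrow> t ^ k * exp (- (m * t)\<^sup>2) \<le> C" using power_exp_minus_square_bounded[OF m(1)] by blast
    have "norm x ^ k * norm (gauss_wave B p x) \<le> C" for x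
    proof -
      have "(m * norm x)\<^sup>2 \<le> (norm (B x))\<^sup>2" using m by (intro power_mono) auto
      then have "norm x ^ k * norm (gauss_wave B p x) \<le> norm x ^ k * exp (- (m * norm x)\<^sup>2)"
        unfolding norm_gauss_wave by (intro mult_left_mono) auto
      also have "\<dots> \<le> C" by (rule C) simp
      finally show ?thesis .
    qed
    then show ?thesis by blast
  qed
qed

lemma integrable_gaussian: "integrable lborel (\<lambda>x::'a::euclidean_space. exp (- (norm x)\<^sup>2))"
proof -
  have half: "(\<integral>\<^sup>+x. ennreal (exp (- x)) * indicator {0..} x \<partial>lborel) < \<infinity>"
    using nn_integral_has_integral_lebesgue'[OF _ has_integral_exp_minus_to_infinity[of 1 0]] by simp
  have 1: "(\<integral>\<^sup>+x. ennreal (exp (- (x::real)\<^sup>2)) \<partial>lborel) < \<infinity>"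
  proof -
    have "(\<integral>\<^sup>+x. ennreal (exp (- (x::real)\<^sup>2)) \<partial>lborel)
        \<le> (\<integral>\<^sup>+x. ennreal (exp 1) * (ennreal (exp (- x)) * indicator {0..} x + ennreal (exp (- (- x))) * indicator {0..} (- x)) \<partial>lborel)"
    proof (rule nn_integral_mono)
      fix x :: real
      have "\<bar>x\<bar> \<le> x\<^sup>2 + 1"
        using zero_le_power2[of "\<bar>x\<bar> - 1/2"] by (simp add: power2_eq_square algebra_simps)
      then have "exp (- x\<^sup>2) \<le> exp 1 * exp (- \<bar>x\<bar>)" by (simp flip: exp_add)
      then have "ennreal (exp (- x\<^sup>2)) \<le> ennreal (exp 1) * ennreal (exp (- \<bar>x\<bar>))"
        by (simp add: ennreal_mult[symmetric])
      also have "\<dots> \<le> ennreal (exp 1) * (ennreal (exp (- x)) * indicator {0..} x + ennreal (exp (- (- x))) * indicator {0..} (- x))"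
        by (intro mult_left_mono) (auto simp: indicator_def abs_if)
      finally show "ennreal (exp (- x\<^sup>2)) \<le> \<dots>" .
    qed
    also have "\<dots> = ennreal (exp 1) * ((\<integral>\<^sup>+x. ennreal (exp (- x)) * indicator {0..} x \<partial>lborel)
        + (\<integral>\<^sup>+x. ennreal (exp (- (- x))) * indicator {0..} (- x) \<partial>lborel))"
      by (simp add: nn_integral_cmult nn_integral_add)
    also have "(\<integral>\<^sup>+x. ennreal (exp (- (- x))) * indicator {0..} (- x) \<partial>lborel)
        = (\<integral>\<^sup>+x. ennreal (exp (- x)) * indicator {0..} x \<partial>distr lborel borel uminus)"
      by (subst nn_integral_distr) auto
    also have "\<dots> = (\<integral>\<^sup>+x. ennreal (exp (- x)) * indicator {0..} x \<partial>lborel)"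
      by (simp add: lborel_distr_uminus)
    finally show ?thesis using half by (auto simp: ennreal_mult_less_top elim!: le_less_trans)
  qed
  have "(\<integral>\<^sup>+x. ennreal (exp (- (norm (x::'a))\<^sup>2)) \<partial>lborel)
      = (\<integral>\<^sup>+x. (\<Prod>b\<in>Basis. ennreal (exp (- ((x::'a) \<bullet> b)\<^sup>2))) \<partial>lborel)"
  proof (intro nn_integral_cong)
    fix x :: 'a
    have "- (norm x)\<^sup>2 = (\<Sum>b\<in>Basis. - (x \<bullet> b)\<^sup>2)"
      unfolding power2_norm_eq_inner euclidean_inner[of x x] by (simp add: sum_negf power2_eq_square)
    then show "ennreal (exp (- (norm x)\<^sup>2)) = (\<Prod>b\<in>Basis. ennreal (exp (- (x \<bullet> b)\<^sup>2)))"
      by (simp add: exp_sum prod_ennreal)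
  qed
  also have "\<dots> = (\<Prod>b\<in>(Basis::'a set). (\<integral>\<^sup>+x. ennreal (exp (- x\<^sup>2)) \<partial>lborel))"
    by (rule nn_integral_lborel_prod[where f = "\<lambda>b x. ennreal (exp (- x\<^sup>2))"]) auto
  also have "\<dots> < \<infinity>" using 1 by (simp add: power_less_top_ennreal)
  finally show ?thesis by (simp add: integrable_iff_bounded)
qed

text \<open>Continuity of the transform at 0, where it equals the positive integral of the Gaussian,
  suffices; the explicit formula is avoided.\<close>

lemma gaussian_fourier_lower_bound:
  obtains \<epsilon> g0 where "\<epsilon> > 0" "g0 > 0"
    "\<And>w::'a::euclidean_space. norm w \<le> \<epsilon> \<Longrightarrow>
       g0 \<le> norm (LINT x|lborel. exp (- \<i> * of_real (x \<bullet> w)) * of_real (exp (- (norm x)\<^sup>2)))"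
proof -
  define G where "G w = (LINT x|lborel. exp (- \<i> * of_real (x \<bullet> w)) * of_real (exp (- (norm x)\<^sup>2)))" for w :: 'a
  have "G 0 = of_real (LINT x|lborel. exp (- (norm (x::'a))\<^sup>2))" by (simp add: G_def)
  moreover have "(LINT x|lborel. exp (- (norm (x::'a))\<^sup>2)) \<noteq> 0"
  proof
    assume "(LINT x|lborel. exp (- (norm (x::'a))\<^sup>2)) = 0"
    then have "AE x::'a in lborel. exp (- (norm x)\<^sup>2) = 0"
      using integral_nonneg_eq_0_iff_AE[OF integrable_gaussian] by auto
    then have "AE x::'a in lborel. False" by simp
    then have "emeasure lborel (UNIV :: 'a set) = 0" by (simp add: AE_iff_measurable[OF _ refl])
    then show False by simp
  qed
  moreover have "0 \<le> (LINT x|lborel. exp (- (norm (x::'a))\<^sup>2))" by (rule Bochner_Integration.integral_nonneg) simp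
  ultimately have "G 0 \<noteq> 0" by (simp only: of_real_eq_0_iff not_False_eq_True)
  then have G0: "norm (G 0) > 0" by (simp only: zero_less_norm_iff not_False_eq_True)
  have lim: "(\<lambda>n. G (w n)) \<longlonglongrightarrow> G 0" if "w \<longlonglongrightarrow> 0" for w :: "nat \<Rightarrow> 'a"
    unfolding G_def
  proof (rule integral_dominated_convergence[where w = "\<lambda>x. exp (- (norm x)\<^sup>2)"])
    show "AE x in lborel. (\<lambda>n. exp (- \<i> * of_real (x \<bullet> w n)) * of_real (exp (- (norm x)\<^sup>2)))
        \<longlonglongrightarrow> exp (- \<i> * of_real (x \<bullet> 0)) * complex_of_real (exp (- (norm x)\<^sup>2))"
      by (intro AE_I2 tendsto_intros that)
    show "AE x in lborel. norm (exp (- \<i> * of_real (x \<bullet> w n)) * complex_of_real (exp (- (norm x)\<^sup>2))) \<le> exp (- (norm x)\<^sup>2)" for n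
      by (simp add: norm_mult norm_exp_eq_Re)
  qed (use integrable_gaussian in auto)
  have "\<exists>n. \<forall>w. norm w \<le> inverse (real (Suc n)) \<longrightarrow> norm (G 0) / 2 \<le> norm (G w)"
  proof (rule ccontr)
    assume "\<not> ?thesis"
    then have "\<forall>n. \<exists>w. norm w \<le> inverse (real (Suc n)) \<and> norm (G w) < norm (G 0) / 2" by (auto simp: not_le)
    then obtain w where w: "\<And>n. norm (w n) \<le> inverse (real (Suc n))" "\<And>n. norm (G (w n)) < norm (G 0) / 2" by metis
    have "w \<longlonglongrightarrow> 0"
      by (rule Lim_null_comparison[OF _ LIMSEQ_inverse_real_of_nat]) (use w(1) in auto)
    then have "(\<lambda>n. norm (G (w n))) \<longlonglongrightarrow> norm (G 0)" by (intro tendsto_norm lim)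
    then have "norm (G 0) \<le> norm (G 0) / 2" by (rule LIMSEQ_le_const2) (use w(2) less_imp_le in blast)
    then show False using G0 by simp
  qed
  then obtain n where n: "\<And>w. norm w \<le> inverse (real (Suc n)) \<Longrightarrow> norm (G 0) / 2 \<le> norm (G w)" by blast
  show ?thesis using n G0 that[of "inverse (real (Suc n))" "norm (G 0) / 2"] by (simp add: G_def)
qed

lemma sets_surface_measure: "sets (surface_measure S) = sets (restrict_space borel S)"
proof -
  have "sets (surface_measure S) = sigma_sets S (sets (restrict_space borel S))"
    unfolding surface_measure_def by (rule sets_measure_of) (auto simp: sets_restrict_space)
  also have "\<dots> = sets (restrict_space borel S)"
    using sets.sigma_sets_eq[of "restrict_space borel S"] by (simp add: space_restrict_space)
  finally show ?thesis .
qed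

text \<open>On X the transform of the wave has modulus at least g0 / |det B|, whereas the p-norm of
  the wave is a constant times |det B|^(-1/p). Comparing the two sides leaves the exponent 1 - 1/p.
  Finiteness of the surface measure makes the L^2 integral a genuine one, so that it can be bounded
  from below on X.\<close>

lemma knapp:
  fixes S :: "(real^'n) set"
  assumes R: "restriction_bounded S p" and fin: "finite_measure (surface_measure S)" and p: "p > 0"
  obtains K where "K \<ge> 0" "\<And>T x0 X. linear T \<Longrightarrow> det (matrix T) \<noteq> 0 \<Longrightarrow> X \<in> sets (surface_measure S) \<Longrightarrow>
     (\<And>x. x \<in> X \<Longrightarrow> \<exists>u. norm u \<le> 1 \<and> x = x0 + T u) \<Longrightarrow>
     sqrt (measure (surface_measure S) X) \<le> K * \<bar>det (matrix T)\<bar> powr (1 - 1 / p)"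
proof -
  obtain C where C: "\<And>f. schwartz f \<Longrightarrow> Lp_norm (surface_measure S) 2 (fourier_transform f) \<le> C * Lp_norm lborel p f"
    using R unfolding restriction_bounded_def by blast
  obtain \<epsilon> g0 where eg: "\<epsilon> > 0" "g0 > 0"
    "\<And>w::real^'n. norm w \<le> \<epsilon> \<Longrightarrow>
       g0 \<le> norm (LINT x|lborel. exp (- \<i> * of_real (x \<bullet> w)) * of_real (exp (- (norm x)\<^sup>2)))"
    using gaussian_fourier_lower_bound by blast
  interpret fm: finite_measure "surface_measure S" by (rule fin)
  let ?s = "surface_measure S"
  define c where "c = (LINT x|(lborel :: (real^'n) measure). exp (- (norm x)\<^sup>2) powr p)"
  define m where "m = inverse (\<epsilon> ^ CARD('n))"
  have m: "m > 0" using eg by (simp add: m_def)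
  define K where "K = \<bar>C\<bar> * c powr (1 / p) / g0 * m powr (1 - 1 / p)"
  have sets_eq: "sets ?s = sets (restrict_space borel S)" by (rule sets_surface_measure)
  show ?thesis
  proof (rule that[of K])
    show "K \<ge> 0" using eg by (simp add: K_def)
    fix T :: "real^'n \<Rightarrow> real^'n" and x0 X
    assume T: "linear T" "det (matrix T) \<noteq> 0" and X: "X \<in> sets ?s"
      and XT: "\<And>x. x \<in> X \<Longrightarrow> \<exists>u. norm u \<le> 1 \<and> x = x0 + T u"
    \<comment> \<open>T u = T' (epsilon u), so parameters in the unit ball become parameters of norm
      at most epsilon, where the transform of the Gaussian is bounded below. The factor
      \<open>m\<close> in the determinant is the price.\<close>
    define T' where "T' = (\<lambda>u. T (inverse \<epsilon> *\<^sub>R u))"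
    have T'l: "linear T'" unfolding T'_def using linear_compose[OF _ T(1), of "\<lambda>u. inverse \<epsilon> *\<^sub>R u"]
      by (simp add: o_def linear_scaleR)
    have T'd: "det (matrix T') = m * det (matrix T)"
    proof -
      have "matrix T' = (\<chi> i. inverse \<epsilon> *s matrix T $ i)"
        by (auto simp: T'_def matrix_def vec_eq_iff linear_scale[OF T(1)])
      then show ?thesis using det_rows_mul[of "\<lambda>_. inverse \<epsilon>" "\<lambda>i. matrix T $ i"]
        by (simp add: m_def power_inverse)
    qed
    define B where "B = adjoint T'"
    have Bl: "linear B" unfolding B_def by (rule adjoint_linear[OF T'l])
    have Bd: "det (matrix B) = m * det (matrix T)" unfolding B_def by (simp add: matrix_adjoint[OF T'l] T'd)
    have Bd0: "det (matrix B) \<noteq> 0" using Bd T m by simp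
    have Binj: "inj B" using Bl Bd0 det_nz_iff_inj by blast
    have Badj: "B x \<bullet> w = x \<bullet> T' w" for x w unfolding B_def
      using adjoint_works[OF T'l, of w x] by (simp add: inner_commute)
    let ?d = "\<bar>det (matrix B)\<bar>"
    have d: "?d > 0" using Bd0 by simp
    let ?f = "gauss_wave B x0"
    have Bcont: "continuous_on UNIV B" using Bl linear_continuous_on linear_conv_bounded_linear by blast
    have Bm [measurable]: "B \<in> borel_measurable borel" using Bcont by (rule borel_measurable_continuous_onI)
    have fcont: "continuous_on UNIV ?f" unfolding gauss_wave_def[abs_def] by (intro continuous_intros Bcont)
    have fm [measurable]: "?f \<in> borel_measurable borel" using fcont by (rule borel_measurable_continuous_onI)
    have lower: "g0 / ?d \<le> norm (fourier_transform ?f x)" if x: "x \<in> X" for x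
    proof -
      obtain u where u: "norm u \<le> 1" "x = x0 + T u" using XT[OF x] by blast
      define w where "w = \<epsilon> *\<^sub>R u"
      have w: "norm w \<le> \<epsilon>" "x = x0 + T' w" using u eg(1) by (auto simp: w_def T'_def mult_left_le)
      have "fourier_transform ?f x = (LINT y|lborel. exp (- \<i> * of_real (B y \<bullet> w)) * of_real (exp (- (norm (B y))\<^sup>2)))"
        unfolding fourier_transform_def
      proof (rule Bochner_Integration.integral_cong[OF refl])
        fix y
        have e: "y \<bullet> x = x0 \<bullet> y + B y \<bullet> w" by (simp add: w(2) Badj inner_add_right inner_commute[of y x0])
        show "exp (- \<i> * of_real (y \<bullet> x)) * ?f y = exp (- \<i> * of_real (B y \<bullet> w)) * of_real (exp (- (norm (B y))\<^sup>2))"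
          unfolding e gauss_wave_def exp_of_real[symmetric] exp_add[symmetric] power2_norm_eq_inner
          by (simp add: algebra_simps)
      qed
      also have "\<dots> = (LINT y|lborel. exp (- \<i> * of_real (y \<bullet> w)) * of_real (exp (- (norm y)\<^sup>2))) /\<^sub>R ?d"
        by (rule integral_lborel_linear[OF Bl Bd0]) measurable
      finally show ?thesis using eg(3)[OF w(1)] d by (simp add: divide_inverse mult.commute mult_left_mono)
    qed
    have fint: "integrable lborel (\<lambda>x. exp (- (norm (B x))\<^sup>2))"
    proof -
      have "(\<integral>\<^sup>+x. ennreal (exp (- (norm (x::real^'n))\<^sup>2)) \<partial>lborel) = ennreal ?d * (\<integral>\<^sup>+x. ennreal (exp (- (norm (B x))\<^sup>2)) \<partial>lborel)"
        by (subst lborel_linear[OF Bl Bd0]) (simp add: nn_integral_density nn_integral_distr nn_integral_cmult)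
      moreover have "(\<integral>\<^sup>+x. ennreal (exp (- (norm (x::real^'n))\<^sup>2)) \<partial>lborel) < \<infinity>"
        using integrable_gaussian[where 'a="real^'n"] by (simp add: integrable_iff_bounded)
      ultimately have "(\<integral>\<^sup>+x. ennreal (exp (- (norm (B x))\<^sup>2)) \<partial>lborel) < \<infinity>"
        using d by (auto simp: ennreal_mult_less_top)
      then show ?thesis by (simp add: integrable_iff_bounded)
    qed
    have ftm: "(\<lambda>x. fourier_transform ?f x) \<in> borel_measurable borel"
      unfolding fourier_transform_def by measurable
    have ftms [measurable]: "(\<lambda>x. fourier_transform ?f x) \<in> borel_measurable ?s"
      using measurable_restrict_space1[OF ftm, of S] by (simp add: measurable_cong_sets[OF sets_eq refl])
    have ftb: "norm (fourier_transform ?f x) \<le> (LINT y|lborel. exp (- (norm (B y))\<^sup>2))" for x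
    proof -
      have "norm (fourier_transform ?f x) \<le> (LINT y|lborel. norm (exp (- \<i> * of_real (y \<bullet> x)) * ?f y))"
        unfolding fourier_transform_def by (rule integral_norm_bound)
      also have "\<dots> = (LINT y|lborel. exp (- (norm (B y))\<^sup>2))" by (simp add: norm_mult norm_exp_eq_Re norm_gauss_wave)
      finally show ?thesis .
    qed
    have int2: "integrable ?s (\<lambda>x. norm (fourier_transform ?f x) powr 2)"
      by (rule fm.integrable_const_bound[where B = "(LINT y|lborel. exp (- (norm (B y))\<^sup>2)) powr 2"])
         (use ftb in \<open>auto intro!: powr_mono2\<close>)
    have "(g0 / ?d)\<^sup>2 * measure ?s X = (LINT x|?s. indicator X x * (g0 / ?d)\<^sup>2)"
      using X fm.emeasure_finite by simp
    also have "\<dots> \<le> (LINT x|?s. norm (fourier_transform ?f x) powr 2)"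
    proof (rule integral_mono)
      show "integrable ?s (\<lambda>x. indicator X x * (g0 / ?d)\<^sup>2)"
        using X by (intro integrable_mult_left integrable_real_indicator) (auto simp: less_top[symmetric])
      show "indicator X x * (g0 / ?d)\<^sup>2 \<le> norm (fourier_transform ?f x) powr 2" for x
        using lower[of x] eg(2) d by (auto simp: indicator_def powr_numeral intro!: power_mono)
    qed (rule int2)
    finally have "sqrt ((g0 / ?d)\<^sup>2 * measure ?s X) \<le> Lp_norm ?s 2 (fourier_transform ?f)"
      unfolding Lp_norm_def by (simp add: powr_half_sqrt)
    moreover have "sqrt ((g0 / ?d)\<^sup>2 * measure ?s X) = g0 / ?d * sqrt (measure ?s X)"
      using eg(2) d by (simp add: real_sqrt_mult)
    ultimately have 1: "g0 / ?d * sqrt (measure ?s X) \<le> C * Lp_norm lborel p ?f"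
      using C[OF schwartz_gauss_wave[OF Bl Binj, of x0]] by linarith
    have "(LINT x|lborel. norm (?f x) powr p) = c / ?d"
      unfolding norm_gauss_wave c_def
      by (subst integral_lborel_linear[OF Bl Bd0, of "\<lambda>x. exp (- (norm x)\<^sup>2) powr p"]) (auto simp: divide_inverse)
    moreover have c0: "c \<ge> 0" unfolding c_def by (rule Bochner_Integration.integral_nonneg) simp
    ultimately have "Lp_norm lborel p ?f = c powr (1 / p) * ?d powr (- 1 / p)"
      unfolding Lp_norm_def using d powr_divide[of c ?d "1 / p"] powr_minus[of ?d "1 / p"]
      by (simp add: divide_inverse)
    with 1 have "g0 / ?d * sqrt (measure ?s X) \<le> C * (c powr (1 / p) * ?d powr (- 1 / p))" by simp
    also have "\<dots> \<le> \<bar>C\<bar> * (c powr (1 / p) * ?d powr (- 1 / p))" by (intro mult_right_mono) auto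
    finally have "sqrt (measure ?s X) \<le> \<bar>C\<bar> * (c powr (1 / p) * ?d powr (- 1 / p)) * ?d / g0"
      using eg(2) d by (simp add: field_simps)
    also have "\<dots> = \<bar>C\<bar> * c powr (1 / p) / g0 * (?d powr 1 * ?d powr (- 1 / p))" using d by simp
    also have "?d powr 1 * ?d powr (- 1 / p) = ?d powr (1 - 1 / p)" unfolding powr_add[symmetric] by simp
    also have "?d powr (1 - 1 / p) = m powr (1 - 1 / p) * \<bar>det (matrix T)\<bar> powr (1 - 1 / p)"
      using m by (simp add: Bd abs_mult powr_mult)
    finally show "sqrt (measure ?s X) \<le> K * \<bar>det (matrix T)\<bar> powr (1 - 1 / p)" by (simp add: K_def)
  qed
qed

(* V maximizes |det| among the matrices with rows in Sigma; Cramer's rule bounds the coordinates. *)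

lemma auerbach_rows:
  fixes \<Sigma> :: "(real^'n) set"
  assumes \<Sigma>: "compact \<Sigma>" and sp: "span \<Sigma> = UNIV"
  obtains V :: "real^'n^'n" where "\<And>i. V $ i \<in> \<Sigma>" "det V \<noteq> 0"
    "\<And>x. x \<in> \<Sigma> \<Longrightarrow> \<exists>c. (\<forall>i. \<bar>c $ i\<bar> \<le> 1) \<and> x = (\<Sum>i\<in>UNIV. c $ i *\<^sub>R V $ i)"
proof -
  let ?M = "{V :: real^'n^'n. \<forall>i. V $ i \<in> \<Sigma>}"
  obtain B where B: "\<And>x. x \<in> \<Sigma> \<Longrightarrow> norm x \<le> B" using compact_imp_bounded[OF \<Sigma>] by (auto simp: bounded_iff)
  have "compact ?M"
  proof (rule compact_eq_bounded_closed[THEN iffD2], rule conjI)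
    have "norm V \<le> (\<Sum>i\<in>(UNIV::'n set). B)" if "V \<in> ?M" for V
    proof -
      have "norm V \<le> (\<Sum>i\<in>UNIV. norm (V $ i))" unfolding norm_vec_def[of V] by (rule L2_set_le_sum) simp
      also have "\<dots> \<le> (\<Sum>i\<in>(UNIV::'n set). B)" by (rule sum_mono) (use that B in auto)
      finally show ?thesis .
    qed
    then show "bounded ?M" by (auto simp: bounded_iff)
    have "?M = (\<Inter>i. (\<lambda>V. V $ i) -` \<Sigma>)" by auto
    also have "closed \<dots>"
      by (intro closed_INT ballI closed_vimage compact_imp_closed \<Sigma> continuous_on_component continuous_on_id)
    finally show "closed ?M" .
  qed
  moreover have "continuous_on ?M (\<lambda>V. \<bar>det V\<bar>)"
    unfolding det_def by (intro continuous_intros)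
  moreover obtain V0 where V0: "V0 \<in> ?M" "det V0 \<noteq> 0"
  proof -
    obtain b where b: "b \<subseteq> \<Sigma>" "independent b" "\<Sigma> \<subseteq> span b"
      by (rule maximal_independent_subset)
    then have spb: "span b = UNIV" using sp by (metis span_mono span_span top.extremum_uniqueI)
    have "card b = CARD('n)" using basis_card_eq_dim[OF _ _ b(2)] spb
      by (metis DIM_cart DIM_real b(2) dim_UNIV dim_eq_card mult.right_neutral span_UNIV)
    moreover have "finite b" using b(2) by (rule independent_imp_finite)
    ultimately obtain f where f: "bij_betw f (UNIV :: 'n set) b"
      by (metis finite_same_card_bij finite_class.finite_UNIV)
    let ?V = "\<chi> i. f i"
    have "rows ?V = b" using f by (auto simp: rows_def row_def bij_betw_def vec_lambda_eta)
    then have "invertible ?V" using matrix_left_invertible_span_rows[of ?V] spb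
      by (auto simp: invertible_left_inverse)
    then have "det ?V \<noteq> 0" by (simp add: invertible_det_nz)
    moreover have "?V \<in> ?M" using f b(1) by (auto simp: bij_betw_def)
    ultimately show ?thesis by (rule that[rotated])
  qed
  ultimately obtain V where V: "V \<in> ?M" "\<And>V'. V' \<in> ?M \<Longrightarrow> \<bar>det V'\<bar> \<le> \<bar>det V\<bar>"
    using continuous_attains_sup[of ?M "\<lambda>V. \<bar>det V\<bar>"] by blast
  have dV: "det V \<noteq> 0" using V(2)[OF V0(1)] V0(2) by auto
  show ?thesis
  proof (rule that[OF _ dV])
    show "V $ i \<in> \<Sigma>" for i using V(1) by simp
    fix x assume x: "x \<in> \<Sigma>"
    obtain W where W: "W ** V = mat 1" using dV invertible_det_nz invertible_left_inverse by blast
    define c where "c = x v* W"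
    have xc: "x = (\<Sum>i\<in>UNIV. c $ i *\<^sub>R V $ i)"
    proof -
      have "x = x v* (W ** V)" by (simp add: W)
      also have "\<dots> = c v* V" by (simp add: c_def vector_matrix_mul_assoc)
      also have "\<dots> = (\<Sum>i\<in>UNIV. c $ i *\<^sub>R V $ i)"
        by (simp add: vector_matrix_mult_def vec_eq_iff mult.commute)
      finally show ?thesis .
    qed
    have "\<bar>c $ k\<bar> \<le> 1" for k
    proof -
      let ?V' = "\<chi> i. if i = k then x else V $ i"
      have "?V' = (\<chi> i. if i = k then sum (\<lambda>i. c $ i *s row i V) UNIV else row i V)"
        using xc by (auto simp: vec_eq_iff row_def vec_lambda_eta scalar_mult_eq_scaleR)
      then have "det ?V' = c $ k * det V" by (simp only: cramer_lemma_transpose)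
      moreover have "?V' \<in> ?M" using V(1) x by simp
      ultimately have "\<bar>c $ k\<bar> * \<bar>det V\<bar> \<le> 1 * \<bar>det V\<bar>" using V(2)[of ?V'] by (simp add: abs_mult)
      then show ?thesis using dV by (simp add: mult_le_cancel_right)
    qed
    then show "\<exists>c. (\<forall>i. \<bar>c $ i\<bar> \<le> 1) \<and> x = (\<Sum>i\<in>UNIV. c $ i *\<^sub>R V $ i)" using xc by blast
  qed
qed

text \<open>The simplex with vertices 0 and the rows of V lies in the convex set, so |det V| / n! is
  at most its volume. Coordinates bounded by 1 have Euclidean norm at most n, which the dilation by
  n in T compensates; this explains the constant n^n n!. Positive volume guarantees that the set
  spans.\<close>

lemma auerbach_convex:
  fixes \<Sigma> :: "(real^'n) set"
  assumes \<Sigma>: "compact \<Sigma>" "convex \<Sigma>" "0 \<in> \<Sigma>" and pos: "emeasure lborel \<Sigma> \<noteq> 0"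
  obtains T where "linear T" "det (matrix T) \<noteq> 0" "\<And>x. x \<in> \<Sigma> \<Longrightarrow> \<exists>u. norm u \<le> 1 \<and> x = T u"
    "\<bar>det (matrix T)\<bar> \<le> real CARD('n) ^ CARD('n) * fact CARD('n) * measure lborel \<Sigma>"
proof -
  have "span \<Sigma> = UNIV"
  proof (rule ccontr)
    assume "span \<Sigma> \<noteq> UNIV"
    then have "dim \<Sigma> < DIM(real^'n)" by (metis dim_eq_full dim_subset_UNIV le_neq_implies_less)
    then have "negligible \<Sigma>" by (rule negligible_lowdim)
    then have "emeasure lebesgue \<Sigma> = 0" by (simp add: negligible_iff_null_sets null_sets_def)
    then show False using pos \<Sigma>(1) by (simp add: borel_compact)
  qed
  then obtain V :: "real^'n^'n" where V: "\<And>i. V $ i \<in> \<Sigma>" "det V \<noteq> 0"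
    "\<And>x. x \<in> \<Sigma> \<Longrightarrow> \<exists>c. (\<forall>i. \<bar>c $ i\<bar> \<le> 1) \<and> x = (\<Sum>i\<in>UNIV. c $ i *\<^sub>R V $ i)"
    using auerbach_rows[OF \<Sigma>(1)] by blast
  define f where "f c = (\<Sum>i\<in>UNIV. c $ i *\<^sub>R V $ i)" for c :: "real^'n"
  have f: "linear f" unfolding f_def by (intro linearI) (auto simp: algebra_simps sum.distrib scaleR_sum_right)
  have faxis: "f (axis k 1) = V $ k" for k
    by (simp add: f_def axis_def if_distrib[of "\<lambda>c. c *\<^sub>R _"] cong: if_cong)
  have mf: "matrix f = transpose V" unfolding matrix_def faxis by (simp add: transpose_def)
  have df: "det (matrix f) = det V" by (simp add: mf)
  let ?n = "real CARD('n)"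
  define T where "T u = f (?n *\<^sub>R u)" for u
  have T: "linear T" unfolding T_def using linear_compose[OF _ f, of "\<lambda>u. ?n *\<^sub>R u"] by (simp add: o_def linear_scaleR)
  have dT: "det (matrix T) = ?n ^ CARD('n) * det V"
  proof -
    have "matrix T = (\<chi> i. ?n *s matrix f $ i)"
      by (auto simp: T_def matrix_def vec_eq_iff linear_scale[OF f])
    then show ?thesis using det_rows_mul[of "\<lambda>_. ?n" "\<lambda>i. matrix f $ i"] by (simp add: df)
  qed
  show ?thesis
  proof (rule that[OF T])
    show "det (matrix T) \<noteq> 0" using dT V(2) by simp
    fix x assume "x \<in> \<Sigma>"
    then obtain c where c: "\<forall>i. \<bar>c $ i\<bar> \<le> 1" "x = f c" using V(3) by (auto simp: f_def)
    have "norm c \<le> (\<Sum>i\<in>(UNIV::'n set). 1)"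
      by (rule order_trans[OF norm_le_l1_cart], rule sum_mono) (use c(1) in auto)
    then have "norm (inverse ?n *\<^sub>R c) \<le> 1" by (simp add: field_simps)
    moreover have "x = T (inverse ?n *\<^sub>R c)" using c(2) by (simp add: T_def)
    ultimately show "\<exists>u. norm u \<le> 1 \<and> x = T u" by blast
  next
    let ?C = "convex hull (insert 0 Basis :: (real^'n) set)"
    have "f ` ?C = convex hull (f ` insert 0 Basis)" by (rule convex_hull_linear_image[OF f])
    also have "\<dots> \<subseteq> \<Sigma>"
    proof (rule hull_minimal)
      show "convex \<Sigma>" by (rule \<Sigma>(2))
      show "f ` insert 0 Basis \<subseteq> \<Sigma>" using V(1) \<Sigma>(3) faxis linear_0[OF f] by (auto simp: Basis_vec_def)
    qed
    finally have sub: "f ` ?C \<subseteq> \<Sigma>" .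
    have cC: "compact ?C" by (intro finite_imp_compact_convex_hull) auto
    have "ennreal \<bar>det V\<bar> * emeasure lborel ?C = emeasure lborel (f ` ?C)"
      using emeasure_linear_image(2)[OF f _ borel_compact[OF cC]] bounded_subset[OF compact_imp_bounded[OF \<Sigma>(1)] sub] df V(2) by simp
    also have "\<dots> \<le> emeasure lborel \<Sigma>" using \<Sigma>(1) sub by (intro emeasure_mono) (auto simp: borel_compact)
    also have "emeasure lborel \<Sigma> = ennreal (measure lborel \<Sigma>)"
      using emeasure_compact_finite[OF \<Sigma>(1)] by (intro emeasure_eq_ennreal_measure) auto
    also have "emeasure lborel ?C = ennreal (1 / fact CARD('n))" by (simp add: emeasure_std_simplex)
    finally have "\<bar>det V\<bar> / fact CARD('n) \<le> measure lborel \<Sigma>"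
      by (simp add: ennreal_mult[symmetric] ennreal_le_iff)
    then have "\<bar>det V\<bar> \<le> fact CARD('n) * measure lborel \<Sigma>" by (simp add: field_simps)
    then show "\<bar>det (matrix T)\<bar> \<le> ?n ^ CARD('n) * fact CARD('n) * measure lborel \<Sigma>"
      unfolding dT by (simp add: abs_mult mult_left_mono mult.assoc)
  qed
qed

section \<open>Graph charts and their surface measure\<close>

text \<open>The function h lives on a ball of the whole space and is constant along b, so that
  derivatives of the ambient space apply to it. The open set W isolates one sheet: over the same
  base S has further points, such as those on the opposite side of the convex body.\<close>

definition graph_chart ::
  "'a::euclidean_space set \<Rightarrow> 'a \<Rightarrow> ('a \<Rightarrow> real) \<Rightarrow> 'a \<Rightarrow> real \<Rightarrow> 'a set \<Rightarrow> bool" where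
  "graph_chart S b h z \<rho> W \<longleftrightarrow> b \<in> Basis \<and> z \<bullet> b = 0 \<and> \<rho> > 0 \<and> smooth_on (ball z \<rho>) h \<and>
     (\<forall>x. h (hproj b x) = h x) \<and> open W \<and> (\<forall>x\<in>W. hproj b x \<in> ball z \<rho>) \<and>
     S \<inter> W = {x \<in> W. x \<bullet> b = h (hproj b x)} \<and> (\<forall>y\<in>ball z \<rho>. y \<bullet> b = 0 \<longrightarrow> y + h y *\<^sub>R b \<in> W)"

lemma norm_hproj_le: "norm b = 1 \<Longrightarrow> norm (hproj b x) \<le> norm x"
proof -
  assume b: "norm b = 1"
  have "x = hproj b x + (x \<bullet> b) *\<^sub>R b" by (rule hproj_decomp)
  then have "(norm x)\<^sup>2 = (norm (hproj b x + (x \<bullet> b) *\<^sub>R b))\<^sup>2" by simp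
  also have "\<dots> = (norm (hproj b x))\<^sup>2 + (norm ((x \<bullet> b) *\<^sub>R b))\<^sup>2"
    by (rule norm_add_Pythagorean) (simp add: orthogonal_def hproj_inner[OF b])
  finally have "(norm (hproj b x))\<^sup>2 \<le> (norm x)\<^sup>2" by simp
  then show ?thesis by (rule power2_le_imp_le) simp
qed

lemma hproj_in_ball:
  assumes "norm b = 1" "z \<bullet> b = 0" "x \<in> ball z \<rho>" shows "hproj b x \<in> ball z \<rho>"
proof -
  have "dist z (hproj b x) = norm (hproj b (z - x))"
    using hproj_id[OF assms(2)] by (simp add: dist_norm linear_diff[OF linear_hproj])
  also have "\<dots> \<le> dist z x" unfolding dist_norm by (rule norm_hproj_le[OF assms(1)])
  finally show ?thesis using assms(3) by simp
qed

lemma graph_chartD: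
  assumes "graph_chart S b h z \<rho> W"
  shows "b \<in> Basis" "norm b = 1" "z \<bullet> b = 0" "\<rho> > 0" "smooth_on (ball z \<rho>) h"
    "h (hproj b x) = h x" "open W" "x \<in> W \<Longrightarrow> hproj b x \<in> ball z \<rho>"
    "S \<inter> W = {x \<in> W. x \<bullet> b = h (hproj b x)}"
    "y \<in> ball z \<rho> \<Longrightarrow> y \<bullet> b = 0 \<Longrightarrow> y + h y *\<^sub>R b \<in> W"
    "y \<in> ball z \<rho> \<Longrightarrow> y \<bullet> b = 0 \<Longrightarrow> y + h y *\<^sub>R b \<in> S"
proof -
  have b: "b \<in> Basis" using assms by (simp add: graph_chart_def)
  show "b \<in> Basis" "norm b = 1" using b by simp_all
  have bb: "b \<bullet> b = 1" using b by simp
  show "y + h y *\<^sub>R b \<in> S" if "y \<in> ball z \<rho>" "y \<bullet> b = 0"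
  proof -
    have "y + h y *\<^sub>R b \<in> W" using assms that by (simp add: graph_chart_def)
    moreover have "hproj b (y + h y *\<^sub>R b) = y"
      using hproj_scale_self[of b y "h y"] hproj_id[OF that(2)] b by simp
    ultimately show ?thesis using assms that bb unfolding graph_chart_def by (auto simp: inner_add_left)
  qed
qed (use assms in \<open>simp_all add: graph_chart_def\<close>)

lemma graph_patch_chart:
  assumes "graph_chart S b h z \<rho> W" "D \<in> sets borel" "D \<subseteq> ball z \<rho> \<inter> {y. y \<bullet> b = 0}"
  shows "graph_patch S (b, h, D)"
  unfolding graph_patch_def
  using assms(2,3) graph_chartD(2,5,11)[OF assms(1)]
  by (auto simp: graph_over_def intro!: exI[of _ "ball z \<rho>"])

lemma borel_graph_over:
  assumes "norm b = 1" "continuous_on D h" "D \<in> sets borel" "D \<subseteq> {y. y \<bullet> b = 0}"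
  shows "graph_over b h D \<in> sets borel"
proof -
  have [measurable]: "(\<lambda>x. indicator D x *\<^sub>R h x) \<in> borel_measurable borel"
    by (rule borel_measurable_continuous_on_indicator[OF assms(3,2)])
  note assms(3)[measurable]
  have "graph_over b h D = {x. hproj b x \<in> D \<and> x \<bullet> b = indicator D (hproj b x) *\<^sub>R h (hproj b x)}"
  proof (intro equalityI subsetI)
    fix x assume "x \<in> graph_over b h D"
    then obtain y where y: "y \<in> D" "x = y + h y *\<^sub>R b" by (auto simp: graph_over_def)
    have yb: "y \<bullet> b = 0" using y assms(4) by auto
    have "hproj b x = y" using hproj_scale_self[OF assms(1)] hproj_id[OF yb] y by simp
    then show "x \<in> {x. hproj b x \<in> D \<and> x \<bullet> b = indicator D (hproj b x) *\<^sub>R h (hproj b x)}"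
      using y yb assms(1) by (simp add: inner_add_left dot_square_norm)
  next
    fix x assume x: "x \<in> {x. hproj b x \<in> D \<and> x \<bullet> b = indicator D (hproj b x) *\<^sub>R h (hproj b x)}"
    then have "x = hproj b x + h (hproj b x) *\<^sub>R b" using hproj_decomp[of x b] by simp
    then show "x \<in> graph_over b h D" using x by (auto simp: graph_over_def)
  qed
  also have "\<dots> \<in> sets borel" by measurable
  finally show ?thesis .
qed

lemma graph_patch_borel:
  assumes "graph_patch S (b, h, D)"
  shows "graph_over b h D \<in> sets (restrict_space borel S)" "graph_over b h D \<in> sets borel"
proof -
  obtain U where U: "open U" "D \<subseteq> U" "smooth_on U h" "graph_over b h (U \<inter> {y. y \<bullet> b = 0}) \<subseteq> S"
    and D: "norm b = 1" "D \<in> sets borel" "D \<subseteq> {y. y \<bullet> b = 0}"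
    using assms by (auto simp: graph_patch_def)
  have "continuous_on D h" using smooth_on_continuous[OF U(3), of "[]"] U(2) continuous_on_subset by auto
  then show 1: "graph_over b h D \<in> sets borel" by (intro borel_graph_over D)
  have "graph_over b h D \<subseteq> S" using U(2,4) D(3) by (auto simp: graph_over_def)
  then show "graph_over b h D \<in> sets (restrict_space borel S)"
    using 1 by (auto simp: sets_restrict_space)
qed

text \<open>The nontrivial half is that no cover has smaller total area than D. An arbitrary cover
  by patches over other hyperplanes is cut down to the given graph and read in the chart (b, h),
  which preserves areas by \<open>graph_area_transition\<close>; the pieces \<open>D1 i\<close> then
  cover D, and the integral is subadditive.\<close>

lemma surface_outer_graph:
  fixes S :: "(real^'n) set"
  assumes ch: "graph_chart S b h z \<rho> W" and D: "D \<in> sets borel" "D \<subseteq> ball z \<rho> \<inter> {y. y \<bullet> b = 0}"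
  shows "surface_outer S (graph_over b h D) = graph_area b h D"
proof (rule antisym)
  note c = graph_chartD[OF ch]
  have gp: "graph_patch S (b, h, D)" "graph_patch S (b, h, {})"
    using graph_patch_chart[OF ch] D by auto
  let ?P = "\<lambda>i::nat. if i = 0 then (b, h, D) else (b, h, {})"
  have "surface_outer S (graph_over b h D) \<le> (\<Sum>i. case ?P i of (b, h, D) \<Rightarrow> graph_area b h D)"
    by (rule surface_outer_le) (use gp in \<open>auto intro!: exI[of _ 0]\<close>)
  also have "\<dots> = (\<Sum>i\<in>{0}. case ?P i of (b, h, D) \<Rightarrow> graph_area b h D)"
    by (rule suminf_finite) (auto simp: graph_area_def)
  finally show "surface_outer S (graph_over b h D) \<le> graph_area b h D" by simp
  show "graph_area b h D \<le> surface_outer S (graph_over b h D)"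
    unfolding surface_outer_def
  proof (rule INF_greatest, clarify)
    fix P :: "nat \<Rightarrow> (real^'n) \<times> ((real^'n) \<Rightarrow> real) \<times> (real^'n) set"
    assume P: "\<forall>i. graph_patch S (P i)"
      and cov: "graph_over b h D \<subseteq> (\<Union>i. case P i of (b, h, D) \<Rightarrow> graph_over b h D)"
    define b' h' D' where "b' i = fst (P i)" and "h' i = fst (snd (P i))" and "D' i = snd (snd (P i))" for i
    have Pi: "P i = (b' i, h' i, D' i)" for i by (simp add: b'_def h'_def D'_def)
    have gpi: "graph_patch S (b' i, h' i, D' i)" for i using P by (simp add: Pi[symmetric])
    define E where "E i = D' i \<inter> (\<lambda>y. y + h' i y *\<^sub>R b' i) -` graph_over b h D" for i
    define D1 where "D1 i = (\<lambda>y. hproj b (y + h' i y *\<^sub>R b' i)) ` E i" for i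
    have gE: "graph_patch S (b' i, h' i, E i)" for i
      unfolding E_def by (rule graph_patch_Int[OF gpi graph_patch_borel(1)[OF gp(1)]])
    have hG: "hproj b (y + h y *\<^sub>R b) = y" if "y \<in> D" for y
      using hproj_scale_self[OF c(2)] hproj_id[of y b] that D by auto
    have D1_eq: "D1 i = D \<inter> (\<lambda>y. y + h y *\<^sub>R b) -` graph_over (b' i) (h' i) (D' i)" for i
    proof (intro equalityI subsetI)
      fix y assume "y \<in> D1 i"
      then obtain y' where y': "y' \<in> D' i" "y' + h' i y' *\<^sub>R b' i \<in> graph_over b h D" "y = hproj b (y' + h' i y' *\<^sub>R b' i)"
        by (auto simp: D1_def E_def)
      then obtain w where w: "w \<in> D" "y' + h' i y' *\<^sub>R b' i = w + h w *\<^sub>R b" by (auto simp: graph_over_def)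
      have "y = w" using y'(3) hG[OF w(1)] unfolding w(2) by (simp only:)
      then show "y \<in> D \<inter> (\<lambda>y. y + h y *\<^sub>R b) -` graph_over (b' i) (h' i) (D' i)"
      proof -
        have "y' + h' i y' *\<^sub>R b' i \<in> graph_over (b' i) (h' i) (D' i)"
          unfolding graph_over_def using y'(1) by (rule imageI)
        then show ?thesis using w(1) unfolding w(2) \<open>y = w\<close> by simp
      qed
    next
      fix y assume y: "y \<in> D \<inter> (\<lambda>y. y + h y *\<^sub>R b) -` graph_over (b' i) (h' i) (D' i)"
      then obtain y' where y': "y' \<in> D' i" "y + h y *\<^sub>R b = y' + h' i y' *\<^sub>R b' i" by (auto simp: graph_over_def)
      have "y' + h' i y' *\<^sub>R b' i \<in> graph_over b h D"
        unfolding y'(2)[symmetric] graph_over_def using y by (intro imageI) simp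
      then have "y' \<in> E i" unfolding E_def using y'(1) by simp
      moreover have "y = hproj b (y' + h' i y' *\<^sub>R b' i)" unfolding y'(2)[symmetric] using hG y by simp
      ultimately show "y \<in> D1 i" unfolding D1_def by blast
    qed
    have D1: "D1 i \<in> sets borel" "D1 i \<subseteq> D" for i
      using graph_patch_Int[OF gp(1) graph_patch_borel(1)[OF gpi[of i]]] D1_eq[of i]
      by (auto simp: graph_patch_def)
    have area: "graph_area b h (D1 i) = graph_area (b' i) (h' i) (E i)" for i
    proof -
      obtain U where U: "open U" "D' i \<subseteq> U" "smooth_on U (h' i)" "graph_over (b' i) (h' i) (U \<inter> {y. y \<bullet> b' i = 0}) \<subseteq> S"
        and bi: "norm (b' i) = 1" "D' i \<subseteq> {y. y \<bullet> b' i = 0}"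
        using gpi[of i] by (auto simp: graph_patch_def)
      have "E i \<in> sets borel" using gE[of i] by (simp add: graph_patch_def)
      then show ?thesis unfolding D1_def
      proof (rule graph_area_transition[OF c(2) bi(1) open_ball c(5) U(1,3) _ _ _ c(7)])
        show "y + h' i y *\<^sub>R b' i \<in> W" if "y \<in> E i" for y
        proof -
          obtain w where w: "w \<in> D" "y + h' i y *\<^sub>R b' i = w + h w *\<^sub>R b"
            using \<open>y \<in> E i\<close> by (auto simp: E_def graph_over_def)
          show ?thesis unfolding w(2) by (rule c(10)) (use w(1) D(2) in auto)
        qed
        show "hproj b (y + h' i y *\<^sub>R b' i) \<in> ball z \<rho> \<and>
            (y + h' i y *\<^sub>R b' i) \<bullet> b = h (hproj b (y + h' i y *\<^sub>R b' i))"
          if "y \<in> U" "y \<bullet> b' i = 0" "y + h' i y *\<^sub>R b' i \<in> W" for y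
        proof -
          have "y + h' i y *\<^sub>R b' i \<in> S" using U(4) that by (auto simp: graph_over_def)
          then show ?thesis using c(8)[OF that(3)] c(9) that(3) by blast
        qed
        show "(\<lambda>y. hproj b (y + h' i y *\<^sub>R b' i)) ` E i \<in> sets borel" using D1(1)[of i] by (simp add: D1_def)
        show "bounded ((\<lambda>y. hproj b (y + h' i y *\<^sub>R b' i)) ` E i)"
          using D1(2)[of i] D(2) bounded_subset[OF bounded_ball, of _ z \<rho>] by (auto simp: D1_def)
      qed (use U(2) bi(2) in \<open>auto simp: E_def\<close>)
    qed
    have DU: "D = (\<Union>i. D1 i)"
    proof (intro equalityI subsetI)
      fix y assume y: "y \<in> D"
      then have "y + h y *\<^sub>R b \<in> graph_over b h D" by (auto simp: graph_over_def)
      then have "y + h y *\<^sub>R b \<in> (\<Union>i. case P i of (b, h, D) \<Rightarrow> graph_over b h D)" using cov by blast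
      then obtain i where "y + h y *\<^sub>R b \<in> graph_over (b' i) (h' i) (D' i)" by (auto simp: Pi)
      then show "y \<in> (\<Union>i. D1 i)" using y unfolding D1_eq by blast
    qed (use D1 in blast)
    have bm: "(\<lambda>y. ennreal (area_density b h y) * indicator (D1 i) y) \<in> borel_measurable borel" for i
      by (rule borel_area_density[OF c(5) D1(1)]) (use D1(2)[of i] D(2) in blast)
    have "graph_area b h D \<le> (\<integral>\<^sup>+y. (\<Sum>i. ennreal (area_density b h y) * indicator (D1 i) y) \<partial>hyperplane_lborel b)"
      unfolding graph_area_eq
    proof (rule nn_integral_mono)
      fix y
      show "ennreal (area_density b h y) * indicator D y \<le> (\<Sum>i. ennreal (area_density b h y) * indicator (D1 i) y)"
      proof (cases "y \<in> D")
        case True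
        then obtain i where "y \<in> D1 i" using DU by blast
        then have "ennreal (area_density b h y) * indicator D y = (\<Sum>i\<in>{i}. ennreal (area_density b h y) * indicator (D1 i) y)"
          using True by simp
        also have "\<dots> \<le> (\<Sum>i. ennreal (area_density b h y) * indicator (D1 i) y)" by (rule sum_le_suminf) auto
        finally show ?thesis .
      qed simp
    qed
    also have "\<dots> = (\<Sum>i. graph_area b h (D1 i))"
      unfolding graph_area_eq by (rule nn_integral_suminf) (use bm in simp)
    also have "\<dots> = (\<Sum>i. graph_area (b' i) (h' i) (E i))" by (simp add: area)
    also have "\<dots> \<le> (\<Sum>i. graph_area (b' i) (h' i) (D' i))"
    proof (rule suminf_le)
      show "graph_area (b' i) (h' i) (E i) \<le> graph_area (b' i) (h' i) (D' i)" for i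
        unfolding graph_area_eq by (intro nn_integral_mono) (auto simp: E_def indicator_def)
    qed auto
    finally show "graph_area b h D \<le> (\<Sum>i. case P i of (b, h, D) \<Rightarrow> graph_area b h D)" by (simp add: Pi)
  qed
qed

section \<open>A smooth hypersurface is locally a graph\<close>

lemma has_real_derivative_line:
  assumes "f differentiable (at (y + t *\<^sub>R v))"
  shows "((\<lambda>t. f (y + t *\<^sub>R v)) has_real_derivative frechet_derivative f (at (y + t *\<^sub>R v)) v) (at t)"
proof -
  have D: "(f has_derivative frechet_derivative f (at (y + t *\<^sub>R v))) (at (y + t *\<^sub>R v))"
    using assms frechet_derivative_works by blast
  have "((\<lambda>t. y + t *\<^sub>R v) has_derivative (\<lambda>s. s *\<^sub>R v)) (at t)" by (auto intro!: derivative_eq_intros)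
  from has_derivative_compose[OF this D]
  have "((\<lambda>t. f (y + t *\<^sub>R v)) has_derivative (\<lambda>s. frechet_derivative f (at (y + t *\<^sub>R v)) (s *\<^sub>R v))) (at t)" .
  moreover have "(\<lambda>s. frechet_derivative f (at (y + t *\<^sub>R v)) (s *\<^sub>R v)) = (*) (frechet_derivative f (at (y + t *\<^sub>R v)) v)"
    by (auto simp: linear_scale[OF has_derivative_linear[OF D]])
  ultimately show ?thesis by (simp add: has_field_derivative_def)
qed

text \<open>An implicit function theorem of class C^infinity. Along b the function psi increases
  strictly, so each vertical segment has exactly one zero. W is a full box over the ball: every base
  point has its graph point in W, and the zero set within W is nothing but the graph.\<close>

lemma zero_set_graph:
  fixes \<psi> :: "'a::euclidean_space \<Rightarrow> real"
  assumes U: "open U" "p \<in> U" "smooth_on U \<psi>" "\<psi> p = 0" and b: "b \<in> Basis"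
    and pos: "frechet_derivative \<psi> (at p) b > 0"
  obtains h \<rho> W where "p \<in> W" "\<rho> > 0" "smooth_on (ball (hproj b p) \<rho>) h" "\<And>x. h (hproj b x) = h x" "open W" "W \<subseteq> U"
     "\<And>x. x \<in> W \<Longrightarrow> hproj b x \<in> ball (hproj b p) \<rho>" "\<And>x. x \<in> W \<Longrightarrow> \<psi> x = 0 \<longleftrightarrow> x \<bullet> b = h (hproj b x)"
     "\<And>y. y \<in> ball (hproj b p) \<rho> \<Longrightarrow> y \<bullet> b = 0 \<Longrightarrow> y + h y *\<^sub>R b \<in> W"
proof -
  have nb: "norm b = 1" "b \<bullet> b = 1" using b by simp_all
  let ?z = "hproj b p" and ?c = "p \<bullet> b"
  have zb: "?z \<bullet> b = 0" by (rule hproj_inner[OF nb(1)])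
  have pdec: "p = ?z + ?c *\<^sub>R b" by (rule hproj_decomp)
  have dk: "diff_on k U \<psi>" for k using U(3) by (rule smooth_on_imp_diff_on)
  have cont: "continuous_on U \<psi>" using diff_on_imp_continuous_on[OF dk] .
  have contb: "continuous_on U (\<lambda>x. frechet_derivative \<psi> (at x) b)"
    using diff_on_imp_continuous_on[OF diff_on_deriv[OF dk]] .
  have "open {x \<in> U. frechet_derivative \<psi> (at x) b > 0}"
    using continuous_open_preimage[OF contb U(1), of "{0<..}"] by (simp add: vimage_def Int_def)
  then obtain e where e: "e > 0" "ball p e \<subseteq> {x \<in> U. frechet_derivative \<psi> (at x) b > 0}"
    using U(2) pos open_contains_ball by (metis (mono_tags, lifting) mem_Collect_eq)
  define \<epsilon> where "\<epsilon> = e / 3"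
  have \<epsilon>: "\<epsilon> > 0" using e by (simp add: \<epsilon>_def)
  have near: "y + t *\<^sub>R b \<in> ball p e" if "y \<in> ball ?z \<epsilon>" "\<bar>t - ?c\<bar> \<le> \<epsilon>" for y t
  proof -
    have "dist p (y + t *\<^sub>R b) = norm ((?z - y) + (?c - t) *\<^sub>R b)"
      by (subst pdec) (simp add: dist_norm algebra_simps)
    also have "\<dots> \<le> norm (?z - y) + \<bar>?c - t\<bar>" by (rule order_trans[OF norm_triangle_ineq]) (simp add: nb)
    also have "\<dots> < e"
    proof -
      have "norm (?z - y) < \<epsilon>" "\<bar>?c - t\<bar> \<le> \<epsilon>" using that by (auto simp: dist_norm)
      then show ?thesis using \<epsilon> unfolding \<epsilon>_def by linarith
    qed
    finally show ?thesis by simp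
  qed
  have ballU: "x \<in> U" "frechet_derivative \<psi> (at x) b > 0" if "x \<in> ball p e" for x using e that by auto
  have mono: "\<psi> (y + s *\<^sub>R b) < \<psi> (y + t *\<^sub>R b)"
    if y: "y \<in> ball ?z \<epsilon>" and st: "\<bar>s - ?c\<bar> \<le> \<epsilon>" "\<bar>t - ?c\<bar> \<le> \<epsilon>" "s < t" for y s t
  proof (rule DERIV_pos_imp_increasing[OF st(3)])
    fix x assume "s \<le> x" "x \<le> t"
    then have x: "y + x *\<^sub>R b \<in> ball p e" using st by (intro near[OF y]) linarith
    show "\<exists>d. ((\<lambda>t. \<psi> (y + t *\<^sub>R b)) has_real_derivative d) (at x) \<and> 0 < d"
      using has_real_derivative_line[OF diff_on_imp_differentiable[OF dk[of 0] ballU(1)[OF x]]] ballU(2)[OF x] by blast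
  qed
  have pm: "?z + (?c + \<epsilon>) *\<^sub>R b \<in> {x \<in> U. \<psi> x > 0}" "?z + (?c - \<epsilon>) *\<^sub>R b \<in> {x \<in> U. \<psi> x < 0}"
    using mono[of ?z ?c "?c + \<epsilon>"] mono[of ?z "?c - \<epsilon>" ?c] U(4) pdec \<epsilon>
      ballU(1)[OF near[of ?z "?c + \<epsilon>"]] ballU(1)[OF near[of ?z "?c - \<epsilon>"]] by auto
  have os: "open {x \<in> U. \<psi> x > 0}" "open {x \<in> U. \<psi> x < 0}"
    using continuous_open_preimage[OF cont U(1), of "{0<..}"] continuous_open_preimage[OF cont U(1), of "{..<0}"]
    by (simp_all add: vimage_def Int_def)
  obtain d1 where d1: "d1 > 0" "ball (?z + (?c + \<epsilon>) *\<^sub>R b) d1 \<subseteq> {x \<in> U. \<psi> x > 0}"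
    using os(1) pm(1) by (rule openE)
  obtain d2 where d2: "d2 > 0" "ball (?z + (?c - \<epsilon>) *\<^sub>R b) d2 \<subseteq> {x \<in> U. \<psi> x < 0}"
    using os(2) pm(2) by (rule openE)
  note d = d1 d2
  define \<delta> where "\<delta> = min \<epsilon> (min d1 d2)"
  have \<delta>: "\<delta> > 0" "\<delta> \<le> \<epsilon>" using d \<epsilon> by (auto simp: \<delta>_def)
  have signs: "\<psi> (y + (?c + \<epsilon>) *\<^sub>R b) > 0" "\<psi> (y + (?c - \<epsilon>) *\<^sub>R b) < 0" if "y \<in> ball ?z \<delta>" for y
  proof -
    have "y + (?c + \<epsilon>) *\<^sub>R b \<in> ball (?z + (?c + \<epsilon>) *\<^sub>R b) d1" "y + (?c - \<epsilon>) *\<^sub>R b \<in> ball (?z + (?c - \<epsilon>) *\<^sub>R b) d2"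
      using that by (auto simp: dist_norm \<delta>_def)
    from subsetD[OF d(2) this(1)] subsetD[OF d(4) this(2)]
    show "\<psi> (y + (?c + \<epsilon>) *\<^sub>R b) > 0" "\<psi> (y + (?c - \<epsilon>) *\<^sub>R b) < 0" by simp_all
  qed
  define W where "W = {x. hproj b x \<in> ball ?z \<delta> \<and> \<bar>x \<bullet> b - ?c\<bar> < \<epsilon>}"
  have oW: "open W"
  proof -
    have "W = hproj b -` ball ?z \<delta> \<inter> (\<lambda>x. x \<bullet> b) -` ball ?c \<epsilon>"
      by (auto simp: W_def dist_real_def abs_minus_commute)
    then show ?thesis
      by (auto intro!: open_Int open_vimage linear_continuous_on bounded_linear_hproj continuous_intros)
  qed
  have W_ball: "x \<in> ball p e" if "x \<in> W" for x
  proof -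
    have "hproj b x + (x \<bullet> b) *\<^sub>R b \<in> ball p e" by (rule near) (use that \<delta> in \<open>auto simp: W_def\<close>)
    then show ?thesis using hproj_decomp[of x b] by simp
  qed
  have WU: "W \<subseteq> U" using W_ball ballU by blast
  \<comment> \<open>Straightens the zero set by replacing the b-coordinate with the value of psi. It
    is injective on W by monotonicity along b, and its inverse restricted to the hyperplane
    parametrizes the graph; the inverse function theorem supplies differentiability.\<close>
  define \<Omega> where "\<Omega> x = hproj b x + \<psi> x *\<^sub>R b" for x
  have \<Omega>p: "hproj b (\<Omega> x) = hproj b x" "\<Omega> x \<bullet> b = \<psi> x" for x
    using hproj_scale_self[OF nb(1)] hproj_id[OF hproj_inner[OF nb(1)]] hproj_inner[OF nb(1)] nb
    by (auto simp: \<Omega>_def inner_add_left)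
  have inj: "inj_on \<Omega> W"
  proof (rule inj_onI, rule ccontr)
    fix x y assume xy: "x \<in> W" "y \<in> W" "\<Omega> x = \<Omega> y" "x \<noteq> y"
    have p: "hproj b x = hproj b y" "\<psi> x = \<psi> y" using \<Omega>p xy(3) by metis+
    then have "x \<bullet> b \<noteq> y \<bullet> b" using xy(4) hproj_decomp[of _ b] by metis
    then consider "x \<bullet> b < y \<bullet> b" | "y \<bullet> b < x \<bullet> b" by linarith
    then show False
    proof cases
      case 1
      then have "\<psi> (hproj b x + (x \<bullet> b) *\<^sub>R b) < \<psi> (hproj b x + (y \<bullet> b) *\<^sub>R b)"
        using xy \<delta> by (intro mono) (auto simp: W_def)
      then show False using p hproj_decomp[of x b] hproj_decomp[of y b] by simp
    next
      case 2
      then have "\<psi> (hproj b x + (y \<bullet> b) *\<^sub>R b) < \<psi> (hproj b x + (x \<bullet> b) *\<^sub>R b)"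
        using xy \<delta> by (intro mono) (auto simp: W_def)
      then show False using p hproj_decomp[of x b] hproj_decomp[of y b] by simp
    qed
  qed
  define g where "g = inv_into W \<Omega>"
  have g\<Omega>: "g (\<Omega> x) = x" if "x \<in> W" for x using inj that by (simp add: g_def)
  define h where "h x = g (hproj b x) \<bullet> b" for x
  have h_inv: "h (hproj b x) = h x" for x by (simp add: h_def hproj_id[OF hproj_inner[OF nb(1)]])
  have gh: "g y = y + h y *\<^sub>R b" "g y \<in> W" "\<Omega> (g y) = y" "\<psi> (g y) = 0" if y: "y \<in> ball ?z \<delta>" "y \<bullet> b = 0" for y
  proof -
    have "continuous_on {?c - \<epsilon>..?c + \<epsilon>} (\<lambda>t. \<psi> (y + t *\<^sub>R b))"
      using y \<delta> by (intro continuous_on_compose2[OF cont] continuous_intros) (auto intro!: ballU near simp: abs_le_iff)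
    then obtain t where t: "?c - \<epsilon> \<le> t" "t \<le> ?c + \<epsilon>" "\<psi> (y + t *\<^sub>R b) = 0"
      using IVT'[of "\<lambda>t. \<psi> (y + t *\<^sub>R b)" "?c - \<epsilon>" 0 "?c + \<epsilon>"] signs[OF y(1)] \<epsilon> by auto
    have "t \<noteq> ?c - \<epsilon>" "t \<noteq> ?c + \<epsilon>" using t(3) signs[OF y(1)] by auto
    then have "\<bar>t - ?c\<bar> < \<epsilon>" using t by (auto simp: abs_less_iff)
    moreover have tp: "hproj b (y + t *\<^sub>R b) = y" "(y + t *\<^sub>R b) \<bullet> b = t"
      using hproj_scale_self[OF nb(1)] hproj_id[OF y(2)] y(2) nb by (auto simp: inner_add_left)
    ultimately have tW: "y + t *\<^sub>R b \<in> W" using y by (simp add: W_def)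
    have "\<Omega> (y + t *\<^sub>R b) = y" unfolding \<Omega>_def tp t(3) by simp
    then have gy: "g y = y + t *\<^sub>R b" using g\<Omega>[OF tW] by simp
    then have "h y = t" using tp(2) hproj_id[OF y(2)] by (simp add: h_def)
    then show "g y = y + h y *\<^sub>R b" "g y \<in> W" "\<Omega> (g y) = y" "\<psi> (g y) = 0"
      using gy tW t(3) \<open>\<Omega> (y + t *\<^sub>R b) = y\<close> by auto
  qed
  define X where "X x = hproj b x + h x *\<^sub>R b" for x
  have hb: "hproj b x \<in> ball ?z \<delta>" "hproj b x \<bullet> b = 0" if "x \<in> ball ?z \<delta>" for x
    using hproj_in_ball[OF nb(1) zb that] hproj_inner[OF nb(1)] by auto
  have XW: "X x \<in> W" "\<psi> (X x) = 0" if "x \<in> ball ?z \<delta>" for x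
    using gh[OF hb[OF that]] by (auto simp: X_def h_inv)
  have hdiff: "h differentiable (at x)" if x: "x \<in> ball ?z \<delta>" for x
  proof -
    let ?y = "hproj b x"
    let ?X = "g ?y"
    note gy = gh[OF hb[OF x]]
    have XU: "?X \<in> U" "frechet_derivative \<psi> (at ?X) b > 0" using W_ball[OF gy(2)] ballU by auto
    let ?D = "frechet_derivative \<psi> (at ?X)"
    have D: "(\<psi> has_derivative ?D) (at ?X)" by (rule diff_on_imp_has_derivative[OF dk[of 0] XU(1)])
    have lD: "linear ?D" using D by (rule has_derivative_linear)
    have "(g has_derivative (\<lambda>w. hproj b w + ((w \<bullet> b - ?D (hproj b w)) / ?D b) *\<^sub>R b)) (at (\<Omega> ?X))"
    proof (rule has_derivative_inverse_strong[OF oW gy(2)])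
      show "continuous_on W \<Omega>" unfolding \<Omega>_def[abs_def]
        by (intro continuous_intros continuous_on_subset[OF cont WU] linear_continuous_on bounded_linear_hproj)
      show "(\<Omega> has_derivative (\<lambda>v. hproj b v + ?D v *\<^sub>R b)) (at ?X)"
        unfolding \<Omega>_def[abs_def]
        by (intro has_derivative_add has_derivative_scaleR_left D bounded_linear_imp_has_derivative bounded_linear_hproj)
      show "(\<lambda>v. hproj b v + ?D v *\<^sub>R b) \<circ> (\<lambda>w. hproj b w + ((w \<bullet> b - ?D (hproj b w)) / ?D b) *\<^sub>R b) = id"
      proof
        fix w
        let ?k = "(w \<bullet> b - ?D (hproj b w)) / ?D b"
        have "hproj b (hproj b w + ?k *\<^sub>R b) = hproj b w"
          using hproj_scale_self[OF nb(1)] hproj_id[OF hproj_inner[OF nb(1)]] by simp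
        moreover have "?D (hproj b w + ?k *\<^sub>R b) = w \<bullet> b"
          using XU(2) by (simp add: linear_add[OF lD] linear_scale[OF lD])
        ultimately show "((\<lambda>v. hproj b v + ?D v *\<^sub>R b) \<circ> (\<lambda>w. hproj b w + ((w \<bullet> b - ?D (hproj b w)) / ?D b) *\<^sub>R b)) w = id w"
          using hproj_decomp[of w b] by simp
      qed
    qed (rule g\<Omega>)
    then have "(g has_derivative (\<lambda>w. hproj b w + ((w \<bullet> b - ?D (hproj b w)) / ?D b) *\<^sub>R b)) (at ?y)" by (simp add: gy(3))
    from has_derivative_inner_left[OF has_derivative_compose[OF bounded_linear_imp_has_derivative[OF bounded_linear_hproj] this], of b]
    show ?thesis unfolding h_def[abs_def] differentiable_def by blast
  qed
  have dX: "(X has_derivative (\<lambda>v. hproj b v + frechet_derivative h (at x) v *\<^sub>R b)) (at x)" if "x \<in> ball ?z \<delta>" for x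
    unfolding X_def[abs_def] using hdiff[OF that]
    by (intro has_derivative_add has_derivative_scaleR_left bounded_linear_imp_has_derivative bounded_linear_hproj)
       (simp add: frechet_derivative_works)
  have hder: "(h has_derivative (\<lambda>v. - frechet_derivative \<psi> (at (X x)) (hproj b v) / frechet_derivative \<psi> (at (X x)) b)) (at x)"
    if x: "x \<in> ball ?z \<delta>" for x
  proof -
    let ?D = "frechet_derivative \<psi> (at (X x))" and ?Dh = "frechet_derivative h (at x)"
    have XU: "X x \<in> U" "?D b > 0" using W_ball[OF XW(1)[OF x]] ballU by auto
    have D: "(\<psi> has_derivative ?D) (at (X x))" by (rule diff_on_imp_has_derivative[OF dk[of 0] XU(1)])
    have lD: "linear ?D" using D by (rule has_derivative_linear)
    have "((\<lambda>x. \<psi> (X x)) has_derivative (\<lambda>v. ?D (hproj b v + ?Dh v *\<^sub>R b))) (at x)"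
      by (rule has_derivative_compose[OF dX[OF x] D])
    moreover have "((\<lambda>x. \<psi> (X x)) has_derivative (\<lambda>v. 0)) (at x)"
      by (rule has_derivative_transform_within_open[OF has_derivative_const[of 0] open_ball x]) (simp add: XW(2))
    ultimately have "(\<lambda>v. ?D (hproj b v + ?Dh v *\<^sub>R b)) = (\<lambda>v. 0)" by (rule has_derivative_unique)
    then have "?D (hproj b v) + ?Dh v * ?D b = 0" for v
      by (simp add: fun_eq_iff linear_add[OF lD] linear_scale[OF lD])
    then have "?Dh v * ?D b = - ?D (hproj b v)" for v by (simp add: eq_neg_iff_add_eq_0 add.commute)
    then have "?Dh v = - ?D (hproj b v) / ?D b" for v
      using XU(2) by (metis less_irrefl nonzero_mult_div_cancel_right)
    then have "?Dh = (\<lambda>v. - ?D (hproj b v) / ?D b)" by blast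
    then show ?thesis using hdiff[OF x] frechet_derivative_works by metis
  qed
  \<comment> \<open>Bootstrapping: \<open>hder\<close> expresses the derivative of h through
    derivatives of psi along X, and X is as regular as h, so order k gives order k + 1.\<close>
  have "diff_on k (ball ?z \<delta>) h" for k
  proof (induction k)
    case 0
    then show ?case using hdiff by (simp add: diff_on_0)
  next
    case (Suc k)
    have Xk: "diff_on k (ball ?z \<delta>) X"
      unfolding X_def[abs_def]
      by (intro diff_on_add diff_on_scaleR diff_on_const diff_on_bounded_linear bounded_linear_hproj open_ball Suc)
    have "diff_on k (ball ?z \<delta>) (\<lambda>x. frechet_derivative \<psi> (at (X x)) v)" for v
      by (rule diff_on_compose[OF open_ball diff_on_deriv[OF dk[of "Suc k"]] Xk]) (use XW(1) WU in blast)
    moreover have "frechet_derivative \<psi> (at (X x)) b \<noteq> 0" if "x \<in> ball ?z \<delta>" for x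
      using ballU(2)[OF W_ball[OF XW(1)[OF that]]] by simp
    ultimately show ?case
      by (intro diff_on_SucI[OF open_ball hder] diff_on_divide diff_on_uminus open_ball)
  qed
  then have sm: "smooth_on (ball ?z \<delta>) h" by (simp add: smooth_on_iff_diff_on)
  show ?thesis
  proof (rule that[OF _ \<delta>(1) sm h_inv oW WU])
    show "p \<in> W" using \<delta> \<epsilon> by (simp add: W_def)
    show "hproj b x \<in> ball ?z \<delta>" if "x \<in> W" for x using that by (simp add: W_def)
    show "y + h y *\<^sub>R b \<in> W" if "y \<in> ball ?z \<delta>" "y \<bullet> b = 0" for y using gh(1,2)[OF that] by simp
    show "\<psi> x = 0 \<longleftrightarrow> x \<bullet> b = h (hproj b x)" if "x \<in> W" for x
    proof -
      have y: "hproj b x \<in> ball ?z \<delta>" "hproj b x \<bullet> b = 0" using that hproj_inner[OF nb(1)] by (auto simp: W_def)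
      note gy = gh[OF y]
      show ?thesis
      proof
        assume "\<psi> x = 0"
        then have "\<Omega> x = hproj b x" by (simp add: \<Omega>_def)
        then have "x = g (hproj b x)" using g\<Omega>[OF that] by simp
        then show "x \<bullet> b = h (hproj b x)" unfolding h_inv unfolding h_def by (rule arg_cong)
      next
        assume "x \<bullet> b = h (hproj b x)"
        then have "x = g (hproj b x)" using gy(1) hproj_decomp[of x b] by simp
        then show "\<psi> x = 0" using gy(4) by simp
      qed
    qed
  qed
qed

lemma graph_chart_exists:
  assumes "smooth_hypersurface S" "p \<in> S"
  obtains b h \<rho> W where "graph_chart S b h (hproj b p) \<rho> W" "p \<in> W"
proof -
  obtain U \<phi> where ldf: "local_defining_function S p U \<phi>"
    using assms unfolding smooth_hypersurface_def by blast
  note l = ldf[unfolded local_defining_function_def]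
  note U = l[THEN conjunct1] l[THEN conjunct2, THEN conjunct1] l[THEN conjunct2, THEN conjunct2, THEN conjunct1]
    l[THEN conjunct2, THEN conjunct2, THEN conjunct2, THEN conjunct1]
  note nz = bspec[OF l[THEN conjunct2, THEN conjunct2, THEN conjunct2, THEN conjunct2] U(2)]
  have dk: "diff_on k U \<phi>" for k using U(3) by (rule smooth_on_imp_diff_on)
  have D: "(\<phi> has_derivative frechet_derivative \<phi> (at p)) (at p)" by (rule diff_on_imp_has_derivative[OF dk[of 0] U(2)])
  then have lD: "linear (frechet_derivative \<phi> (at p))" by (rule has_derivative_linear)
  obtain b where b: "b \<in> Basis" "frechet_derivative \<phi> (at p) b \<noteq> 0"
    using nz linear_eq_0_on_span[of "frechet_derivative \<phi> (at p)" Basis] lD by (auto simp: span_Basis)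
  define \<sigma> where "\<sigma> = sgn (frechet_derivative \<phi> (at p) b)"
  define \<psi> where "\<psi> x = \<sigma> * \<phi> x" for x
  have \<sigma>: "\<sigma> \<noteq> 0" using b(2) by (simp add: \<sigma>_def sgn_zero_iff)
  have "smooth_on U \<psi>" unfolding \<psi>_def[abs_def] smooth_on_iff_diff_on
    by (intro allI diff_on_mult diff_on_const U(1) dk)
  moreover have "\<psi> p = 0" using U(2,4) assms(2) by (auto simp: \<psi>_def)
  moreover have "frechet_derivative \<psi> (at p) b > 0"
  proof -
    have "frechet_derivative \<psi> (at p) = (\<lambda>v. \<sigma> * frechet_derivative \<phi> (at p) v)"
      unfolding \<psi>_def[abs_def] by (rule frechet_derivative_at[symmetric]) (rule has_derivative_mult_right[OF D])
    then show ?thesis using b(2) by (simp add: \<sigma>_def sgn_real_def)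
  qed
  ultimately show ?thesis
  proof (rule zero_set_graph[OF U(1,2) _ _ b(1)])
    fix h \<rho> W
    assume h: "p \<in> W" "\<rho> > 0" "smooth_on (ball (hproj b p) \<rho>) h" "\<And>x. h (hproj b x) = h x" "open W" "W \<subseteq> U"
       "\<And>x. x \<in> W \<Longrightarrow> hproj b x \<in> ball (hproj b p) \<rho>" "\<And>x. x \<in> W \<Longrightarrow> \<psi> x = 0 \<longleftrightarrow> x \<bullet> b = h (hproj b x)"
       "\<And>y. y \<in> ball (hproj b p) \<rho> \<Longrightarrow> y \<bullet> b = 0 \<Longrightarrow> y + h y *\<^sub>R b \<in> W"
    have "S \<inter> W = {x \<in> W. \<psi> x = 0}" using U(4) h(6) \<sigma> by (auto simp: \<psi>_def)
    also have "\<dots> = {x \<in> W. x \<bullet> b = h (hproj b x)}" using h(8) by blast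
    finally have SW: "S \<inter> W = {x \<in> W. x \<bullet> b = h (hproj b x)}" .
    have "hproj b p \<bullet> b = 0" using b(1) by (intro hproj_inner) simp
    then have "graph_chart S b h (hproj b p) \<rho> W"
      unfolding graph_chart_def using SW by (intro conjI allI ballI impI b(1) h) simp_all
    then show ?thesis using h(1) by (rule that)
  qed
qed

section \<open>Convexity and finite type in a chart\<close>

lemma line_in_ball:
  fixes y0 v :: "'a::real_normed_vector"
  assumes "y0 \<in> ball z \<rho>"
  obtains e where "e > 0" "\<And>t. t \<in> ball 0 e \<Longrightarrow> y0 + t *\<^sub>R v \<in> ball z \<rho>"
proof -
  define e where "e = (\<rho> - dist z y0) / (norm v + 1)"
  have p: "norm v + 1 > 0" by (simp add: add_nonneg_pos)
  have "e > 0" using assms p by (simp add: e_def)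
  moreover have "y0 + t *\<^sub>R v \<in> ball z \<rho>" if "t \<in> ball 0 e" for t
  proof -
    have "\<bar>t\<bar> * (norm v + 1) < \<rho> - dist z y0" using that p by (simp add: e_def pos_less_divide_eq)
    moreover have "\<bar>t\<bar> * norm v \<le> \<bar>t\<bar> * (norm v + 1)" by (rule mult_left_mono) auto
    moreover have "dist z (y0 + t *\<^sub>R v) \<le> dist z y0 + \<bar>t\<bar> * norm v"
      using dist_triangle[of z "y0 + t *\<^sub>R v" y0] by (simp add: dist_norm)
    ultimately show ?thesis by simp
  qed
  ultimately show ?thesis by (rule that)
qed

text \<open>The supporting hyperplane of the convex body at the graph point is the tangent plane:
  its normal a is stationary along the graph (\<open>crit\<close>). If a were orthogonal to b,
  stationarity in direction a itself would force a = 0. So the remainder times a . b is nonnegative,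
  and the sign of a . b decides the side.\<close>

lemma chart_tangent_side:
  assumes ch: "graph_chart S b h z \<rho> W" and S: "compact S" "convex_hypersurface S"
    and y0: "y0 \<in> ball z \<rho>" "y0 \<bullet> b = 0"
  shows "(\<forall>y\<in>ball z \<rho> \<inter> {y. y \<bullet> b = 0}. h y0 + frechet_derivative h (at y0) (y - y0) \<le> h y) \<or>
    (\<forall>y\<in>ball z \<rho> \<inter> {y. y \<bullet> b = 0}. h y \<le> h y0 + frechet_derivative h (at y0) (y - y0))"
proof -
  note c = graph_chartD[OF ch]
  obtain K where K: "compact K" "convex K" "interior K \<noteq> {}" "S = frontier K"
    using S(2) by (auto simp: convex_hypersurface_def)
  have SK: "S \<subseteq> K" using K(1,4) by (simp add: compact_imp_closed frontier_subset_closed)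
  let ?G = "\<lambda>y. y + h y *\<^sub>R b"
  have GS: "?G y \<in> S" if "y \<in> ball z \<rho>" "y \<bullet> b = 0" for y using c(11) that .
  have nri: "?G y0 \<notin> rel_interior K"
    using GS[OF y0] K by (simp add: rel_interior_nonempty_interior frontier_def)
  have GK: "?G y0 \<in> K" using GS[OF y0] SK by blast
  obtain a where a: "a \<noteq> 0" "\<And>y. y \<in> K \<Longrightarrow> a \<bullet> ?G y0 \<le> a \<bullet> y"
  proof (rule supporting_hyperplane_rel_boundary[OF K(2) GK nri])
    fix a assume "a \<noteq> 0" "\<And>y. y \<in> K \<Longrightarrow> a \<bullet> ?G y0 \<le> a \<bullet> y"
    then show ?thesis by (rule that)
  qed
  have dh: "h differentiable (at y)" if "y \<in> ball z \<rho>" for y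
    using diff_on_imp_differentiable[OF smooth_on_imp_diff_on[OF c(5)] that] .
  let ?D = "frechet_derivative h (at y0)"
  have crit: "a \<bullet> v + ?D v * (a \<bullet> b) = 0" if v: "v \<bullet> b = 0" for v
  proof -
    let ?f = "\<lambda>t. a \<bullet> (y0 + t *\<^sub>R v) + h (y0 + t *\<^sub>R v) * (a \<bullet> b)"
    have d: "(?f has_real_derivative (a \<bullet> v + ?D v * (a \<bullet> b))) (at 0)"
      using has_real_derivative_line[of h y0 0 v] dh[OF y0(1)]
      by (auto intro!: derivative_eq_intros simp: inner_add_right)
    obtain e where e: "e > 0" "\<And>t. t \<in> ball 0 e \<Longrightarrow> y0 + t *\<^sub>R v \<in> ball z \<rho>"
      using line_in_ball[OF y0(1)] by blast
    have "?f 0 \<le> ?f t" if "\<bar>0 - t\<bar> < e" for t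
    proof -
      have "?G (y0 + t *\<^sub>R v) \<in> K"
        using GS[of "y0 + t *\<^sub>R v"] e(2)[of t] that v y0(2) SK by (auto simp: dist_real_def inner_add_left)
      from a(2)[OF this] show ?thesis by (simp add: inner_add_right)
    qed
    then show ?thesis using DERIV_local_min[OF d e(1)] by blast
  qed
  have ab: "a \<bullet> b \<noteq> 0"
  proof
    assume ab: "a \<bullet> b = 0"
    have "a \<bullet> hproj b a = 0" using crit[of "hproj b a"] hproj_inner[OF c(2)] ab by simp
    moreover have "hproj b a = a" using ab by (rule hproj_id)
    ultimately show False using a(1) by simp
  qed
  have eq: "a \<bullet> ?G y - a \<bullet> ?G y0 = (a \<bullet> b) * (h y - h y0 - ?D (y - y0))" if "y \<bullet> b = 0" for y
  proof -
    have "(y - y0) \<bullet> b = 0" using that y0(2) by (simp add: inner_diff_left)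
    from crit[OF this] show ?thesis by (simp add: inner_add_right inner_diff_right algebra_simps)
  qed
  have ge: "0 \<le> (a \<bullet> b) * (h y - h y0 - ?D (y - y0))" if "y \<in> ball z \<rho>" "y \<bullet> b = 0" for y
  proof -
    have "a \<bullet> ?G y0 \<le> a \<bullet> ?G y" using a(2) GS[OF that] SK by blast
    then show ?thesis using eq[OF that(2)] by linarith
  qed
  show ?thesis
  proof (cases "a \<bullet> b > 0")
    case True
    then have "0 \<le> h y - h y0 - ?D (y - y0)" if "y \<in> ball z \<rho>" "y \<bullet> b = 0" for y
      using ge[OF that] by (simp add: zero_le_mult_iff)
    then show ?thesis by (intro disjI1) fastforce
  next
    case False
    then have "h y - h y0 - ?D (y - y0) \<le> 0" if "y \<in> ball z \<rho>" "y \<bullet> b = 0" for y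
      using ge[OF that] ab by (simp add: zero_le_mult_iff)
    then show ?thesis by (intro disjI2) fastforce
  qed
qed

lemma funpow_deriv_zero:
  fixes f :: "nat \<Rightarrow> real \<Rightarrow> real"
  assumes "\<And>j t. t \<in> ball 0 e \<Longrightarrow> (f j has_real_derivative f (Suc j) t) (at t)" "t \<in> ball 0 e"
  shows "(deriv ^^ k) (f 0) t = f k t"
  using assms(2)
proof (induction k arbitrary: t)
  case (Suc k)
  have "(deriv ^^ Suc k) (f 0) t = deriv ((deriv ^^ k) (f 0)) t" by simp
  also have "\<dots> = deriv (f k) t"
    by (rule deriv_cong_ev[OF eventually_mono[OF eventually_nhds_in_open[OF open_ball Suc.prems]] refl]) (rule Suc.IH)
  also have "\<dots> = f (Suc k) t" by (rule DERIV_imp_deriv) (rule assms(1)[OF Suc.prems])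
  finally show ?case .
qed simp

text \<open>The b-coordinate minus h is a local defining function, and on the tangent line with
  direction theta + (D h theta) b it equals minus the line remainder. Orders 0 and 1 of that
  remainder vanish at t = 0, so finite contact yields a nonzero derivative of order at least
  2.\<close>

lemma chart_finite_type:
  assumes ch: "graph_chart S b h z \<rho> W" and ft: "finite_type S"
    and y0: "y0 \<in> ball z \<rho>" "y0 \<bullet> b = 0" and \<theta>: "\<theta> \<bullet> b = 0" "\<theta> \<noteq> 0"
  shows "\<exists>k\<ge>2. iterated_deriv (replicate k \<theta>) h y0 \<noteq> 0"
proof -
  note c = graph_chartD[OF ch]
  have hk: "diff_on k (ball z \<rho>) h" for k using c(5) by (rule smooth_on_imp_diff_on)
  define F where "F x = x \<bullet> b - h (hproj b x)" for x
  let ?p = "y0 + h y0 *\<^sub>R b"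
  let ?D = "frechet_derivative h (at y0)"
  have bb: "b \<bullet> b = 1" using c(1) by simp
  have dF: "(F has_derivative (\<lambda>v. v \<bullet> b - frechet_derivative h (at (hproj b x)) (hproj b v))) (at x)" if "x \<in> W" for x
    unfolding F_def[abs_def]
    by (intro has_derivative_diff bounded_linear_imp_has_derivative bounded_linear_inner_left
          has_derivative_compose[OF bounded_linear_imp_has_derivative[OF bounded_linear_hproj] diff_on_imp_has_derivative[OF hk[of 0]]] c(8) that)
  have fdF: "frechet_derivative F (at x) = (\<lambda>v. v \<bullet> b - frechet_derivative h (at (hproj b x)) (hproj b v))" if "x \<in> W" for x
    using frechet_derivative_at[OF dF[OF that]] by simp
  have pW: "?p \<in> W" by (rule c(10)[OF y0])
  have hp: "hproj b ?p = y0" using hproj_scale_self[OF c(2)] hproj_id[OF y0(2)] by simp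
  have lin: "linear (frechet_derivative h (at y))" if "y \<in> ball z \<rho>" for y
    using diff_on_imp_has_derivative[OF hk[of 0] that] has_derivative_linear by blast
  have ldf: "local_defining_function S ?p W F"
    unfolding local_defining_function_def
  proof (intro conjI ballI)
    have hW: "diff_on k W (\<lambda>x. h (hproj b x))" for k
      by (rule diff_on_compose[OF c(7) hk diff_on_bounded_linear[OF bounded_linear_hproj]]) (rule c(8))
    show "smooth_on W F" unfolding F_def[abs_def] smooth_on_iff_diff_on
      by (intro allI diff_on_diff c(7) hW diff_on_bounded_linear[OF bounded_linear_inner_left])
    show "S \<inter> W = {x \<in> W. F x = 0}" unfolding c(9) F_def by auto
    fix x assume x: "x \<in> W"
    have "frechet_derivative F (at x) b = 1"
      using linear_0[OF lin[OF c(8)[OF x]]] bb by (simp add: fdF[OF x] hproj_self[OF c(2)])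
    then show "\<exists>v. frechet_derivative F (at x) v \<noteq> 0" by (intro exI[of _ b]) simp
  qed (use c(7) pW in auto)
  define v where "v = \<theta> + ?D \<theta> *\<^sub>R b"
  have hv: "hproj b v = \<theta>" using hproj_scale_self[OF c(2)] hproj_id[OF \<theta>(1)] by (simp add: v_def)
  have vb: "v \<bullet> b = ?D \<theta>" using \<theta>(1) bb by (simp add: v_def inner_add_left)
  have "v \<noteq> 0" using hv \<theta>(2) linear_0[OF linear_hproj] by metis
  moreover have "frechet_derivative F (at ?p) v = 0" by (simp add: fdF[OF pW] hp hv vb)
  moreover have "?p \<in> S" by (rule c(11)[OF y0])
  ultimately have "contact_order F ?p v < \<infinity>" using ft ldf unfolding finite_type_def by blast
  then obtain k where k: "(deriv ^^ k) (\<lambda>t. F (?p + t *\<^sub>R v)) 0 \<noteq> 0"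
    unfolding contact_order_def INF_less_iff by blast
  have Feq: "(\<lambda>t. F (?p + t *\<^sub>R v)) = (\<lambda>t. - line_rem h y0 \<theta> 0 t)"
  proof
    fix t
    have "hproj b (?p + t *\<^sub>R v) = y0 + t *\<^sub>R \<theta>"
      by (simp add: linear_add[OF linear_hproj] linear_scale[OF linear_hproj] hv hproj_id[OF y0(2)] hproj_self[OF c(2)])
    then show "F (?p + t *\<^sub>R v) = - line_rem h y0 \<theta> 0 t"
      using y0(2) bb vb by (simp add: F_def line_rem_def inner_add_left)
  qed
  obtain e where e: "e > 0" "\<And>t. t \<in> ball 0 e \<Longrightarrow> y0 + t *\<^sub>R \<theta> \<in> ball z \<rho>"
    using line_in_ball[OF y0(1)] by blast
  have "(deriv ^^ k) (\<lambda>t. - line_rem h y0 \<theta> 0 t) 0 = - line_rem h y0 \<theta> k 0"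
    by (rule funpow_deriv_zero[of e "\<lambda>j t. - line_rem h y0 \<theta> j t"])
       (use e in \<open>auto intro!: DERIV_minus line_rem_deriv[OF hk]\<close>)
  then have "line_rem h y0 \<theta> k 0 \<noteq> 0" using k unfolding Feq by simp
  then show ?thesis
    by (cases "k = 0"; cases "k = 1") (auto simp: line_rem_def intro!: exI[of _ k])
qed

text \<open>The supporting plane may a priori lie on different sides at different points. The sets P
  and N of points with either sign are relatively closed and cover the connected base. At a common
  point h would coincide with its tangent, and all higher derivatives in direction theta would
  vanish, against finite type. Hence one of the sets is empty.\<close>

lemma chart_convex_sign:
  assumes ch: "graph_chart S b h z \<rho> W" and S: "compact S" "convex_hypersurface S" and ft: "finite_type S"
    and \<theta>: "\<theta> \<bullet> b = 0" "\<theta> \<noteq> 0"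
  obtains \<kappa> :: real where "\<kappa> = 1 \<or> \<kappa> = -1"
    "\<And>y0 y. y0 \<in> ball z \<rho> \<inter> {y. y \<bullet> b = 0} \<Longrightarrow> y \<in> ball z \<rho> \<inter> {y. y \<bullet> b = 0} \<Longrightarrow>
       0 \<le> \<kappa> * (h y - h y0 - frechet_derivative h (at y0) (y - y0))"
proof -
  note c = graph_chartD[OF ch]
  let ?B = "ball z \<rho> \<inter> {y. y \<bullet> b = 0}"
  let ?e = "\<lambda>y0 y. h y - h y0 - frechet_derivative h (at y0) (y - y0)"
  have hk: "diff_on k (ball z \<rho>) h" for k using c(5) by (rule smooth_on_imp_diff_on)
  have lin: "linear (frechet_derivative h (at y))" if "y \<in> ball z \<rho>" for y
    using diff_on_imp_has_derivative[OF hk[of 0] that] has_derivative_linear by blast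
  define P where "P = (\<Inter>y\<in>?B. {y0 \<in> ?B. ?e y0 y \<ge> 0})"
  define N where "N = (\<Inter>y\<in>?B. {y0 \<in> ?B. ?e y0 y \<le> 0})"
  have zB: "z \<in> ?B" using c(3,4) by simp
  have cont: "continuous_on ?B (\<lambda>y0. ?e y0 y)" for y
  proof -
    have c1: "continuous_on ?B (\<lambda>y0. h y - h y0 - (\<Sum>i\<in>Basis. ((y - y0) \<bullet> i) * frechet_derivative h (at y0) i))"
      by (intro continuous_intros continuous_on_subset[OF diff_on_imp_continuous_on[OF diff_on_deriv[OF hk[of "Suc 0"]]]]
          continuous_on_subset[OF diff_on_imp_continuous_on[OF hk[of 0]]]) auto
    have c2: "frechet_derivative h (at y0) (y - y0) = (\<Sum>i\<in>Basis. ((y - y0) \<bullet> i) * frechet_derivative h (at y0) i)"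
      if "y0 \<in> ?B" for y0
    proof -
      have "frechet_derivative h (at y0) (\<Sum>i\<in>Basis. ((y - y0) \<bullet> i) *\<^sub>R i) = (\<Sum>i\<in>Basis. ((y - y0) \<bullet> i) * frechet_derivative h (at y0) i)"
        using lin[of y0] that by (simp add: linear_sum linear_scale)
      then show ?thesis by (simp only: euclidean_representation)
    qed
    show ?thesis by (rule continuous_on_eq[OF c1]) (simp only: c2)
  qed
  have clP: "closedin (top_of_set ?B) P" unfolding P_def
  proof (rule closedin_INT)
    show "?B \<noteq> {}" using zB by blast
    show "closedin (top_of_set ?B) {y0 \<in> ?B. ?e y0 y >= 0}" for y
      using continuous_closedin_preimage[OF cont[of y] closed_atLeast[of 0]] by (simp add: vimage_def Int_def)
  qed
  have clN: "closedin (top_of_set ?B) N" unfolding N_def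
  proof (rule closedin_INT)
    show "?B \<noteq> {}" using zB by blast
    show "closedin (top_of_set ?B) {y0 \<in> ?B. ?e y0 y <= 0}" for y
      using continuous_closedin_preimage[OF cont[of y] closed_atMost[of 0]] by (simp add: vimage_def Int_def)
  qed
  have cover: "?B \<subseteq> P \<union> N"
  proof
    fix y0 assume y0: "y0 \<in> ?B"
    have "(\<forall>y\<in>?B. h y0 + frechet_derivative h (at y0) (y - y0) \<le> h y) \<or>
      (\<forall>y\<in>?B. h y \<le> h y0 + frechet_derivative h (at y0) (y - y0))"
      by (rule chart_tangent_side[OF ch S]) (use y0 in auto)
    then show "y0 \<in> P \<union> N"
    proof
      assume a: "\<forall>y\<in>?B. h y0 + frechet_derivative h (at y0) (y - y0) \<le> h y"
      have "?e y0 y \<ge> 0" if "y \<in> ?B" for y using a[rule_format, OF that] by linarith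
      then show ?thesis using y0 by (auto simp: P_def)
    next
      assume a: "\<forall>y\<in>?B. h y \<le> h y0 + frechet_derivative h (at y0) (y - y0)"
      have "?e y0 y \<le> 0" if "y \<in> ?B" for y using a[rule_format, OF that] by linarith
      then show ?thesis using y0 by (auto simp: N_def)
    qed
  qed
  have disj: "P \<inter> N = {}"
  proof (rule ccontr)
    assume "P \<inter> N \<noteq> {}"
    then obtain y0 where y0PN: "y0 \<in> P" "y0 \<in> N" by blast
    have y0: "y0 \<in> ?B" "?e y0 y = 0" if "y \<in> ?B" for y
    proof -
      have "y0 \<in> {y0 \<in> ?B. ?e y0 y \<ge> 0}" "y0 \<in> {y0 \<in> ?B. ?e y0 y \<le> 0}"
        using INT_D[OF y0PN(1)[unfolded P_def] that] INT_D[OF y0PN(2)[unfolded N_def] that] .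
      then show "y0 \<in> ?B" "?e y0 y = 0" by simp_all
    qed
    note y0B = y0(1)[OF zB]
    have y0': "y0 \<in> ball z \<rho>" "y0 \<bullet> b = 0" using y0B by auto
    obtain e where e: "e > 0" "\<And>t. t \<in> ball 0 e \<Longrightarrow> y0 + t *\<^sub>R \<theta> \<in> ball z \<rho>"
      using line_in_ball[OF y0'(1)] by blast
    have z: "line_rem h y0 \<theta> k t = 0" if "t \<in> ball 0 e" for k t
      using that
    proof (induction k arbitrary: t)
      case 0
      have "?e y0 (y0 + t *\<^sub>R \<theta>) = 0" by (rule y0(2)) (use e(2)[OF 0] y0' \<theta>(1) in \<open>auto simp: inner_add_left\<close>)
      then show ?case by (simp add: line_rem_def linear_scale[OF lin[OF y0'(1)]])
    next
      case (Suc k)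
      have "(line_rem h y0 \<theta> k has_real_derivative line_rem h y0 \<theta> (Suc k) t) (at t)"
        by (rule line_rem_deriv[OF hk e(2)[OF Suc.prems]])
      moreover have "(line_rem h y0 \<theta> k has_real_derivative 0) (at t)"
      proof (rule DERIV_cong_ev[THEN iffD1, OF refl _ refl])
        show "((\<lambda>_. 0) has_real_derivative 0) (at t)" by simp
        show "\<forall>\<^sub>F t in nhds t. 0 = line_rem h y0 \<theta> k t"
          using Suc.IH by (auto intro!: eventually_mono[OF eventually_nhds_in_open[OF open_ball Suc.prems]])
      qed
      ultimately show ?case by (rule DERIV_unique)
    qed
    obtain k where k: "k \<ge> 2" "iterated_deriv (replicate k \<theta>) h y0 \<noteq> 0"
      using chart_finite_type[OF ch ft y0' \<theta>] by blast
    then have "line_rem h y0 \<theta> k 0 \<noteq> 0" by (auto simp: line_rem_def)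
    then show False using z[of 0 k] e(1) by simp
  qed
  have "connected ?B"
    by (intro convex_connected convex_Int convex_ball) (simp add: convex_def inner_add_left)
  then have "\<not> (closedin (top_of_set ?B) P \<and> closedin (top_of_set ?B) N \<and> ?B \<subseteq> P \<union> N \<and> P \<inter> N = {} \<and> P \<noteq> {} \<and> N \<noteq> {})"
    unfolding connected_closedin not_ex by (elim allE)
  then have "P = {} \<or> N = {}" using clP clN cover disj by simp
  then show ?thesis
  proof
    assume "N = {}"
    then have "?B \<subseteq> P" using cover by simp
    then show ?thesis by (intro that[of 1]) (auto simp: P_def)
  next
    assume "P = {}"
    then have "?B \<subseteq> N" using cover by simp
    then show ?thesis by (intro that[of "-1"]) (auto simp: N_def)
  qed
qed

section \<open>Uniform bounds for caps\<close>

lemma knapp_exponents: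
  fixes M \<delta> K N r :: real
  assumes pos: "M > 0" "\<delta> > 0" "K \<ge> 0" "N > 0" "r > 0"
    and le: "sqrt M \<le> K * (\<delta> * (N * M)) powr (r / (2 * (r + 1)))"
  shows "M \<le> (K * N powr (r / (2 * (r + 1)))) powr (2 * (r + 1)) * \<delta> powr r"
proof -
  let ?t = "r / (2 * (r + 1))" and ?q = "2 * (r + 1)"
  have half: "1 / 2 - ?t = 1 / ?q" using pos by (simp add: field_simps)
  have tq: "?t * ?q = r" using pos by simp
  have "M powr (1 / 2) \<le> (K * N powr ?t) * \<delta> powr ?t * M powr ?t"
    using le pos by (simp add: powr_half_sqrt powr_mult mult_ac)
  then have "M powr (1 / 2) * M powr (- ?t) \<le> (K * N powr ?t) * \<delta> powr ?t * M powr ?t * M powr (- ?t)"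
    by (intro mult_right_mono) auto
  also have "\<dots> = (K * N powr ?t) * \<delta> powr ?t"
    using pos by (simp add: powr_minus)
  also have "M powr (1 / 2) * M powr (- ?t) = M powr (1 / ?q)"
    unfolding powr_add[symmetric] half[symmetric] by simp
  finally have "M powr (1 / ?q) \<le> (K * N powr ?t) * \<delta> powr ?t" .
  then have "(M powr (1 / ?q)) powr ?q \<le> ((K * N powr ?t) * \<delta> powr ?t) powr ?q"
    by (rule powr_mono2[rotated 2]) (use pos in auto)
  moreover have "(M powr (1 / ?q)) powr ?q = M" using pos by (simp add: powr_powr)
  moreover have "((K * N powr ?t) * \<delta> powr ?t) powr ?q = (K * N powr ?t) powr ?q * \<delta> powr r"
    using pos by (simp add: powr_mult powr_powr tq)
  ultimately show ?thesis by simp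
qed

lemma emeasure_hyperplane_lborel:
  assumes "D \<in> sets borel"
  shows "emeasure (hyperplane_lborel b) D = emeasure lborel ({x. hproj b x \<in> D} \<inter> slab b)"
proof -
  note assms[measurable]
  have "emeasure (hyperplane_lborel b) D = (\<integral>\<^sup>+y. indicator D y \<partial>hyperplane_lborel b)"
    by simp
  also have "\<dots> = (\<integral>\<^sup>+x. indicator D (hproj b x) * indicator (slab b) x \<partial>lborel)"
    by (rule nn_integral_hyperplane_lborel) simp
  also have "\<dots> = (\<integral>\<^sup>+x. indicator ({x. hproj b x \<in> D} \<inter> slab b) x \<partial>lborel)"
    by (intro nn_integral_cong) (simp split: split_indicator)
  also have "\<dots> = emeasure lborel ({x. hproj b x \<in> D} \<inter> slab b)"
    by (rule nn_integral_indicator) measurable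
  finally show ?thesis .
qed

lemma bounded_slab_cylinder:
  assumes "norm b = 1" "bounded D" shows "bounded ({x. hproj b x \<in> D} \<inter> slab b)"
proof -
  obtain B where B: "\<And>y. y \<in> D \<Longrightarrow> norm y \<le> B" using assms(2) by (auto simp: bounded_iff)
  have "norm w \<le> B + 1" if "w \<in> {x. hproj b x \<in> D} \<inter> slab b" for w
  proof -
    have w: "hproj b w \<in> D" "0 \<le> w \<bullet> b" "w \<bullet> b \<le> 1" using that by auto
    have "norm w \<le> norm (hproj b w) + norm ((w \<bullet> b) *\<^sub>R b)"
      by (subst hproj_decomp[of w b]) (rule norm_triangle_ineq)
    then show ?thesis using B[OF w(1)] w assms(1) by simp
  qed
  then show ?thesis by (auto simp: bounded_iff)
qed

lemma emeasure_hyperplane_finite: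
  assumes "norm b = 1" "bounded D" "D \<in> sets borel"
  shows "emeasure (hyperplane_lborel b) D < \<infinity>"
  unfolding emeasure_hyperplane_lborel[OF assms(3)]
  using emeasure_bounded_finite[OF bounded_slab_cylinder[OF assms(1,2)]] by simp

(* With M the measure of the cap's base, the Knapp inequality reads
  M^(1/2) <= K (delta M)^(r/(2(r+1))): the cap, of height delta, is the image of the set Sg below under an affine map
  of determinant +-delta. *)

lemma chart_knapp:
  fixes S :: "(real^'n) set" and r :: real
  assumes ch: "graph_chart S b h z \<rho> W" and \<kappa>: "\<kappa> = 1 \<or> \<kappa> = -1"
    and conv: "\<And>y0 y. y0 \<in> ball z \<rho> \<inter> {y. y \<bullet> b = 0} \<Longrightarrow> y \<in> ball z \<rho> \<inter> {y. y \<bullet> b = 0} \<Longrightarrow>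
       0 \<le> \<kappa> * (h y - h y0 - frechet_derivative h (at y0) (y - y0))"
    and R: "restriction_bounded S (2 * (r + 1) / (r + 2))" "r > 0" and fin: "finite_measure (surface_measure S)"
    and R1: "R1 < \<rho>"
  obtains C where "C \<ge> 0" "\<And>y0 \<delta>. y0 \<in> cball z R1 \<Longrightarrow> y0 \<bullet> b = 0 \<Longrightarrow> \<delta> > 0 \<Longrightarrow>
     emeasure (hyperplane_lborel b) {y \<in> cball z R1. y \<bullet> b = 0 \<and>
       \<kappa> * (h y - h y0 - frechet_derivative h (at y0) (y - y0)) \<le> \<delta>} \<le> ennreal (C * \<delta> powr r)"
proof -
  note c = graph_chartD[OF ch]
  have hk: "diff_on k (ball z \<rho>) h" for k using c(5) by (rule smooth_on_imp_diff_on)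
  have hd: "h differentiable (at y)" if "y \<in> ball z \<rho>" for y by (rule diff_on_imp_differentiable[OF hk that])
  have lin: "linear (frechet_derivative h (at y))" if "y \<in> ball z \<rho>" for y
    using linear_frechet_derivative[OF hd[OF that]] .
  have hc: "continuous_on (ball z \<rho>) h" by (rule diff_on_imp_continuous_on[OF hk])
  let ?p = "2 * (r + 1) / (r + 2)"
  have p: "?p > 0" using R(2) by simp
  have th: "1 - 1 / ?p = r / (2 * (r + 1))" using R(2) by (simp add: field_simps)
  obtain K where K: "K \<ge> 0" "\<And>T x0 X. linear T \<Longrightarrow> det (matrix T) \<noteq> 0 \<Longrightarrow> X \<in> sets (surface_measure S) \<Longrightarrow>
     (\<And>x. x \<in> X \<Longrightarrow> \<exists>u. norm u \<le> 1 \<and> x = x0 + T u) \<Longrightarrow>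
     sqrt (measure (surface_measure S) X) \<le> K * \<bar>det (matrix T)\<bar> powr (r / (2 * (r + 1)))"
  proof (rule knapp[OF R(1) fin p])
    fix K
    assume "K \<ge> 0" "\<And>T x0 X. linear T \<Longrightarrow> det (matrix T) \<noteq> 0 \<Longrightarrow> X \<in> sets (surface_measure S) \<Longrightarrow>
     (\<And>x. x \<in> X \<Longrightarrow> \<exists>u. norm u \<le> 1 \<and> x = x0 + T u) \<Longrightarrow>
     sqrt (measure (surface_measure S) X) \<le> K * \<bar>det (matrix T)\<bar> powr (1 - 1 / ?p)"
    then show ?thesis unfolding th by (rule that)
  qed
  interpret fm: finite_measure "surface_measure S" by (rule fin)
  define N where "N = real CARD('n) ^ CARD('n) * fact CARD('n)"
  have N: "N > 0" by (simp add: N_def)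
  define C where "C = (K * N powr (r / (2 * (r + 1)))) powr (2 * (r + 1))"
  show ?thesis
  proof (rule that[of C])
    show "C \<ge> 0" by (simp add: C_def)
    fix y0 \<delta> assume y0: "y0 \<in> cball z R1" "y0 \<bullet> b = 0" and \<delta>: "(\<delta>::real) > 0"
    have y0b: "y0 \<in> ball z \<rho>" using y0 R1 by auto
    let ?e = "\<lambda>y. h y - h y0 - frechet_derivative h (at y0) (y - y0)"
    define D where "D = {y \<in> cball z R1. y \<bullet> b = 0 \<and> \<kappa> * ?e y \<le> \<delta>}"
    have Dsub: "D \<subseteq> ball z \<rho> \<inter> {y. y \<bullet> b = 0}" using R1 by (auto simp: D_def)
    have lin0: "linear (frechet_derivative h (at y0))" by (rule lin[OF y0b])
    have Dcomp: "compact D"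
    proof -
      have "continuous_on (cball z R1) (\<lambda>y. \<kappa> * ?e y)"
        using R1 lin0
        by (intro continuous_intros continuous_on_subset[OF hc] linear_continuous_on_compose[OF _ lin0]) auto
      from continuous_closed_preimage[OF this closed_cball closed_atMost[of \<delta>]]
      have cl: "closed (cball z R1 \<inter> (\<lambda>y. \<kappa> * ?e y) -` {..\<delta>})" .
      have D_eq: "D = cball z R1 \<inter> ((cball z R1 \<inter> (\<lambda>y. \<kappa> * ?e y) -` {..\<delta>}) \<inter> {y. b \<bullet> y = 0})"
        by (auto simp: D_def inner_commute)
      show ?thesis
        unfolding D_eq by (intro compact_Int_closed compact_cball closed_Int closed_hyperplane cl)
    qed
    \<comment> \<open>Convexity of the chart function is available only as tangent inequalities.
      Those at the intermediate point \<open>?y\<close>, weighted by u and v, give Jensen's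
      inequality because the linear terms cancel.\<close>
    have Dconv: "convex D"
    proof (rule convexI)
      fix y1 y2 u v assume y: "y1 \<in> D" "y2 \<in> D" and uv: "(0::real) \<le> u" "0 \<le> v" "u + v = 1"
      let ?y = "u *\<^sub>R y1 + v *\<^sub>R y2"
      have yR: "?y \<in> cball z R1" using convexD[OF convex_cball, of y1 z R1 y2 u v] y uv by (auto simp: D_def)
      have yb: "?y \<bullet> b = 0" using y by (simp add: D_def inner_add_left)
      have yB: "?y \<in> ball z \<rho> \<inter> {y. y \<bullet> b = 0}" using yR yb R1 by auto
      let ?L = "frechet_derivative h (at ?y)"
      have 1: "0 \<le> \<kappa> * (h y1 - h ?y - ?L (y1 - ?y))" "0 \<le> \<kappa> * (h y2 - h ?y - ?L (y2 - ?y))"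
        using conv[OF yB] y Dsub by blast+
      have l: "linear ?L" using lin yB by blast
      have "u * (\<kappa> * (h y1 - h ?y - ?L (y1 - ?y))) + v * (\<kappa> * (h y2 - h ?y - ?L (y2 - ?y)))
          = \<kappa> * (u * h y1 + v * h y2 - (u + v) * h ?y - (u * ?L (y1 - ?y) + v * ?L (y2 - ?y)))"
        by (simp add: algebra_simps)
      also have "u * ?L (y1 - ?y) + v * ?L (y2 - ?y) = ?L (u *\<^sub>R (y1 - ?y) + v *\<^sub>R (y2 - ?y))"
        by (simp add: linear_add[OF l] linear_scale[OF l])
      also have "u *\<^sub>R (y1 - ?y) + v *\<^sub>R (y2 - ?y) = ?y - (u + v) *\<^sub>R ?y" by (simp add: algebra_simps)
      finally have 2: "u * (\<kappa> * (h y1 - h ?y - ?L (y1 - ?y))) + v * (\<kappa> * (h y2 - h ?y - ?L (y2 - ?y)))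
          = \<kappa> * (u * h y1 + v * h y2 - h ?y)" using uv linear_0[OF l] by simp
      have "0 \<le> \<kappa> * (u * h y1 + v * h y2 - h ?y)"
        unfolding 2[symmetric]
        using mult_nonneg_nonneg[OF uv(1) 1(1)] mult_nonneg_nonneg[OF uv(2) 1(2)] by (rule add_nonneg_nonneg)
      moreover have "\<kappa> * ?e ?y + \<kappa> * (u * h y1 + v * h y2 - h ?y) = u * (\<kappa> * ?e y1) + v * (\<kappa> * ?e y2)"
      proof -
        have "?y - y0 = u *\<^sub>R (y1 - y0) + v *\<^sub>R (y2 - y0)"
          using uv by (simp add: algebra_simps flip: scaleR_add_left)
        then have "frechet_derivative h (at y0) (?y - y0) = u * frechet_derivative h (at y0) (y1 - y0) + v * frechet_derivative h (at y0) (y2 - y0)"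
          by (simp only: linear_add[OF lin0] linear_scale[OF lin0] real_scaleR_def)
        moreover have "u * (\<kappa> * ?e y1) + v * (\<kappa> * ?e y2) = \<kappa> * (u * h y1 + v * h y2
            - (u * frechet_derivative h (at y0) (y1 - y0) + v * frechet_derivative h (at y0) (y2 - y0))) - (u + v) * (\<kappa> * h y0)"
          by (simp add: algebra_simps)
        ultimately show ?thesis unfolding uv(3) by (simp add: right_diff_distrib)
      qed
      moreover have "u * (\<kappa> * ?e y1) + v * (\<kappa> * ?e y2) \<le> u * \<delta> + v * \<delta>"
        using y uv by (intro add_mono mult_left_mono) (auto simp: D_def)
      moreover have "u * \<delta> + v * \<delta> = \<delta>" using uv by (simp flip: distrib_right)
      ultimately have "\<kappa> * ?e ?y \<le> \<delta>" by linarith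
      then show "?y \<in> D" using yR yb by (simp add: D_def)
    qed
    have y0D: "y0 \<in> D" using y0 \<delta> linear_0[OF lin0] by (simp add: D_def)
    have Dborel [measurable]: "D \<in> sets borel" using Dcomp by (rule borel_compact)
    \<comment> \<open>The unit cylinder over the base of the cap, translated so that it contains 0
      as \<open>auerbach_convex\<close> requires. Its volume is the hyperplane measure of the
      base.\<close>
    define Sg where "Sg = {x. hproj b x + y0 \<in> D} \<inter> slab b"
    have hy0: "hproj b (y0 + x) = hproj b x + y0" "(y0 + x) \<bullet> b = x \<bullet> b" for x
      using hproj_id[OF y0(2)] y0(2) by (simp_all add: linear_add[OF linear_hproj] inner_add_left add.commute)
    have Sgb: "Sg \<in> sets borel" unfolding Sg_def by measurable
    have Sg0: "emeasure (hyperplane_lborel b) D = emeasure lborel Sg"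
    proof -
      have "emeasure lborel ({x. hproj b x \<in> D} \<inter> slab b)
          = emeasure (distr lborel borel ((+) y0)) ({x. hproj b x \<in> D} \<inter> slab b)"
        by (simp add: lborel_distr_plus)
      also have "\<dots> = emeasure lborel ((+) y0 -` ({x. hproj b x \<in> D} \<inter> slab b))"
        by (subst emeasure_distr) (auto simp: sets.Int_space_eq2)
      also have "(+) y0 -` ({x. hproj b x \<in> D} \<inter> slab b) = Sg" by (auto simp: Sg_def hy0)
      finally show ?thesis by (simp add: emeasure_hyperplane_lborel)
    qed
    show "emeasure (hyperplane_lborel b) {y \<in> cball z R1. y \<bullet> b = 0 \<and> \<kappa> * ?e y \<le> \<delta>} \<le> ennreal (C * \<delta> powr r)"
      unfolding D_def[symmetric]
    proof (cases "emeasure lborel Sg = 0")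
      case False
      have Sgconv: "convex Sg"
      proof -
        have "Sg = (\<lambda>x. hproj b x) -` ((+) (- y0) ` D) \<inter> slab b" by (force simp: Sg_def)
        moreover have "convex (slab b)" by (auto simp: convex_def inner_add_left intro: convex_bound_le)
        moreover have "convex ((\<lambda>x. hproj b x) -` ((+) (- y0) ` D))"
          by (intro convex_linear_vimage linear_hproj convex_translation Dconv)
        ultimately show ?thesis by (simp add: convex_Int)
      qed
      have Sgcomp: "compact Sg"
      proof -
        have "Sg = {x. hproj b x \<in> (+) (- y0) ` D} \<inter> slab b" by (force simp: Sg_def)
        then have bdd: "bounded Sg"
          by (simp only:) (intro bounded_slab_cylinder c(2) bounded_translation compact_imp_bounded Dcomp)
        have "closed Sg"
        proof -
          have "Sg = (\<lambda>x. hproj b x + y0) -` D \<inter> ({x. 0 \<le> b \<bullet> x} \<inter> {x. b \<bullet> x \<le> 1})"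
            by (auto simp: Sg_def inner_commute)
          then show ?thesis
            by (auto intro!: closed_Int closed_vimage compact_imp_closed[OF Dcomp] continuous_on_add linear_continuous_on[OF bounded_linear_hproj] continuous_on_const
                closed_halfspace_le closed_halfspace_ge)
        qed
        with bdd show ?thesis by (simp only: compact_eq_bounded_closed)
      qed
      have Sg_0: "0 \<in> Sg" using y0D by (simp add: Sg_def linear_0[OF linear_hproj])
      obtain T where T: "linear T" "det (matrix T) \<noteq> 0" "\<And>x. x \<in> Sg \<Longrightarrow> \<exists>u. norm u \<le> 1 \<and> x = T u"
        "\<bar>det (matrix T)\<bar> \<le> N * measure lborel Sg"
      proof (rule auerbach_convex[OF Sgcomp Sgconv Sg_0 False, folded N_def])
        fix T :: "real^'n \<Rightarrow> real^'n"
        assume T: "linear T" "det (matrix T) \<noteq> 0" "\<And>x. x \<in> Sg \<Longrightarrow> \<exists>u. norm u \<le> 1 \<and> x = T u"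
          "\<bar>det (matrix T)\<bar> \<le> N * measure lborel Sg"
        show thesis by (rule that[OF T])
      qed
      define M where "M = measure lborel Sg"
      have emM: "emeasure lborel Sg = ennreal M" unfolding M_def
        using emeasure_compact_finite[OF Sgcomp] by (intro emeasure_eq_ennreal_measure) auto
      then have M: "M > 0" using False by (simp add: ennreal_eq_0_iff not_le)
      define a where "a = hgrad b h y0"
      have ab: "a \<bullet> b = 0" unfolding a_def by (rule hgrad_orth[OF c(2) hd[OF y0b]])
      have av: "a \<bullet> v = frechet_derivative h (at y0) v" if "v \<bullet> b = 0" for v
        unfolding a_def inner_hgrad[OF hd[OF y0b]] hproj_id[OF that] ..
      \<comment> \<open>T1 x = x + (a . x) b + (kappa delta - 1)(b . x) b shears the base hyperplane
        onto the tangent plane and scales b by kappa delta. The unit cylinder thus becomes the layer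
        of height delta next to the tangent plane, which contains the cap.\<close>
      define m where "m = a + (\<kappa> * \<delta> - 1) *\<^sub>R b"
      define T1 where "T1 = (\<lambda>x. x + (m \<bullet> x) *\<^sub>R b)"
      have T1: "linear T1" unfolding T1_def by (auto intro!: linearI simp: algebra_simps)
      have bb: "b \<bullet> b = 1" using c(1) by simp
      have dT1: "det (matrix T1) = \<kappa> * \<delta>" unfolding T1_def det_rank_one by (simp add: m_def inner_add_left ab bb)
      define T2 where "T2 = T1 \<circ> T"
      have T2: "linear T2" unfolding T2_def by (rule linear_compose[OF T(1) T1])
      have "det (matrix T2) = \<kappa> * \<delta> * det (matrix T)"
        unfolding T2_def by (simp add: matrix_compose[OF T(1) T1] det_mul dT1)
      then have dT2: "\<bar>det (matrix T2)\<bar> = \<delta> * \<bar>det (matrix T)\<bar>" using \<kappa> \<delta> by (auto simp: abs_mult)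
      have dT2n: "det (matrix T2) \<noteq> 0" using dT2 \<delta> T(2) by auto
      let ?X = "graph_over b h D"
      have gp: "graph_patch S (b, h, D)" by (rule graph_patch_chart[OF ch Dborel Dsub])
      have XS: "?X \<in> sets (surface_measure S)" using graph_patch_borel(1)[OF gp] by (simp add: sets_surface_measure)
      have "sqrt (measure (surface_measure S) ?X) \<le> K * \<bar>det (matrix T2)\<bar> powr (r / (2 * (r + 1)))"
      proof (rule K(2)[OF T2 dT2n XS, of "y0 + h y0 *\<^sub>R b"])
        fix x assume "x \<in> ?X"
        then obtain y where y: "y \<in> D" "x = y + h y *\<^sub>R b" by (auto simp: graph_over_def)
        have yb: "y \<bullet> b = 0" and ye: "\<kappa> * ?e y \<le> \<delta>" using y(1) by (auto simp: D_def)
        have ypos: "0 \<le> \<kappa> * ?e y" by (rule conv) (use y0b y0 y(1) Dsub in auto)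
        have yy0: "(y - y0) \<bullet> b = 0" using yb y0(2) by (simp add: inner_diff_left)
        define s where "s = (y - y0) + (\<kappa> * ?e y / \<delta>) *\<^sub>R b"
        have "hproj b s = y - y0" using hproj_scale_self[OF c(2)] hproj_id[OF yy0] by (simp add: s_def)
        moreover have sb: "s \<bullet> b = \<kappa> * ?e y / \<delta>" using yy0 bb by (simp add: s_def inner_add_left)
        moreover have "0 \<le> \<kappa> * ?e y / \<delta>" "\<kappa> * ?e y / \<delta> \<le> 1" using ypos ye \<delta> by (simp_all add: divide_le_eq)
        ultimately have "s \<in> Sg" using y(1) by (simp add: Sg_def)
        then obtain u where u: "norm u \<le> 1" "s = T u" using T(3) by blast
        have "m \<bullet> s = frechet_derivative h (at y0) (y - y0) + (\<kappa> * \<delta> - 1) * (\<kappa> * ?e y / \<delta>)"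
          using av[OF yy0] ab sb by (simp add: m_def inner_add_left inner_commute[of b s]) (simp add: s_def inner_add_right ab)
        moreover have "(\<kappa> * \<delta> - 1) * (\<kappa> * ?e y / \<delta>) = ?e y - \<kappa> * ?e y / \<delta>"
          using \<kappa> \<delta> by (auto simp: field_simps)
        ultimately have ms: "m \<bullet> s = h y - h y0 - \<kappa> * ?e y / \<delta>" by simp
        have cancel: "(w + E *\<^sub>R b) + (d - E) *\<^sub>R b = w + d *\<^sub>R b" for w and d E :: real
          by (simp add: algebra_simps)
        have "T1 s = (y - y0) + (h y - h y0) *\<^sub>R b" unfolding T1_def ms unfolding s_def by (rule cancel)
        then have "x = (y0 + h y0 *\<^sub>R b) + T2 u" by (simp add: y(2) T2_def u(2)[symmetric] algebra_simps)
        then show "\<exists>u. norm u \<le> 1 \<and> x = (y0 + h y0 *\<^sub>R b) + T2 u" using u(1) by blast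
      qed
      also have "\<dots> \<le> K * (\<delta> * (N * M)) powr (r / (2 * (r + 1)))"
        unfolding dT2 using T(4) \<delta> R(2) K(1) by (intro mult_left_mono powr_mono2) (auto simp: M_def)
      also have "sqrt M \<le> sqrt (measure (surface_measure S) ?X)"
      proof (rule real_sqrt_le_mono)
        have "ennreal M = (\<integral>\<^sup>+y. indicator D y \<partial>hyperplane_lborel b)" using Sg0 emM by simp
        also have "\<dots> \<le> graph_area b h D"
          unfolding graph_area_eq
        proof (rule nn_integral_mono)
          fix y
          have "1 \<le> ennreal (area_density b h y)" using ennreal_leI[OF area_density_ge_1[of b h y]] by simp
          then show "indicator D y \<le> ennreal (area_density b h y) * indicator D y" by (simp add: indicator_def)
        qed
        also have "\<dots> = emeasure (surface_measure S) ?X"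
          using surface_outer_graph[OF ch Dborel Dsub] emeasure_surface_measure[OF graph_patch_borel(1)[OF gp]] by simp
        also have "\<dots> = ennreal (measure (surface_measure S) ?X)" by (rule fm.emeasure_eq_measure)
        finally show "M \<le> measure (surface_measure S) ?X" by (simp add: ennreal_le_iff)
      qed
      finally have "sqrt M \<le> K * (\<delta> * (N * M)) powr (r / (2 * (r + 1)))" .
      from knapp_exponents[OF M \<delta> K(1) N R(2) this] have "M \<le> C * \<delta> powr r" by (simp add: C_def)
      then show "emeasure (hyperplane_lborel b) D \<le> ennreal (C * \<delta> powr r)"
        unfolding Sg0 emM by (rule ennreal_leI)
    qed (simp add: Sg0)
  qed
qed

section \<open>Finiteness of the surface measure and integration in charts\<close>

lemma graph_area_finite:
  assumes ch: "graph_chart S b h z \<rho> W" and D: "compact D" "D \<subseteq> ball z \<rho>"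
  shows "graph_area b h D < \<infinity>"
proof -
  note c = graph_chartD[OF ch]
  have "continuous_on D (area_density b h)"
    using continuous_on_area_density[OF c(5)] D(2) continuous_on_subset by blast
  then have "bounded (area_density b h ` D)" using D(1) by (intro compact_imp_bounded compact_continuous_image)
  then obtain B where B: "\<And>y. y \<in> D \<Longrightarrow> \<bar>area_density b h y\<bar> \<le> B" by (auto simp: bounded_iff)
  have Db: "D \<in> sets borel" using D(1) by (rule borel_compact)
  have "graph_area b h D \<le> (\<integral>\<^sup>+y. ennreal B * indicator D y \<partial>hyperplane_lborel b)"
    unfolding graph_area_eq
    by (intro nn_integral_mono) (auto simp: indicator_def intro!: ennreal_leI order_trans[OF abs_ge_self] B)
  also have "\<dots> = ennreal B * emeasure (hyperplane_lborel b) D" using Db by (simp add: nn_integral_cmult)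
  also have "\<dots> < \<infinity>"
    using emeasure_hyperplane_finite[OF c(2) compact_imp_bounded[OF D(1)] Db] by (simp add: ennreal_mult_less_top)
  finally show ?thesis .
qed

text \<open>Charts are shrunk to half their radius, so that the bases are compact and the area
  densities bounded; finitely many of them cover S.\<close>

lemma finite_surface_measure:
  fixes S :: "(real^'n) set"
  assumes S: "compact S" "smooth_hypersurface S"
  shows "finite_measure (surface_measure S)"
proof
  let ?s = "surface_measure S"
  have "\<exists>V X. open V \<and> p \<in> V \<and> S \<inter> V \<subseteq> X \<and> X \<in> sets ?s \<and> emeasure ?s X < \<infinity>" if p: "p \<in> S" for p
  proof -
    obtain b h \<rho> W where ch: "graph_chart S b h (hproj b p) \<rho> W" and pW: "p \<in> W"
      by (rule graph_chart_exists[OF S(2) p])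
    note c = graph_chartD[OF ch]
    let ?z = "hproj b p"
    define D where "D = cball ?z (\<rho> / 2) \<inter> {y. b \<bullet> y = 0}"
    have Dc: "compact D" unfolding D_def by (intro compact_Int_closed compact_cball closed_hyperplane)
    have Db: "D \<in> sets borel" using Dc by (rule borel_compact)
    have Ds: "D \<subseteq> ball ?z \<rho> \<inter> {y. y \<bullet> b = 0}" using c(4) by (auto simp: D_def inner_commute)
    have gp: "graph_patch S (b, h, D)" by (rule graph_patch_chart[OF ch Db Ds])
    define V where "V = W \<inter> hproj b -` ball ?z (\<rho> / 2)"
    have "open V" unfolding V_def
      by (intro open_Int c(7) open_vimage linear_continuous_on bounded_linear_hproj open_ball)
    moreover have "p \<in> V" using pW c(4) by (simp add: V_def)
    moreover have "S \<inter> V \<subseteq> graph_over b h D"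
    proof
      fix x assume x: "x \<in> S \<inter> V"
      then have "x \<bullet> b = h (hproj b x)" using c(9) by (auto simp: V_def)
      then have "x = hproj b x + h (hproj b x) *\<^sub>R b" using hproj_decomp[of x b] by simp
      moreover have "hproj b x \<in> D" using x hproj_inner[OF c(2), of x] by (auto simp: V_def D_def inner_commute)
      ultimately show "x \<in> graph_over b h D" by (auto simp: graph_over_def)
    qed
    moreover have "emeasure ?s (graph_over b h D) < \<infinity>"
      using graph_area_finite[OF ch Dc] Ds surface_outer_graph[OF ch Db Ds] emeasure_surface_measure[OF graph_patch_borel(1)[OF gp]]
      by auto
    ultimately show ?thesis using graph_patch_borel(1)[OF gp] by (auto simp: sets_surface_measure)
  qed
  then obtain V X where VX: "\<And>p. p \<in> S \<Longrightarrow> open (V p)" "\<And>p. p \<in> S \<Longrightarrow> p \<in> V p" "\<And>p. p \<in> S \<Longrightarrow> S \<inter> V p \<subseteq> X p"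
    "\<And>p. p \<in> S \<Longrightarrow> X p \<in> sets ?s" "\<And>p. p \<in> S \<Longrightarrow> emeasure ?s (X p) < \<infinity>"
    by metis
  obtain F where F: "F \<subseteq> S" "finite F" "S \<subseteq> (\<Union>p\<in>F. V p)"
    using compactE_image[OF S(1), of S V] VX(1,2) by blast
  have sp: "space ?s = S"
    using sets_eq_imp_space_eq[OF sets_surface_measure[of S]] by (simp add: space_restrict_space)
  have "emeasure ?s S \<le> emeasure ?s (\<Union>p\<in>F. X p)"
    by (rule emeasure_mono) (use F VX(3,4) in \<open>blast intro!: sets.finite_UN\<close>)+
  also have "\<dots> \<le> (\<Sum>p\<in>F. emeasure ?s (X p))"
    by (rule emeasure_subadditive_finite) (use F VX(4) in auto)
  also have "\<dots> < \<infinity>" using F VX(5) by (auto simp: less_top[symmetric])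
  finally show "emeasure ?s (space ?s) \<noteq> \<infinity>" by (simp add: sp)
qed

text \<open>Proved as an equality of two Borel measures, the surface measure on the patch and the
  push-forward of the area density. Densities and push-forwards transform Bochner integrals
  unconditionally, so F need only be measurable.\<close>

lemma chart_integral:
  fixes S :: "(real^'n) set" and F :: "real^'n \<Rightarrow> complex"
  assumes ch: "graph_chart S b h z \<rho> W" and D: "D \<in> sets borel" "D \<subseteq> ball z \<rho> \<inter> {y. y \<bullet> b = 0}"
    and F: "F \<in> borel_measurable borel"
  shows "(LINT x|surface_measure S. indicator (graph_over b h D) x *\<^sub>R F x)
      = (LINT y|hyperplane_lborel b. indicator D y *\<^sub>R (area_density b h y *\<^sub>R F (y + h y *\<^sub>R b)))"
proof -
  note c = graph_chartD[OF ch]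
  let ?s = "surface_measure S" and ?H = "hyperplane_lborel b" and ?G = "graph_over b h D"
  have gp: "graph_patch S (b, h, D)" by (rule graph_patch_chart[OF ch D])
  have hc: "continuous_on D h"
    using smooth_on_continuous[OF c(5), of "[]"] D(2) continuous_on_subset by auto
  define \<gamma> where "\<gamma> y = indicator D y *\<^sub>R (y + h y *\<^sub>R b)" for y
  have \<gamma>m [measurable]: "\<gamma> \<in> borel_measurable borel"
    unfolding \<gamma>_def by (rule borel_measurable_continuous_on_indicator[OF D(1)]) (intro continuous_intros hc)
  have \<gamma>D: "\<gamma> y = y + h y *\<^sub>R b" if "y \<in> D" for y using that by (simp add: \<gamma>_def)
  have Gs: "?G \<in> sets ?s" using graph_patch_borel(1)[OF gp] by (simp add: sets_surface_measure)
  have idm: "(\<lambda>x. x) \<in> measurable ?s borel"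
    unfolding measurable_cong_sets[OF sets_surface_measure refl] by (rule measurable_restrict_space1) simp
  let ?J = "\<lambda>y. indicator D y * area_density b h y"
  have Jm: "?J \<in> borel_measurable borel"
    using borel_measurable_continuous_on_indicator[OF D(1), of "area_density b h"]
      continuous_on_subset[OF continuous_on_area_density[OF c(5)], of D] D(2) by auto
  have eq: "distr (density ?s (indicator ?G)) borel (\<lambda>x. x) = distr (density ?H (\<lambda>y. ennreal (?J y))) borel \<gamma>"
  proof (rule measure_eqI)
    fix B assume "B \<in> sets (distr (density ?s (indicator ?G)) borel (\<lambda>x. x))"
    then have B: "B \<in> sets borel" by simp
    have BS: "B \<inter> S \<in> sets ?s" using B by (auto simp: sets_surface_measure sets_restrict_space)
    have sp: "space ?s = S"
      using sets_eq_imp_space_eq[OF sets_surface_measure[of S]] by (simp add: space_restrict_space)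
    have "emeasure (distr (density ?s (indicator ?G)) borel (\<lambda>x. x)) B = emeasure (density ?s (indicator ?G)) (B \<inter> S)"
      using B idm by (subst emeasure_distr) (auto simp: sp)
    also have "\<dots> = (\<integral>\<^sup>+x. indicator ?G x * indicator (B \<inter> S) x \<partial>?s)"
      by (rule emeasure_density) (use BS Gs in auto)
    also have "\<dots> = (\<integral>\<^sup>+x. indicator (?G \<inter> (B \<inter> S)) x \<partial>?s)"
      by (intro nn_integral_cong) (simp split: split_indicator)
    also have "\<dots> = emeasure ?s (?G \<inter> (B \<inter> S))" by (rule nn_integral_indicator) (use BS Gs in auto)
    also have "?G \<inter> (B \<inter> S) = graph_over b h (D \<inter> \<gamma> -` B)"
      using graph_patch_borel(1)[OF gp] \<gamma>D by (auto simp: graph_over_def sets_restrict_space)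
    also have "emeasure ?s (graph_over b h (D \<inter> \<gamma> -` B)) = graph_area b h (D \<inter> \<gamma> -` B)"
    proof -
      have D': "D \<inter> \<gamma> -` B \<in> sets borel" "D \<inter> \<gamma> -` B \<subseteq> ball z \<rho> \<inter> {y. y \<bullet> b = 0}"
        using D measurable_sets[OF \<gamma>m B] by auto
      show ?thesis
        using surface_outer_graph[OF ch D'] emeasure_surface_measure[OF graph_patch_borel(1)[OF graph_patch_chart[OF ch D']]] by simp
    qed
    also have "\<dots> = (\<integral>\<^sup>+y. ennreal (?J y) * indicator (\<gamma> -` B) y \<partial>?H)"
      unfolding graph_area_eq by (intro nn_integral_cong) (simp split: split_indicator)
    also have "\<dots> = emeasure (density ?H (\<lambda>y. ennreal (?J y))) (\<gamma> -` B)"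
      by (rule emeasure_density[symmetric]) (use Jm measurable_sets[OF \<gamma>m B] in auto)
    also have "\<dots> = emeasure (distr (density ?H (\<lambda>y. ennreal (?J y))) borel \<gamma>) B"
      using B by (subst emeasure_distr) auto
    finally show "emeasure (distr (density ?s (indicator ?G)) borel (\<lambda>x. x)) B
        = emeasure (distr (density ?H (\<lambda>y. ennreal (?J y))) borel \<gamma>) B" .
  qed simp
  have Fs: "F \<in> borel_measurable ?s" using measurable_compose[OF idm F] by simp
  have "(LINT x|?s. indicator ?G x *\<^sub>R F x) = (LINT x|density ?s (\<lambda>x. ennreal (indicator ?G x)). F x)"
    by (rule integral_density[symmetric]) (use Fs Gs in auto)
  also have "\<dots> = (LINT x|density ?s (indicator ?G). F x)" by (simp add: ennreal_indicator)
  also have "\<dots> = (LINT x|distr (density ?s (indicator ?G)) borel (\<lambda>x. x). F x)"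
    by (rule integral_distr[symmetric]) (use idm F in auto)
  also have "\<dots> = (LINT y|density ?H (\<lambda>y. ennreal (?J y)). F (\<gamma> y))"
    unfolding eq by (rule integral_distr) (use F in auto)
  also have "\<dots> = (LINT y|?H. ?J y *\<^sub>R F (\<gamma> y))"
    by (rule integral_density) (use Jm F order_trans[OF zero_le_one area_density_ge_1[of b h]] in \<open>auto simp: indicator_def\<close>)
  also have "\<dots> = (LINT y|?H. indicator D y *\<^sub>R (area_density b h y *\<^sub>R F (y + h y *\<^sub>R b)))"
    by (rule Bochner_Integration.integral_cong) (auto simp: \<gamma>_def indicator_def)
  finally show ?thesis .
qed

section \<open>Symbol estimates along exponential rays\<close>

lemma jet_sum:
  assumes "finite I" "\<And>i. i \<in> I \<Longrightarrow> jet K (C i) w (u i)" "\<And>s. s \<in> {0..1} \<Longrightarrow> 0 \<le> w s"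
  shows "jet K (\<Sum>i\<in>I. C i) w (\<lambda>s. \<Sum>i\<in>I. u i s)"
  using assms(1,2)
proof (induction I rule: finite_induct)
  case empty
  show ?case using jet_mono[OF jet_const_zero[of 0 K]] by simp
next
  case (insert i I)
  then show ?case using jet_add[of K "C i" w "u i" "\<Sum>i\<in>I. C i" "\<lambda>s. \<Sum>i\<in>I. u i s"] by simp
qed

text \<open>Unlike in \<open>jet_cmult\<close> the factor goes into the weight, and the constant
  stays independent of it. This matters because tau is a frequency and unbounded.\<close>

lemma jet_scale:
  "jet K C w u \<Longrightarrow> 0 \<le> \<tau> \<Longrightarrow> jet K C (\<lambda>s. \<tau> * w s) (\<lambda>s. of_real \<tau> * u s)"
proof (induction K arbitrary: u)
  case 0
  then show ?case
    by (auto intro!: continuous_intros simp: norm_mult mult.left_commute[of C] mult_left_mono)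
next
  case (Suc K)
  obtain u' where u': "\<forall>s\<in>{0..1}. (u has_vector_derivative u' s) (at s within {0..1})" "jet K C w u'"
    using Suc.prems by auto
  have "norm (of_real \<tau> * u s) \<le> C * (\<tau> * w s)" if "s \<in> {0..1}" for s
    using jet_bound[OF Suc.prems(1) that] Suc.prems(2)
    by (simp add: norm_mult mult.left_commute[of C] mult_left_mono)
  moreover have "((\<lambda>s. of_real \<tau> * u s) has_vector_derivative of_real \<tau> * u' s) (at s within {0..1})" if "s \<in> {0..1}" for s
    by (intro has_vector_derivative_mult_right u'(1)[rule_format] that)
  ultimately show ?case
    unfolding jet.simps(2) using Suc.IH[OF u'(2) Suc.prems(2)]
    by (intro conjI ballI exI[of _ "\<lambda>s. of_real \<tau> * u' s"])
qed

lemma jet_SucI: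
  assumes "\<And>s. s \<in> {0..1} \<Longrightarrow> norm (u s) \<le> C * w s"
    "\<And>s. s \<in> {0..1} \<Longrightarrow> (u has_vector_derivative u' s) (at s within {0..1})" "jet K C w u'"
  shows "jet (Suc K) C w u"
  unfolding jet.simps(2) using assms by blast

lemma jet_exp_self: "jet K 1 (\<lambda>s. exp s * \<bar>l\<bar>) (\<lambda>s. of_real (exp s * l))"
proof (induction K)
  case 0
  show ?case by (auto intro!: continuous_intros simp: norm_mult abs_mult)
next
  case (Suc K)
  show ?case
  proof (rule jet_SucI[OF _ _ Suc])
    show "((\<lambda>s. of_real (exp s * l) :: complex) has_vector_derivative of_real (exp s * l)) (at s within {0..1})" for s
      by (rule has_vector_derivative_of_real) (auto intro!: derivative_eq_intros)
  qed (simp add: abs_mult norm_mult)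
qed

lemma exp_ray_has_derivative:
  assumes "f differentiable (at (z + exp s *\<^sub>R v))"
  shows "((\<lambda>s. f (z + exp s *\<^sub>R v)) has_real_derivative
      (\<Sum>i\<in>Basis. (exp s * (v \<bullet> i)) * frechet_derivative f (at (z + exp s *\<^sub>R (v::'a::euclidean_space))) i)) (at s within T)"
proof -
  let ?D = "frechet_derivative f (at (z + exp s *\<^sub>R v))"
  have D: "(f has_derivative ?D) (at (z + exp s *\<^sub>R v))"
    using assms frechet_derivative_works by blast
  have l: "linear ?D" using D by (rule has_derivative_linear)
  have "((\<lambda>s. z + exp s *\<^sub>R v) has_derivative (\<lambda>t. (t * exp s) *\<^sub>R v)) (at s)"
    by (auto intro!: derivative_eq_intros)
  from has_derivative_compose[OF this D]
  have "((\<lambda>s. f (z + exp s *\<^sub>R v)) has_derivative (\<lambda>t. ?D ((t * exp s) *\<^sub>R v))) (at s)" .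
  moreover have "?D v = (\<Sum>i\<in>Basis. (v \<bullet> i) * ?D i)"
  proof -
    have "?D (\<Sum>i\<in>Basis. (v \<bullet> i) *\<^sub>R i) = (\<Sum>i\<in>Basis. (v \<bullet> i) * ?D i)" by (simp add: linear_sum[OF l] linear_scale[OF l])
    then show ?thesis by (simp only: euclidean_representation)
  qed
  then have "(\<lambda>t. ?D ((t * exp s) *\<^sub>R v)) = (*) (\<Sum>i\<in>Basis. (exp s * (v \<bullet> i)) * ?D i)"
    by (auto simp: fun_eq_iff linear_scale[OF l] sum_distrib_left sum_distrib_right mult_ac)
  ultimately have "((\<lambda>s. f (z + exp s *\<^sub>R v)) has_real_derivative (\<Sum>i\<in>Basis. (exp s * (v \<bullet> i)) * ?D i)) (at s)"
    by (simp add: has_field_derivative_def)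
  then show ?thesis by (rule has_field_derivative_at_within)
qed

text \<open>The constant is uniform over all rays that stay in Q: a derivative in s produces factors
  e^s (v . i), which e^s <= 3 bounds by 3 V.\<close>

lemma jet_ray:
  fixes a :: "'a::euclidean_space \<Rightarrow> real"
  assumes "open U" "compact Q" "Q \<subseteq> U" "V \<ge> 0" "diff_on K U a"
  shows "\<exists>C\<ge>0. \<forall>z v. norm v \<le> V \<and> (\<forall>s\<in>{0..1}. z + exp s *\<^sub>R v \<in> Q) \<longrightarrow>
    jet K C (\<lambda>_. 1) (\<lambda>s. of_real (a (z + exp s *\<^sub>R v)))"
  using assms(5)
proof (induction K arbitrary: a)
  case 0
  have ca: "continuous_on Q a" using diff_on_imp_continuous_on[OF 0] assms(3) continuous_on_subset by blast
  then have "bounded (a ` Q)" using assms(2) by (intro compact_imp_bounded compact_continuous_image)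
  then obtain B where B: "\<And>x. x \<in> Q \<Longrightarrow> \<bar>a x\<bar> \<le> B" by (auto simp: bounded_iff)
  show ?case
  proof (intro exI[of _ "max 0 B"] conjI allI impI; (elim conjE)?)
    fix z v :: 'a assume *: "\<forall>s\<in>{0..1}. z + exp s *\<^sub>R v \<in> Q"
    have "continuous_on {0..1} (\<lambda>s. a (z + exp s *\<^sub>R v))"
      by (rule continuous_on_compose2[OF ca]) (use * in \<open>auto intro!: continuous_intros\<close>)
    then show "jet 0 (max 0 B) (\<lambda>_. 1) (\<lambda>s. of_real (a (z + exp s *\<^sub>R v)))"
      using B * by (auto intro!: continuous_intros simp: le_max_iff_disj)
  qed simp
next
  case (Suc K)
  have ca: "continuous_on Q a" using diff_on_imp_continuous_on[OF Suc.prems] assms(3) continuous_on_subset by blast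
  then have "bounded (a ` Q)" using assms(2) by (intro compact_imp_bounded compact_continuous_image)
  then obtain B where B: "\<And>x. x \<in> Q \<Longrightarrow> \<bar>a x\<bar> \<le> B" by (auto simp: bounded_iff)
  have "\<forall>i. \<exists>C\<ge>0. \<forall>z v. norm v \<le> V \<and> (\<forall>s\<in>{0..1}. z + exp s *\<^sub>R v \<in> Q) \<longrightarrow>
    jet K C (\<lambda>_. 1) (\<lambda>s. of_real (frechet_derivative a (at (z + exp s *\<^sub>R v)) i))"
    using Suc.IH[OF diff_on_deriv[OF Suc.prems]] by blast
  from choice[OF this] obtain C where C: "\<And>i. C i \<ge> 0"
    "\<And>i z v. norm v \<le> V \<Longrightarrow> (\<forall>s\<in>{0..1}. z + exp s *\<^sub>R v \<in> Q) \<Longrightarrow>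
    jet K (C i) (\<lambda>_. 1) (\<lambda>s. of_real (frechet_derivative a (at (z + exp s *\<^sub>R v)) i))"
    by blast
  define D where "D = (\<Sum>i\<in>(Basis::'a set). 2 ^ K * (3 * V * C i))"
  have D: "D \<ge> 0" unfolding D_def using C(1) assms(4) by (intro sum_nonneg mult_nonneg_nonneg) auto
  show ?case
  proof (intro exI[of _ "max B D"] conjI allI impI; (elim conjE)?)
    show "0 \<le> max B D" using D by (simp add: le_max_iff_disj)
    fix z v :: 'a assume v: "norm v \<le> V" and *: "\<forall>s\<in>{0..1}. z + exp s *\<^sub>R v \<in> Q"
    let ?u = "\<lambda>s. \<Sum>i\<in>Basis. (exp s * (v \<bullet> i)) * frechet_derivative a (at (z + exp s *\<^sub>R v)) i"
    have "jet K (2 ^ K * (3 * V * C i)) (\<lambda>_. 1) (\<lambda>s. of_real (exp s * (v \<bullet> i)) * of_real (frechet_derivative a (at (z + exp s *\<^sub>R v)) i))"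
      if i: "i \<in> Basis" for i
    proof (rule jet_mono[OF jet_mult[OF jet_mono[OF jet_exp_self, of "v \<bullet> i" "3 * V" "\<lambda>_. 1"] C(2)[OF v *]]])
      fix s :: real assume s: "s \<in> {0..1}"
      have "exp s \<le> exp 1" using s by simp
      also have "exp 1 \<le> (3::real)" using exp_le by simp
      finally show "1 * (exp s * \<bar>v \<bullet> i\<bar>) \<le> 3 * V * 1"
        using Basis_le_norm[OF i, of v] v by (simp add: mult_mono)
    qed simp
    from jet_sum[OF finite_Basis this]
    have "jet K D (\<lambda>_. 1) (\<lambda>s. of_real (?u s))" by (simp add: D_def)
    then have j: "jet K (max B D) (\<lambda>_. 1) (\<lambda>s. of_real (?u s))" by (rule jet_mono) simp
    show "jet (Suc K) (max B D) (\<lambda>_. 1) (\<lambda>s. of_real (a (z + exp s *\<^sub>R v)))"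
    proof (rule jet_SucI[OF _ _ j])
      fix s :: real assume s: "s \<in> {0..1}"
      have zU: "z + exp s *\<^sub>R v \<in> U" using * s assms(3) by blast
      show "norm (of_real (a (z + exp s *\<^sub>R v)) :: complex) \<le> max B D * 1"
        using B * s by (auto simp: le_max_iff_disj)
      show "((\<lambda>s. of_real (a (z + exp s *\<^sub>R v)) :: complex) has_vector_derivative of_real (?u s)) (at s within {0..1})"
        by (rule has_vector_derivative_of_real[OF exp_ray_has_derivative[OF diff_on_imp_differentiable[OF Suc.prems zU]]])
    qed
  qed
qed

lemma log_scale_has_derivative:
  assumes "(L j has_real_derivative L (Suc j) (exp s * \<rho>)) (at (exp s * \<rho>))"
  shows "((\<lambda>s. (exp s * \<rho>) ^ j * L j (exp s * \<rho>)) has_real_derivative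
     (real j * ((exp s * \<rho>) ^ j * L j (exp s * \<rho>)) + (exp s * \<rho>) ^ Suc j * L (Suc j) (exp s * \<rho>))) (at s within T)"
proof -
  have e: "((\<lambda>s. exp s * \<rho>) has_real_derivative exp s * \<rho>) (at s)"
    by (auto intro!: derivative_eq_intros)
  have 1: "((\<lambda>s. L j (exp s * \<rho>)) has_real_derivative L (Suc j) (exp s * \<rho>) * (exp s * \<rho>)) (at s)"
    by (rule DERIV_chain2[OF assms e])
  have 2: "((\<lambda>s. (exp s * \<rho>) ^ j) has_real_derivative real j * (exp s * \<rho>) ^ j) (at s)"
    using DERIV_power[OF e, of j] by (cases j) (simp_all add: mult_ac)
  from DERIV_mult[OF 2 1] show ?thesis
    by (auto simp: algebra_simps intro: has_field_derivative_at_within)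
qed

text \<open>With t = e^s rho one has d/ds (t^j L_j(t)) = j t^j L_j(t) + t^(j+1) L_(j+1)(t). The
  family of these functions is closed under d/ds and each is O(L_0), so L_0 itself is an admissible
  weight. K derivatives starting from index j reach index j + K <= J.\<close>

lemma jet_log_scale:
  "j + K \<le> J \<Longrightarrow> \<exists>D\<ge>0. \<forall>(L :: nat \<Rightarrow> real \<Rightarrow> real) \<rho>.
     (\<forall>i\<le>J. \<forall>s\<in>{0..1}. (L i has_real_derivative L (Suc i) (exp s * \<rho>)) (at (exp s * \<rho>)) \<and>
        \<bar>(exp s * \<rho>) ^ i * L i (exp s * \<rho>)\<bar> \<le> C * L 0 (exp s * \<rho>)) \<and>
     (\<forall>s\<in>{0..1}. 0 \<le> L 0 (exp s * \<rho>)) \<longrightarrow>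
     jet K D (\<lambda>s. L 0 (exp s * \<rho>)) (\<lambda>s. of_real ((exp s * \<rho>) ^ j * L j (exp s * \<rho>)))"
proof (induction K arbitrary: j)
  case 0
  show ?case
  proof (intro exI[of _ "max 0 C"] conjI allI impI; (elim conjE)?)
    fix L :: "nat \<Rightarrow> real \<Rightarrow> real" and \<rho> :: real
    assume d: "\<forall>i\<le>J. \<forall>s\<in>{0..1}. (L i has_real_derivative L (Suc i) (exp s * \<rho>)) (at (exp s * \<rho>)) \<and>
        \<bar>(exp s * \<rho>) ^ i * L i (exp s * \<rho>)\<bar> \<le> C * L 0 (exp s * \<rho>)"
      and p: "\<forall>s\<in>{0..1}. 0 \<le> L 0 (exp s * \<rho>)"
    have "continuous_on {0..1} (\<lambda>s. (exp s * \<rho>) ^ j * L j (exp s * \<rho>))"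
      using 0 d by (intro DERIV_continuous_on[OF log_scale_has_derivative]) auto
    moreover have "norm (of_real ((exp s * \<rho>) ^ j * L j (exp s * \<rho>)) :: complex) \<le> max 0 C * L 0 (exp s * \<rho>)"
      if s: "s \<in> {0..1}" for s
    proof -
      have "\<bar>(exp s * \<rho>) ^ j * L j (exp s * \<rho>)\<bar> \<le> C * L 0 (exp s * \<rho>)" using d 0 s by auto
      also have "\<dots> \<le> max 0 C * L 0 (exp s * \<rho>)" using p s by (intro mult_right_mono) auto
      finally show ?thesis by (simp only: norm_of_real)
    qed
    ultimately show "jet 0 (max 0 C) (\<lambda>s. L 0 (exp s * \<rho>)) (\<lambda>s. of_real ((exp s * \<rho>) ^ j * L j (exp s * \<rho>)))"
      unfolding jet.simps by (intro conjI ballI continuous_on_of_real)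
  qed simp
next
  case (Suc K)
  let ?A = "\<lambda>(L :: nat \<Rightarrow> real \<Rightarrow> real) \<rho>. (\<forall>i\<le>J. \<forall>s\<in>{0..1}. (L i has_real_derivative L (Suc i) (exp s * \<rho>)) (at (exp s * \<rho>)) \<and>
        \<bar>(exp s * \<rho>) ^ i * L i (exp s * \<rho>)\<bar> \<le> C * L 0 (exp s * \<rho>)) \<and> (\<forall>s\<in>{0..1}. 0 \<le> L 0 (exp s * \<rho>))"
  have le: "j + K \<le> J" "Suc j + K \<le> J" using Suc.prems by auto
  obtain D1 where D1: "D1 \<ge> 0" "\<And>L \<rho>. ?A L \<rho> \<Longrightarrow> jet K D1 (\<lambda>s. L 0 (exp s * \<rho>)) (\<lambda>s. of_real ((exp s * \<rho>) ^ j * L j (exp s * \<rho>)))"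
    using Suc.IH[OF le(1)] by blast
  obtain D2 where D2: "D2 \<ge> 0" "\<And>L \<rho>. ?A L \<rho> \<Longrightarrow> jet K D2 (\<lambda>s. L 0 (exp s * \<rho>)) (\<lambda>s. of_real ((exp s * \<rho>) ^ Suc j * L (Suc j) (exp s * \<rho>)))"
    using Suc.IH[OF le(2)] by blast
  define D where "D = max C (2 ^ K * (norm (of_real (real j) :: complex) * D1) + D2)"
  show ?case
  proof (intro exI[of _ D] conjI allI impI)
    show "0 \<le> D" using D1 D2 by (simp add: D_def le_max_iff_disj)
    fix L \<rho> assume A: "?A L \<rho>"
    have "jet K (2 ^ K * (norm (of_real (real j) :: complex) * D1) + D2) (\<lambda>s. L 0 (exp s * \<rho>))
       (\<lambda>s. of_real (real j) * of_real ((exp s * \<rho>) ^ j * L j (exp s * \<rho>)) + of_real ((exp s * \<rho>) ^ Suc j * L (Suc j) (exp s * \<rho>)))"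
      by (rule jet_add[OF jet_cmult[OF D1(2)[OF A]] D2(2)[OF A]])
    then have j: "jet K D (\<lambda>s. L 0 (exp s * \<rho>))
       (\<lambda>s. of_real (real j) * of_real ((exp s * \<rho>) ^ j * L j (exp s * \<rho>)) + of_real ((exp s * \<rho>) ^ Suc j * L (Suc j) (exp s * \<rho>)))"
      by (rule jet_mono) (use A in \<open>auto simp: D_def intro!: mult_right_mono\<close>)
    show "jet (Suc K) D (\<lambda>s. L 0 (exp s * \<rho>)) (\<lambda>s. of_real ((exp s * \<rho>) ^ j * L j (exp s * \<rho>)))"
    proof (rule jet_SucI[OF _ _ j])
      fix s :: real assume s: "s \<in> {0..1}"
      have "\<bar>(exp s * \<rho>) ^ j * L j (exp s * \<rho>)\<bar> \<le> C * L 0 (exp s * \<rho>)" using A le s by auto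
      also have "\<dots> \<le> D * L 0 (exp s * \<rho>)" using A s by (intro mult_right_mono) (auto simp: D_def)
      finally show "norm (of_real ((exp s * \<rho>) ^ j * L j (exp s * \<rho>)) :: complex) \<le> D * L 0 (exp s * \<rho>)"
        by (simp only: norm_of_real)
      have "(L j has_real_derivative L (Suc j) (exp s * \<rho>)) (at (exp s * \<rho>))" using A le s by auto
      from has_vector_derivative_of_real[OF log_scale_has_derivative[OF this]]
      show "((\<lambda>s. of_real ((exp s * \<rho>) ^ j * L j (exp s * \<rho>)) :: complex) has_vector_derivative
         of_real (real j) * of_real ((exp s * \<rho>) ^ j * L j (exp s * \<rho>)) + of_real ((exp s * \<rho>) ^ Suc j * L (Suc j) (exp s * \<rho>))) (at s within {0..1})"
        by (simp only: of_real_add of_real_mult)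
    qed
  qed
qed

text \<open>The phase p(s) = tau L_0(e^s rho) + e^s l has p' = tau t L_1 + e^s l >= p, and p'' is a
  symbol of weight 1 + p' with constant E1 + E2 + 1, independent of tau, l and rho. Since p''
  contains L_2 and is differentiated N more times, N + 2 derivatives of the phase enter.\<close>

lemma ray_oscillation:
  assumes J: "N + 2 \<le> J"
  obtains B where "B \<ge> 0" "\<And>(L :: nat \<Rightarrow> real \<Rightarrow> real) \<rho> \<tau> l u.
     \<lbrakk>\<And>i s. i \<le> J \<Longrightarrow> s \<in> {0..1} \<Longrightarrow> (L i has_real_derivative L (Suc i) (exp s * \<rho>)) (at (exp s * \<rho>));
      \<And>i s. i \<le> J \<Longrightarrow> s \<in> {0..1} \<Longrightarrow> \<bar>(exp s * \<rho>) ^ i * L i (exp s * \<rho>)\<bar> \<le> C * L 0 (exp s * \<rho>);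
      \<And>s. s \<in> {0..1} \<Longrightarrow> 0 \<le> L 0 (exp s * \<rho>);
      \<And>s. s \<in> {0..1} \<Longrightarrow> L 0 (exp s * \<rho>) \<le> exp s * \<rho> * L 1 (exp s * \<rho>);
      0 \<le> \<tau>; 0 \<le> l; jet N A (indicator {0<..<1}) u\<rbrakk> \<Longrightarrow>
     norm (integral {0..1} (\<lambda>s. u s * exp (- \<i> * of_real (\<tau> * L 0 (exp s * \<rho>) + exp s * l))))
       \<le> B / (1 + (\<tau> * L 0 \<rho> + l)) ^ N"
proof -
  have J1: "1 + N \<le> J" and J2: "2 + N \<le> J" using J by auto
  let ?A = "\<lambda>(L :: nat \<Rightarrow> real \<Rightarrow> real) \<rho>. (\<forall>i\<le>J. \<forall>s\<in>{0..1}. (L i has_real_derivative L (Suc i) (exp s * \<rho>)) (at (exp s * \<rho>)) \<and>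
        \<bar>(exp s * \<rho>) ^ i * L i (exp s * \<rho>)\<bar> \<le> C * L 0 (exp s * \<rho>)) \<and> (\<forall>s\<in>{0..1}. 0 \<le> L 0 (exp s * \<rho>))"
  obtain E1 where E1: "E1 \<ge> 0" "\<And>L \<rho>. ?A L \<rho> \<Longrightarrow> jet N E1 (\<lambda>s. L 0 (exp s * \<rho>)) (\<lambda>s. of_real ((exp s * \<rho>) ^ 1 * L 1 (exp s * \<rho>)))"
    using jet_log_scale[OF J1, of C] by blast
  obtain E2 where E2: "E2 \<ge> 0" "\<And>L \<rho>. ?A L \<rho> \<Longrightarrow> jet N E2 (\<lambda>s. L 0 (exp s * \<rho>)) (\<lambda>s. of_real ((exp s * \<rho>) ^ 2 * L 2 (exp s * \<rho>)))"
    using jet_log_scale[OF J2, of C] by blast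
  obtain B where B: "B \<ge> 0" "\<And>p p1 p2 u. \<lbrakk>\<And>s. s \<in> {0..1} \<Longrightarrow> 0 \<le> p s \<and> p s \<le> p1 s;
      \<And>s. s \<in> {0..1} \<Longrightarrow> (p has_real_derivative p1 s) (at s within {0..1});
      \<And>s. s \<in> {0..1} \<Longrightarrow> (p1 has_real_derivative p2 s) (at s within {0..1});
      jet N (E1 + E2 + 1) (\<lambda>s. 1 + p1 s) (\<lambda>s. of_real (p2 s)); jet N A (indicator {0<..<1}) u\<rbrakk> \<Longrightarrow>
      norm (integral {0..1} (\<lambda>s. u s * exp (- \<i> * of_real (p s)))) \<le> B / (1 + p 0) ^ N"
    using oscillatory_bound[of N "E1 + E2 + 1" A] by blast
  show ?thesis
  proof (rule that[OF B(1)])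
    fix L :: "nat \<Rightarrow> real \<Rightarrow> real" and \<rho> \<tau> l :: real and u
    assume d: "\<And>i s. i \<le> J \<Longrightarrow> s \<in> {0..1} \<Longrightarrow> (L i has_real_derivative L (Suc i) (exp s * \<rho>)) (at (exp s * \<rho>))"
      and b: "\<And>i s. i \<le> J \<Longrightarrow> s \<in> {0..1} \<Longrightarrow> \<bar>(exp s * \<rho>) ^ i * L i (exp s * \<rho>)\<bar> \<le> C * L 0 (exp s * \<rho>)"
      and p0: "\<And>s. s \<in> {0..1} \<Longrightarrow> 0 \<le> L 0 (exp s * \<rho>)"
      and p1: "\<And>s. s \<in> {0..1} \<Longrightarrow> L 0 (exp s * \<rho>) \<le> exp s * \<rho> * L 1 (exp s * \<rho>)"
      and nn: "0 \<le> \<tau>" "0 \<le> l" and u: "jet N A (indicator {0<..<1}) u"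
    have AL: "?A L \<rho>" using d b p0 by blast
    define p where "p s = \<tau> * L 0 (exp s * \<rho>) + exp s * l" for s
    define q where "q s = \<tau> * ((exp s * \<rho>) ^ 1 * L 1 (exp s * \<rho>)) + exp s * l" for s
    define w where "w s = \<tau> * ((exp s * \<rho>) ^ 1 * L 1 (exp s * \<rho>) + (exp s * \<rho>) ^ 2 * L 2 (exp s * \<rho>)) + exp s * l" for s
    have pq: "0 \<le> p s \<and> p s \<le> q s" if "s \<in> {0..1}" for s
      using p0[OF that] mult_left_mono[OF p1[OF that] nn(1)] nn by (simp add: p_def q_def)
    have J0: "0 \<le> J" "1 \<le> J" using J by auto
    have dp: "(p has_real_derivative q s) (at s within {0..1})" if "s \<in> {0..1}" for s
      using log_scale_has_derivative[of L 0 s \<rho> "{0..1}", OF d[OF J0(1) that]]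
      unfolding p_def[abs_def] q_def by (auto intro!: derivative_eq_intros)
    have dq: "(q has_real_derivative w s) (at s within {0..1})" if "s \<in> {0..1}" for s
    proof -
      have "((\<lambda>s. exp s * l) has_real_derivative exp s * l) (at s within {0..1})"
        by (auto intro!: derivative_eq_intros)
      from DERIV_add[OF DERIV_cmult[OF log_scale_has_derivative[of L 1 s \<rho> "{0..1}", OF d[OF J0(2) that]], of \<tau>] this]
      show ?thesis unfolding q_def[abs_def] w_def by (simp add: numeral_2_eq_2)
    qed
    have "jet N (E1 + E2 + 1) (\<lambda>s. 1 + q s)
        (\<lambda>s. of_real \<tau> * (of_real ((exp s * \<rho>) ^ 1 * L 1 (exp s * \<rho>)) + of_real ((exp s * \<rho>) ^ 2 * L 2 (exp s * \<rho>))) + of_real (exp s * l))"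
    proof (rule jet_add)
      show "jet N (E1 + E2) (\<lambda>s. 1 + q s)
        (\<lambda>s. of_real \<tau> * (of_real ((exp s * \<rho>) ^ 1 * L 1 (exp s * \<rho>)) + of_real ((exp s * \<rho>) ^ 2 * L 2 (exp s * \<rho>))))"
      proof (rule jet_mono[OF jet_scale[OF jet_add[OF E1(2)[OF AL] E2(2)[OF AL]] nn(1)]])
        fix s :: real assume s: "s \<in> {0..1}"
        have "\<tau> * L 0 (exp s * \<rho>) \<le> 1 + q s"
          using mult_left_mono[OF p1[OF s] nn(1)] nn by (simp add: q_def) (smt (verit) exp_ge_zero mult_nonneg_nonneg)
        then show "(E1 + E2) * (\<tau> * L 0 (exp s * \<rho>)) \<le> (E1 + E2) * (1 + q s)"
          using E1(1) E2(1) by (intro mult_left_mono) auto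
      qed
      show "jet N 1 (\<lambda>s. 1 + q s) (\<lambda>s. of_real (exp s * l))"
      proof (rule jet_mono[OF jet_exp_self])
        fix s :: real assume s: "s \<in> {0..1}"
        have "0 \<le> \<tau> * (exp s * \<rho> * L 1 (exp s * \<rho>))"
          by (rule mult_nonneg_nonneg[OF nn(1) order_trans[OF p0[OF s] p1[OF s]]])
        then show "1 * (exp s * \<bar>l\<bar>) \<le> 1 * (1 + q s)" using nn(2) by (simp add: q_def)
      qed
    qed
    then have jw: "jet N (E1 + E2 + 1) (\<lambda>s. 1 + q s) (\<lambda>s. of_real (w s))"
      by (rule jet_cong) (simp add: w_def)
    have "norm (integral {0..1} (\<lambda>s. u s * exp (- \<i> * of_real (p s)))) \<le> B / (1 + p 0) ^ N"
      by (rule B(2)[OF pq dp dq jw u])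
    then show "norm (integral {0..1} (\<lambda>s. u s * exp (- \<i> * of_real (\<tau> * L 0 (exp s * \<rho>) + exp s * l))))
       \<le> B / (1 + (\<tau> * L 0 \<rho> + l)) ^ N" unfolding p_def by simp
  qed
qed

section \<open>Dyadic sums over sublevel sets and averaging over dilations\<close>

text \<open>The layer 2^(k-1) < Phi <= 2^k contributes at most 2^N 2^(-kN) C (2^k / X)^r, and the
  layer Phi <= 1 likewise with k = 0. This is a geometric series of ratio q = 2^r / 2^N, which
  converges because N > r.\<close>

lemma sublevel_integral:
  fixes \<Phi> :: "'a \<Rightarrow> real" and C X r :: real
  assumes C: "C \<ge> 0" and X: "X > 0" and N: "real N > r"
    and meas: "\<And>\<delta>. {y \<in> Y. \<Phi> y \<le> \<delta>} \<in> sets M"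
    and sub: "\<And>\<delta>. \<delta> > 0 \<Longrightarrow> emeasure M {y \<in> Y. \<Phi> y \<le> \<delta>} \<le> ennreal (C * (\<delta> / X) powr r)"
    and pos: "\<And>y. y \<in> Y \<Longrightarrow> \<Phi> y \<ge> 0"
  shows "(\<integral>\<^sup>+y. ennreal (1 / (1 + \<Phi> y) ^ N) * indicator Y y \<partial>M)
     \<le> ennreal (2 ^ N / (1 - 2 powr r / 2 ^ N) * C * X powr (- r))"
proof -
  define q where "q = 2 powr r / (2::real) ^ N"
  have q: "0 \<le> q" "q < 1"
  proof -
    have "2 powr r < (2::real) powr real N" using N by (intro powr_less_mono) auto
    then show "q < 1" by (simp add: q_def powr_realpow)
  qed (simp add: q_def)
  define a where "a = 2 ^ N * C * X powr (- r)"
  have a: "a \<ge> 0" using C by (simp add: a_def)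
  have "(\<integral>\<^sup>+y. ennreal (1 / (1 + \<Phi> y) ^ N) * indicator Y y \<partial>M)
      \<le> (\<integral>\<^sup>+y. (\<Sum>k. ennreal (2 ^ N * (1 / 2 ^ N) ^ k) * indicator {y \<in> Y. \<Phi> y \<le> 2 ^ k} y) \<partial>M)"
  proof (rule nn_integral_mono)
    fix y
    show "ennreal (1 / (1 + \<Phi> y) ^ N) * indicator Y y
        \<le> (\<Sum>k. ennreal (2 ^ N * (1 / 2 ^ N) ^ k) * indicator {y \<in> Y. \<Phi> y \<le> 2 ^ k} y)"
    proof (cases "y \<in> Y")
      case True
      have ex: "\<exists>k. \<Phi> y \<le> 2 ^ k" using real_arch_pow[of 2 "\<Phi> y"] by (auto intro: less_imp_le)
      define k where "k = (LEAST k. \<Phi> y \<le> 2 ^ k)"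
      have k: "\<Phi> y \<le> 2 ^ k" unfolding k_def using ex by (rule LeastI_ex)
      have le: "1 / (1 + \<Phi> y) ^ N \<le> 2 ^ N * (1 / 2 ^ N) ^ k"
      proof (cases k)
        case 0
        have "1 / (1 + \<Phi> y) ^ N \<le> 1" using pos[OF True] by (simp add: one_le_power)
        also have "\<dots> \<le> 2 ^ N" by simp
        finally show ?thesis using 0 by simp
      next
        case (Suc j)
        have "\<not> \<Phi> y \<le> 2 ^ j" using not_less_Least[of j "\<lambda>k. \<Phi> y \<le> 2 ^ k"] Suc by (simp add: k_def)
        then have "(2 ^ j) ^ N \<le> (1 + \<Phi> y) ^ N" by (intro power_mono) auto
        then have "1 / (1 + \<Phi> y) ^ N \<le> 1 / (2 ^ j) ^ N" by (intro frac_le) auto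
        also have "\<dots> = 2 ^ N * (1 / 2 ^ N) ^ k"
          by (simp add: Suc power_one_over power_mult[symmetric] mult.commute field_simps)
        finally show ?thesis .
      qed
      have "ennreal (1 / (1 + \<Phi> y) ^ N) * indicator Y y \<le> (\<Sum>k\<in>{k}. ennreal (2 ^ N * (1 / 2 ^ N) ^ k) * indicator {y \<in> Y. \<Phi> y \<le> 2 ^ k} y)"
        using True k le by (simp add: ennreal_leI)
      also have "\<dots> \<le> (\<Sum>k. ennreal (2 ^ N * (1 / 2 ^ N) ^ k) * indicator {y \<in> Y. \<Phi> y \<le> 2 ^ k} y)"
        by (rule sum_le_suminf) auto
      finally show ?thesis .
    qed simp
  qed
  also have "\<dots> = (\<Sum>k. ennreal (2 ^ N * (1 / 2 ^ N) ^ k) * emeasure M {y \<in> Y. \<Phi> y \<le> 2 ^ k})"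
    using meas by (subst nn_integral_suminf) (auto simp: nn_integral_cmult)
  also have "\<dots> \<le> (\<Sum>k. ennreal (a * q ^ k))"
  proof (rule suminf_le)
    fix k :: nat
    have "ennreal (2 ^ N * (1 / 2 ^ N) ^ k) * emeasure M {y \<in> Y. \<Phi> y \<le> 2 ^ k}
       \<le> ennreal (2 ^ N * (1 / 2 ^ N) ^ k) * ennreal (C * (2 ^ k / X) powr r)"
      by (intro mult_left_mono sub) auto
    also have "\<dots> = ennreal ((2 ^ N * (1 / 2 ^ N) ^ k) * (C * (2 ^ k / X) powr r))"
      using C by (simp add: ennreal_mult[symmetric])
    also have "(2 ^ N * (1 / 2 ^ N) ^ k) * (C * (2 ^ k / X) powr r) = a * q ^ k"
    proof -
      have "(2 ^ k / X) powr r = (2 powr r) ^ k * X powr (- r)"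
      proof -
        have "(2 ^ k / X) powr r = (2 ^ k) powr r / X powr r" using X by (simp add: powr_divide)
        also have "(2 ^ k :: real) powr r = (2 powr r) ^ k"
          by (simp add: powr_powr mult.commute flip: powr_realpow)
        finally show ?thesis by (simp add: powr_minus divide_inverse)
      qed
      then show ?thesis by (simp add: a_def q_def power_divide)
    qed
    finally show "ennreal (2 ^ N * (1 / 2 ^ N) ^ k) * emeasure M {y \<in> Y. \<Phi> y \<le> 2 ^ k} \<le> ennreal (a * q ^ k)" .
  qed auto
  also have "\<dots> = ennreal (a * (1 / (1 - q)))"
    using a q sums_mult[OF geometric_sums[of q], of a] by (intro suminf_ennreal_eq) auto
  also have "a * (1 / (1 - q)) = 2 ^ N / (1 - 2 powr r / 2 ^ N) * C * X powr (- r)"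
    by (simp add: a_def q_def)
  finally show ?thesis .
qed

lemma integral_hyperplane_lborel:
  fixes F :: "'a::euclidean_space \<Rightarrow> 'b::{banach,second_countable_topology}"
  assumes "F \<in> borel_measurable borel"
  shows "(LINT y|hyperplane_lborel b. F y) = (LINT x|lborel. indicator (slab b) x *\<^sub>R F (hproj b x))"
proof -
  have [measurable]: "F \<in> borel_measurable borel" by (rule assms)
  have "(LINT y|hyperplane_lborel b. F y) = (LINT x|density lborel (indicator (slab b)). F (hproj b x))"
    unfolding hyperplane_lborel_def by (rule integral_distr) measurable
  also have "\<dots> = (LINT x|density lborel (\<lambda>x. ennreal (indicator (slab b) x)). F (hproj b x))"
    by (simp add: ennreal_indicator)
  also have "\<dots> = (LINT x|lborel. indicator (slab b) x *\<^sub>R F (hproj b x))"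
    by (rule integral_density) auto
  finally show ?thesis .
qed

text \<open>The dilation of the hyperplane about y0 is extended by the identity along b to an affine
  map of the whole space. It preserves the slab and has n - 1 equal factors e^s as Jacobian.\<close>

lemma integral_hyperplane_dilation:
  fixes F :: "'a::euclidean_space \<Rightarrow> complex"
  assumes b: "b \<in> Basis" and y: "y0 \<bullet> b = 0" and F: "F \<in> borel_measurable borel"
  shows "(LINT x|lborel. indicator (slab b) x *\<^sub>R F (hproj b x))
    = of_real (exp (real (DIM('a) - 1) * s)) * (LINT x|lborel. indicator (slab b) x *\<^sub>R F (y0 + exp s *\<^sub>R (hproj b x - y0)))"
proof -
  have [measurable]: "F \<in> borel_measurable borel" by (rule F)
  define c where "c j = (if j = b then 1 else exp s)" for j :: 'a
  define T where "T x = (y0 - exp s *\<^sub>R y0) + (\<Sum>j\<in>Basis. (c j * (x \<bullet> j)) *\<^sub>R j)" for x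
  have nb: "norm b = 1" "b \<bullet> b = 1" using b by simp_all
  have Teq: "T x = (y0 + exp s *\<^sub>R (hproj b x - y0)) + (x \<bullet> b) *\<^sub>R b" for x
  proof -
    have "(\<Sum>j\<in>Basis. (c j * (x \<bullet> j)) *\<^sub>R j) = (\<Sum>j\<in>Basis. (exp s * (hproj b x \<bullet> j)) *\<^sub>R j + ((x \<bullet> b) * (b \<bullet> j)) *\<^sub>R j)"
    proof (rule sum.cong[OF refl])
      fix j :: 'a assume j: "j \<in> Basis"
      show "(c j * (x \<bullet> j)) *\<^sub>R j = (exp s * (hproj b x \<bullet> j)) *\<^sub>R j + ((x \<bullet> b) * (b \<bullet> j)) *\<^sub>R j"
        using b j by (auto simp: c_def hproj_def inner_diff_left inner_not_same_Basis)
    qed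
    also have "\<dots> = exp s *\<^sub>R (\<Sum>j\<in>Basis. (hproj b x \<bullet> j) *\<^sub>R j) + (x \<bullet> b) *\<^sub>R (\<Sum>j\<in>Basis. (b \<bullet> j) *\<^sub>R j)"
      by (simp add: sum.distrib scaleR_sum_right)
    finally show ?thesis by (simp add: T_def euclidean_representation algebra_simps)
  qed
  have hT: "hproj b (T x) = y0 + exp s *\<^sub>R (hproj b x - y0)" "T x \<bullet> b = x \<bullet> b" for x
    using hproj_scale_self[OF nb(1)] nb y hproj_inner[OF nb(1), of x]
    by (auto simp: Teq hproj_id inner_add_left inner_diff_left)
  have Tm [measurable]: "T \<in> borel_measurable borel" unfolding T_def by measurable
  have prod: "(\<Prod>j\<in>(Basis::'a set). \<bar>c j\<bar>) = exp (real (DIM('a) - 1) * s)"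
  proof -
    have "(\<Prod>j\<in>(Basis::'a set). \<bar>c j\<bar>) = (\<Prod>j\<in>(Basis::'a set) - {b}. exp s)"
      using b by (subst prod.remove[of _ b]) (auto simp: c_def intro!: prod.cong)
    also have "\<dots> = exp s ^ (DIM('a) - 1)" using b by (simp only: prod_constant card_Diff_singleton)
    also have "\<dots> = exp (real (DIM('a) - 1) * s)" by (rule exp_of_nat_mult[symmetric])
    finally show ?thesis .
  qed
  have lb: "lborel = density (distr lborel borel T) (\<lambda>_. ennreal (exp (real (DIM('a) - 1) * s)))"
    unfolding T_def prod[symmetric] by (rule lborel_affine_euclidean) (simp add: c_def)
  have "(LINT x|lborel. indicator (slab b) x *\<^sub>R F (hproj b x))
     = (LINT x|density (distr lborel borel T) (\<lambda>_. ennreal (exp (real (DIM('a) - 1) * s))). indicator (slab b) x *\<^sub>R F (hproj b x))"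
    using lb by simp
  also have "\<dots> = (LINT x|distr lborel borel T. exp (real (DIM('a) - 1) * s) *\<^sub>R (indicator (slab b) x *\<^sub>R F (hproj b x)))"
    by (rule integral_density) auto
  also have "\<dots> = (LINT x|lborel. exp (real (DIM('a) - 1) * s) *\<^sub>R (indicator (slab b) (T x) *\<^sub>R F (hproj b (T x))))"
    by (rule integral_distr) measurable
  also have "\<dots> = (LINT x|lborel. exp (real (DIM('a) - 1) * s) *\<^sub>R (indicator (slab b) x *\<^sub>R F (y0 + exp s *\<^sub>R (hproj b x - y0))))"
    by (simp add: hT indicator_def)
  finally show ?thesis by (simp add: scaleR_conv_of_real)
qed

text \<open>For each s the dilation y -> y0 + e^s (y - y0) leaves the integral of F unchanged up to
  the Jacobian. Averaging over s with weight kappa and exchanging the integrals puts an integral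
  along a ray inside, where oscillation can be exploited before taking absolute values.\<close>

lemma dilation_average:
  fixes F :: "'a::euclidean_space \<Rightarrow> complex" and \<kappa> :: "real \<Rightarrow> real"
  assumes b: "b \<in> Basis" and y: "y0 \<bullet> b = 0" and F: "F \<in> borel_measurable borel" "\<And>y. norm (F y) \<le> B"
    "\<And>y. y \<notin> cball z R \<Longrightarrow> F y = 0" and \<kappa>: "continuous_on {0..1} \<kappa>" "\<And>s. s \<in> {0..1} \<Longrightarrow> 0 \<le> \<kappa> s"
  shows "ennreal (integral {0..1} \<kappa> * norm (LINT y|hyperplane_lborel b. F y))
    \<le> (\<integral>\<^sup>+y. ennreal (norm (LINT s|lborel. indicator {0..1} s *\<^sub>R
          (of_real (\<kappa> s * exp (real (DIM('a) - 1) * s)) * F (y0 + exp s *\<^sub>R (y - y0))))) \<partial>hyperplane_lborel b)"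
proof -
  have [measurable]: "F \<in> borel_measurable borel" by (rule F)
  let ?d = "real (DIM('a) - 1)"
  define k where "k s = indicator {0..1} s *\<^sub>R \<kappa> s" for s
  have km [measurable]: "k \<in> borel_measurable borel"
    unfolding k_def by (rule borel_measurable_continuous_on_indicator[OF _ \<kappa>(1)]) simp
  have "bounded (\<kappa> ` {0..1})" using \<kappa>(1) by (intro compact_imp_bounded compact_continuous_image) auto
  then obtain Bk where Bk: "\<And>s. s \<in> {0..1} \<Longrightarrow> \<bar>\<kappa> s\<bar> \<le> Bk"
    unfolding bounded_iff by (metis imageI real_norm_def)
  define \<Psi> where "\<Psi> s x = of_real (k s * exp (?d * s)) * (indicator (slab b) x *\<^sub>R F (y0 + exp s *\<^sub>R (hproj b x - y0)))" for s x
  \<comment> \<open>As e^s >= 1, a ray point in \<open>cball z R\<close> has |y - y0| <= R + |z -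
    y0| at its start, hence |y| <= Rb. All integrands therefore live on one set of finite measure,
    and Fubini applies.\<close>
  define Rb where "Rb = \<bar>R\<bar> + norm (z - y0) + norm y0"
  define Xs where "Xs = {x. hproj b x \<in> cball 0 Rb} \<inter> slab b"
  have nb: "norm b = 1" using b by simp
  have [measurable]: "cball 0 Rb \<in> sets (borel :: 'a measure)" "slab b \<in> sets borel" by auto
  have Xsb: "Xs \<in> sets borel" unfolding Xs_def by measurable
  have Xsf: "emeasure lborel Xs < \<infinity>"
    unfolding Xs_def using emeasure_bounded_finite[OF bounded_slab_cylinder[OF nb bounded_cball[of 0 Rb]]] by simp
  have supp: "\<Psi> s x = 0" if "\<not> (s \<in> {0..1} \<and> x \<in> Xs)" for s x
  proof (rule ccontr)
    assume nz: "\<Psi> s x \<noteq> 0"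
    then have s: "s \<in> {0..1}" and x: "x \<in> slab b" and "F (y0 + exp s *\<^sub>R (hproj b x - y0)) \<noteq> 0"
      by (auto simp: \<Psi>_def k_def indicator_def split: if_splits)
    then have "y0 + exp s *\<^sub>R (hproj b x - y0) \<in> cball z R" using F(3) by blast
    then have "norm (exp s *\<^sub>R (hproj b x - y0) - (z - y0)) \<le> R" by (simp add: dist_norm norm_minus_commute algebra_simps)
    then have "norm (exp s *\<^sub>R (hproj b x - y0)) \<le> R + norm (z - y0)"
      using norm_triangle_ineq2[of "exp s *\<^sub>R (hproj b x - y0)" "z - y0"] by linarith
    moreover have "1 * norm (hproj b x - y0) \<le> exp s * norm (hproj b x - y0)" using s by (intro mult_right_mono) auto
    ultimately have "norm (hproj b x) \<le> Rb"
      using norm_triangle_ineq2[of "hproj b x" y0] by (simp add: Rb_def)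
    then show False using that s x by (simp add: Xs_def)
  qed
  have \<Psi>m [measurable]: "(\<lambda>(s, x). \<Psi> s x) \<in> borel_measurable (lborel \<Otimes>\<^sub>M lborel)"
    unfolding \<Psi>_def by measurable
  have \<Psi>b: "norm (\<Psi> s x) \<le> Bk * exp ?d * B" if "s \<in> {0..1}" for s x
  proof -
    have "norm (\<Psi> s x) \<le> (\<bar>k s\<bar> * exp (?d * s)) * B"
      unfolding \<Psi>_def norm_mult using F(2)[of "y0 + exp s *\<^sub>R (hproj b x - y0)"] norm_ge_zero[THEN order_trans, OF F(2)]
      by (intro mult_mono) (auto simp: indicator_def norm_mult abs_mult)
    also have "\<dots> \<le> (Bk * exp ?d) * B"
      using that Bk[OF that] norm_ge_zero[THEN order_trans, OF F(2)]
      by (intro mult_right_mono mult_mono) (auto simp: k_def mult_left_le intro: order_trans[OF abs_ge_zero])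
    finally show ?thesis .
  qed
  have int: "integrable (lborel \<Otimes>\<^sub>M lborel) (\<lambda>(s, x). \<Psi> s x)"
  proof (rule Bochner_Integration.integrable_bound)
    show "integrable ((lborel :: real measure) \<Otimes>\<^sub>M (lborel :: 'a measure)) (\<lambda>p. indicator ({0..1::real} \<times> Xs) p *\<^sub>R (Bk * exp ?d * B))"
    proof (rule integrable_scaleR_left, rule integrable_real_indicator)
      show "{0..1::real} \<times> Xs \<in> sets (lborel \<Otimes>\<^sub>M lborel)" using Xsb by (intro pair_measureI) auto
      have "emeasure (lborel \<Otimes>\<^sub>M lborel) ({0..1::real} \<times> Xs) = emeasure lborel {0..1::real} * emeasure lborel Xs"
        using Xsb by (intro lborel.emeasure_pair_measure_Times) auto
      then show "emeasure (lborel \<Otimes>\<^sub>M lborel) ({0..1::real} \<times> Xs) < \<infinity>" using Xsf by (simp add: ennreal_mult_less_top)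
    qed
    show "AE p in lborel \<Otimes>\<^sub>M lborel. norm (case p of (s, x) \<Rightarrow> \<Psi> s x) \<le> norm (indicator ({0..1::real} \<times> Xs) p *\<^sub>R (Bk * exp ?d * B))"
    proof (rule AE_I2, clarify)
      fix s x
      show "norm (\<Psi> s x) \<le> norm (indicator ({0..1::real} \<times> Xs) (s, x) *\<^sub>R (Bk * exp ?d * B))"
        using \<Psi>b[of s x] supp[of s x] by (cases "s \<in> {0..1} \<and> x \<in> Xs") (auto simp: indicator_def)
    qed
  qed measurable
  have inner1: "(LINT x|lborel. \<Psi> s x) = of_real (k s) * (LINT y|hyperplane_lborel b. F y)" for s
  proof -
    have "(LINT x|lborel. \<Psi> s x) = of_real (k s * exp (?d * s)) * (LINT x|lborel. indicator (slab b) x *\<^sub>R F (y0 + exp s *\<^sub>R (hproj b x - y0)))"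
      unfolding \<Psi>_def by (rule integral_mult_right_zero)
    also have "\<dots> = of_real (k s) * (LINT x|lborel. indicator (slab b) x *\<^sub>R F (hproj b x))"
      unfolding integral_hyperplane_dilation[OF b y F(1), of s] by simp
    finally show ?thesis by (simp add: integral_hyperplane_lborel[OF F(1)])
  qed
  have kint: "(LINT s|lborel. k s) = integral {0..1} \<kappa>"
    using borel_integrable_compact[of "{0..1}" \<kappa>] \<kappa>(1) set_borel_integral_eq_integral(2)[of "{0..1}" \<kappa>]
    by (simp add: k_def set_lebesgue_integral_def set_integrable_def if_distrib indicator_def cong: if_cong)
  have k0: "integral {0..1} \<kappa> \<ge> 0" using \<kappa> by (intro integral_nonneg integrable_continuous_interval) auto
  have "of_real (integral {0..1} \<kappa>) * (LINT y|hyperplane_lborel b. F y) = (LINT s|lborel. (LINT x|lborel. \<Psi> s x))"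
    unfolding inner1 kint[symmetric] by simp
  also have "\<dots> = (LINT x|lborel. (LINT s|lborel. \<Psi> s x))"
    using lborel_pair.Fubini_integral[OF int] by simp
  finally have eq: "of_real (integral {0..1} \<kappa>) * (LINT y|hyperplane_lborel b. F y) = (LINT x|lborel. (LINT s|lborel. \<Psi> s x))" .
  have "ennreal (integral {0..1} \<kappa> * norm (LINT y|hyperplane_lborel b. F y)) = ennreal (norm (LINT x|lborel. (LINT s|lborel. \<Psi> s x)))"
    unfolding eq[symmetric] using k0 by (simp add: norm_mult)
  also have "\<dots> \<le> (\<integral>\<^sup>+x. ennreal (norm (LINT s|lborel. \<Psi> s x)) \<partial>lborel)"
    by (rule integral_norm_bound_ennreal) (rule lborel_pair.integrable_snd[OF int])
  also have "\<dots> = (\<integral>\<^sup>+x. ennreal (norm (LINT s|lborel. indicator {0..1} s *\<^sub>R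
          (of_real (\<kappa> s * exp (?d * s)) * F (y0 + exp s *\<^sub>R (hproj b x - y0))))) * indicator (slab b) x \<partial>lborel)"
  proof (intro nn_integral_cong)
    fix x
    have "\<Psi> s x = indicator (slab b) x *\<^sub>R (indicator {0..1} s *\<^sub>R
          (of_real (\<kappa> s * exp (?d * s)) * F (y0 + exp s *\<^sub>R (hproj b x - y0))))" for s
      by (simp add: \<Psi>_def k_def indicator_def)
    then show "ennreal (norm (LINT s|lborel. \<Psi> s x)) = ennreal (norm (LINT s|lborel. indicator {0..1} s *\<^sub>R
          (of_real (\<kappa> s * exp (?d * s)) * F (y0 + exp s *\<^sub>R (hproj b x - y0))))) * indicator (slab b) x"
      by (simp add: indicator_def)
  qed
  also have "\<dots> = (\<integral>\<^sup>+y. ennreal (norm (LINT s|lborel. indicator {0..1} s *\<^sub>R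
          (of_real (\<kappa> s * exp (?d * s)) * F (y0 + exp s *\<^sub>R (y - y0))))) \<partial>hyperplane_lborel b)"
  proof (rule nn_integral_hyperplane_lborel[symmetric])
    have e: "indicator {0..1} s *\<^sub>R (of_real (\<kappa> s * exp (?d * s)) * w) = of_real (k s * exp (?d * s)) * w" for s and w :: complex
      by (simp add: k_def indicator_def)
    show "(\<lambda>y. ennreal (norm (LINT s|lborel. indicator {0..1} s *\<^sub>R
          (of_real (\<kappa> s * exp (?d * s)) * F (y0 + exp s *\<^sub>R (y - y0)))))) \<in> borel_measurable borel"
      unfolding e by measurable
  qed
  finally show ?thesis .
qed

section \<open>Oscillatory integrals with convex phase\<close>

lemma convex_minimizer_deriv:
  fixes f :: "'a::real_normed_vector \<Rightarrow> real"
  assumes Y: "convex Y" "y0 \<in> Y" "w \<in> Y" and min: "\<And>y. y \<in> Y \<Longrightarrow> f y0 \<le> f y"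
    and d: "((\<lambda>t. f (y0 + t *\<^sub>R (w - y0))) has_real_derivative l) (at 0)"
  shows "0 \<le> l"
proof (rule ccontr)
  assume "\<not> 0 \<le> l"
  then obtain e where e: "e > 0" "\<And>h. 0 < h \<Longrightarrow> h < e \<Longrightarrow> f (y0 + (0 + h) *\<^sub>R (w - y0)) < f (y0 + 0 *\<^sub>R (w - y0))"
    using DERIV_neg_dec_right[OF d] by auto
  define h where "h = min 1 (e / 2)"
  have h: "0 < h" "h < e" "h \<le> 1" using e(1) by (auto simp: h_def)
  have "y0 + h *\<^sub>R (w - y0) = (1 - h) *\<^sub>R y0 + h *\<^sub>R w" by (simp add: algebra_simps)
  also have "\<dots> \<in> Y" using h by (intro convexD[OF Y(1) Y(2) Y(3)]) auto
  finally show False using min e(2)[OF h(1,2)] by force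
qed

text \<open>R is the radius of the support of the amplitude and 2 R that of the ball on which the
  phase is minimized. A point y whose ray from y0 meets the support has |y - y0| <= 3 R; with e^s <=
  3 the ray has length at most 9 R and stays in the ball of radius 11 R, within the contact range 12
  R and, by 48 R <= rho, well inside the domain of g. The unit vector theta0 serves the degenerate
  ray v = 0.\<close>

locale convex_phase =
  fixes b z \<theta>0 :: "'a::euclidean_space" and g :: "'a \<Rightarrow> real" and \<rho> R Cf :: real and N :: nat
  assumes b: "b \<in> Basis" and z: "z \<bullet> b = 0" and \<theta>0: "\<theta>0 \<bullet> b = 0" "norm \<theta>0 = 1"
    and smooth: "smooth_on (ball z \<rho>) g" and R: "0 < R" "48 * R \<le> \<rho>"
    and conv: "\<And>y0 y. y0 \<in> ball z \<rho> \<inter> {y. y \<bullet> b = 0} \<Longrightarrow> y \<in> ball z \<rho> \<inter> {y. y \<bullet> b = 0} \<Longrightarrow>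
       0 \<le> g y - g y0 - frechet_derivative g (at y0) (y - y0)"
    and contact: "\<And>y \<theta> t j. y \<in> cball z (\<rho> / 2) \<inter> {y. y \<bullet> b = 0} \<Longrightarrow> \<theta> \<bullet> b = 0 \<Longrightarrow> norm \<theta> = 1 \<Longrightarrow>
       0 < t \<Longrightarrow> t \<le> 12 * R \<Longrightarrow> j \<le> N + 2 \<Longrightarrow>
       t ^ j * \<bar>line_rem g y \<theta> j t\<bar> \<le> Cf * line_rem g y \<theta> 0 t"
begin

definition rem :: "'a \<Rightarrow> 'a \<Rightarrow> real" where
  "rem y0 y = g y - g y0 - frechet_derivative g (at y0) (y - y0)"

abbreviation Y2 :: "'a set" where "Y2 \<equiv> cball z (2 * R) \<inter> {y. y \<bullet> b = 0}"
abbreviation Y1 :: "'a set" where "Y1 \<equiv> cball z R \<inter> {y. y \<bullet> b = 0}"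

lemma gk: "diff_on k (ball z \<rho>) g"
  using smooth by (rule smooth_on_imp_diff_on)

lemma norm_b: "norm b = 1"
  using b by simp

lemma compact_Y: "compact Y2" "compact Y1"
proof -
  have "{y. y \<bullet> b = 0} = {y. b \<bullet> y = 0}" by (simp add: inner_commute)
  then show "compact Y2" "compact Y1"
    by (simp_all only:) (intro compact_Int_closed compact_cball closed_hyperplane)+
qed

lemma convex_Y2: "convex Y2"
proof -
  have "{y. y \<bullet> b = 0} = {y. b \<bullet> y = 0}" by (simp add: inner_commute)
  then show ?thesis by (simp only:) (intro convex_Int convex_cball convex_hyperplane)
qed

lemma ray_in_ball:
  assumes "y0 \<in> cball z (2 * R)" "norm v \<le> 3 * R" "s \<in> {0..1::real}"
  shows "y0 + exp s *\<^sub>R v \<in> cball z (11 * R)"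
proof -
  have "exp s \<le> exp 1" using assms(3) by simp
  also have "exp 1 \<le> (3::real)" using exp_le by simp
  finally have "exp s * norm v \<le> 3 * (3 * R)" using assms(2) by (intro mult_mono) auto
  moreover have "norm (y0 + exp s *\<^sub>R v - z) \<le> norm (y0 - z) + norm (exp s *\<^sub>R v)"
    using norm_triangle_ineq[of "y0 - z" "exp s *\<^sub>R v"] by (simp add: algebra_simps)
  ultimately show ?thesis using assms(1) by (simp add: dist_norm norm_minus_commute)
qed

text \<open>Writing v = |v| theta brings the ray into the form of \<open>ray_oscillation\<close>
  with scale |v|: contact gives the symbol bounds, convexity at y0 the sign of the remainder L_0,
  and convexity at the moving point L_0 <= t L_1. The amplitude is a flat bump times a Jacobian
  times a; the bump supplies the vanishing at the end points.\<close>

lemma ray_bound: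
  assumes a: "diff_on N (ball z \<rho>) a"
  obtains B where "B \<ge> 0" "\<And>y0 v \<tau> l. y0 \<in> Y2 \<Longrightarrow> v \<bullet> b = 0 \<Longrightarrow> norm v \<le> 3 * R \<Longrightarrow> 0 \<le> \<tau> \<Longrightarrow> 0 \<le> l \<Longrightarrow>
     norm (integral {0..1} (\<lambda>s. of_real ((s * (1 - s)) ^ (N + 1)) * (of_real (exp (d * s)) * of_real (a (y0 + exp s *\<^sub>R v)))
       * exp (- \<i> * of_real (\<tau> * rem y0 (y0 + exp s *\<^sub>R v) + exp s * l)))) \<le> B / (1 + (\<tau> * rem y0 (y0 + v) + l)) ^ N"
proof -
  have Q: "cball z (11 * R) \<subseteq> ball z \<rho>" using R by auto
  have "0 \<le> 3 * R" using R by simp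
  from jet_ray[OF open_ball compact_cball Q this a] obtain A3 where A3: "\<And>y v. norm v \<le> 3 * R \<Longrightarrow>
      (\<forall>s\<in>{0..1}. y + exp s *\<^sub>R v \<in> cball z (11 * R)) \<Longrightarrow> jet N A3 (\<lambda>_. 1) (\<lambda>s. of_real (a (y + exp s *\<^sub>R v)))"
    by blast
  obtain A1 where A1: "jet N A1 (indicator {0<..<1}) (\<lambda>s. of_real ((s * (1 - s)) ^ (N + 1)))"
    using jet_flat_bump[of N "N + 1"] by auto
  obtain A2 where A2: "jet N A2 (\<lambda>_. 1) (\<lambda>s. of_real (exp (d * s)))" using jet_exp by blast
  define A where "A = 2 ^ N * (A1 * (2 ^ N * (A2 * A3)))"
  obtain B where B: "B \<ge> 0" "\<And>(L :: nat \<Rightarrow> real \<Rightarrow> real) \<rho> \<tau> l u.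
     \<lbrakk>\<And>i s. i \<le> N + 2 \<Longrightarrow> s \<in> {0..1} \<Longrightarrow> (L i has_real_derivative L (Suc i) (exp s * \<rho>)) (at (exp s * \<rho>));
      \<And>i s. i \<le> N + 2 \<Longrightarrow> s \<in> {0..1} \<Longrightarrow> \<bar>(exp s * \<rho>) ^ i * L i (exp s * \<rho>)\<bar> \<le> Cf * L 0 (exp s * \<rho>);
      \<And>s. s \<in> {0..1} \<Longrightarrow> 0 \<le> L 0 (exp s * \<rho>);
      \<And>s. s \<in> {0..1} \<Longrightarrow> L 0 (exp s * \<rho>) \<le> exp s * \<rho> * L 1 (exp s * \<rho>);
      0 \<le> \<tau>; 0 \<le> l; jet N A (indicator {0<..<1}) u\<rbrakk> \<Longrightarrow>
     norm (integral {0..1} (\<lambda>s. u s * exp (- \<i> * of_real (\<tau> * L 0 (exp s * \<rho>) + exp s * l))))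
       \<le> B / (1 + (\<tau> * L 0 \<rho> + l)) ^ N"
    using ray_oscillation[of N "N + 2" Cf A] by blast
  show ?thesis
  proof (rule that[OF B(1)])
    fix y0 v :: 'a and \<tau> l :: real
    assume y0: "y0 \<in> Y2" and v: "v \<bullet> b = 0" "norm v \<le> 3 * R" and nn: "0 \<le> \<tau>" "0 \<le> l"
    obtain \<theta> where \<theta>: "\<theta> \<bullet> b = 0" "norm \<theta> = 1" "v = norm v *\<^sub>R \<theta>"
    proof (cases "v = 0")
      case True
      then show ?thesis using that[of \<theta>0] \<theta>0 by simp
    next
      case False
      then show ?thesis using that[of "(1 / norm v) *\<^sub>R v"] v by simp
    qed
    have in11: "y0 + exp s *\<^sub>R v \<in> cball z (11 * R)" if "s \<in> {0..1}" for s
      using ray_in_ball[OF _ v(2) that] y0 by blast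
    have inB: "y0 + exp s *\<^sub>R v \<in> ball z \<rho> \<inter> {y. y \<bullet> b = 0}" if "s \<in> {0..1}" for s
      using in11[OF that] Q y0 v by (auto simp: inner_add_left)
    have y0B: "y0 \<in> ball z \<rho> \<inter> {y. y \<bullet> b = 0}" using y0 R by auto
    have ray: "y0 + (exp s * norm v) *\<^sub>R \<theta> = y0 + exp s *\<^sub>R v" for s
      using \<theta>(3) by (metis scaleR_scaleR)
    have gd: "g differentiable (at y)" if "y \<in> ball z \<rho>" for y by (rule diff_on_imp_differentiable[OF gk that])
    have lin: "linear (frechet_derivative g (at y))" if "y \<in> ball z \<rho>" for y
      using linear_frechet_derivative[OF gd[OF that]] .
    have lin0: "linear (frechet_derivative g (at y0))" using lin y0B by blast
    let ?L = "line_rem g y0 \<theta>" and ?r = "norm v"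
    have L0: "?L 0 (exp s * ?r) = rem y0 (y0 + exp s *\<^sub>R v)" for s
    proof -
      have "frechet_derivative g (at y0) (exp s *\<^sub>R v) = (exp s * ?r) * frechet_derivative g (at y0) \<theta>"
        using \<theta>(3) linear_scale[OF lin0] by (metis real_scaleR_def scaleR_scaleR)
      then show ?thesis by (simp add: line_rem_def rem_def ray)
    qed
    have "norm (integral {0..1} (\<lambda>s. of_real ((s * (1 - s)) ^ (N + 1)) * (of_real (exp (d * s)) * of_real (a (y0 + exp s *\<^sub>R v)))
        * exp (- \<i> * of_real (\<tau> * ?L 0 (exp s * ?r) + exp s * l)))) \<le> B / (1 + (\<tau> * ?L 0 ?r + l)) ^ N"
    proof (rule B(2))
      fix i and s :: real assume i: "i \<le> N + 2" and s: "s \<in> {0..1}"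
      show "(?L i has_real_derivative ?L (Suc i) (exp s * ?r)) (at (exp s * ?r))"
        by (rule line_rem_deriv[OF gk]) (use inB[OF s] ray in auto)
      show "\<bar>(exp s * ?r) ^ i * ?L i (exp s * ?r)\<bar> \<le> Cf * ?L 0 (exp s * ?r)"
      proof (cases "v = 0")
        case True
        then show ?thesis by (cases i) (simp_all add: line_rem_def)
      next
        case False
        have "exp s \<le> exp 1" using s by simp
        also have "exp 1 \<le> (3::real)" using exp_le by simp
        finally have "exp s * ?r \<le> 3 * (3 * R)" using v(2) by (intro mult_mono) auto
        then have "exp s * ?r \<le> 12 * R" using R by simp
        moreover have "y0 \<in> cball z (\<rho> / 2) \<inter> {y. y \<bullet> b = 0}" using y0 R by auto
        ultimately have "(exp s * ?r) ^ i * \<bar>?L i (exp s * ?r)\<bar> \<le> Cf * ?L 0 (exp s * ?r)"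
          by (intro contact) (use False \<theta> i in auto)
        then show ?thesis by (simp add: abs_mult)
      qed
    next
      fix s :: real assume s: "s \<in> {0..1}"
      let ?x = "y0 + exp s *\<^sub>R v"
      show "0 \<le> ?L 0 (exp s * ?r)" unfolding L0 rem_def by (rule conv[OF y0B inB[OF s]])
      have "0 \<le> g y0 - g ?x - frechet_derivative g (at ?x) (y0 - ?x)" by (rule conv[OF inB[OF s] y0B])
      moreover have "frechet_derivative g (at ?x) (y0 - ?x) = - ((exp s * ?r) * frechet_derivative g (at ?x) \<theta>)"
      proof -
        have lx: "linear (frechet_derivative g (at ?x))" using lin inB[OF s] by blast
        have "y0 - ?x = - ((exp s * ?r) *\<^sub>R \<theta>)" using ray[of s] by (simp add: algebra_simps)
        then show ?thesis by (simp only: linear_neg[OF lx] linear_scale[OF lx] real_scaleR_def)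
      qed
      ultimately show "?L 0 (exp s * ?r) \<le> exp s * ?r * ?L 1 (exp s * ?r)"
        unfolding line_rem_def ray by (simp add: algebra_simps)
    next
      have "jet N A (\<lambda>s. indicator {0<..<1} s * (1 * 1)) (\<lambda>s. of_real ((s * (1 - s)) ^ (N + 1)) * (of_real (exp (d * s)) * of_real (a (y0 + exp s *\<^sub>R v))))"
        unfolding A_def by (intro jet_mult A1 A2 A3) (use v in11 in auto)
      then show "jet N A (indicator {0<..<1}) (\<lambda>s. of_real ((s * (1 - s)) ^ (N + 1)) * (of_real (exp (d * s)) * of_real (a (y0 + exp s *\<^sub>R v))))"
        by (rule jet_mono) simp
    qed (use nn in auto)
    moreover have "?L 0 ?r = rem y0 (y0 + v)" using L0[of 0] by simp
    ultimately show "norm (integral {0..1} (\<lambda>s. of_real ((s * (1 - s)) ^ (N + 1)) * (of_real (exp (d * s)) * of_real (a (y0 + exp s *\<^sub>R v)))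
       * exp (- \<i> * of_real (\<tau> * rem y0 (y0 + exp s *\<^sub>R v) + exp s * l)))) \<le> B / (1 + (\<tau> * rem y0 (y0 + v) + l)) ^ N"
      unfolding L0 by simp
  qed
qed

lemma rem_nonneg: "y0 \<in> Y2 \<Longrightarrow> y \<in> ball z \<rho> \<Longrightarrow> y \<bullet> b = 0 \<Longrightarrow> 0 \<le> rem y0 y"
  unfolding rem_def by (rule conv) (use R in auto)

text \<open>The indicator on the right singles out the points whose ray reaches the support of the
  amplitude; elsewhere the inner integral is 0. The nonnegative linear functional is the first-order
  condition at a minimizer y0, and the constant c of the phase drops out of the modulus. Since a
  vanishes on the hyperplane part of the domain outside the smaller ball, the cutoff by
  \<open>Y1\<close> can be ignored along rays, where a is differentiable.\<close>

lemma averaged_bound: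
  assumes a: "diff_on N (ball z \<rho>) a" and va: "\<And>y. y \<in> ball z \<rho> \<Longrightarrow> y \<bullet> b = 0 \<Longrightarrow> y \<notin> cball z R \<Longrightarrow> a y = 0"
  obtains B where "B \<ge> 0" "\<And>y0 \<tau> \<phi> c f. y0 \<in> Y2 \<Longrightarrow> 0 \<le> \<tau> \<Longrightarrow> linear \<phi> \<Longrightarrow> (\<And>w. w \<in> Y2 \<Longrightarrow> 0 \<le> \<phi> (w - y0)) \<Longrightarrow>
     (\<And>y. y \<in> ball z \<rho> \<Longrightarrow> y \<bullet> b = 0 \<Longrightarrow> f y = c + (\<tau> * rem y0 y + \<phi> (y - y0))) \<Longrightarrow> continuous_on Y1 f \<Longrightarrow>
     ennreal (norm (LINT y|hyperplane_lborel b. indicator Y1 y *\<^sub>R (of_real (a y) * exp (- \<i> * of_real (f y)))))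
      \<le> (\<integral>\<^sup>+y. ennreal (B / (1 + (\<tau> * rem y0 y + \<phi> (y - y0))) ^ N) *
          indicator {y \<in> Y2. \<exists>s\<in>{0..1}. y0 + exp s *\<^sub>R (y - y0) \<in> cball z R} y \<partial>hyperplane_lborel b)"
proof -
  let ?d = "real (DIM('a) - 1)" and ?\<kappa> = "\<lambda>s::real. (s * (1 - s)) ^ (N + 1)"
  obtain B0 where B0: "B0 \<ge> 0" "\<And>y0 v \<tau> l. y0 \<in> Y2 \<Longrightarrow> v \<bullet> b = 0 \<Longrightarrow> norm v \<le> 3 * R \<Longrightarrow> 0 \<le> \<tau> \<Longrightarrow> 0 \<le> l \<Longrightarrow>
     norm (integral {0..1} (\<lambda>s. of_real (?\<kappa> s) * (of_real (exp (?d * s)) * of_real (a (y0 + exp s *\<^sub>R v)))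
       * exp (- \<i> * of_real (\<tau> * rem y0 (y0 + exp s *\<^sub>R v) + exp s * l)))) \<le> B0 / (1 + (\<tau> * rem y0 (y0 + v) + l)) ^ N"
    using ray_bound[OF a, of ?d] by blast
  define k where "k = integral {0..1} ?\<kappa>"
  have kc: "continuous_on {0..1} ?\<kappa>" by (intro continuous_intros)
  have kn: "0 \<le> ?\<kappa> s" if "s \<in> {0..1}" for s using that by auto
  have k: "k > 0"
  proof -
    have "k \<ge> 0" unfolding k_def using kc kn by (intro integral_nonneg integrable_continuous_interval) auto
    moreover have "k \<noteq> 0"
    proof
      assume "k = 0"
      then have "\<forall>s\<in>{0..1}. ?\<kappa> s = 0"
        unfolding k_def using integral_eq_0_iff[OF kc zero_less_one kn] by blast
      from bspec[OF this, of "1/2"] show False by simp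
    qed
    ultimately show ?thesis by simp
  qed
  have aY: "continuous_on Y1 a"
    using diff_on_imp_continuous_on[OF a] by (rule continuous_on_subset) (use R in auto)
  then have "bounded (a ` Y1)" using compact_Y(2) by (intro compact_imp_bounded compact_continuous_image)
  then obtain Ba where Ba: "\<And>y. y \<in> Y1 \<Longrightarrow> \<bar>a y\<bar> \<le> Ba" unfolding bounded_iff by (metis imageI real_norm_def)
  show ?thesis
  proof (rule that[of "B0 / k"])
    show "B0 / k \<ge> 0" using B0(1) k by simp
    fix y0 \<tau> \<phi> c f
    assume y0: "y0 \<in> Y2" and \<tau>: "0 \<le> \<tau>" and \<phi>: "linear \<phi>" "\<And>w. w \<in> Y2 \<Longrightarrow> 0 \<le> \<phi> (w - y0)"
      and f: "\<And>y. y \<in> ball z \<rho> \<Longrightarrow> y \<bullet> b = 0 \<Longrightarrow> f y = c + (\<tau> * rem y0 y + \<phi> (y - y0))" and fc: "continuous_on Y1 f"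
    define F where "F y = indicator Y1 y *\<^sub>R (of_real (a y) * exp (- \<i> * of_real (f y)) :: complex)" for y
    let ?act = "{y \<in> Y2. \<exists>s\<in>{0..1}. y0 + exp s *\<^sub>R (y - y0) \<in> cball z R}"
    let ?\<Phi> = "\<lambda>y. \<tau> * rem y0 y + \<phi> (y - y0)"
    have y0b: "y0 \<bullet> b = 0" using y0 by simp
    have Y1b: "Y1 \<in> sets borel" using compact_Y(2) by (rule borel_compact)
    have Fm: "F \<in> borel_measurable borel"
      unfolding F_def[abs_def] by (rule borel_measurable_continuous_on_indicator[OF Y1b]) (intro continuous_intros aY fc)
    have Fb: "norm (F y) \<le> max 0 Ba" for y
      using Ba[of y] by (auto simp: F_def indicator_def norm_mult)
    have F0: "F y = 0" if "y \<notin> cball z R" for y using that by (simp add: F_def)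
    have inner: "norm (LINT s|lborel. indicator {0..1} s *\<^sub>R (of_real (?\<kappa> s * exp (?d * s)) * F (y0 + exp s *\<^sub>R (y - y0))))
        \<le> B0 / (1 + ?\<Phi> y) ^ N * indicator ?act y" for y
    proof (cases "y \<in> ?act")
      case True
      then obtain s1 where s1: "s1 \<in> {0..1}" "y0 + exp s1 *\<^sub>R (y - y0) \<in> cball z R" and y: "y \<in> Y2" by auto
      let ?v = "y - y0"
      have vb: "?v \<bullet> b = 0" using y y0 by (simp add: inner_diff_left)
      have "norm (exp s1 *\<^sub>R ?v) \<le> norm (y0 + exp s1 *\<^sub>R ?v - z) + norm (y0 - z)"
        using norm_triangle_ineq4[of "y0 + exp s1 *\<^sub>R ?v - z" "y0 - z"] by simp
      then have "exp s1 * norm ?v \<le> 3 * R" using s1(2) y0 by (simp add: dist_norm norm_minus_commute)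
      moreover have "1 * norm ?v \<le> exp s1 * norm ?v" using s1 by (intro mult_right_mono) auto
      ultimately have v: "norm ?v \<le> 3 * R" by linarith
      let ?U = "\<lambda>s. of_real (?\<kappa> s) * (of_real (exp (?d * s)) * of_real (a (y0 + exp s *\<^sub>R ?v)))
          * exp (- \<i> * of_real (\<tau> * rem y0 (y0 + exp s *\<^sub>R ?v) + exp s * \<phi> ?v))"
      have inB: "y0 + exp s *\<^sub>R ?v \<in> ball z \<rho>" "(y0 + exp s *\<^sub>R ?v) \<bullet> b = 0" if "s \<in> {0..1}" for s
        using ray_in_ball[OF _ v that, of y0] y0 R vb by (auto simp: inner_add_left)
      have gc: "continuous_on {0..1} (\<lambda>s. G (y0 + exp s *\<^sub>R ?v))" if "continuous_on (ball z \<rho>) G" for G :: "'a \<Rightarrow> real"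
        by (rule continuous_on_compose2[OF that]) (use inB in \<open>auto intro!: continuous_intros\<close>)
      have lin0: "linear (frechet_derivative g (at y0))"
        by (rule linear_frechet_derivative[OF diff_on_imp_differentiable[OF gk]]) (use y0 R in auto)
      have Uc: "continuous_on {0..1} ?U"
        unfolding rem_def
        by (intro continuous_intros gc[OF diff_on_imp_continuous_on[OF a]] gc[OF diff_on_imp_continuous_on[OF gk]]
            linear_continuous_on_compose[OF _ lin0])
      have eq: "indicator {0..1} s *\<^sub>R (of_real (?\<kappa> s * exp (?d * s)) * F (y0 + exp s *\<^sub>R ?v))
          = exp (- \<i> * of_real c) * (indicator {0..1} s *\<^sub>R ?U s)" for s
      proof (cases "s \<in> {0..1}")
        case s: True
        let ?x = "y0 + exp s *\<^sub>R ?v"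
        have "F ?x = of_real (a ?x) * exp (- \<i> * of_real (f ?x))"
          using va[OF inB[OF s]] inB(2)[OF s] by (auto simp: F_def indicator_def)
        also have "f ?x = c + (\<tau> * rem y0 ?x + exp s * \<phi> ?v)"
          using f[OF inB[OF s]] linear_scale[OF \<phi>(1), of "exp s" ?v] by simp
        also have "exp (- \<i> * of_real (c + (\<tau> * rem y0 ?x + exp s * \<phi> ?v)))
            = exp (- \<i> * of_real c) * exp (- \<i> * of_real (\<tau> * rem y0 ?x + exp s * \<phi> ?v))"
          by (simp add: exp_add[symmetric] algebra_simps)
        finally show ?thesis using s by (simp add: mult_ac)
      qed simp
      have ne: "norm (exp (- \<i> * of_real c) :: complex) = 1" by (simp add: norm_exp_eq_Re)
      have "norm (LINT s|lborel. indicator {0..1} s *\<^sub>R (of_real (?\<kappa> s * exp (?d * s)) * F (y0 + exp s *\<^sub>R ?v)))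
          = norm (LINT s:{0..1}|lborel. ?U s)"
        by (simp only: eq set_lebesgue_integral_def integral_mult_right_zero norm_mult ne mult_1_left)
      also have "(LINT s:{0..1}|lborel. ?U s) = integral {0..1} ?U"
        by (rule set_borel_integral_eq_integral(2)) (use borel_integrable_compact[OF compact_Icc Uc] in \<open>simp add: set_integrable_def\<close>)
      also have "norm (integral {0..1} ?U) \<le> B0 / (1 + (\<tau> * rem y0 (y0 + ?v) + \<phi> ?v)) ^ N"
        by (rule B0(2)[OF y0 vb v \<tau> \<phi>(2)[OF y]])
      finally show ?thesis using True by simp
    next
      case False
      have "F (y0 + exp s *\<^sub>R (y - y0)) = 0" if s: "s \<in> {0..1}" for s
      proof (rule ccontr)
        let ?x = "y0 + exp s *\<^sub>R (y - y0)"
        assume "F ?x \<noteq> 0"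
        then have x: "?x \<in> Y1" by (auto simp: F_def indicator_def split: if_splits)
        \<comment> \<open>Going backwards along the ray is a convex combination of y0 and a point of
          the support, so by convexity y itself lies in \<open>Y2\<close>.\<close>
        have "y = (1 - exp (- s)) *\<^sub>R y0 + exp (- s) *\<^sub>R ?x"
          by (simp add: algebra_simps exp_minus_inverse flip: exp_add)
        moreover have "\<dots> \<in> Y2"
        proof (rule convexD[OF convex_Y2 y0])
          show "?x \<in> Y2" using x R by auto
        qed (use s in auto)
        ultimately have "y \<in> ?act" using x s by auto
        then show False using False by blast
      qed
      then have z0: "indicator {0..1} s *\<^sub>R (of_real (?\<kappa> s * exp (?d * s)) * F (y0 + exp s *\<^sub>R (y - y0))) = 0" for s
        by (cases "s \<in> {0..1}") simp_all
      show ?thesis unfolding z0 using False by simp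
    qed
    have int_k: "integral {0..1} (\<lambda>s. ?\<kappa> s / k) = 1"
      using k by (simp only: integral_divide) (simp add: k_def)
    have "ennreal (norm (LINT y|hyperplane_lborel b. F y)) = ennreal (integral {0..1} (\<lambda>s. ?\<kappa> s / k) * norm (LINT y|hyperplane_lborel b. F y))"
      unfolding int_k by simp
    also have "\<dots> \<le> (\<integral>\<^sup>+y. ennreal (norm (LINT s|lborel. indicator {0..1} s *\<^sub>R
          (of_real (?\<kappa> s / k * exp (?d * s)) * F (y0 + exp s *\<^sub>R (y - y0))))) \<partial>hyperplane_lborel b)"
    proof (rule dilation_average[OF b y0b Fm Fb F0])
      show "continuous_on {0..1} (\<lambda>s. ?\<kappa> s / k)" using k by (intro continuous_intros) auto
      show "0 \<le> ?\<kappa> s / k" if "s \<in> {0..1}" for s using kn[OF that] k by simp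
    qed
    also have "\<dots> \<le> (\<integral>\<^sup>+y. ennreal (B0 / k / (1 + ?\<Phi> y) ^ N) * indicator ?act y \<partial>hyperplane_lborel b)"
    proof (rule nn_integral_mono)
      fix y :: 'a
      have ind: "ennreal (1 / k * (B0 / X * indicator A y)) = ennreal (B0 / k / X) * indicator A y" for X A
        by (simp add: indicator_def mult.commute)
      have "indicator {0..1} s *\<^sub>R (of_real (?\<kappa> s / k * exp (?d * s)) * w) = of_real (1 / k) * (indicator {0..1} s *\<^sub>R (of_real (?\<kappa> s * exp (?d * s)) * w))"
        for s and w :: complex by (simp add: indicator_def)
      then have "norm (LINT s|lborel. indicator {0..1} s *\<^sub>R (of_real (?\<kappa> s / k * exp (?d * s)) * F (y0 + exp s *\<^sub>R (y - y0))))
        = 1 / k * norm (LINT s|lborel. indicator {0..1} s *\<^sub>R (of_real (?\<kappa> s * exp (?d * s)) * F (y0 + exp s *\<^sub>R (y - y0))))"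
        using k by (simp only: integral_mult_right_zero norm_mult) (simp add: norm_divide)
      also have "\<dots> \<le> 1 / k * (B0 / (1 + ?\<Phi> y) ^ N * indicator ?act y)"
        using inner k by (intro mult_left_mono) auto
      also have "ennreal \<dots> = ennreal (B0 / k / (1 + ?\<Phi> y) ^ N) * indicator ?act y"
        by (rule ind)
      finally show "ennreal (norm (LINT s|lborel. indicator {0..1} s *\<^sub>R (of_real (?\<kappa> s / k * exp (?d * s)) * F (y0 + exp s *\<^sub>R (y - y0)))))
        \<le> ennreal (B0 / k / (1 + ?\<Phi> y) ^ N) * indicator ?act y" by (simp only: ennreal_leI)
    qed
    finally show "ennreal (norm (LINT y|hyperplane_lborel b. indicator Y1 y *\<^sub>R (of_real (a y) * exp (- \<i> * of_real (f y)))))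
      \<le> (\<integral>\<^sup>+y. ennreal (B0 / k / (1 + ?\<Phi> y) ^ N) * indicator ?act y \<partial>hyperplane_lborel b)"
      by (simp only: F_def[abs_def])
  qed
qed

text \<open>For tau >= 0 the phase zeta . y + tau g(y) is convex; the opposite sign is left to
  complex conjugation. The dichotomy compares |zeta| with tau times the bound L for the gradient of
  g. Beyond 2 L tau the gradient of the phase has length at least |zeta| / 2 on \<open>Y2\<close>;
  otherwise tau controls the whole frequency and the cap bounds apply.\<close>

lemma decay_nonneg:
  fixes r L C1 :: real
  assumes a: "diff_on N (ball z \<rho>) a" and va: "\<And>y. y \<in> ball z \<rho> \<Longrightarrow> y \<bullet> b = 0 \<Longrightarrow> y \<notin> cball z R \<Longrightarrow> a y = 0"
    and r: "0 < r" "r < real N"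
    and C1: "0 \<le> C1" "\<And>y0 \<delta>. y0 \<in> Y2 \<Longrightarrow> \<delta> > 0 \<Longrightarrow>
       emeasure (hyperplane_lborel b) {y \<in> Y2. rem y0 y \<le> \<delta>} \<le> ennreal (C1 * \<delta> powr r)"
  obtains C where "C \<ge> 0" "\<And>\<zeta> \<tau>. \<zeta> \<bullet> b = 0 \<Longrightarrow> 0 \<le> \<tau> \<Longrightarrow>
     norm (LINT y|hyperplane_lborel b. indicator Y1 y *\<^sub>R (of_real (a y) * exp (- \<i> * of_real (\<zeta> \<bullet> y + \<tau> * g y))))
       \<le> C * (1 + norm \<zeta> + \<tau>) powr (- r)"
proof -
  let ?H = "hyperplane_lborel b"
  obtain B where B: "B \<ge> 0" "\<And>y0 \<tau> \<phi> c f. y0 \<in> Y2 \<Longrightarrow> 0 \<le> \<tau> \<Longrightarrow> linear \<phi> \<Longrightarrow> (\<And>w. w \<in> Y2 \<Longrightarrow> 0 \<le> \<phi> (w - y0)) \<Longrightarrow>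
     (\<And>y. y \<in> ball z \<rho> \<Longrightarrow> y \<bullet> b = 0 \<Longrightarrow> f y = c + (\<tau> * rem y0 y + \<phi> (y - y0))) \<Longrightarrow> continuous_on Y1 f \<Longrightarrow>
     ennreal (norm (LINT y|?H. indicator Y1 y *\<^sub>R (of_real (a y) * exp (- \<i> * of_real (f y)))))
      \<le> (\<integral>\<^sup>+y. ennreal (B / (1 + (\<tau> * rem y0 y + \<phi> (y - y0))) ^ N) *
          indicator {y \<in> Y2. \<exists>s\<in>{0..1}. y0 + exp s *\<^sub>R (y - y0) \<in> cball z R} y \<partial>?H)"
    using averaged_bound[OF a va] by blast
  have Y2B: "Y2 \<subseteq> ball z \<rho>" "Y1 \<subseteq> ball z \<rho>" using R by auto
  have Y2b: "Y2 \<in> sets borel" "Y1 \<in> sets borel" using compact_Y by (auto intro: borel_compact)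
  have gd: "g differentiable (at y)" if "y \<in> ball z \<rho>" for y by (rule diff_on_imp_differentiable[OF gk that])
  have gc: "continuous_on (ball z \<rho>) g" by (rule diff_on_imp_continuous_on[OF gk])
  have "continuous_on Y2 (\<lambda>y. norm (hgrad b g y))"
  proof -
    have "continuous_on (ball z \<rho>) (\<lambda>y. frechet_derivative g (at y) v)" for v
      using smooth_on_continuous[OF smooth, of "[v]"] by simp
    then show ?thesis unfolding hgrad_def
      by (intro continuous_intros continuous_on_subset[OF _ Y2B(1)])
  qed
  then have "bounded ((\<lambda>y. norm (hgrad b g y)) ` Y2)"
    using compact_Y(1) by (intro compact_imp_bounded compact_continuous_image)
  then obtain L0 where L0: "\<And>y. y \<in> Y2 \<Longrightarrow> \<bar>norm (hgrad b g y)\<bar> \<le> L0"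
    unfolding bounded_iff by (metis imageI real_norm_def)
  define L where "L = max 1 L0"
  have L: "L \<ge> 1" "\<And>y. y \<in> Y2 \<Longrightarrow> norm (hgrad b g y) \<le> L" using L0 by (force simp: L_def)+
  have "continuous_on Y1 a"
    using diff_on_imp_continuous_on[OF a] Y2B(2) by (rule continuous_on_subset)
  then have "bounded (a ` Y1)" using compact_Y(2) by (intro compact_imp_bounded compact_continuous_image)
  then obtain Ba where Ba: "\<And>y. y \<in> Y1 \<Longrightarrow> \<bar>a y\<bar> \<le> Ba" unfolding bounded_iff by (metis imageI real_norm_def)
  have fin: "emeasure ?H Y2 < \<infinity>" "emeasure ?H Y1 < \<infinity>"
    using emeasure_hyperplane_finite[OF norm_b compact_imp_bounded] compact_Y Y2b by auto
  define V2 where "V2 = measure ?H Y2"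
  have V2: "emeasure ?H Y2 = ennreal V2" unfolding V2_def
    using fin(1) by (intro emeasure_eq_ennreal_measure) auto
  define C0 where "C0 = max 0 Ba * measure ?H Y1"
  have C0: "C0 \<ge> 0" by (simp add: C0_def)
  define I where "I \<zeta> \<tau> = (LINT y|?H. indicator Y1 y *\<^sub>R (of_real (a y) * exp (- \<i> * of_real (\<zeta> \<bullet> y + \<tau> * g y))) :: complex)" for \<zeta> \<tau>
  have triv: "norm (I \<zeta> \<tau>) \<le> C0" for \<zeta> \<tau>
  proof -
    have "norm (I \<zeta> \<tau>) \<le> (LINT y|?H. max 0 Ba * indicator Y1 y)"
      unfolding I_def
    proof (rule Bochner_Integration.integral_norm_bound_integral)
      show int: "integrable ?H (\<lambda>y. max 0 Ba * indicator Y1 y)"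
        using Y2b(2) fin(2) by (intro integrable_mult_right integrable_real_indicator) auto
      have n: "norm (indicator Y1 y *\<^sub>R (of_real (a y) * exp (- \<i> * of_real (\<zeta> \<bullet> y + \<tau> * g y))) :: complex) \<le> max 0 Ba * indicator Y1 y" for y
        using Ba[of y] by (auto simp: indicator_def norm_mult)
      then show "norm (indicator Y1 y *\<^sub>R (of_real (a y) * exp (- \<i> * of_real (\<zeta> \<bullet> y + \<tau> * g y))) :: complex) \<le> max 0 Ba * indicator Y1 y" for y .
      show "integrable ?H (\<lambda>y. indicator Y1 y *\<^sub>R (of_real (a y) * exp (- \<i> * of_real (\<zeta> \<bullet> y + \<tau> * g y))) :: complex)"
      proof (rule Bochner_Integration.integrable_bound[OF int])
        have "(\<lambda>y. indicator Y1 y *\<^sub>R (of_real (a y) * exp (- \<i> * of_real (\<zeta> \<bullet> y + \<tau> * g y))) :: complex) \<in> borel_measurable borel"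
          by (rule borel_measurable_continuous_on_indicator[OF Y2b(2)])
            (intro continuous_intros \<open>continuous_on Y1 a\<close> continuous_on_subset[OF gc Y2B(2)])
        then show "(\<lambda>y. indicator Y1 y *\<^sub>R (of_real (a y) * exp (- \<i> * of_real (\<zeta> \<bullet> y + \<tau> * g y))) :: complex) \<in> borel_measurable ?H"
          by simp
      qed (use n in \<open>auto intro!: AE_I2 order_trans[OF n]\<close>)
    qed
    also have "\<dots> = C0" using Y2b(2) fin(2) by (simp add: C0_def)
    finally show ?thesis .
  qed
  \<comment> \<open>CA is for |zeta| <= 2 L tau with tau >= 1, CB for |zeta| > 2 L tau, and the term
    with C0 for the bounded frequencies with |zeta| <= 2 L tau and tau < 1. The factors with
    exponent r exchange tau, respectively 1 + R |zeta| / 6, for 1 + |zeta| + tau by means of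
    \<open>shift\<close>.\<close>
  define CA where "CA = B * (2 ^ N / (1 - 2 powr r / 2 ^ N) * C1) * (2 * L + 2) powr r"
  define CB where "CB = B * V2 * (2 + 12 / R) powr r"
  define C where "C = max (C0 * (2 * L + 2) powr r) (max CA CB)"
  have pow2: "2 powr r / 2 ^ N < (1::real)"
  proof -
    have "2 powr r < (2::real) powr real N" using r by (intro powr_less_mono) auto
    then show ?thesis by (simp add: powr_realpow)
  qed
  have shift: "X powr (- r) \<le> c powr r * Z powr (- r)" if "0 < X" "0 < c" "0 < Z" "Z \<le> c * X" for X c Z
  proof -
    have "X powr (- r) = c powr r * (c * X) powr (- r)"
      using that by (simp add: powr_mult powr_minus field_simps)
    also have "\<dots> \<le> c powr r * Z powr (- r)"
      using that r by (intro mult_left_mono powr_mono2') auto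
    finally show ?thesis .
  qed
  show ?thesis
  proof (rule that[of C])
    show "C \<ge> 0" using C0 by (simp add: C_def le_max_iff_disj)
    fix \<zeta> \<tau> assume \<zeta>: "\<zeta> \<bullet> b = 0" and \<tau>: "(0::real) \<le> \<tau>"
    let ?Z = "1 + norm \<zeta> + \<tau>"
    have Z: "?Z > 0" using \<tau> by (simp add: add_pos_nonneg)
    define f where "f y = \<zeta> \<bullet> y + \<tau> * g y" for y
    have fc: "continuous_on (ball z \<rho>) f" unfolding f_def by (intro continuous_intros gc)
    have "z \<in> Y2" using z R by simp
    then have "Y2 \<noteq> {}" by blast
    then obtain y0 where y0: "y0 \<in> Y2" and min: "\<And>y. y \<in> Y2 \<Longrightarrow> f y0 \<le> f y"
      using continuous_attains_inf[OF compact_Y(1) _ continuous_on_subset[OF fc Y2B(1)]] by blast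
    have y0B: "y0 \<in> ball z \<rho>" and y0b: "y0 \<bullet> b = 0" using y0 Y2B by auto
    let ?D = "frechet_derivative g (at y0)"
    have lin0: "linear ?D" by (rule linear_frechet_derivative[OF gd[OF y0B]])
    define \<phi> where "\<phi> v = \<zeta> \<bullet> v + \<tau> * ?D v" for v
    have \<phi>: "linear \<phi>" unfolding \<phi>_def
      by (intro linearI) (auto simp: inner_add_right linear_add[OF lin0] linear_scale[OF lin0] algebra_simps)
    have \<phi>0: "0 \<le> \<phi> (w - y0)" if w: "w \<in> Y2" for w
    proof (rule convex_minimizer_deriv[where f = f, OF convex_Y2 y0 w min])
      have "((\<lambda>t. g (y0 + t *\<^sub>R (w - y0))) has_real_derivative ?D (w - y0)) (at 0)"
        using has_real_derivative_line[of g y0 0 "w - y0"] gd[OF y0B] by simp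
      then show "((\<lambda>t. f (y0 + t *\<^sub>R (w - y0))) has_real_derivative \<phi> (w - y0)) (at 0)"
        unfolding f_def \<phi>_def inner_add_right inner_scaleR_right by (auto intro!: derivative_eq_intros)
    qed
    have f\<phi>: "f y = f y0 + (\<tau> * rem y0 y + \<phi> (y - y0))" for y
      by (simp add: f_def \<phi>_def rem_def inner_diff_right algebra_simps)
    let ?\<Phi> = "\<lambda>y. \<tau> * rem y0 y + \<phi> (y - y0)"
    have \<Phi>0: "0 \<le> ?\<Phi> y" if "y \<in> Y2" for y
      using min[OF that] f\<phi>[of y] by simp
    let ?act = "{y \<in> Y2. \<exists>s\<in>{0..1}. y0 + exp s *\<^sub>R (y - y0) \<in> cball z R}"
    have main: "ennreal (norm (I \<zeta> \<tau>)) \<le> (\<integral>\<^sup>+y. ennreal (B / (1 + ?\<Phi> y) ^ N) * indicator ?act y \<partial>?H)"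
      unfolding I_def f_def[symmetric] by (rule B(2)[OF y0 \<tau> \<phi> \<phi>0 f\<phi> continuous_on_subset[OF fc Y2B(2)]])
    have "norm (I \<zeta> \<tau>) \<le> C * ?Z powr (- r)"
    proof (cases "norm \<zeta> \<le> 2 * L * \<tau>")
      case A: True
      (* nearly normal frequencies: sum over the caps Phi <= 2^k *)
      show ?thesis
      proof (cases "\<tau> \<ge> 1")
        case True
        have Yc: "continuous_on Y2 ?\<Phi>"
        proof -
          have "continuous_on Y2 (\<lambda>y. f y - f y0)" by (intro continuous_intros continuous_on_subset[OF fc Y2B(1)])
          moreover have "(\<lambda>y. f y - f y0) = ?\<Phi>"
          proof
            fix y
            show "f y - f y0 = ?\<Phi> y" using f\<phi>[of y] by linarith
          qed
          ultimately show ?thesis by (simp only:)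
        qed
        have meas: "{y \<in> Y2. ?\<Phi> y \<le> \<delta>} \<in> sets ?H" for \<delta>
        proof -
          have "closed (Y2 \<inter> ?\<Phi> -` {..\<delta>})"
            using continuous_closed_preimage[OF Yc compact_imp_closed[OF compact_Y(1)] closed_atMost] .
          moreover have "{y \<in> Y2. ?\<Phi> y \<le> \<delta>} = Y2 \<inter> ?\<Phi> -` {..\<delta>}" by auto
          ultimately have "{y \<in> Y2. ?\<Phi> y \<le> \<delta>} \<in> sets borel" by (simp only: borel_closed)
          then show ?thesis by simp
        qed
        \<comment> \<open>The linear term is nonnegative on \<open>Y2\<close>, so a sublevel set of
          the phase is contained in the cap of height delta / tau based at y0. This is where the
          minimizer may fail to be critical at no cost.\<close>
        have sub: "emeasure ?H {y \<in> Y2. ?\<Phi> y \<le> \<delta>} \<le> ennreal (C1 * (\<delta> / \<tau>) powr r)" if \<delta>: "\<delta> > 0" for \<delta>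
        proof -
          have rc: "continuous_on Y2 (rem y0)" unfolding rem_def
            by (intro continuous_intros continuous_on_subset[OF gc Y2B(1)] linear_continuous_on_compose[OF _ lin0])
          have "closed (Y2 \<inter> rem y0 -` {..\<delta> / \<tau>})"
            using continuous_closed_preimage[OF rc compact_imp_closed[OF compact_Y(1)] closed_atMost] .
          moreover have "{y \<in> Y2. rem y0 y \<le> \<delta> / \<tau>} = Y2 \<inter> rem y0 -` {..\<delta> / \<tau>}" by auto
          ultimately have m: "{y \<in> Y2. rem y0 y \<le> \<delta> / \<tau>} \<in> sets borel" by (simp only: borel_closed)
          have "{y \<in> Y2. ?\<Phi> y \<le> \<delta>} \<subseteq> {y \<in> Y2. rem y0 y \<le> \<delta> / \<tau>}"
          proof
            fix y assume y: "y \<in> {y \<in> Y2. ?\<Phi> y \<le> \<delta>}"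
            then have "\<tau> * rem y0 y \<le> \<delta>" using \<phi>0[of y] by auto
            then have "rem y0 y \<le> \<delta> / \<tau>" using True by (simp add: le_divide_eq mult.commute)
            then show "y \<in> {y \<in> Y2. rem y0 y \<le> \<delta> / \<tau>}" using y by blast
          qed
          from emeasure_mono[OF this] m have "emeasure ?H {y \<in> Y2. ?\<Phi> y \<le> \<delta>} \<le> emeasure ?H {y \<in> Y2. rem y0 y \<le> \<delta> / \<tau>}" by simp
          also have "\<dots> \<le> ennreal (C1 * (\<delta> / \<tau>) powr r)" by (rule C1(2)[OF y0]) (use \<delta> True in simp)
          finally show ?thesis .
        qed
        have "ennreal (norm (I \<zeta> \<tau>)) \<le> (\<integral>\<^sup>+y. ennreal B * (ennreal (1 / (1 + ?\<Phi> y) ^ N) * indicator Y2 y) \<partial>?H)"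
        proof (rule order_trans[OF main nn_integral_mono])
          fix y
          show "ennreal (B / (1 + ?\<Phi> y) ^ N) * indicator ?act y \<le> ennreal B * (ennreal (1 / (1 + ?\<Phi> y) ^ N) * indicator Y2 y)"
            using B(1) by (auto simp: indicator_def ennreal_mult'[symmetric])
        qed
        also have "\<dots> = ennreal B * (\<integral>\<^sup>+y. ennreal (1 / (1 + ?\<Phi> y) ^ N) * indicator Y2 y \<partial>?H)"
        proof (rule nn_integral_cmult)
          have "(\<lambda>y. indicator Y2 y *\<^sub>R (1 / (1 + ?\<Phi> y) ^ N)) \<in> borel_measurable borel"
          proof (rule borel_measurable_continuous_on_indicator[OF Y2b(1)])
            show "continuous_on Y2 (\<lambda>y. 1 / (1 + ?\<Phi> y) ^ N)"
              by (intro continuous_on_divide continuous_on_power continuous_on_add continuous_on_const Yc ballI)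
                (use \<Phi>0 in \<open>fastforce simp: add_nonneg_eq_0_iff\<close>)
          qed
          then have "(\<lambda>y. ennreal (indicator Y2 y *\<^sub>R (1 / (1 + ?\<Phi> y) ^ N))) \<in> borel_measurable ?H" by simp
          moreover have "(\<lambda>y. ennreal (indicator Y2 y *\<^sub>R (1 / (1 + ?\<Phi> y) ^ N))) = (\<lambda>y. ennreal (1 / (1 + ?\<Phi> y) ^ N) * indicator Y2 y)"
            by (auto simp: fun_eq_iff indicator_def)
          ultimately show "(\<lambda>y. ennreal (1 / (1 + ?\<Phi> y) ^ N) * indicator Y2 y) \<in> borel_measurable ?H" by simp
        qed
        also have "\<dots> \<le> ennreal B * ennreal (2 ^ N / (1 - 2 powr r / 2 ^ N) * C1 * \<tau> powr (- r))"
          by (intro mult_left_mono sublevel_integral[OF C1(1) _ r(2) meas sub \<Phi>0]) (use True in auto)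
        also have "\<dots> = ennreal (B * (2 ^ N / (1 - 2 powr r / 2 ^ N) * C1 * \<tau> powr (- r)))"
          using B(1) C1(1) pow2 by (intro ennreal_mult[symmetric]) auto
        finally have "norm (I \<zeta> \<tau>) \<le> B * (2 ^ N / (1 - 2 powr r / 2 ^ N) * C1) * \<tau> powr (- r)"
          using B(1) C1(1) pow2 by (simp add: ennreal_le_iff mult.assoc)
        also have "\<dots> \<le> B * (2 ^ N / (1 - 2 powr r / 2 ^ N) * C1) * ((2 * L + 2) powr r * ?Z powr (- r))"
        proof (intro mult_left_mono shift)
          show "?Z \<le> (2 * L + 2) * \<tau>" using A True by (simp add: algebra_simps)
        qed (use True L Z B(1) C1(1) pow2 in auto)
        also have "\<dots> = CA * ?Z powr (- r)" by (simp add: CA_def)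
        also have "\<dots> \<le> C * ?Z powr (- r)" by (intro mult_right_mono) (auto simp: C_def)
        finally show ?thesis .
      next
        case False
        have "2 * L * \<tau> \<le> 2 * L * 1" using L \<tau> False by (intro mult_left_mono) auto
        then have Z': "?Z \<le> (2 * L + 2) * 1" using A False by simp
        have "norm (I \<zeta> \<tau>) \<le> C0 * 1" using triv by simp
        also have "\<dots> \<le> C0 * ((2 * L + 2) powr r * ?Z powr (- r))"
          using shift[of 1 "2 * L + 2" ?Z] Z Z' L C0 by (intro mult_left_mono) auto
        also have "\<dots> \<le> C * ?Z powr (- r)" unfolding mult.assoc[symmetric] by (intro mult_right_mono) (auto simp: C_def)
        finally show ?thesis .
      qed
    next
      case False
      (* moving a point of the inner ball by R against the gradient q stays in Y2, so phi >= R |q| there *)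
      define q where "q = \<zeta> + \<tau> *\<^sub>R hgrad b g y0"
      have qb: "q \<bullet> b = 0" using \<zeta> hgrad_orth[OF norm_b gd[OF y0B]] by (simp add: q_def inner_add_left)
      have \<phi>q: "\<phi> v = q \<bullet> v" if "v \<bullet> b = 0" for v
        using inner_hgrad[OF gd[OF y0B], of b v] hproj_id[OF that] by (simp add: \<phi>_def q_def inner_add_left)
      have "norm \<zeta> \<le> norm q + norm (\<tau> *\<^sub>R hgrad b g y0)"
        using norm_triangle_ineq4[of q "\<tau> *\<^sub>R hgrad b g y0"] by (simp add: q_def)
      also have "norm (\<tau> *\<^sub>R hgrad b g y0) \<le> \<tau> * L" using L(2)[OF y0] \<tau> by (simp add: mult_left_mono)
      finally have "norm \<zeta> \<le> norm q + \<tau> * L" by simp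
      moreover have "2 * (\<tau> * L) < norm \<zeta>" using False by (simp add: mult_ac)
      ultimately have nq: "norm q \<ge> norm \<zeta> / 2" by linarith
      have \<zeta>0: "norm \<zeta> > 0" using False L \<tau> by (smt (verit) mult_nonneg_nonneg)
      have q0: "norm q > 0" using nq \<zeta>0 by linarith
      \<comment> \<open>The 6 is 2 from |q| >= |zeta| / 2 times 3 from e^s <= 3.\<close>
      have lower: "R * norm \<zeta> / 6 \<le> ?\<Phi> y" if y: "y \<in> ?act" for y
      proof -
        obtain s where s: "s \<in> {0..1}" "y0 + exp s *\<^sub>R (y - y0) \<in> cball z R" using y by auto
        let ?w = "y0 + exp s *\<^sub>R (y - y0)" and ?n = "(R / norm q) *\<^sub>R q"
        have yy: "(y - y0) \<bullet> b = 0" using y y0b by (simp add: inner_diff_left)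
        have wb: "?w \<bullet> b = 0" using yy y0b by (simp add: inner_add_left)
        have "norm ?n = R" using R q0 by simp
        then have "?w - ?n \<in> cball z (2 * R)"
          using s(2) norm_triangle_ineq4[of "?w - z" ?n] by (simp add: dist_norm norm_minus_commute algebra_simps)
        then have "?w - ?n \<in> Y2" using wb qb by (simp add: inner_diff_left)
        then have "0 \<le> \<phi> (?w - ?n - y0)" by (rule \<phi>0)
        also have "?w - ?n - y0 = exp s *\<^sub>R (y - y0) - ?n" by simp
        also have "\<phi> \<dots> = exp s * \<phi> (y - y0) - R / norm q * \<phi> q"
          by (simp only: linear_diff[OF \<phi>] linear_scale[OF \<phi>] real_scaleR_def)
        also have "\<phi> q = norm q * norm q" unfolding \<phi>q[OF qb] by (simp add: power2_norm_eq_inner[symmetric] power2_eq_square)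
        finally have "R * norm q \<le> exp s * \<phi> (y - y0)" using q0 by simp
        moreover have "R * (norm \<zeta> / 2) \<le> R * norm q" using nq R by (intro mult_left_mono) auto
        moreover have "exp s * \<phi> (y - y0) \<le> 3 * \<phi> (y - y0)"
        proof (rule mult_right_mono)
          have "exp s \<le> exp 1" using s by simp
          also have "exp 1 \<le> (3::real)" using exp_le by simp
          finally show "exp s \<le> 3" .
        qed (use \<phi>0 y in blast)
        moreover have "0 \<le> \<tau> * rem y0 y"
          using y Y2B \<tau> by (intro mult_nonneg_nonneg rem_nonneg[OF y0]) auto
        ultimately show ?thesis by simp
      qed
      let ?X = "1 + R * norm \<zeta> / 6"
      have X: "?X \<ge> 1" using R by simp
      have "ennreal (norm (I \<zeta> \<tau>)) \<le> (\<integral>\<^sup>+y. ennreal (B * ?X powr (- r)) * indicator Y2 y \<partial>?H)"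
      proof (rule order_trans[OF main nn_integral_mono])
        fix y
        have indicator_le: "ennreal u * indicator A y \<le> ennreal v * indicator A' y"
          if "y \<in> A \<Longrightarrow> u \<le> v" "y \<in> A \<Longrightarrow> y \<in> A'" for u v and A A' :: "'a set"
          using that by (simp add: indicator_def ennreal_leI)
        have "B / (1 + ?\<Phi> y) ^ N \<le> B * ?X powr (- r)" if "y \<in> ?act"
        proof -
          have "?X powr r \<le> ?X powr real N" using X r by (intro powr_mono) auto
          also have "\<dots> = ?X ^ N" using X by (simp add: powr_realpow)
          also have "\<dots> \<le> (1 + ?\<Phi> y) ^ N" using lower[OF that] X by (intro power_mono) auto
          finally have le: "?X powr r \<le> (1 + ?\<Phi> y) ^ N" .
          have Xr: "0 < ?X powr r" using X by simp
          have "B / (1 + ?\<Phi> y) ^ N \<le> B / ?X powr r"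
            by (rule divide_left_mono[OF le B(1) mult_pos_pos[OF less_le_trans[OF Xr le] Xr]])
          then show ?thesis by (simp only: powr_minus divide_inverse)
        qed
        moreover have "y \<in> ?act \<Longrightarrow> y \<in> Y2" by blast
        ultimately show "ennreal (B / (1 + ?\<Phi> y) ^ N) * indicator ?act y \<le> ennreal (B * ?X powr (- r)) * indicator Y2 y"
          by (rule indicator_le)
      qed
      also have "\<dots> = ennreal (B * ?X powr (- r)) * ennreal V2"
        unfolding V2[symmetric] by (rule nn_integral_cmult_indicator) (simp only: sets_hyperplane_lborel Y2b(1))
      also have "\<dots> = ennreal (B * ?X powr (- r) * V2)" using B(1) by (intro ennreal_mult[symmetric]) (auto simp: V2_def)
      finally have "norm (I \<zeta> \<tau>) \<le> B * V2 * ?X powr (- r)"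
        using B(1) by (simp add: ennreal_le_iff V2_def mult_ac)
      also have "\<dots> \<le> B * V2 * ((2 + 12 / R) powr r * ?Z powr (- r))"
      proof (intro mult_left_mono shift)
        have "1 * \<tau> \<le> 2 * L * \<tau>" using L \<tau> by (intro mult_right_mono) auto
        then have "?Z \<le> 1 + 2 * norm \<zeta>" using False by linarith
        also have "\<dots> \<le> (2 + 12 / R) * ?X" using R by (simp add: field_simps)
        finally show "?Z \<le> (2 + 12 / R) * ?X" .
      qed (use X R Z B(1) in \<open>auto simp: V2_def add_pos_nonneg\<close>)
      also have "\<dots> = CB * ?Z powr (- r)" by (simp add: CB_def)
      also have "\<dots> \<le> C * ?Z powr (- r)" by (intro mult_right_mono) (auto simp: C_def)
      finally show ?thesis .
    qed
    then show "norm (LINT y|?H. indicator Y1 y *\<^sub>R (of_real (a y) * exp (- \<i> * of_real (\<zeta> \<bullet> y + \<tau> * g y))))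
       \<le> C * ?Z powr (- r)" by (simp only: I_def)
  qed
qed

end

section \<open>Decay of a localized integral in one chart\<close>

lemma iterated_deriv_cmult:
  fixes h :: "'a::real_normed_vector \<Rightarrow> real"
  assumes "open U" "smooth_on U h" "y \<in> U"
  shows "iterated_deriv vs (\<lambda>x. \<kappa> * h x) y = \<kappa> * iterated_deriv vs h y"
  using assms(3)
proof (induction vs arbitrary: y)
  case (Cons v vs)
  have "frechet_derivative (iterated_deriv vs (\<lambda>x. \<kappa> * h x)) (at y) = frechet_derivative (\<lambda>x. \<kappa> * iterated_deriv vs h x) (at y)"
    by (rule frechet_derivative_cong_open[OF assms(1) Cons.prems Cons.IH])
  also have "\<dots> = (\<lambda>v. \<kappa> * frechet_derivative (iterated_deriv vs h) (at y) v)"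
  proof (rule frechet_derivative_at[symmetric], rule has_derivative_mult_right)
    show "(iterated_deriv vs h has_derivative frechet_derivative (iterated_deriv vs h) (at y)) (at y)"
      using assms(2) Cons.prems by (auto simp: smooth_on_def frechet_derivative_works[symmetric])
  qed
  finally show ?case by simp
qed simp

text \<open>With g = kappa h convex and tau the modulus of the b-component of the frequency, the
  phase of the chart integral is of the form treated in \<open>decay_nonneg\<close>, directly or
  after conjugation. The cap bound is taken on the ball of radius 2 R because the minimizer of the
  phase ranges there.\<close>

lemma chart_decay:
  fixes S :: "(real^'n) set" and r :: real
  assumes card: "CARD('n) \<ge> 2" and ch: "graph_chart S b h z \<rho> W"
    and S: "compact S" "smooth_hypersurface S" "convex_hypersurface S" "finite_type S"
    and R: "restriction_bounded S (2 * (r + 1) / (r + 2))" and r: "r > 0" "r < real N"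
  obtains R where "R > 0" "R < \<rho>" "\<And>a. diff_on N (ball z \<rho>) a \<Longrightarrow>
     (\<And>y. y \<in> ball z \<rho> \<Longrightarrow> y \<bullet> b = 0 \<Longrightarrow> y \<notin> cball z R \<Longrightarrow> a y = 0) \<Longrightarrow>
     \<exists>C\<ge>0. \<forall>\<xi>. norm (LINT y|hyperplane_lborel b. indicator (cball z R \<inter> {y. y \<bullet> b = 0}) y *\<^sub>R
        (of_real (a y) * exp (- \<i> * of_real ((y + h y *\<^sub>R b) \<bullet> \<xi>)))) \<le> C * (1 + norm \<xi>) powr (- r)"
proof -
  note c = graph_chartD[OF ch]
  \<comment> \<open>Here the dimension hypothesis enters: the hyperplane contains a nonzero
    direction, along which finite type can fix the sign of convexity.\<close>
  have "\<not> (Basis :: (real^'n) set) \<subseteq> {b}"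
  proof
    assume "(Basis :: (real^'n) set) \<subseteq> {b}"
    from card_mono[OF _ this] show False using card by simp
  qed
  then obtain \<theta>0 :: "real^'n" where \<theta>0: "\<theta>0 \<in> Basis" "\<theta>0 \<noteq> b" by auto
  then have \<theta>: "\<theta>0 \<bullet> b = 0" "norm \<theta>0 = 1" "\<theta>0 \<noteq> 0" using c(1) by (auto simp: inner_not_same_Basis)
  obtain \<kappa> :: real where \<kappa>: "\<kappa> = 1 \<or> \<kappa> = -1"
    and hconv: "\<And>y0 y. y0 \<in> ball z \<rho> \<inter> {y. y \<bullet> b = 0} \<Longrightarrow> y \<in> ball z \<rho> \<inter> {y. y \<bullet> b = 0} \<Longrightarrow>
       0 \<le> \<kappa> * (h y - h y0 - frechet_derivative h (at y0) (y - y0))"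
  proof (rule chart_convex_sign[OF ch S(1,3,4) \<theta>(1,3)])
    fix \<kappa> :: real assume "\<kappa> = 1 \<or> \<kappa> = -1"
      "\<And>y0 y. y0 \<in> ball z \<rho> \<inter> {y. y \<bullet> b = 0} \<Longrightarrow> y \<in> ball z \<rho> \<inter> {y. y \<bullet> b = 0} \<Longrightarrow>
       0 \<le> \<kappa> * (h y - h y0 - frechet_derivative h (at y0) (y - y0))"
    then show thesis by (rule that)
  qed
  define g where "g y = \<kappa> * h y" for y
  have gs: "smooth_on (ball z \<rho>) g"
    unfolding smooth_on_iff_diff_on g_def
    by (intro allI diff_on_mult open_ball diff_on_const smooth_on_imp_diff_on c(5))
  have gi: "iterated_deriv vs g y = \<kappa> * iterated_deriv vs h y" if "y \<in> ball z \<rho>" for vs y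
    unfolding g_def[abs_def] by (rule iterated_deriv_cmult[OF open_ball c(5) that])
  have gD: "frechet_derivative g (at y) v = \<kappa> * frechet_derivative h (at y) v" if "y \<in> ball z \<rho>" for y v
    using gi[OF that, of "[v]"] by simp
  have gconv: "0 \<le> g y - g y0 - frechet_derivative g (at y0) (y - y0)"
    if "y0 \<in> ball z \<rho> \<inter> {y. y \<bullet> b = 0}" "y \<in> ball z \<rho> \<inter> {y. y \<bullet> b = 0}" for y0 y
    using hconv[OF that] gD[of y0 "y - y0"] that(1) by (simp add: g_def right_diff_distrib)
  have sub: "subspace {y. y \<bullet> b = 0}" using subspace_hyperplane[of b] by (simp add: inner_commute)
  obtain \<rho>0 Cf where \<rho>0: "\<rho>0 > 0" "\<rho>0 \<le> \<rho> / 4" "\<And>y \<theta> t j. y \<in> cball z (\<rho> / 2) \<inter> {y. y \<bullet> b = 0} \<Longrightarrow> \<theta> \<in> {y. y \<bullet> b = 0} \<Longrightarrow>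
       norm \<theta> = 1 \<Longrightarrow> 0 < t \<Longrightarrow> t \<le> \<rho>0 \<Longrightarrow> j \<le> N + 2 \<Longrightarrow> t ^ j * \<bar>line_rem g y \<theta> j t\<bar> \<le> Cf * line_rem g y \<theta> 0 t"
  proof (rule finite_type_convex_bound[OF gs c(4) sub, of "N + 2"])
    fix y y' assume "y \<in> ball z \<rho> \<inter> {y. y \<bullet> b = 0}" "y' \<in> ball z \<rho> \<inter> {y. y \<bullet> b = 0}"
    from gconv[OF this] show "g y + frechet_derivative g (at y) (y' - y) \<le> g y'" by simp
  next
    fix y \<theta> assume y: "y \<in> ball z \<rho> \<inter> {y. y \<bullet> b = 0}" and \<theta>: "\<theta> \<in> {y. y \<bullet> b = 0}" "\<theta> \<noteq> 0"
    obtain k where "k \<ge> 2" "iterated_deriv (replicate k \<theta>) h y \<noteq> 0"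
      using chart_finite_type[OF ch S(4), of y \<theta>] y \<theta> by blast
    then show "\<exists>k\<ge>2. iterated_deriv (replicate k \<theta>) g y \<noteq> 0" using gi[of y] y \<kappa> by auto
  next
    fix \<rho>0 C assume "\<rho>0 > 0" "\<rho>0 \<le> \<rho> / 4" and *: "\<And>y \<theta> t j. y \<in> cball z (\<rho> / 2) \<inter> {y. y \<bullet> b = 0} \<Longrightarrow> \<theta> \<in> {y. y \<bullet> b = 0} \<Longrightarrow>
       norm \<theta> = 1 \<Longrightarrow> 0 < t \<Longrightarrow> t \<le> \<rho>0 \<Longrightarrow> j \<le> N + 2 \<Longrightarrow> t ^ j * \<bar>line_rem g y \<theta> j t\<bar> \<le> C * line_rem g y \<theta> 0 t"
    then show thesis by (intro that[of \<rho>0 C] *) auto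
  qed
  \<comment> \<open>The contact range 12 R of \<open>convex_phase\<close> is then exactly \<rho>0,
    and \<rho>0 <= \<rho> / 4 gives 48 R <= \<rho>.\<close>
  define R where "R = \<rho>0 / 12"
  interpret convex_phase b z \<theta>0 g \<rho> R Cf N
    by unfold_locales (use c \<theta> gs gconv \<rho>0 in \<open>auto simp: R_def\<close>)
  have R\<rho>: "2 * R < \<rho>" using R by simp
  obtain C1 where C1: "C1 \<ge> 0" "\<And>y0 \<delta>. y0 \<in> cball z (2 * R) \<Longrightarrow> y0 \<bullet> b = 0 \<Longrightarrow> \<delta> > 0 \<Longrightarrow>
     emeasure (hyperplane_lborel b) {y \<in> cball z (2 * R). y \<bullet> b = 0 \<and>
       \<kappa> * (h y - h y0 - frechet_derivative h (at y0) (y - y0)) \<le> \<delta>} \<le> ennreal (C1 * \<delta> powr r)"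
  proof (rule chart_knapp[OF ch \<kappa> hconv assms(7) r(1) finite_surface_measure[OF S(1,2)] R\<rho>])
    fix C1 assume "C1 \<ge> 0" "\<And>y0 \<delta>. y0 \<in> cball z (2 * R) \<Longrightarrow> y0 \<bullet> b = 0 \<Longrightarrow> \<delta> > 0 \<Longrightarrow>
     emeasure (hyperplane_lborel b) {y \<in> cball z (2 * R). y \<bullet> b = 0 \<and>
       \<kappa> * (h y - h y0 - frechet_derivative h (at y0) (y - y0)) \<le> \<delta>} \<le> ennreal (C1 * \<delta> powr r)"
    then show thesis by (rule that)
  qed
  have C1': "emeasure (hyperplane_lborel b) {y \<in> Y2. rem y0 y \<le> \<delta>} \<le> ennreal (C1 * \<delta> powr r)"
    if y0: "y0 \<in> Y2" and \<delta>: "\<delta> > 0" for y0 \<delta>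
  proof -
    have "y0 \<in> ball z \<rho>" using y0 R\<rho> by auto
    then have "{y \<in> Y2. rem y0 y \<le> \<delta>} = {y \<in> cball z (2 * R). y \<bullet> b = 0 \<and>
       \<kappa> * (h y - h y0 - frechet_derivative h (at y0) (y - y0)) \<le> \<delta>}"
      by (auto simp: rem_def gD g_def right_diff_distrib)
    then show ?thesis using C1(2)[of y0 \<delta>] y0 \<delta> by simp
  qed
  show ?thesis
  proof (rule that[of R])
    fix a :: "real^'n \<Rightarrow> real" assume a: "diff_on N (ball z \<rho>) a" and va: "\<And>y. y \<in> ball z \<rho> \<Longrightarrow> y \<bullet> b = 0 \<Longrightarrow> y \<notin> cball z R \<Longrightarrow> a y = 0"
    let ?H = "hyperplane_lborel b"
    obtain C where C: "C \<ge> 0" "\<And>\<zeta> \<tau>. \<zeta> \<bullet> b = 0 \<Longrightarrow> 0 \<le> \<tau> \<Longrightarrow>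
     norm (LINT y|?H. indicator Y1 y *\<^sub>R (of_real (a y) * exp (- \<i> * of_real (\<zeta> \<bullet> y + \<tau> * g y))))
       \<le> C * (1 + norm \<zeta> + \<tau>) powr (- r)"
    proof (rule decay_nonneg[OF a va r C1(1) C1'])
      fix C assume "C \<ge> 0" "\<And>\<zeta> \<tau>. \<zeta> \<bullet> b = 0 \<Longrightarrow> 0 \<le> \<tau> \<Longrightarrow>
     norm (LINT y|?H. indicator Y1 y *\<^sub>R (of_real (a y) * exp (- \<i> * of_real (\<zeta> \<bullet> y + \<tau> * g y))))
       \<le> C * (1 + norm \<zeta> + \<tau>) powr (- r)"
      then show thesis by (rule that)
    qed
    have "norm (LINT y|?H. indicator Y1 y *\<^sub>R (of_real (a y) * exp (- \<i> * of_real ((y + h y *\<^sub>R b) \<bullet> \<xi>))))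
        \<le> C * (1 + norm \<xi>) powr (- r)" for \<xi>
    proof -
      let ?t = "\<xi> \<bullet> b" and ?\<zeta> = "hproj b \<xi>"
      have ph: "(y + h y *\<^sub>R b) \<bullet> \<xi> = ?\<zeta> \<bullet> y + ?t * h y" if "y \<bullet> b = 0" for y
        using that inner_commute[of b y] inner_commute[of y \<xi>] inner_commute[of b \<xi>]
        by (simp add: hproj_def inner_add_left inner_diff_left)
      have \<zeta>b: "?\<zeta> \<bullet> b = 0" by (rule hproj_inner[OF c(2)])
      have "norm \<xi> \<le> norm ?\<zeta> + norm (?t *\<^sub>R b)" using hproj_decomp[of \<xi> b] norm_triangle_ineq by metis
      then have "norm \<xi> \<le> norm ?\<zeta> + \<bar>?t\<bar>" using c(2) by simp
      then have "(1 + norm ?\<zeta> + \<bar>?t\<bar>) powr (- r) \<le> (1 + norm \<xi>) powr (- r)"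
        using r by (intro powr_mono2') (auto simp: add_pos_nonneg)
      then have Cle: "C * (1 + norm ?\<zeta> + \<bar>?t\<bar>) powr (- r) \<le> C * (1 + norm \<xi>) powr (- r)"
        using C(1) by (rule mult_left_mono)
      have "norm (LINT y|?H. indicator Y1 y *\<^sub>R (of_real (a y) * exp (- \<i> * of_real ((y + h y *\<^sub>R b) \<bullet> \<xi>))))
          \<le> C * (1 + norm ?\<zeta> + \<bar>?t\<bar>) powr (- r)"
      proof (cases "0 \<le> \<kappa> * ?t")
        case True
        then have t: "\<kappa> * ?t = \<bar>?t\<bar>" using \<kappa> by auto
        have "\<bar>?t\<bar> * g y = ?t * h y" for y unfolding t[symmetric] g_def using \<kappa> by auto
        then have eqI: "indicator Y1 y *\<^sub>R (of_real (a y) * exp (- \<i> * of_real ((y + h y *\<^sub>R b) \<bullet> \<xi>)) :: complex)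
            = indicator Y1 y *\<^sub>R (of_real (a y) * exp (- \<i> * of_real (?\<zeta> \<bullet> y + \<bar>?t\<bar> * g y)))" for y
          by (cases "y \<in> Y1") (simp_all add: ph)
        show ?thesis unfolding eqI by (rule C(2)[OF \<zeta>b abs_ge_zero])
      next
        case False
        then have t: "\<kappa> * ?t = - \<bar>?t\<bar>" using \<kappa> by auto
        have tg: "\<bar>?t\<bar> * g y = - (?t * h y)" for y
        proof -
          have "\<bar>?t\<bar> = - (\<kappa> * ?t)" using t by simp
          then show ?thesis unfolding g_def using \<kappa> by auto
        qed
        \<comment> \<open>When the b-frequency and kappa have opposite signs, the phase is the
          negative of a convex one. As the amplitude is real, the integral is the conjugate of that
          with tangential frequency -zeta and nonnegative tau.\<close>
        have eqI: "indicator Y1 y *\<^sub>R (of_real (a y) * exp (- \<i> * of_real ((y + h y *\<^sub>R b) \<bullet> \<xi>)))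
            = cnj (indicator Y1 y *\<^sub>R (of_real (a y) * exp (- \<i> * of_real ((- ?\<zeta>) \<bullet> y + \<bar>?t\<bar> * g y))))" for y
          by (cases "y \<in> Y1") (simp_all add: ph tg exp_cnj ring_distribs)
        have "(- ?\<zeta>) \<bullet> b = 0" using \<zeta>b by simp
        from C(2)[OF this abs_ge_zero[of ?t]] show ?thesis
          unfolding eqI Bochner_Integration.integral_cnj complex_mod_cnj norm_minus_cancel .
      qed
      then show ?thesis using Cle by linarith
    qed
    then show "\<exists>C\<ge>0. \<forall>\<xi>. norm (LINT y|?H. indicator Y1 y *\<^sub>R
        (of_real (a y) * exp (- \<i> * of_real ((y + h y *\<^sub>R b) \<bullet> \<xi>)))) \<le> C * (1 + norm \<xi>) powr (- r)"
      using C(1) by blast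
  qed (use R R\<rho> in auto)
qed

section \<open>Partition of unity and assembly\<close>

lemma diff_on_ball_bump:
  fixes p :: "'a::euclidean_space"
  shows "diff_on k U (\<lambda>x. (max 0 (s\<^sup>2 - (norm (x - p))\<^sup>2)) ^ (k + 2))"
proof -
  have q: "(\<lambda>x. s\<^sup>2 - (norm (x - p))\<^sup>2) = (\<lambda>x. s\<^sup>2 - (\<Sum>i\<in>Basis. (x \<bullet> i - p \<bullet> i) ^ 2))"
  proof
    fix x show "s\<^sup>2 - (norm (x - p))\<^sup>2 = s\<^sup>2 - (\<Sum>i\<in>Basis. (x \<bullet> i - p \<bullet> i) ^ 2)"
      unfolding power2_norm_eq_inner euclidean_inner[of "x - p" "x - p"]
      by (simp add: inner_diff_left power2_eq_square)
  qed
  have "diff_on k UNIV (\<lambda>x. s\<^sup>2 - (norm (x - p))\<^sup>2)" unfolding q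
    by (intro diff_on_diff diff_on_sum diff_on_power diff_on_const diff_on_bounded_linear[OF bounded_linear_inner_left] open_UNIV)
  from diff_on_max_0_power[OF open_UNIV this] show ?thesis by (rule diff_on_subset) simp
qed

lemma diff_on_area_density:
  assumes "open U" "smooth_on U h" shows "diff_on k U (area_density b h)"
proof -
  have "diff_on k U (\<lambda>y. sqrt (1 + (\<Sum>i\<in>Basis. (frechet_derivative h (at y) (hproj b i))\<^sup>2)))"
    by (intro diff_on_sqrt diff_on_add diff_on_sum diff_on_power diff_on_const diff_on_deriv smooth_on_imp_diff_on assms
        add_pos_nonneg sum_nonneg) auto
  then show ?thesis by (simp only: area_density_def[abs_def])
qed

theorem mainTheorem2:
  fixes S :: "(real ^ 'n) set" and r :: real
  assumes "CARD('n) \<ge> 2"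
    and "compact S" and "smooth_hypersurface S" and "convex_hypersurface S"
    and "finite_type S"
    and "r > 0"
    and "restriction_bounded S (2 * (r + 1) / (r + 2))"
  shows "\<exists>C. \<forall>\<xi>. norm (surface_fourier S \<xi>) \<le> C * (1 + norm \<xi>) powr (- r)"
proof -
  let ?s = "surface_measure S"
  interpret fm: finite_measure ?s by (rule finite_surface_measure[OF assms(2,3)])
  obtain N where N: "r < real N" using reals_Archimedean2 by blast
  \<comment> \<open>All data of a chart are bundled, including its decay estimate, so that they can
    be chosen simultaneously for every point. The radius s has two purposes: the ball lies in W,
    where S is a single graph, and s <= R puts its projection into the disc on which amplitudes may
    live.\<close>
  define Q where "Q p b h \<rho> W R s \<longleftrightarrow> graph_chart S b h (hproj b p) \<rho> W \<and> 0 < R \<and> R < \<rho> \<and> 0 < s \<and> s \<le> R \<and> ball p s \<subseteq> W \<and>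
     (\<forall>a. diff_on N (ball (hproj b p) \<rho>) a \<longrightarrow>
     (\<forall>y. y \<in> ball (hproj b p) \<rho> \<longrightarrow> y \<bullet> b = 0 \<longrightarrow> y \<notin> cball (hproj b p) R \<longrightarrow> a y = 0) \<longrightarrow>
     (\<exists>C\<ge>0. \<forall>\<xi>. norm (LINT y|hyperplane_lborel b. indicator (cball (hproj b p) R \<inter> {y. y \<bullet> b = 0}) y *\<^sub>R
        (of_real (a y) * exp (- \<i> * of_real ((y + h y *\<^sub>R b) \<bullet> \<xi>)))) \<le> C * (1 + norm \<xi>) powr (- r)))"
    for p b :: "real^'n" and h and \<rho> :: real and W and R s :: real
  have ex: "\<exists>b h \<rho> W R s. Q p b h \<rho> W R s" if p: "p \<in> S" for p
  proof -
    obtain b h \<rho> W where ch: "graph_chart S b h (hproj b p) \<rho> W" and pW: "p \<in> W"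
      by (rule graph_chart_exists[OF assms(3) p])
    obtain R where R: "R > 0" "R < \<rho>" "\<And>a. diff_on N (ball (hproj b p) \<rho>) a \<Longrightarrow>
     (\<And>y. y \<in> ball (hproj b p) \<rho> \<Longrightarrow> y \<bullet> b = 0 \<Longrightarrow> y \<notin> cball (hproj b p) R \<Longrightarrow> a y = 0) \<Longrightarrow>
     \<exists>C\<ge>0. \<forall>\<xi>. norm (LINT y|hyperplane_lborel b. indicator (cball (hproj b p) R \<inter> {y. y \<bullet> b = 0}) y *\<^sub>R
        (of_real (a y) * exp (- \<i> * of_real ((y + h y *\<^sub>R b) \<bullet> \<xi>)))) \<le> C * (1 + norm \<xi>) powr (- r)"
    proof (rule chart_decay[OF assms(1) ch assms(2-5) assms(7) assms(6) N])
      fix R assume R: "R > 0" "R < \<rho>" "\<And>a. diff_on N (ball (hproj b p) \<rho>) a \<Longrightarrow>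
         (\<And>y. y \<in> ball (hproj b p) \<rho> \<Longrightarrow> y \<bullet> b = 0 \<Longrightarrow> y \<notin> cball (hproj b p) R \<Longrightarrow> a y = 0) \<Longrightarrow>
         \<exists>C\<ge>0. \<forall>\<xi>. norm (LINT y|hyperplane_lborel b. indicator (cball (hproj b p) R \<inter> {y. y \<bullet> b = 0}) y *\<^sub>R
            (of_real (a y) * exp (- \<i> * of_real ((y + h y *\<^sub>R b) \<bullet> \<xi>)))) \<le> C * (1 + norm \<xi>) powr (- r)"
      show thesis by (rule that[OF R])
    qed
    obtain e where e: "e > 0" "ball p e \<subseteq> W" using graph_chartD(7)[OF ch] pW openE by blast
    have "Q p b h \<rho> W R (min e R)"
      unfolding Q_def
    proof (intro conjI allI impI)
      show "ball p (min e R) \<subseteq> W" using e(2) by auto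
    qed (use ch R e in auto)
    then show ?thesis by blast
  qed
  obtain b h \<rho> W R s where all: "\<And>p. p \<in> S \<Longrightarrow> Q p (b p) (h p) (\<rho> p) (W p) (R p) (s p)"
    using ex by metis
  define z where "z p = hproj (b p) p" for p
  have ch: "graph_chart S (b p) (h p) (z p) (\<rho> p) (W p)" and Rs: "0 < R p" "R p < \<rho> p" "0 < s p" "s p \<le> R p" "ball p (s p) \<subseteq> W p"
    if "p \<in> S" for p using all[OF that] by (simp_all only: z_def Q_def)
  have decay: "\<exists>C\<ge>0. \<forall>\<xi>. norm (LINT y|hyperplane_lborel (b p). indicator (cball (z p) (R p) \<inter> {y. y \<bullet> b p = 0}) y *\<^sub>R
        (of_real (a y) * exp (- \<i> * of_real ((y + h p y *\<^sub>R b p) \<bullet> \<xi>)))) \<le> C * (1 + norm \<xi>) powr (- r)"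
    if "p \<in> S" "diff_on N (ball (z p) (\<rho> p)) a"
      "\<And>y. y \<in> ball (z p) (\<rho> p) \<Longrightarrow> y \<bullet> b p = 0 \<Longrightarrow> y \<notin> cball (z p) (R p) \<Longrightarrow> a y = 0" for p a
    using all[OF that(1)] that(2,3) unfolding z_def Q_def by blast
  obtain F where F: "F \<subseteq> S" "finite F" "S \<subseteq> (\<Union>p\<in>F. ball p (s p))"
    using compactE_image[OF assms(2), of S "\<lambda>p. ball p (s p)"] Rs(3) by force
  define \<beta> where "\<beta> p x = (max 0 ((s p)\<^sup>2 - (norm (x - p))\<^sup>2)) ^ (N + 2)" for p x
  \<comment> \<open>The quotients \<open>\<beta> p x / \<Sigma> x\<close> add up to 1 on S, where
    the sum is positive because the balls cover S. Off S the sum may vanish and the quotient is then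
    0 by convention, so that it is still globally measurable.\<close>
  define \<Sigma> where "\<Sigma> x = (\<Sum>p\<in>F. \<beta> p x)" for x
  have \<beta>0: "0 \<le> \<beta> p x" for p x by (simp add: \<beta>_def)
  have \<beta>pos: "\<beta> p x > 0" if "x \<in> ball p (s p)" for p x
  proof -
    have "norm (x - p) < s p" using that by (simp add: dist_norm norm_minus_commute)
    then have "(norm (x - p))\<^sup>2 < (s p)\<^sup>2" by (intro power_strict_mono) auto
    then show ?thesis unfolding \<beta>_def by (intro zero_less_power) simp
  qed
  have \<beta>supp: "x \<in> ball p (s p)" if "\<beta> p x \<noteq> 0" "p \<in> S" for p x
  proof (rule ccontr)
    assume "x \<notin> ball p (s p)"
    then have "(s p)\<^sup>2 \<le> (norm (x - p))\<^sup>2"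
      using Rs(3)[OF that(2)] by (intro power_mono) (auto simp: dist_norm norm_minus_commute)
    then have "\<beta> p x = 0" by (simp add: \<beta>_def)
    then show False using that by simp
  qed
  have \<Sigma>pos: "\<Sigma> x > 0" if "x \<in> S" for x
  proof -
    obtain p where p: "p \<in> F" "x \<in> ball p (s p)" using F(3) \<open>x \<in> S\<close> by blast
    have "0 < \<beta> p x" using \<beta>pos[OF p(2)] .
    also have "\<dots> \<le> \<Sigma> x" unfolding \<Sigma>_def using p(1) F(2) \<beta>0 by (intro member_le_sum) auto
    finally show ?thesis .
  qed
  have \<beta>d: "diff_on N UNIV (\<beta> p)" for p unfolding \<beta>_def[abs_def] by (rule diff_on_ball_bump)
  have \<Sigma>d: "diff_on N UNIV \<Sigma>" unfolding \<Sigma>_def[abs_def] by (intro diff_on_sum \<beta>d open_UNIV)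
  have \<beta>m [measurable]: "\<beta> p \<in> borel_measurable borel" for p
    by (rule borel_measurable_continuous_onI[OF diff_on_imp_continuous_on[OF \<beta>d]])
  have \<Sigma>m [measurable]: "\<Sigma> \<in> borel_measurable borel"
    by (rule borel_measurable_continuous_onI[OF diff_on_imp_continuous_on[OF \<Sigma>d]])
  define G where "G p \<xi> x = of_real (\<beta> p x / \<Sigma> x) * exp (- \<i> * of_real (x \<bullet> \<xi>))" for p and \<xi> x :: "real^'n"
  have Gm: "G p \<xi> \<in> borel_measurable borel" for p \<xi> unfolding G_def by measurable
  have sp: "space ?s = S"
    using sets_eq_imp_space_eq[OF sets_surface_measure[of S]] by (simp add: space_restrict_space)
  have Gint: "integrable ?s (G p \<xi>)" if "p \<in> F" for p \<xi>
  proof (rule fm.integrable_const_bound[of _ 1])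
    show "G p \<xi> \<in> borel_measurable ?s"
      unfolding measurable_cong_sets[OF sets_surface_measure refl] by (rule measurable_restrict_space1[OF Gm])
    show "AE x in ?s. norm (G p \<xi> x) \<le> 1"
    proof (rule AE_I2)
      fix x assume "x \<in> space ?s"
      then have x: "\<Sigma> x > 0" using \<Sigma>pos sp by simp
      have "\<beta> p x \<le> \<Sigma> x" unfolding \<Sigma>_def using that F(2) \<beta>0 by (intro member_le_sum) auto
      then have "\<beta> p x / \<Sigma> x \<le> 1" using x by simp
      then show "norm (G p \<xi> x) \<le> 1" using \<beta>0[of p x] x by (simp add: G_def norm_mult norm_divide)
    qed
  qed
  have split: "surface_fourier S \<xi> = (\<Sum>p\<in>F. LINT x|?s. G p \<xi> x)" for \<xi>
  proof -
    have "surface_fourier S \<xi> = (LINT x|?s. (\<Sum>p\<in>F. G p \<xi> x))"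
      unfolding surface_fourier_def
    proof (rule Bochner_Integration.integral_cong[OF refl])
      fix x assume "x \<in> space ?s"
      then have "\<Sigma> x > 0" using \<Sigma>pos sp by simp
      moreover have "(\<Sum>p\<in>F. G p \<xi> x) = of_real ((\<Sum>p\<in>F. \<beta> p x) / \<Sigma> x) * exp (- \<i> * of_real (x \<bullet> \<xi>))"
        by (simp add: G_def sum_distrib_right sum_divide_distrib)
      ultimately show "exp (- \<i> * of_real (x \<bullet> \<xi>)) = (\<Sum>p\<in>F. G p \<xi> x)"
        unfolding \<Sigma>_def[symmetric] by simp
    qed
    also have "\<dots> = (\<Sum>p\<in>F. LINT x|?s. G p \<xi> x)" by (rule Bochner_Integration.integral_sum) (rule Gint)
    finally show ?thesis .
  qed
  have "\<exists>C. \<forall>\<xi>. norm (LINT x|?s. G p \<xi> x) \<le> C * (1 + norm \<xi>) powr (- r)" if pF: "p \<in> F" for p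
  proof -
    have p: "p \<in> S" using pF F(1) by blast
    note c = graph_chartD[OF ch[OF p]]
    let ?B = "ball (z p) (\<rho> p)" and ?D = "cball (z p) (R p) \<inter> {y. y \<bullet> b p = 0}"
    \<comment> \<open>X projects y to the hyperplane before lifting, so it maps the whole ambient
      ball into S. Hence the denominator of the amplitude \<open>a\<close> is positive and
      \<open>a\<close> has order N on the full ball, as \<open>chart_decay\<close> requires; on the
      base disc X is the graph map itself.\<close>
    define X where "X y = hproj (b p) y + h p y *\<^sub>R b p" for y
    define a where "a y = \<beta> p (X y) * area_density (b p) (h p) y / \<Sigma> (X y)" for y
    have XS: "X y \<in> S" if "y \<in> ?B" for y
    proof -
      have "hproj (b p) y \<in> ?B" by (rule hproj_in_ball[OF c(2,3) that])
      from c(11)[OF this hproj_inner[OF c(2)]] show ?thesis by (simp add: X_def c(6))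
    qed
    have Xd: "diff_on N ?B X" unfolding X_def[abs_def]
      by (intro diff_on_add diff_on_scaleR diff_on_const diff_on_bounded_linear bounded_linear_hproj open_ball smooth_on_imp_diff_on c(5))
    have ad: "diff_on N ?B a" unfolding a_def[abs_def]
      by (intro diff_on_divide diff_on_mult diff_on_area_density open_ball c(5) diff_on_compose[OF _ \<beta>d Xd] diff_on_compose[OF _ \<Sigma>d Xd])
        (use \<Sigma>pos XS in \<open>auto simp: less_imp_neq[symmetric] dest: less_imp_neq\<close>)
    have av: "a y = 0" if y: "y \<in> ?B" "y \<bullet> b p = 0" "y \<notin> cball (z p) (R p)" for y
    proof (rule ccontr)
      assume "a y \<noteq> 0"
      then have "\<beta> p (X y) \<noteq> 0" by (auto simp: a_def)
      then have "norm (X y - p) < s p" using \<beta>supp p by (auto simp: dist_norm norm_minus_commute)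
      moreover have "hproj (b p) (X y - p) = y - z p"
        using hproj_scale_self[OF c(2)] y(2) by (simp add: X_def z_def linear_diff[OF linear_hproj] hproj_id)
      ultimately have "norm (y - z p) < s p" using norm_hproj_le[OF c(2), of "X y - p"] by simp
      then show False using y(3) Rs(4)[OF p] by (simp add: dist_norm norm_minus_commute)
    qed
    obtain C where C: "\<And>\<xi>. norm (LINT y|hyperplane_lborel (b p). indicator ?D y *\<^sub>R
        (of_real (a y) * exp (- \<i> * of_real ((y + h p y *\<^sub>R b p) \<bullet> \<xi>)))) \<le> C * (1 + norm \<xi>) powr (- r)"
      using decay[OF p ad av] by blast
    have "?D = cball (z p) (R p) \<inter> {y. b p \<bullet> y = 0}" by (simp add: inner_commute)
    then have "compact ?D" by (simp only:) (intro compact_Int_closed compact_cball closed_hyperplane)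
    then have Db: "?D \<in> sets borel" by (rule borel_compact)
    have Ds: "?D \<subseteq> ?B \<inter> {y. y \<bullet> b p = 0}" using Rs(2)[OF p] by auto
    have "(LINT x|?s. G p \<xi> x) = (LINT y|hyperplane_lborel (b p). indicator ?D y *\<^sub>R
        (of_real (a y) * exp (- \<i> * of_real ((y + h p y *\<^sub>R b p) \<bullet> \<xi>))))" for \<xi>
    proof -
      have "(LINT x|?s. G p \<xi> x) = (LINT x|?s. indicator (graph_over (b p) (h p) ?D) x *\<^sub>R G p \<xi> x)"
      proof (rule Bochner_Integration.integral_cong[OF refl])
        fix x assume "x \<in> space ?s"
        then have xS: "x \<in> S" by (simp add: sp)
        show "G p \<xi> x = indicator (graph_over (b p) (h p) ?D) x *\<^sub>R G p \<xi> x"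
        proof (cases "\<beta> p x = 0")
          case False
          then have xb: "x \<in> ball p (s p)" using \<beta>supp p by blast
          then have "x \<in> W p" using Rs(5)[OF p] by blast
          then have "x \<bullet> b p = h p (hproj (b p) x)" using c(9) xS by blast
          then have xe: "x = hproj (b p) x + h p (hproj (b p) x) *\<^sub>R b p" using hproj_decomp[of x "b p"] by simp
          have "norm (hproj (b p) x - z p) \<le> norm (x - p)"
            using norm_hproj_le[OF c(2), of "x - p"] by (simp add: z_def linear_diff[OF linear_hproj])
          then have "hproj (b p) x \<in> ?D"
            using xb Rs(4)[OF p] hproj_inner[OF c(2)] by (simp add: dist_norm norm_minus_commute)
          then have "x \<in> graph_over (b p) (h p) ?D" using xe unfolding graph_over_def by blast
          then show ?thesis by simp
        qed (simp add: G_def)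
      qed
      also have "\<dots> = (LINT y|hyperplane_lborel (b p). indicator ?D y *\<^sub>R (area_density (b p) (h p) y *\<^sub>R G p \<xi> (y + h p y *\<^sub>R b p)))"
        by (rule chart_integral[OF ch[OF p] Db Ds Gm])
      also have "\<dots> = (LINT y|hyperplane_lborel (b p). indicator ?D y *\<^sub>R
        (of_real (a y) * exp (- \<i> * of_real ((y + h p y *\<^sub>R b p) \<bullet> \<xi>))))"
      proof (rule Bochner_Integration.integral_cong[OF refl])
        fix y
        show "indicator ?D y *\<^sub>R (area_density (b p) (h p) y *\<^sub>R G p \<xi> (y + h p y *\<^sub>R b p))
          = indicator ?D y *\<^sub>R (of_real (a y) * exp (- \<i> * of_real ((y + h p y *\<^sub>R b p) \<bullet> \<xi>)))"
        proof (cases "y \<in> ?D")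
          case True
          then have "X y = y + h p y *\<^sub>R b p" by (simp add: X_def hproj_id)
          then show ?thesis using True by (simp add: a_def G_def scaleR_conv_of_real mult_ac)
        qed simp
      qed
      finally show ?thesis .
    qed
    then show ?thesis using C by auto
  qed
  then obtain C where C: "\<And>p \<xi>. p \<in> F \<Longrightarrow> norm (LINT x|?s. G p \<xi> x) \<le> C p * (1 + norm \<xi>) powr (- r)" by metis
  show ?thesis
  proof (intro exI allI)
    fix \<xi>
    have "norm (surface_fourier S \<xi>) \<le> (\<Sum>p\<in>F. norm (LINT x|?s. G p \<xi> x))" unfolding split by (rule norm_sum)
    also have "\<dots> \<le> (\<Sum>p\<in>F. C p * (1 + norm \<xi>) powr (- r))" by (intro sum_mono C)
    also have "\<dots> = (\<Sum>p\<in>F. C p) * (1 + norm \<xi>) powr (- r)" by (simp add: sum_distrib_right)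
    finally show "norm (surface_fourier S \<xi>) \<le> (\<Sum>p\<in>F. C p) * (1 + norm \<xi>) powr (- r)" .
  qed
qed

end
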